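(* For every $n\in\mathbb{N}$, Kraśkiewicz–Hecke insertion $(a_1,\dots,a_n)\mapsto (P,Q)$ is a bijection $$KH:\ \mathbb{N}^n \xrightarrow{\ \sim\ } \bigsqcup_{\lambda\ \text{strict},\ |\lambda|\le n} \mathrm{SDT}(\lambda)\times \mathrm{ShSet}_n(\lambda).$$ Moreover, if $KH(a_1,\dots,a_p)=(P,Q)$, then the words $(a_1,\dots,a_p)$ and $\rho(P)$ are $0$-Hecke expressions for the same signed permutation.
   Context: $\mathbb{N}=\{0,1,2,\dots\}$. **Signed permutations, 0-Hecke expressions.** $W_m$ is the group of bijections $w$ of $\{-m,\dots,-1,1,\dots,m\}$ with $w(-i)=-w(i)$, with Coxeter generators $s_0=(-1\ 1)$ and $s_i=(-i{-}1\ \,{-}i)(i\ \,i{+}1)$, $1\le i\le m-1$; $W_m\subset W_{m+1}$ naturally. The 0-Hecke product $\circ$ is the monoid structure on $W_m$ generated by the $s_i$ with the relations $s_i\circ s_i=s_i$, $s_i\circ s_j=s_j\circ s_i$ ($|i-j|\ge2$), $s_i\circ s_{i+1}\circ s_i=s_{i+1}\circ s_i\circ s_{i+1}$ ($i>0$), $s_1\circ s_0\circ s_1\circ s_0=s_0\circ s_1\circ s_0\circ s_1$. A word $(a_1,\dots,a_p)\in\mathbb{N}^p$ is a 0-Hecke expression for $w$ if $w=s_{a_1}\circ\cdots\circ s_{a_p}$. **Shapes and recording tableaux.** A strict partition is $\lambda=(\lambda_1>\dots>\lambda_k>0)$, $|\lambda|=\sum\lambda_i$, with shifted diagram $D_\lambda=\{(i,j):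 1\le i\le k,\ i\le j\le \lambda_i+i-1\}$ (row $i$, column $j$, rows numbered downward). $\mathrm{ShSet}_n(\lambda)$ is the set of fillings $T$ of $D_\lambda$ by nonempty sets that partition $\{1,\dots,n\}$ with $\max T_{ij}<\min T_{i+1,j}$ and $\max T_{ij}<\min T_{i,j+1}$ whenever those cells exist. The reading word $\rho(T)$ of a tableau with rows $R_1,\dots,R_k$ (top to bottom, each read left to right) is the concatenation $R_kR_{k-1}\cdots R_1$. **Strict decomposition tableaux (SDT).** A sequence $r_1\dots r_k$ in $\mathbb{N}$ is unimodal if $r_1>\dots>r_j<\dots<r_k$ for some $j$; $j$ (or $r_j$) is its dip. $\mathrm{SDT}(\lambda)$ is the set of fillings $T:D_\lambda\to\mathbb{N}$ with every row unimodal such that for any two consecutive rows $i,i+1$, writing $r_j=T_{i,j}$, $s_j=T_{i+1,j}$, none of the following occurs (for cells that exist): (i) $s_j\ge r_i$ for some $j$ ($r_i$ is the first entry of row $i$); (ii) $r_j\le s_{j'}<s_j$ with $j<j'$; (iii) $r_{j-1}<r_j$ and $s_j<s_{j'}\le r_j$ with $j<j'$; (iv)/(v) $s_j<r_{j'}\le r_j$ with $j'<j$. **Row insertion of $a\in\mathbb{N}$** into a row $R=r_1\dots r_\ell$ (dip position $q$) lying above a (possibly empty) row $S=s_2\dots s_k$ (dip position $p$, with $p=0$ if $S$ is empty), where $s_j$ is directly below $r_j$. Conventions: $r_0=\infty$, $r_{\ell+1}=\infty$, $s_1=-\infty$, $s_m=\infty$ for $m>k$ ($k=1$ if $S$ is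 empty). Put $A_d=\{s_{d+1},\dots,s_k,r_1,\dots,r_{d-1}\}$. Inserting $a$ into an empty row produces the row $(a)$ and outputs $\infty$. *Right insertion* (outputs $a'\in\mathbb{N}\cup\{\infty\}$ and a row $R''$). If $a=r_q$ let $i=q$; otherwise let $i$ be minimal with $q<i\le \ell+1$ and $r_i\ge a$. (R1) If $a\ne r_i$: $a'=r_i$, and $R''$ is $R$ with $r_i$ replaced by $a$ (if $i=\ell+1$, append $a$). (R2) If $a=r_i$ and $r_{i-1}>r_{i+1}$: $a'=r_{i+1}$ and $R''$ is $R$ with $r_{i+1}$ replaced by $r_i$. (R3) If $a=r_i$ and $r_{i-1}\le r_{i+1}$: $R''=R$ and $a'=\min(\{r_{i+1}\}\cup[(s_i,r_{i+1})\cap A_i])$. *Left insertion* (outputs $b\in\mathbb{N}\cup\{\infty\}$ and the new row $R'$). If $a'=\infty$: $b=\infty$, $R'=R''$. Otherwise, with $r_1,r_2,\dots$, $q$, and $A_d$ now referring to $R''$, let $1\le j\le q$ be minimal with $r_j\le a'$. (L1) If $a'\ne r_j$: $b=r_j$ and $R'$ is $R''$ with $r_j$ replaced by $a'$. (L2) If $a'=r_j$: $R'=R''$ and (I) if $j<p$: $b=\max(A_j\cap(r_{j+1},s_j))$ if $j+1<q$ and this set is nonempty; $b=\max(A_j\cap(-\infty,s_j))$ if $j+1\ge q$ and this set is nonempty; otherwise $b=r_{j+1}$; (II) if $j\ge p$: $b=s_{j+1}$ if $j+1\ge q$ and either $r_{j+1}>s_{j+1}$, or both $r_{j+2}>r_j>s_{j+1}$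 and $s_{j+2}>r_j$; otherwise $b=r_{j+1}$. **Insertion of $a$ into an SDT $P$** with rows $R_1,\dots,R_\ell$: row insert $a$ into $R_1$ (with $S=R_2$), replace $R_1$ by the new row, row insert the output into $R_2$ (with $S=R_3$), and so on, until the output is $\infty$; the insertion terminates in the row whose output is $\infty$. **$KH(a_1,\dots,a_p)=(P,Q)$**: start from empty tableaux and insert $a_1,\dots,a_p$ successively to get $P$. At step $t$, if the shape of $P$ grows by a cell, put $\{t\}$ in that cell of $Q$. If the shape $\lambda$ does not change and the insertion terminated in row $k$, let $\ell$ be the largest row index with $\lambda_\ell+\ell=\lambda_k+k$ (the lowest row whose last cell lies in the same column as the last cell of row $k$), and add $t$ to the set in the last cell $(\ell,\lambda_\ell+\ell-1)$ of row $\ell$ of $Q$.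
   Formalization: Two formulas are corrected, as the claim fails literally: SDT condition (iii) reads r_j<r_{j+1} instead of r_{j-1}<r_j (else rows 312/01 are admitted), and the insertion convention is s_1=+∞ instead of −∞ (else 0,2,1,1 inserts to shape (2,2)); the dip index p counts s_2 as position 2. *)

theory Defs
  imports "HOL-Combinatorics.Permutations" "HOL-Library.Extended"
begin

section \<open>Signed permutations and the 0-Hecke product\<close>

text \<open>Elements of $W_m$ are extended by the identity to all of \<open>\<int>\<close>; in particular they fix \<open>0\<close>,
  and the inclusions $W_m \subset W_{m+1}$ are inclusions of sets.\<close>

definition signed_perms :: "nat \<Rightarrow> (int \<Rightarrow> int) set" where
  "signed_perms m = {w. w permutes ({- int m..int m} - {0}) \<and> (\<forall>i. w (- i) = - w i)}"

definition gen :: "nat \<Rightarrow> int \<Rightarrow> int" where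
  "gen i = (if i = 0 then transpose (-1) 1
            else transpose (- int i - 1) (- int i) \<circ> transpose (int i) (int i + 1))"

text \<open>The product $w \circ s_i$: the condition says that $w s_i$ is longer than $w$
  (for \<open>i = 0\<close> it reads \<open>0 < w 1\<close>).\<close>

definition hecke_step :: "(int \<Rightarrow> int) \<Rightarrow> nat \<Rightarrow> int \<Rightarrow> int" where
  "hecke_step w i = (if w (int i) < w (int i + 1) then w \<circ> gen i else w)"

text \<open>The product $u \circ v$ multiplies \<open>u\<close> successively by the generators in some expression of \<open>v\<close>.
  The lemmas below show that the choice of expression is immaterial, and that this is a monoid
  structure on each \<open>signed_perms m\<close>, generated by the \<open>gen i\<close> with \<open>i < m\<close>, in which the
  0-Hecke relations hold.\<close>

definition hecke_prod :: "(int \<Rightarrow> int) \<Rightarrow> (int \<Rightarrow> int) \<Rightarrow> int \<Rightarrow> int" (infixl \<open>\<odot>\<close> 70) where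
  "u \<odot> v = foldl hecke_step u (SOME a. foldl hecke_step id a = v)"

definition hecke_expression :: "nat list \<Rightarrow> (int \<Rightarrow> int) \<Rightarrow> bool" where
  "hecke_expression a w \<longleftrightarrow> w = foldl (\<odot>) id (map gen a)"

lemma gen_apply:
  "gen i x = (if i = 0 then (if x = 1 then -1 else if x = -1 then 1 else x)
     else if x = int i then int i + 1 else if x = int i + 1 then int i
     else if x = - int i then - int i - 1 else if x = - int i - 1 then - int i else x)"
  by (auto simp: gen_def transpose_def)

lemma gen_gen [simp]: "gen i (gen i x) = x"
  by (auto simp: gen_apply)

lemma gen_comp_gen [simp]: "gen i \<circ> gen i = id"
  by (auto simp: fun_eq_iff)

lemma gen_minus: "gen i (- x) = - gen i x"
  by (auto simp: gen_apply)

lemma bij_gen: "bij (gen i)"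
  by (rule involuntory_imp_bij) simp

definition odd_bij :: "(int \<Rightarrow> int) \<Rightarrow> bool" where
  "odd_bij w \<longleftrightarrow> bij w \<and> (\<forall>i. w (- i) = - w i)"

lemma odd_bij_0: "odd_bij w \<Longrightarrow> w 0 = 0"
  unfolding odd_bij_def by (metis add.inverse_neutral neg_equal_zero)

lemma odd_bij_id: "odd_bij id"
  by (simp add: odd_bij_def)

lemma odd_bij_gen: "odd_bij (gen i)"
  by (simp add: odd_bij_def bij_gen gen_minus)

lemma odd_bij_comp: "odd_bij u \<Longrightarrow> odd_bij v \<Longrightarrow> odd_bij (u \<circ> v)"
  by (auto simp: odd_bij_def bij_comp)

lemma odd_bij_inv: 
  assumes "odd_bij w" shows "odd_bij (inv w)"
proof -
  have b: "bij w" and m: "\<And>i. w (- i) = - w i" using assms by (auto simp: odd_bij_def)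
  have "inv w (- i) = - inv w i" for i
    using b m by (metis bij_inv_eq_iff)
  then show ?thesis using b by (simp add: odd_bij_def bij_imp_bij_inv)
qed

lemma odd_bij_step: "odd_bij w \<Longrightarrow> odd_bij (hecke_step w i)"
  by (simp add: hecke_step_def odd_bij_comp odd_bij_gen)

lemma signed_perms_odd_bij: "w \<in> signed_perms m \<Longrightarrow> odd_bij w"
  by (auto simp: signed_perms_def odd_bij_def permutes_bij)

text \<open>The mirror image $s_i \circ w$ of \<open>hecke_step\<close>.\<close>

definition hecke_lstep :: "nat \<Rightarrow> (int \<Rightarrow> int) \<Rightarrow> int \<Rightarrow> int" where
  "hecke_lstep i w = (if inv w (int i) < inv w (int i + 1) then gen i \<circ> w else w)"

definition lower :: "nat \<Rightarrow> int" where
  "lower i = (if i = 0 then -1 else int i)"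

lemma asc_lower: "odd_bij w \<Longrightarrow> w (int i) < w (int i + 1) \<longleftrightarrow> w (lower i) < w (int i + 1)"
  using odd_bij_0[of w] by (auto simp: lower_def odd_bij_def)

definition swapped :: "nat \<Rightarrow> int \<Rightarrow> int \<Rightarrow> bool" where
  "swapped i x y \<longleftrightarrow> x = lower i \<and> y = int i + 1 \<or> x = int i + 1 \<and> y = lower i \<or>
     x = - lower i \<and> y = - (int i + 1) \<or> x = - (int i + 1) \<and> y = - lower i"

lemma gen_order:
  assumes "x \<noteq> 0" "y \<noteq> 0" "x \<noteq> y"
  shows "gen i x < gen i y \<longleftrightarrow> (if swapped i x y then y < x else x < y)"
proof (cases "i = 0")
  case True
  have "x = 1 \<or> x = -1 \<or> x > 1 \<or> x < -1" "y = 1 \<or> y = -1 \<or> y > 1 \<or> y < -1"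
    using assms by linarith+
  then show ?thesis
    using assms True by (elim disjE) (simp_all add: gen_apply swapped_def lower_def)
next
  case False
  define k where "k = int i"
  have k: "k > 0" using False by (simp add: k_def)
  have g: "gen i z = (if z = k then k + 1 else if z = k + 1 then k
     else if z = - k then - k - 1 else if z = - k - 1 then - k else z)" for z
    using False by (simp add: gen_apply k_def)
  have sw: "swapped i x y \<longleftrightarrow> x = k \<and> y = k + 1 \<or> x = k + 1 \<and> y = k \<or>
     x = - k \<and> y = - k - 1 \<or> x = - k - 1 \<and> y = - k"
    using False by (simp add: swapped_def lower_def k_def)
  have cs: "z = k \<or> z = k + 1 \<or> z = - k \<or> z = - k - 1 \<or> z > k + 1 \<or> z < - k - 1 \<or> (- k < z \<and> z < k)" for z
    by linarith
  show ?thesis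
    using cs[of x] cs[of y] assms(3) k unfolding g sw by (elim disjE) simp_all
qed

lemma gen_lower [simp]: "gen i (lower i) = int i + 1" "gen i (int i + 1) = lower i"
  by (auto simp: gen_apply lower_def)

lemma gen_eqI:
  assumes "odd_bij w" "swapped i (w (lower j)) (w (int j + 1))"
  shows "gen i \<circ> w = w \<circ> gen j"
proof
  fix x
  have inj: "\<And>x y. w x = w y \<longleftrightarrow> x = y" and m: "\<And>x. w (- x) = - w x"
    using assms(1) by (auto simp: odd_bij_def bij_def inj_def)
  have l: "lower j \<noteq> int j + 1" "lower i \<noteq> int i + 1" by (auto simp: lower_def)
  have A: "gen i (w (lower j)) = w (int j + 1)" "gen i (w (int j + 1)) = w (lower j)"
    using assms(2) unfolding swapped_def by (auto simp only: gen_minus gen_lower)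
  consider "x = lower j" | "x = int j + 1" | "x = - lower j" | "x = - (int j + 1)" |
    "x \<notin> {lower j, int j + 1, - lower j, - (int j + 1)}" by blast
  then show "(gen i \<circ> w) x = (w \<circ> gen j) x"
  proof cases
    case 3
    then show ?thesis using A(1) by (simp only: comp_apply gen_minus m gen_lower)
  next
    case 4
    then show ?thesis using A(2) by (simp only: comp_apply gen_minus m gen_lower)
  next
    case 5
    have 1: "gen j x = x" using 5 by (auto simp: gen_apply lower_def split: if_splits)
    have "w x \<notin> {w (lower j), w (int j + 1), w (- lower j), w (- (int j + 1))}"
      using 5 by (simp only: inj insert_iff empty_iff simp_thms)
    then have "w x \<notin> {lower i, int i + 1, - lower i, - (int i + 1)}"
      using assms(2) unfolding swapped_def m by (elim disjE) auto
    then have "gen i (w x) = w x" by (auto simp: gen_apply lower_def split: if_splits)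
    then show ?thesis using 1 by simp
  qed (use A in auto)
qed

lemma step_lstep:
  assumes w: "odd_bij w"
  shows "hecke_step (hecke_lstep i w) j = hecke_lstep i (hecke_step w j)"
proof -
  have b: "bij w" using w by (simp add: odd_bij_def)
  have iw: "odd_bij (inv w)" using w by (rule odd_bij_inv)
  have w_inv: "\<And>x. w (inv w x) = x" "\<And>x. inv w (w x) = x"
    using b by (auto simp: bij_is_surj bij_is_inj surj_f_inv_f)
  have inj: "\<And>x y. w x = w y \<longleftrightarrow> x = y" and m: "\<And>x. w (- x) = - w x"
    using w by (auto simp: odd_bij_def bij_def inj_def)
  have injv: "\<And>x y. inv w x = inv w y \<longleftrightarrow> x = y" and mv: "\<And>x. inv w (- x) = - inv w x"
    using iw by (auto simp: odd_bij_def bij_def inj_def)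
  have nz: "w (lower j) \<noteq> 0" "w (int j + 1) \<noteq> 0" "inv w (lower i) \<noteq> 0" "inv w (int i + 1) \<noteq> 0"
    using inj[of _ 0] injv[of _ 0] odd_bij_0[OF w] odd_bij_0[OF iw] by (auto simp: lower_def)
  have ne: "w (lower j) \<noteq> w (int j + 1)" "inv w (lower i) \<noteq> inv w (int i + 1)"
    by (auto simp: inj injv lower_def)
  let ?P = "w (int j) < w (int j + 1)" and ?Q = "inv w (int i) < inv w (int i + 1)"
  let ?E = "swapped i (w (lower j)) (w (int j + 1))"
  let ?E' = "swapped j (inv w (lower i)) (inv w (int i + 1))"
  have gw: "odd_bij (gen i \<circ> w)" and wg: "odd_bij (w \<circ> gen j)"
    using w by (simp_all add: odd_bij_comp odd_bij_gen)
  have inv_wg: "inv (w \<circ> gen j) = gen j \<circ> inv w"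
    by (rule inv_unique_comp) (auto simp: fun_eq_iff w_inv)
  have lP: "?P \<longleftrightarrow> w (lower j) < w (int j + 1)" by (rule asc_lower[OF w])
  have lQ: "?Q \<longleftrightarrow> inv w (lower i) < inv w (int i + 1)" by (rule asc_lower[OF iw])
  have P': "(gen i \<circ> w) (int j) < (gen i \<circ> w) (int j + 1) \<longleftrightarrow> (if ?E then \<not> ?P else ?P)"
    unfolding asc_lower[OF gw] unfolding comp_apply gen_order[OF nz(1,2) ne(1)] lP using ne(1) by auto
  have Q': "inv (w \<circ> gen j) (int i) < inv (w \<circ> gen j) (int i + 1) \<longleftrightarrow> (if ?E' then \<not> ?Q else ?Q)"
    unfolding asc_lower[OF odd_bij_inv[OF wg]]
    unfolding inv_wg comp_apply gen_order[OF nz(3,4) ne(2)] lQ using ne(2) by auto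
  have sw: "inv w x = y \<longleftrightarrow> w y = x" for x y using w_inv by metis
  have neg: "- a = b \<longleftrightarrow> a = - b" for a b :: int by auto
  have EE: "?E \<longleftrightarrow> ?E'"
    unfolding swapped_def sw m neg by blast
  show ?thesis
  proof (cases ?E)
    case True
    have eq: "gen i \<circ> w = w \<circ> gen j" by (rule gen_eqI[OF w True])
    have PQ: "?P \<longleftrightarrow> ?Q"
    proof -
      have lo: "lower k < int k + 1" for k by (simp add: lower_def)
      consider "w (lower j) = lower i" "w (int j + 1) = int i + 1"
        | "w (lower j) = int i + 1" "w (int j + 1) = lower i"
        | "w (lower j) = - lower i" "w (int j + 1) = - (int i + 1)"
        | "w (lower j) = - (int i + 1)" "w (int j + 1) = - lower i"
        using True unfolding swapped_def by blast
      then show ?thesis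
      proof cases
        case 1
        then have "inv w (lower i) = lower j" "inv w (int i + 1) = int j + 1" by (simp_all add: sw)
        then show ?thesis unfolding lP lQ using 1 lo by simp
      next
        case 2
        then have "inv w (lower i) = int j + 1" "inv w (int i + 1) = lower j" by (simp_all add: sw)
        then show ?thesis unfolding lP lQ using 2 lo[of i] lo[of j] by simp
      next
        case 3
        then have "inv w (lower i) = - lower j" "inv w (int i + 1) = - (int j + 1)"
          by (simp_all only: sw m minus_minus)
        then show ?thesis unfolding lP lQ using 3 lo[of i] lo[of j] by simp
      next
        case 4
        then have "inv w (lower i) = - (int j + 1)" "inv w (int i + 1) = - lower j"
          by (simp_all only: sw m minus_minus)
        then show ?thesis unfolding lP lQ using 4 lo[of i] lo[of j] by simp
      qed
    qed
    show ?thesis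
      using True EE PQ P' Q' eq unfolding hecke_step_def hecke_lstep_def by auto
  next
    case False
    then show ?thesis
      using EE P' Q' unfolding hecke_step_def hecke_lstep_def by (auto simp: comp_assoc)
  qed
qed

lemma odd_bij_lstep: "odd_bij w \<Longrightarrow> odd_bij (hecke_lstep i w)"
  by (simp add: hecke_lstep_def odd_bij_comp odd_bij_gen)

lemma odd_bij_foldl: "odd_bij w \<Longrightarrow> odd_bij (foldl hecke_step w a)"
  by (induction a arbitrary: w) (auto simp: odd_bij_step)

lemma odd_bij_foldr: "odd_bij w \<Longrightarrow> odd_bij (foldr hecke_lstep a w)"
  by (induction a) (auto simp: odd_bij_lstep)

lemma foldl_step_lstep:
  "odd_bij w \<Longrightarrow> foldl hecke_step (hecke_lstep i w) a = hecke_lstep i (foldl hecke_step w a)"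
  by (induction a arbitrary: w) (auto simp: step_lstep odd_bij_step)

lemma foldl_step_foldr_lstep:
  "odd_bij w \<Longrightarrow>
    foldl hecke_step (foldr hecke_lstep b w) a = foldr hecke_lstep b (foldl hecke_step w a)"
  by (induction b) (auto simp: foldl_step_lstep odd_bij_foldr)

lemma foldl_id_eq_foldr_id: "foldl hecke_step id a = foldr hecke_lstep a id"
proof (induction a)
  case (Cons i a)
  have "hecke_step id i = hecke_lstep i id" by (simp add: hecke_step_def hecke_lstep_def)
  then show ?case using Cons foldl_step_lstep[OF odd_bij_id, of i a] by (simp only: foldl_Cons foldr_Cons comp_apply)
qed simp

lemma hecke_prod_word:
  "foldl hecke_step id a \<odot> foldl hecke_step id b = foldl hecke_step id (a @ b)"
proof -
  define c where "c = (SOME c. foldl hecke_step id c = foldl hecke_step id b)"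
  have c: "foldl hecke_step id c = foldl hecke_step id b"
    unfolding c_def by (rule someI[of _ b]) simp
  have "foldl hecke_step (foldl hecke_step id a) c = foldr hecke_lstep a (foldl hecke_step id c)" for c
    using foldl_step_foldr_lstep[OF odd_bij_id] foldl_id_eq_foldr_id by simp
  then show ?thesis
    unfolding hecke_prod_def c_def[symmetric] using c by (metis foldl_append)
qed

lemma step_id [simp]: "hecke_step id i = gen i"
  by (simp add: hecke_step_def)

lemma hecke_expression_iff: "hecke_expression a w \<longleftrightarrow> w = foldl hecke_step id a"
proof -
  have "foldl (\<odot>) id (map gen a) = foldl hecke_step id a"
  proof (induction a rule: rev_induct)
    case (snoc i a)
    have "gen i = foldl hecke_step id [i]" by simp
    then show ?case using hecke_prod_word[of a "[i]"] snoc
      by (simp only: map_append list.map foldl_append foldl_Cons foldl_Nil)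
  qed simp
  then show ?thesis by (simp add: hecke_expression_def)
qed

lemma gen_signed_perms: "i < m \<Longrightarrow> gen i \<in> signed_perms m"
proof -
  assume i: "i < m"
  have "\<exists>!x. gen i x = y" for y
    using bij_gen by (simp add: bij_iff)
  moreover have "gen i x = x" if "x \<notin> {- int m..int m} - {0}" for x
    using that i by (auto simp: gen_apply)
  ultimately show "gen i \<in> signed_perms m"
    by (simp add: signed_perms_def permutes_def gen_minus)
qed

lemma signed_perms_step: 
  "w \<in> signed_perms m \<Longrightarrow> i < m \<Longrightarrow> hecke_step w i \<in> signed_perms m"
  using gen_signed_perms[of i m]
  by (auto simp: hecke_step_def signed_perms_def intro: permutes_compose)

lemma id_signed_perms: "id \<in> signed_perms m"
  by (simp add: signed_perms_def permutes_id)

lemma signed_perms_foldl: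
  "w \<in> signed_perms m \<Longrightarrow> set a \<subseteq> {..<m} \<Longrightarrow> foldl hecke_step w a \<in> signed_perms m"
  by (induction a arbitrary: w) (auto simp: signed_perms_step)


lemma signed_perms_generated:
  assumes "w \<in> signed_perms m"
  shows "\<exists>a. set a \<subseteq> {..<m} \<and> hecke_expression a w"
  using assms
proof (induction "nat ((\<Sum>x=1..int m. x * int m) - (\<Sum>x=1..int m. x * w x))"
    arbitrary: w rule: less_induct)
  case (less w)
  have perm: "w permutes ({- int m..int m} - {0})" and odd: "\<And>i. w (- i) = - w i"
    using less.prems by (auto simp: signed_perms_def)
  have w: "odd_bij w" using less.prems by (rule signed_perms_odd_bij)
  have w0: "w 0 = 0" by (rule odd_bij_0[OF w])
  have range: "w x \<in> {- int m..int m} - {0}" if "x \<in> {- int m..int m} - {0}" for x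
    using permutes_in_image[OF perm] that by blast
  show ?case
  proof (cases "\<exists>i<m. w (int i + 1) < w (int i)")
    case True
    then obtain i where i: "i < m" "w (int i + 1) < w (int i)" by blast
    let ?u = "w \<circ> gen i"
    have u: "?u \<in> signed_perms m"
      using less.prems gen_signed_perms[OF i(1)]
      by (auto simp: signed_perms_def intro: permutes_compose)
    have "(\<Sum>x=1..int m. x * w x) < (\<Sum>x=1..int m. x * ?u x)"
    proof (cases "i = 0")
      case True
      have "x * w x \<le> x * ?u x" if "x \<in> {1..int m}" for x
        using that i odd[of 1] w0 by (auto simp: True gen_apply)
      moreover have "1 * w 1 < 1 * ?u 1" using i odd[of 1] w0 by (auto simp: True gen_apply)
      ultimately show ?thesis using i by (intro sum_strict_mono_ex1) (auto intro!: bexI[of _ 1])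
    next
      case False
      let ?A = "{1..int m} - {int i, int i + 1}"
      have split: "(\<Sum>x=1..int m. f x) = f (int i) + f (int i + 1) + sum f ?A" for f :: "int \<Rightarrow> int"
      proof -
        have "{1..int m} = insert (int i) (insert (int i + 1) ?A)" using i False by auto
        then have "sum f {1..int m} = sum f (insert (int i) (insert (int i + 1) ?A))" by simp
        also have "\<dots> = f (int i) + f (int i + 1) + sum f ?A" by (simp add: add.assoc)
        finally show ?thesis .
      qed
      have "sum (\<lambda>x. x * w x) ?A = sum (\<lambda>x. x * ?u x) ?A"
        by (intro sum.cong) (use False in \<open>auto simp: gen_apply\<close>)
      moreover have "int i * w (int i) + (int i + 1) * w (int i + 1)
          < int i * ?u (int i) + (int i + 1) * ?u (int i + 1)"
        using i False by (simp add: gen_apply algebra_simps)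
      ultimately show ?thesis unfolding split by linarith
    qed
    moreover have "(\<Sum>x=1..int m. x * v x) \<le> (\<Sum>x=1..int m. x * int m)"
      if "v \<in> signed_perms m" for v
    proof (rule sum_mono)
      fix x assume x: "x \<in> {1..int m}"
      have "v x \<in> {- int m..int m} - {0}"
        using that x permutes_in_image[of v "{- int m..int m} - {0}" x]
        by (auto simp: signed_perms_def)
      then show "x * v x \<le> x * int m" using x by (intro mult_left_mono) auto
    qed
    ultimately obtain a where a: "set a \<subseteq> {..<m}" "?u = foldl hecke_step id a"
      using less.hyps[OF _ u] u less.prems unfolding hecke_expression_iff by fastforce
    have "?u (int i) < ?u (int i + 1)"
      using i w0 odd[of 1] by (auto simp: gen_apply)
    then have "hecke_step ?u i = w" by (simp add: hecke_step_def comp_assoc)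
    then have "foldl hecke_step id (a @ [i]) = w" using a by simp
    then show ?thesis
      unfolding hecke_expression_iff using a(1) i(1) by (intro exI[of _ "a @ [i]"]) auto
  next
    case False
    have asc: "w (int i) < w (int i + 1)" if "i < m" for i
    proof -
      have "w (int i) \<noteq> w (int i + 1)"
        using w by (auto simp: odd_bij_def bij_def inj_eq)
      then show ?thesis using False that by force
    qed
    have lb: "int i \<le> w (int i)" if "i \<le> m" for i
      using that
    proof (induction i)
      case (Suc i)
      then show ?case using asc[of i] by (simp add: add.commute)
    qed (simp add: w0)
    have ub: "w (int (m - d)) \<le> int (m - d)" if "d \<le> m" for d
      using that
    proof (induction d)
      case 0
      show ?case using range[of "int m"] w0 by (cases "m = 0") auto
    next
      case (Suc d)
      have "int (m - d) = int (m - Suc d) + 1" using Suc.prems by simp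
      then show ?case using Suc asc[of "m - Suc d"] by simp
    qed
    have eq: "w (int i) = int i" if "i \<le> m" for i
      using lb[OF that] ub[of "m - i"] that by simp
    have "w x = x" for x
    proof (cases "x \<in> {- int m..int m}")
      case True
      then show ?thesis using eq[of "nat x"] eq[of "nat (- x)"] odd[of x] by (cases "x \<ge> 0") auto
    next
      case False
      then show ?thesis using perm by (auto simp: permutes_def)
    qed
    then have "w = id" by auto
    then show ?thesis by (intro exI[of _ "[]"]) (simp add: hecke_expression_iff)
  qed
qed

lemma hecke_prod_closed:
  assumes "u \<in> signed_perms m" "v \<in> signed_perms m"
  shows "u \<odot> v \<in> signed_perms m"
proof -
  obtain a b where "set a \<subseteq> {..<m}" "set b \<subseteq> {..<m}"
      "u = foldl hecke_step id a" "v = foldl hecke_step id b"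
    using assms signed_perms_generated unfolding hecke_expression_iff by metis
  then show ?thesis
    using signed_perms_foldl[OF id_signed_perms, of "a @ b" m] hecke_prod_word[of a b] by simp
qed

lemma hecke_prod_assoc:
  assumes "u \<in> signed_perms m" "v \<in> signed_perms m" "w \<in> signed_perms m"
  shows "u \<odot> v \<odot> w = u \<odot> (v \<odot> w)"
proof -
  obtain a b c where "u = foldl hecke_step id a" "v = foldl hecke_step id b"
      "w = foldl hecke_step id c"
    using assms signed_perms_generated unfolding hecke_expression_iff by metis
  then show ?thesis by (simp only: hecke_prod_word append_assoc)
qed

lemma hecke_prod_id:
  assumes "w \<in> signed_perms m"
  shows "id \<odot> w = w" "w \<odot> id = w"
proof -
  obtain a where "w = foldl hecke_step id a"
    using assms signed_perms_generated unfolding hecke_expression_iff by metis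
  then show "id \<odot> w = w" "w \<odot> id = w"
    using hecke_prod_word[of "[]" a] hecke_prod_word[of a "[]"] by simp_all
qed

lemma hecke_prod_gen:
  assumes "w \<in> signed_perms m"
  shows "w \<odot> gen i = hecke_step w i"
proof -
  obtain a where "w = foldl hecke_step id a"
    using assms signed_perms_generated unfolding hecke_expression_iff by metis
  then show ?thesis using hecke_prod_word[of a "[i]"] by simp
qed

lemma hecke_prod_gens:
  "gen i \<odot> gen j = foldl hecke_step id [i, j]"
  "gen i \<odot> gen j \<odot> gen k = foldl hecke_step id [i, j, k]"
  "gen i \<odot> gen j \<odot> gen k \<odot> gen l = foldl hecke_step id [i, j, k, l]"
  using hecke_prod_word[of "[i]" "[j]"] hecke_prod_word[of "[i, j]" "[k]"]
    hecke_prod_word[of "[i, j, k]" "[l]"] by simp_all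

lemma gen_braid:
  assumes "0 < i"
  shows "gen i \<circ> gen (i + 1) \<circ> gen i = gen (i + 1) \<circ> gen i \<circ> gen (i + 1)"
proof
  fix x
  consider "x = int i" | "x = int i + 1" | "x = int i + 2"
    | "x = - int i" | "x = - int i - 1" | "x = - int i - 2"
    | "x \<notin> {int i, int i + 1, int i + 2, - int i, - int i - 1, - int i - 2}" by blast
  then show "(gen i \<circ> gen (i + 1) \<circ> gen i) x = (gen (i + 1) \<circ> gen i \<circ> gen (i + 1)) x"
    using assms by cases (simp_all add: gen_apply)
qed

lemma gen_braid_0:
  "gen 1 \<circ> gen 0 \<circ> gen 1 \<circ> gen 0 = gen 0 \<circ> gen 1 \<circ> gen 0 \<circ> gen 1"
proof
  fix x :: int
  consider "x = 1" | "x = 2" | "x = -1" | "x = -2" | "x \<notin> {1, 2, -1, -2}" by blast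
  then show "(gen 1 \<circ> gen 0 \<circ> gen 1 \<circ> gen 0) x = (gen 0 \<circ> gen 1 \<circ> gen 0 \<circ> gen 1) x"
    by cases (simp_all add: gen_apply)
qed

lemma hecke_relations:
  "gen i \<odot> gen i = gen i"
  "i + 2 \<le> j \<Longrightarrow> gen i \<odot> gen j = gen j \<odot> gen i"
  "0 < i \<Longrightarrow> gen i \<odot> gen (i + 1) \<odot> gen i = gen (i + 1) \<odot> gen i \<odot> gen (i + 1)"
  "gen 1 \<odot> gen 0 \<odot> gen 1 \<odot> gen 0 = gen 0 \<odot> gen 1 \<odot> gen 0 \<odot> gen 1"
proof -
  show "gen i \<odot> gen i = gen i"
    unfolding hecke_prod_gens(1) by (simp add: hecke_step_def gen_apply)
  show "gen i \<odot> gen j = gen j \<odot> gen i" if "i + 2 \<le> j"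
    unfolding hecke_prod_gens(1) using that by (auto simp: hecke_step_def gen_apply fun_eq_iff)
  show "gen i \<odot> gen (i + 1) \<odot> gen i = gen (i + 1) \<odot> gen i \<odot> gen (i + 1)" if "0 < i"
    unfolding hecke_prod_gens(2) using gen_braid[OF that] that
    by (simp add: hecke_step_def gen_apply)
  show "gen 1 \<odot> gen 0 \<odot> gen 1 \<odot> gen 0 = gen 0 \<odot> gen 1 \<odot> gen 0 \<odot> gen 1"
    unfolding hecke_prod_gens(3) using gen_braid_0 by (simp add: hecke_step_def gen_apply)
qed


section \<open>Shifted shapes, set-valued tableaux and strict decomposition tableaux\<close>

text \<open>A filling of a shifted diagram is the list of its rows; row \<open>i\<close> starts in column \<open>i\<close>.\<close>

type_synonym 'a tableau = "'a list list"

definition strict_partition :: "nat list \<Rightarrow> bool" where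
  "strict_partition mu \<longleftrightarrow> sorted_wrt (>) mu \<and> (\<forall>x\<in>set mu. 0 < x)"

definition shifted_diagram :: "nat list \<Rightarrow> (nat \<times> nat) set" where
  "shifted_diagram mu = {(i, j). 1 \<le> i \<and> i \<le> length mu \<and> i \<le> j \<and> j \<le> mu ! (i - 1) + i - 1}"

definition shape :: "'a tableau \<Rightarrow> nat list" where
  "shape T = map length T"

definition entry :: "'a tableau \<Rightarrow> nat \<Rightarrow> nat \<Rightarrow> 'a" where
  "entry T i j = T ! (i - 1) ! (j - i)"

definition reading_word :: "'a tableau \<Rightarrow> 'a list" where
  "reading_word T = concat (rev T)"

definition ShSet :: "nat \<Rightarrow> nat list \<Rightarrow> nat set tableau set" where
  "ShSet n mu = {T. shape T = mu \<and>
     (\<forall>(i, j)\<in>shifted_diagram mu. entry T i j \<noteq> {}) \<and>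
     (\<Union>(i, j)\<in>shifted_diagram mu. entry T i j) = {1..n} \<and>
     (\<forall>(i, j)\<in>shifted_diagram mu. \<forall>(i', j')\<in>shifted_diagram mu.
        (i, j) \<noteq> (i', j') \<longrightarrow> entry T i j \<inter> entry T i' j' = {}) \<and>
     (\<forall>(i, j)\<in>shifted_diagram mu.
        ((i + 1, j) \<in> shifted_diagram mu \<longrightarrow> Max (entry T i j) < Min (entry T (i + 1) j)) \<and>
        ((i, j + 1) \<in> shifted_diagram mu \<longrightarrow> Max (entry T i j) < Min (entry T i (j + 1))))}"

definition is_dip :: "nat list \<Rightarrow> nat \<Rightarrow> bool" where
  "is_dip r j \<longleftrightarrow> 1 \<le> j \<and> j \<le> length r \<and>
     sorted_wrt (>) (take j r) \<and> sorted_wrt (<) (drop (j - 1) r)"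

definition unimodal :: "nat list \<Rightarrow> bool" where
  "unimodal r \<longleftrightarrow> (\<exists>j. is_dip r j)"

text \<open>In the third alternative the index \<open>j\<close> ranges over the columns at or to the right of the dip of row
  \<open>i\<close>. With the condition \<open>r (j - 1) < r j\<close>, which leaves out the dip itself, the rows
  \<open>3 1 2\<close> over \<open>0 1\<close> would be admitted, although no word inserts to them.\<close>

definition forbidden :: "nat tableau \<Rightarrow> nat \<Rightarrow> bool" where
  "forbidden T i \<longleftrightarrow>
     (let D = shifted_diagram (shape T); r = entry T i; s = entry T (i + 1) in
       (\<exists>j. (i + 1, j) \<in> D \<and> s j \<ge> r i) \<or>
       (\<exists>j j'. j < j' \<and> (i, j) \<in> D \<and> (i + 1, j) \<in> D \<and> (i + 1, j') \<in> D \<and>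
          r j \<le> s j' \<and> s j' < s j) \<or>
       (\<exists>j j'. j < j' \<and> (i, j) \<in> D \<and> (i, j + 1) \<in> D \<and> (i + 1, j) \<in> D \<and> (i + 1, j') \<in> D \<and>
          r j < r (j + 1) \<and> s j < s j' \<and> s j' \<le> r j) \<or>
       (\<exists>j j'. j' < j \<and> (i, j') \<in> D \<and> (i, j) \<in> D \<and> (i + 1, j) \<in> D \<and>
          s j < r j' \<and> r j' \<le> r j))"

definition SDT :: "nat list \<Rightarrow> nat tableau set" where
  "SDT mu = {T. shape T = mu \<and> (\<forall>R\<in>set T. unimodal R) \<and>
     (\<forall>i. 1 \<le> i \<and> i < length mu \<longrightarrow> \<not> forbidden T i)}"

lemma SDT_ShSet_disjoint:
  "mu \<noteq> nu \<Longrightarrow> (SDT mu \<times> ShSet n mu) \<inter> (SDT nu \<times> ShSet n nu) = {}"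
  by (auto simp: SDT_def)


section \<open>Kraskiewicz--Hecke insertion\<close>

text \<open>The dip position is the end of the initial strictly decreasing run. For unimodal rows this is
  the position in \<open>is_dip\<close>. It is also needed for the intermediate row after a right
  insertion that duplicates the minimum of the row; there either occurrence leads to the same left
  insertion.\<close>

definition dip :: "nat list \<Rightarrow> nat" where
  "dip r = (GREATEST j. j \<le> length r \<and> sorted_wrt (>) (take j r))"

lemma dip_eqI:
  assumes "is_dip r j"
  shows "dip r = j"
proof -
  have j: "1 \<le> j" "j \<le> length r" "sorted_wrt (>) (take j r)" "sorted_wrt (<) (drop (j - 1) r)"
    using assms by (auto simp: is_dip_def)
  have "y \<le> j" if y: "y \<le> length r" "sorted_wrt (>) (take y r)" for y
  proof (rule ccontr)
    assume "\<not> y \<le> j"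
    then have "j < y" by simp
    have "r ! (j - 1) > r ! j"
      using y j \<open>j < y\<close> sorted_wrt_nth_less[OF y(2), of "j - 1" j] by auto
    moreover have "r ! (j - 1) < r ! j"
      using y j \<open>j < y\<close> sorted_wrt_nth_less[OF j(4), of 0 1] by auto
    ultimately show False by simp
  qed
  then show ?thesis
    unfolding dip_def using j by (intro Greatest_equality) auto
qed

definition row_at :: "nat list \<Rightarrow> nat \<Rightarrow> nat extended" where
  "row_at R j = (if 1 \<le> j \<and> j \<le> length R then Fin (R ! (j - 1)) else \<infinity>)"

text \<open>The row below is indexed from \<open>2\<close>. Its value at \<open>1\<close> only matters in \<open>left_insert\<close>, in
  the branch \<open>j < p\<close> with \<open>j = 1\<close>, where it bounds intervals from above and has to be \<open>\<infinity>\<close>: with \<open>-\<infinity>\<close> the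
  word \<open>0 2 1 1\<close> would insert to a tableau with two rows of length 2.\<close>

definition below_at :: "nat list \<Rightarrow> nat \<Rightarrow> nat extended" where
  "below_at S j = (if 2 \<le> j \<and> j \<le> length S + 1 then Fin (S ! (j - 2)) else \<infinity>)"

definition below_dip :: "nat list \<Rightarrow> nat" where
  "below_dip S = (if S = [] then 0 else dip S + 1)"

definition A_set :: "nat list \<Rightarrow> nat list \<Rightarrow> nat \<Rightarrow> nat extended set" where
  "A_set R S d = below_at S ` {d + 1..length S + 1} \<union> row_at R ` {1..<d}"

definition right_insert :: "nat \<Rightarrow> nat list \<Rightarrow> nat list \<Rightarrow> nat extended \<times> nat list" where
  "right_insert a R S =
     (let q = dip R; r = row_at R; s = below_at S;
          i = (if Fin a = r q then q
               else (LEAST i. q < i \<and> i \<le> length R + 1 \<and> r i \<ge> Fin a))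
      in if Fin a \<noteq> r i
           then (r i, if i = length R + 1 then R @ [a] else R[i - 1 := a])
         else if r (i - 1) > r (i + 1)
           then (r (i + 1), R[i := R ! (i - 1)])
         else (Min ({r (i + 1)} \<union> ({s i<..<r (i + 1)} \<inter> A_set R S i)), R))"

definition left_insert :: "nat extended \<Rightarrow> nat list \<Rightarrow> nat list \<Rightarrow> nat extended \<times> nat list" where
  "left_insert a' R S =
     (case a' of Fin x \<Rightarrow>
        (let q = dip R; p = below_dip S; r = row_at R; s = below_at S;
             j = (LEAST j. 1 \<le> j \<and> j \<le> q \<and> r j \<le> a')
         in if a' \<noteq> r j then (r j, R[j - 1 := x])
            else
             ((if j < p then
                 (if j + 1 < q \<and> A_set R S j \<inter> {r (j + 1)<..<s j} \<noteq> {}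
                    then Max (A_set R S j \<inter> {r (j + 1)<..<s j})
                  else if j + 1 \<ge> q \<and> A_set R S j \<inter> {-\<infinity><..<s j} \<noteq> {}
                    then Max (A_set R S j \<inter> {-\<infinity><..<s j})
                  else r (j + 1))
               else
                 (if j + 1 \<ge> q \<and>
                     (r (j + 1) > s (j + 1) \<or>
                      (r (j + 2) > r j \<and> r j > s (j + 1) \<and> s (j + 2) > r j))
                    then s (j + 1)
                  else r (j + 1))), R))
      | _ \<Rightarrow> (\<infinity>, R))"

definition row_insert :: "nat \<Rightarrow> nat list \<Rightarrow> nat list \<Rightarrow> nat extended \<times> nat list" where
  "row_insert a R S =
     (if R = [] then (\<infinity>, [a])
      else (let (a', R'') = right_insert a R S in left_insert a' R'' S))"

text \<open>The result is the new tableau and the index of the row in which the insertion terminates.\<close>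

fun tableau_insert :: "nat \<Rightarrow> nat tableau \<Rightarrow> nat tableau \<times> nat" where
  "tableau_insert a [] = ([snd (row_insert a [] [])], 1)"
| "tableau_insert a (R # P) =
     (let (b, R') = row_insert a R (if P = [] then [] else hd P) in
      case b of Fin b' \<Rightarrow> (let (P', k) = tableau_insert b' P in (R' # P', k + 1))
              | _ \<Rightarrow> (R' # P, 1))"

definition record_growth ::
    "nat \<Rightarrow> nat list \<Rightarrow> nat list \<Rightarrow> nat set tableau \<Rightarrow> nat set tableau" where
  "record_growth t mu mu' Q =
     map (\<lambda>i. map (\<lambda>j. if (i, j) \<in> shifted_diagram mu then entry Q i j else {t})
                  [i..<mu' ! (i - 1) + i])
         [1..<length mu' + 1]"

definition record_stay :: "nat \<Rightarrow> nat list \<Rightarrow> nat \<Rightarrow> nat set tableau \<Rightarrow> nat set tableau" where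
  "record_stay t mu k Q =
     (let l = Max {l. 1 \<le> l \<and> l \<le> length mu \<and> mu ! (l - 1) + l = mu ! (k - 1) + k};
          c = mu ! (l - 1) + l - 1
      in Q[l - 1 := (Q ! (l - 1))[c - l := insert t (entry Q l c)]])"

definition KH_step ::
    "nat tableau \<times> nat set tableau \<Rightarrow> nat \<times> nat \<Rightarrow> nat tableau \<times> nat set tableau" where
  "KH_step = (\<lambda>(P, Q) (t, a).
     let (P', k) = tableau_insert a P in
       (P', if shape P' = shape P then record_stay t (shape P) k Q
            else record_growth t (shape P) (shape P') Q))"

definition KH :: "nat list \<Rightarrow> nat tableau \<times> nat set tableau" where
  "KH a = foldl KH_step ([], []) (enumerate 1 a)"

end

theory Submission imports Defs begin

text \<open>
  Consider one row \<open>R\<close> over a row \<open>S\<close>. Both halves of a row insertion are reversible: the pairs (letter, row)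
  that right insertion can hand over to left insertion, and those that left insertion can emit, are cut out
  by explicit inequalities (\<open>mid_state\<close>, \<open>out_state\<close>), and in either case the resulting pair determines
  which rule produced it (\<open>right_stays\<close>, \<open>left_stays\<close>, \<open>swaps\<close>). What makes the rows fit together is that
  a row \<open>R'\<close> can emit \<open>b\<close> over \<open>S\<close> if and only if \<open>R'\<close> may stand over the row that arises from \<open>S\<close> by
  inserting \<open>b\<close>. Hence insertion into a tableau can be undone from the final tableau, the row in which it
  ended and whether the shape has grown. It always ends in a corner, either by adding a box to the shape or
  with the shape unchanged, so the position of the largest entry of \<open>Q\<close> and whether it is alone in its
  cell carry exactly this information.

  For the 0-Hecke statement, each rule turns the word \<open>S R a\<close> into \<open>S b R'\<close>: letters are moved past
  letters at distance other than one, and the rules that leave the row unchanged or take the output from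
  \<open>S\<close> rest on a copy of the letter in \<open>S\<close> that absorbs it, directly or after a braid relation.
\<close>

section \<open>Reversibility of right and left insertion\<close>

text \<open>Everything about two adjacent rows is stated by quantified linear inequalities over
  integer columns and letters, so that each combination of rules becomes one first-order problem.
  \<open>M\<close> is a parameter because letters are unbounded; it is chosen once a tableau and a
  letter are given.

  The difficulty is that the output of a half step does not reveal the rule behind it. Part of the
  information sits in the row below, as (R3) and (L2) may take their output from there. The clauses
  of \<open>mid_state\<close> and \<open>out_state\<close> record what has to be remembered: they
  follow from an insertion and suffice to revert it. Rule (R2) duplicates the minimum, so its
  intermediate row is no \<open>valley\<close>; it never passes through \<open>mid_state\<close>.

  The relation to the row above is an equivalence rather than mere preservation because insertion is
  undone from the bottom: the inner tableau is reverted first, which reveals the letter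
  \<open>b\<close>, and only then can it be asked whether the row above has emitted \<open>b\<close>
  over the restored row.\<close>

declare [[smt_timeout = 200]]

text \<open>A unimodal row in the columns \<open>f\<close> to \<open>l\<close> with dip
  \<open>q\<close>. The first column is a parameter because both rows share one numbering of
  columns: the upper row starts in column 1, the lower one in column 2. For \<open>l < f\<close>
  only the constant \<open>M\<close> remains, which is the empty row.\<close>

definition valley :: "int \<Rightarrow> (int \<Rightarrow> int) \<Rightarrow> int \<Rightarrow> int \<Rightarrow> int \<Rightarrow> bool" where
  "valley M r f l q \<longleftrightarrow>
     (\<forall>x. f \<le> x \<and> x \<le> l \<longrightarrow> 0 \<le> r x \<and> r x < M) \<and> (\<forall>x. x < f \<or> l < x \<longrightarrow> r x = M) \<and>
     (\<forall>x y. f \<le> x \<and> x < y \<and> y \<le> q \<longrightarrow> r y < r x) \<and>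
     (\<forall>x y. q \<le> x \<and> x < y \<and> y \<le> l \<longrightarrow> r x < r y)"

text \<open>Rows are functions on the integers whose value outside the row is \<open>M\<close>, in the role of infinity. The
  lower row lives on \<open>2..k\<close>, and \<open>k = p = 1\<close> encodes an empty one. Since \<open>s 1 = M\<close>, the last condition
  with \<open>x = 1\<close> says that the lower row stays below \<open>r 1\<close>.\<close>

definition stacked ::
    "int \<Rightarrow> (int \<Rightarrow> int) \<Rightarrow> int \<Rightarrow> int \<Rightarrow> (int \<Rightarrow> int) \<Rightarrow> int \<Rightarrow> int \<Rightarrow> bool" where
  "stacked M r l q s k p \<longleftrightarrow>
     1 \<le> q \<and> q \<le> l \<and> (k = 1 \<and> p = 1 \<or> 2 \<le> p \<and> p \<le> k) \<and> k \<le> l \<and>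
     valley M r 1 l q \<and> valley M s 2 k p \<and>
     (\<forall>x y. q \<le> x \<and> x < y \<longrightarrow> \<not> (s x < s y \<and> s y \<le> r x)) \<and>
     (\<forall>x t. q \<le> x \<and> 1 \<le> t \<and> t < x \<longrightarrow> \<not> (s x < r t \<and> r t \<le> r x)) \<and>
     (\<forall>x y. x < y \<longrightarrow> \<not> (r x \<le> s y \<and> s y < s x))"

definition between :: "(int \<Rightarrow> int) \<Rightarrow> (int \<Rightarrow> int) \<Rightarrow> int \<Rightarrow> int \<Rightarrow> bool" where
  "between r s d a \<longleftrightarrow> (\<exists>x. d < x \<and> s x = a) \<or> (\<exists>t. 1 \<le> t \<and> t < d \<and> r t = a)"

text \<open>The value \<open>M\<close> after the last column ends the search for every letter below
  \<open>M\<close>, in place of the bound \<open>length R + 1\<close>.\<close>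

definition right_slot :: "(int \<Rightarrow> int) \<Rightarrow> int \<Rightarrow> int \<Rightarrow> int \<Rightarrow> bool" where
  "right_slot r q a i \<longleftrightarrow>
     (if a = r q then i = q else q < i \<and> a \<le> r i \<and> (\<forall>x. q < x \<and> x < i \<longrightarrow> r x < a))"

text \<open>The first column \<open>f\<close> is 1 for an upper row and 2 when the same row is
  regarded as a lower one.\<close>

definition left_slot :: "(int \<Rightarrow> int) \<Rightarrow> int \<Rightarrow> int \<Rightarrow> int \<Rightarrow> int \<Rightarrow> bool" where
  "left_slot r f q a j \<longleftrightarrow> f \<le> j \<and> j \<le> q \<and> r j \<le> a \<and> (\<forall>x. f \<le> x \<and> x < j \<longrightarrow> a < r x)"

text \<open>The minimum of rule (R3), expressed by the absence of smaller candidates instead of by a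
  finite set. The output infinity is the value \<open>M\<close>, which arises as
  \<open>r (i + 1)\<close> at the end of the row.\<close>

definition right_out :: "(int \<Rightarrow> int) \<Rightarrow> (int \<Rightarrow> int) \<Rightarrow> int \<Rightarrow> int \<Rightarrow> bool" where
  "right_out r s i a \<longleftrightarrow> a \<le> r (i + 1) \<and>
     (a = r (i + 1) \<or> s i < a \<and> a < r (i + 1) \<and> between r s i a) \<and>
     (\<forall>x. i < x \<longrightarrow> \<not> (s i < s x \<and> s x < a)) \<and>
     (\<forall>t. 1 \<le> t \<and> t < i \<longrightarrow> \<not> (s i < r t \<and> r t < a))"

text \<open>The maximum of rule (L2)(I) over the open interval from \<open>c\<close> to
  \<open>s j\<close>; the second alternative is the default for an empty intersection.\<close>

definition maximal_between ::
    "(int \<Rightarrow> int) \<Rightarrow> (int \<Rightarrow> int) \<Rightarrow> int \<Rightarrow> int \<Rightarrow> int \<Rightarrow> bool" where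
  "maximal_between r s j c b \<longleftrightarrow>
     between r s j b \<and> c < b \<and> b < s j \<and>
       (\<forall>x. j < x \<and> c < s x \<and> s x < s j \<longrightarrow> s x \<le> b) \<and>
       (\<forall>t. 1 \<le> t \<and> t < j \<and> c < r t \<and> r t < s j \<longrightarrow> r t \<le> b) \<or>
     b = r (j + 1) \<and> (\<forall>x. j < x \<longrightarrow> \<not> (c < s x \<and> s x < s j)) \<and>
       (\<forall>t. 1 \<le> t \<and> t < j \<longrightarrow> \<not> (c < r t \<and> r t < s j))"

definition drops :: "(int \<Rightarrow> int) \<Rightarrow> (int \<Rightarrow> int) \<Rightarrow> int \<Rightarrow> bool" where
  "drops r s j \<longleftrightarrow> s (j + 1) < r (j + 1) \<or>
     r j < r (j + 2) \<and> s (j + 1) < r j \<and> r j < s (j + 2)"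

text \<open>In the second case of (L2)(I) minus infinity is replaced by \<open>- 1\<close>, which
  lies below all letters.\<close>

definition left_out ::
    "(int \<Rightarrow> int) \<Rightarrow> int \<Rightarrow> (int \<Rightarrow> int) \<Rightarrow> int \<Rightarrow> int \<Rightarrow> int \<Rightarrow> bool" where
  "left_out r q s p j b \<longleftrightarrow>
     (if j < p then maximal_between r s j (if j + 1 < q then r (j + 1) else - 1) b
      else b = (if q \<le> j + 1 \<and> drops r s j then s (j + 1) else r (j + 1)))"

text \<open>The rule (R3) as read off its result: the row was left unchanged.\<close>

definition right_stays :: "(int \<Rightarrow> int) \<Rightarrow> (int \<Rightarrow> int) \<Rightarrow> int \<Rightarrow> int \<Rightarrow> bool" where
  "right_stays r s i a \<longleftrightarrow> a = r (i + 1) \<or> s i < a \<and> between r s i a"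

text \<open>The possible results of the rules (R1) and (R3) at position \<open>i\<close>. The results of (R2) are not included:
  there the row may have equal entries, and the whole row insertion is treated as one step.\<close>

definition mid_state ::
    "int \<Rightarrow> (int \<Rightarrow> int) \<Rightarrow> int \<Rightarrow> (int \<Rightarrow> int) \<Rightarrow> int \<Rightarrow> int \<Rightarrow> bool" where
  "mid_state M r q s i a \<longleftrightarrow> a < M \<and> q \<le> i \<and> r i < a \<and> a \<le> r (i + 1) \<and>
     (\<forall>x. i < x \<longrightarrow> \<not> (s i < s x \<and> s x < a)) \<and>
     (\<forall>t. 1 \<le> t \<and> t < i \<longrightarrow> \<not> (s i < r t \<and> r t < a)) \<and>
     (i = q \<longrightarrow> 2 \<le> q \<and> (r (q - 1) < a \<or> r (q - 1) = a \<and> (s q < a \<or> a = r (q + 1)))) \<and>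
     (\<forall>y. i = q \<and> q - 1 < y \<and> s (q - 1) < s y \<and> s y \<le> r (q - 1) \<longrightarrow> right_stays r s i a)"

text \<open>The possible results of a row insertion whose left half acts at \<open>j\<close>; \<open>m\<close> is the slot that the
  emitted letter \<open>b\<close> finds in the row below.\<close>

definition out_state ::
    "int \<Rightarrow> (int \<Rightarrow> int) \<Rightarrow> int \<Rightarrow> (int \<Rightarrow> int) \<Rightarrow> int \<Rightarrow> int \<Rightarrow> int \<Rightarrow> int \<Rightarrow> bool" where
  "out_state M r q s p j m b \<longleftrightarrow> 2 \<le> q \<and> 1 \<le> j \<and> j < q \<and> b < r j \<and>
     (j + 1 = q \<or> r (j + 1) \<le> b) \<and> 0 \<le> b \<and> b < M \<and>
     (\<forall>x. j < p \<and> j < x \<longrightarrow> \<not> (b < s x \<and> s x < s j)) \<and>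
     (\<forall>t. j < p \<and> 1 \<le> t \<and> t < j \<longrightarrow> \<not> (b < r t \<and> r t < s j)) \<and>
     (\<forall>t. q \<le> m \<and> 1 \<le> t \<and> t < m \<longrightarrow> \<not> (b < r t \<and> r t \<le> r m)) \<and>
     (\<forall>x. q \<le> x \<and> x < m \<longrightarrow> \<not> (s x < b \<and> b \<le> r x))"

text \<open>The rule (R2) as read off the result of the row insertion.\<close>

definition swaps :: "(int \<Rightarrow> int) \<Rightarrow> int \<Rightarrow> (int \<Rightarrow> int) \<Rightarrow> int \<Rightarrow> int \<Rightarrow> int \<Rightarrow> bool" where
  "swaps r q s p j b \<longleftrightarrow> j + 1 = q \<and> b = r q \<and> r (q - 1) < r (q + 1) \<and>
     (r (q - 1) \<le> s q \<or> p \<le> q - 1 \<and> r q < s q \<and> r (q - 1) < s (q + 1))"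

text \<open>The rule (L2) as read off the result of the row insertion.\<close>

definition left_stays :: "(int \<Rightarrow> int) \<Rightarrow> int \<Rightarrow> (int \<Rightarrow> int) \<Rightarrow> int \<Rightarrow> int \<Rightarrow> int \<Rightarrow> bool" where
  "left_stays r q s p j b \<longleftrightarrow> j + 1 < q \<and> b = r (j + 1) \<or> j < p \<and> b < s j \<and> between r s j b \<or>
     j + 1 = q \<and> p \<le> j \<and> b = (if drops r s j then s (j + 1) else r (j + 1))"

section \<open>The single insertion rules, forwards and backwards\<close>

lemmas fo_defs = stacked_def valley_def between_def right_slot_def left_slot_def right_out_def
  maximal_between_def drops_def left_out_def right_stays_def mid_state_def out_state_def swaps_def
  left_stays_def

text \<open>Rule (R1) with unmoved dip. The last conclusion makes the rule recognizable afterwards: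
  the expelled letter is none that (R3) could have emitted from the new row.\<close>

lemma right_replace1:
  assumes "stacked M r l q s k p" "right_slot r q a i" "0 \<le> a" "a < M" "a \<noteq> r i" "i \<le> l"
    "r q < a \<or> i \<noteq> q + 1" "r' i = a" "\<forall>x. x \<noteq> i \<longrightarrow> r' x = r x"
  shows "stacked M r' l q s k p" "mid_state M r' q s i (r i)" "\<not> right_stays r' s i (r i)"
  using assms unfolding fo_defs by ((intro conjI allI impI)?; smt (z3))+

text \<open>A letter below the minimum is put directly behind it and becomes the dip itself.\<close>

lemma right_replace2:
  assumes "stacked M r l q s k p" "right_slot r q a i" "0 \<le> a" "a < M" "a \<noteq> r i" "i \<le> l"
    "a < r q" "i = q + 1" "r' i = a" "\<forall>x. x \<noteq> i \<longrightarrow> r' x = r x"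
  shows "stacked M r' l (q + 1) s k p" "mid_state M r' (q + 1) s i (r i)" "\<not> right_stays r' s i (r i)"
  using assms unfolding fo_defs by ((intro conjI allI impI)?; smt (z3))+

lemma right_keep:
  assumes "stacked M r l q s k p" "right_slot r q (r i) i" "r (i - 1) \<le> r (i + 1)" "right_out r s i a"
    "a < M"
  shows "mid_state M r q s i a" "right_stays r s i a"
  using assms unfolding fo_defs by ((intro conjI allI impI)?; smt (z3))+

lemma right_keep_back:
  assumes "stacked M r l q s k p" "mid_state M r q s i a" "right_stays r s i a"
  shows "right_slot r q (r i) i" "r (i - 1) \<le> r (i + 1)" "right_out r s i a" "i \<le> l"
  using assms unfolding fo_defs by ((intro conjI allI impI)?; smt (z3))+

lemma right_replace_back1:
  assumes "stacked M r l q s k p" "mid_state M r q s i a" "\<not> right_stays r s i a" "i \<noteq> q"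
    "r' i = a" "\<forall>x. x \<noteq> i \<longrightarrow> r' x = r x"
  shows "stacked M r' l q s k p" "right_slot r' q (r i) i" "i \<le> l" "r i < a" "r q < r i"
  using assms unfolding fo_defs by ((intro conjI allI impI)?; smt (z3))+

text \<open>If (R3) is excluded, column \<open>i\<close> can be the dip only because the inserted
  letter has become the minimum. Taking it out returns the dip to column
  \<open>q - 1\<close>.\<close>

lemma right_replace_back2:
  assumes "stacked M r l q s k p" "mid_state M r q s i a" "\<not> right_stays r s i a" "i = q" "r' i = a"
    "\<forall>x. x \<noteq> i \<longrightarrow> r' x = r x"
  shows "stacked M r' l (q - 1) s k p" "right_slot r' (q - 1) (r i) i" "i \<le> l" "r i < a" "r i < r (q - 1)"
  using assms unfolding fo_defs by ((intro conjI allI impI)?; smt (z3))+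

lemma left_replace1:
  assumes "stacked M r l q s k p" "mid_state M r q s i a" "left_slot r 1 q a j" "r j < a"
    "right_slot s p (r j) m" "j < q" "r' j = a" "\<forall>x. x \<noteq> j \<longrightarrow> r' x = r x"
  shows "stacked M r' l q s k p" "out_state M r' q s p j m (r j)" "\<not> swaps r' q s p j (r j)"
  using assms unfolding fo_defs by ((intro conjI allI impI)?; smt (z3))+

text \<open>A letter expelled by (L1) could be mistaken for an output of (L2) in six ways. They
  contradict the inequalities for different reasons and are therefore separated.\<close>

lemma left_replace1_moves:
  assumes "stacked M r l q s k p" "mid_state M r q s i a" "left_slot r 1 q a j" "r j < a"
    "right_slot s p (r j) m" "j < q" "r' j = a" "\<forall>x. x \<noteq> j \<longrightarrow> r' x = r x"
  shows "\<not> left_stays r' q s p j (r j)"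
proof
  note facts = assms[unfolded fo_defs]
  assume "left_stays r' q s p j (r j)"
  then consider "j + 1 < q" "r j = r' (j + 1)"
    | x where "j < p" "r j < s j" "j < x" "s x = r j"
    | t where "j < p" "r j < s j" "1 \<le> t" "t < j" "r' t = r j"
    | "j + 1 = q" "p \<le> j" "\<not> drops r' s j" "r j = r' (j + 1)"
    | "j + 1 = q" "p \<le> j" "s (j + 1) < r' (j + 1)" "r j = s (j + 1)"
    | "j + 1 = q" "p \<le> j" "r' j < r' (j + 2)" "s (j + 1) < r' j" "r' j < s (j + 2)" "r j = s (j + 1)"
    unfolding left_stays_def between_def drops_def by (auto split: if_splits)
  then show False
  proof cases
    case 1
    with facts show False by (smt (z3))
  next
    case 2
    with facts show False by (smt (z3))
  next
    case 3
    with facts show False by (smt (z3))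
  next
    case 4
    with facts show False by (smt (z3))
  next
    case 5
    with facts show False by (smt (z3))
  next
    \<comment> \<open>Here the last clause of \<open>mid_state\<close> decides, applied to the
      column \<open>q\<close>: the lower row increases from column \<open>q - 1\<close> to
      \<open>q\<close> and takes there the value \<open>r (q - 1)\<close>, which would force rule
      (R3).\<close>
    case 6
    have q: "2 \<le> q" "a < r (q + 1)" "r (q - 1) = s q" "s q < a" "a < s (q + 1)"
      using 6 assms(4,7,8) facts(3) by (smt (z3))+
    have iq: "i = q"
      using facts(1,2) q by (smt (z3))
    have inc: "s (q - 1) < s q"
      using facts(1) 6(1,2) q by (smt (z3))
    have "\<not> right_stays r s q a"
      using facts(1,3) 6(1,2) q assms(4) unfolding right_stays_def between_def by (smt (z3))
    then show False
      using assms(2) iq inc q(3) unfolding mid_state_def by auto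
  qed
qed

text \<open>\<open>mid_state\<close> with \<open>i = q\<close> would give a left slot before the
  dip, so \<open>i\<close> lies further right and \<open>r (q + 1) < a\<close>. Replacing the
  minimum by \<open>a\<close> therefore makes column \<open>q + 1\<close> the dip.\<close>

lemma left_replace2:
  assumes "stacked M r l q s k p" "mid_state M r q s i a" "left_slot r 1 q a j" "r j < a"
    "right_slot s p (r j) m" "j = q" "r' j = a" "\<forall>x. x \<noteq> j \<longrightarrow> r' x = r x"
  shows "stacked M r' l (q + 1) s k p" "out_state M r' (q + 1) s p j m (r j)"
    "\<not> swaps r' (q + 1) s p j (r j)"
  using assms unfolding fo_defs by ((intro conjI allI impI)?; smt (z3))+

lemma left_replace2_moves:
  assumes "stacked M r l q s k p" "mid_state M r q s i a" "left_slot r 1 q a j" "r j < a"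
    "right_slot s p (r j) m" "j = q" "r' j = a" "\<forall>x. x \<noteq> j \<longrightarrow> r' x = r x"
  shows "\<not> left_stays r' (q + 1) s p j (r j)"
  unfolding left_stays_def de_Morgan_disj
  by (intro conjI; insert assms; unfold fo_defs; smt (z3))

text \<open>Rule (L2)(I) with \<open>j + 1 < q\<close>. Since (L2) leaves the row as it is, the
  output has to be recognizable as \<open>left_stays\<close>, and must not be confused with that of
  a swap.\<close>

lemma left_keep1:
  assumes "stacked M r l q s k p" "mid_state M r q s i (r j)" "left_slot r 1 q (r j) j" "right_slot s p b m"
    "j < p" "j + 1 < q" "maximal_between r s j (r (j + 1)) b"
  shows "out_state M r q s p j m b" "\<not> swaps r q s p j b" "left_stays r q s p j b"
  using assms unfolding fo_defs by ((intro conjI allI impI)?; smt (z3))+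

lemma left_keep2:
  assumes "stacked M r l q s k p" "mid_state M r q s i (r j)" "left_slot r 1 q (r j) j" "right_slot s p b m"
    "j < p" "q \<le> j + 1" "maximal_between r s j (- 1) b"
  shows "out_state M r q s p j m b" "\<not> swaps r q s p j b" "left_stays r q s p j b"
  using assms unfolding fo_defs by ((intro conjI allI impI)?; smt (z3))+

lemma left_keep3:
  assumes "stacked M r l q s k p" "mid_state M r q s i (r j)" "left_slot r 1 q (r j) j" "right_slot s p b m"
    "p \<le> j" "q \<le> j + 1" "drops r s j" "b = s (j + 1)"
  shows "out_state M r q s p j m b" "\<not> swaps r q s p j b" "left_stays r q s p j b"
  using assms unfolding fo_defs by ((intro conjI allI impI)?; smt (z3))+

lemma left_keep4:
  assumes "stacked M r l q s k p" "mid_state M r q s i (r j)" "left_slot r 1 q (r j) j" "right_slot s p b m"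
    "p \<le> j" "\<not> (q \<le> j + 1 \<and> drops r s j)" "b = r (j + 1)"
  shows "out_state M r q s p j m b" "\<not> swaps r q s p j b" "left_stays r q s p j b"
  using assms unfolding fo_defs by ((intro conjI allI impI)?; smt (z3))+

text \<open>The two halves of (R2) amount to exchanging the minimum with its right neighbour: the
  right half duplicates the minimum and expels \<open>r (q + 1)\<close>, which then replaces the
  left copy.\<close>

lemma swap_out:
  assumes "stacked M r l q s k p" "q < l" "r (q + 1) < r (q - 1)" "right_slot s p (r q) m" "r' q = r (q + 1)"
    "r' (q + 1) = r q" "\<forall>x. x \<noteq> q \<and> x \<noteq> (q + 1) \<longrightarrow> r' x = r x"
  shows "stacked M r' l (q + 1) s k p" "out_state M r' (q + 1) s p q m (r q)" "swaps r' (q + 1) s p q (r q)"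
  using assms unfolding fo_defs by ((intro conjI allI impI)?; smt (z3))+

text \<open>The column \<open>i\<close> of the right half is not part of the result. It is recovered
  as the place where the letter \<open>r j\<close> fits into the increasing side, which exists
  because \<open>r j\<close> exceeds the minimum.\<close>

lemma left_keep_back:
  assumes "stacked M r l q s k p" "out_state M r q s p j m b" "right_slot s p b m" "\<not> swaps r q s p j b"
    "left_stays r q s p j b" "q \<le> i" "r i < r j" "r j \<le> r (i + 1)"
  shows "mid_state M r q s i (r j)" "left_slot r 1 q (r j) j"
  using assms unfolding fo_defs by ((intro conjI allI impI)?; smt (z3))+

lemma left_keep_back1:
  assumes "stacked M r l q s k p" "out_state M r q s p j m b" "right_slot s p b m" "\<not> swaps r q s p j b"
    "left_stays r q s p j b" "q \<le> i" "r i < r j" "r j \<le> r (i + 1)" "j < p" "j + 1 < q"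
  shows "maximal_between r s j (r (j + 1)) b"
  using assms unfolding fo_defs by ((intro conjI allI impI)?; smt (z3))+

lemma left_keep_back2:
  assumes "stacked M r l q s k p" "out_state M r q s p j m b" "right_slot s p b m" "\<not> swaps r q s p j b"
    "left_stays r q s p j b" "q \<le> i" "r i < r j" "r j \<le> r (i + 1)" "j < p" "\<not> j + 1 < q"
  shows "maximal_between r s j (- 1) b"
  using assms unfolding fo_defs by ((intro conjI allI impI)?; smt (z3))+

lemma left_keep_back3:
  assumes "stacked M r l q s k p" "out_state M r q s p j m b" "right_slot s p b m" "\<not> swaps r q s p j b"
    "left_stays r q s p j b" "q \<le> i" "r i < r j" "r j \<le> r (i + 1)" "p \<le> j"
  shows "b = (if q \<le> j + 1 \<and> drops r s j then s (j + 1) else r (j + 1))"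
  using assms unfolding fo_defs by ((intro conjI allI impI)?; smt (z3))+

lemma left_replace_back1:
  assumes "stacked M r l q s k p" "out_state M r q s p j m b" "right_slot s p b m" "\<not> swaps r q s p j b"
    "\<not> left_stays r q s p j b" "q \<le> i" "r i < r j" "r j \<le> r (i + 1)"
    "j + 1 \<noteq> q \<or> r q < b" "r' j = b" "\<forall>x. x \<noteq> j \<longrightarrow> r' x = r x"
  shows "stacked M r' l q s k p" "mid_state M r' q s i (r j)" "left_slot r' 1 q (r j) j"
  using assms unfolding fo_defs by ((intro conjI allI impI)?; smt (z3))+

text \<open>A letter that does not exceed the minimum and is put back directly to its left becomes
  the dip again.\<close>

lemma left_replace_back2:
  assumes "stacked M r l q s k p" "out_state M r q s p j m b" "right_slot s p b m" "\<not> swaps r q s p j b"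
    "\<not> left_stays r q s p j b" "q \<le> i" "r i < r j" "r j \<le> r (i + 1)" "b \<le> r q" "j + 1 = q"
    "r' j = b" "\<forall>x. x \<noteq> j \<longrightarrow> r' x = r x"
  shows "stacked M r' l (q - 1) s k p" "mid_state M r' (q - 1) s i (r j)" "left_slot r' 1 (q - 1) (r j) j"
  using assms unfolding fo_defs by ((intro conjI allI impI)?; smt (z3))+

lemma swap_back:
  assumes "stacked M r l q s k p" "out_state M r q s p j m b" "right_slot s p b m" "swaps r q s p j b"
    "r' j = r q" "r' q = r j" "\<forall>x. x \<noteq> j \<and> x \<noteq> q \<longrightarrow> r' x = r x"
  shows "stacked M r' l j s k p" "r j < r' (j - 1)" "q \<le> l"
  using assms unfolding fo_defs by ((intro conjI allI impI)?; smt (z3))+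

lemma mid_state_unique:
  assumes "stacked M r l q s k p" "mid_state M r q s i a" "mid_state M r q s i' a"
  shows "i = i'"
  using assms unfolding fo_defs by ((intro conjI allI impI)?; smt (z3))+

lemma out_state_unique:
  assumes "stacked M r l q s k p" "out_state M r q s p j m b" "out_state M r q s p j' m' b"
  shows "j = j'"
  using assms unfolding fo_defs by ((intro conjI allI impI)?; smt (z3))+

section \<open>Rows that fit over a lower row before and after an insertion into it\<close>

section \<open>Rows above an insertion\<close>

text \<open>For each way in which \<open>b\<close> can change the lower row, up to three facts are
  proved. A row emitting \<open>b\<close> over \<open>s\<close> fits over \<open>s'\<close>. A row
  over \<open>s'\<close> has \<open>2 \<le> q\<close> and \<open>b < r 1\<close>, so a column
  \<open>j\<close> from which \<open>b\<close> could have come exists. Each such \<open>j\<close>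
  yields an output state over \<open>s\<close>. In the present case \<open>b\<close> is appended to
  an empty or decreasing row and becomes its dip.\<close>

lemma down_grow_dip1:
  assumes "valley M s 2 k p" "k = 1 \<and> p = 1 \<or> 2 \<le> p \<and> p \<le> k" "0 \<le> b" "b < M"
    "right_slot s p b m" "m = k + 1" "b \<noteq> s m" "k = 1 \<or> k = p \<and> b < s p" "s' (k + 1) = b"
    "\<forall>x. x \<noteq> (k + 1) \<longrightarrow> s' x = s x" "stacked M r l q s k p"
    "out_state M r q s p j m b"
  shows "stacked M r l q (s') (k + 1) (k + 1)"
  using assms unfolding fo_defs by ((intro conjI allI impI)?; smt (z3))+

lemma down_grow_dip2:
  assumes "valley M s 2 k p" "k = 1 \<and> p = 1 \<or> 2 \<le> p \<and> p \<le> k" "0 \<le> b" "b < M"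
    "right_slot s p b m" "m = k + 1" "b \<noteq> s m" "k = 1 \<or> k = p \<and> b < s p" "s' (k + 1) = b"
    "\<forall>x. x \<noteq> (k + 1) \<longrightarrow> s' x = s x" "stacked M r l q (s') (k + 1) (k + 1)"
  shows "2 \<le> q" "b < r 1"
  using assms unfolding fo_defs by ((intro conjI allI impI)?; smt (z3))+

lemma down_grow_dip3:
  assumes "valley M s 2 k p" "k = 1 \<and> p = 1 \<or> 2 \<le> p \<and> p \<le> k" "0 \<le> b" "b < M"
    "right_slot s p b m" "m = k + 1" "b \<noteq> s m" "k = 1 \<or> k = p \<and> b < s p" "s' (k + 1) = b"
    "\<forall>x. x \<noteq> (k + 1) \<longrightarrow> s' x = s x" "stacked M r l q (s') (k + 1) (k + 1)"
    "1 \<le> j" "j < q" "b < r j" "j + 1 = q \<or> r (j + 1) \<le> b"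
  shows "stacked M r l q s k p" "out_state M r q s p j m b"
  using assms unfolding fo_defs by ((intro conjI allI impI)?; smt (z3))+

lemma down_grow1:
  assumes "valley M s 2 k p" "k = 1 \<and> p = 1 \<or> 2 \<le> p \<and> p \<le> k" "0 \<le> b" "b < M"
    "right_slot s p b m" "m = k + 1" "b \<noteq> s m" "1 < k" "s k < b" "s' (k + 1) = b"
    "\<forall>x. x \<noteq> (k + 1) \<longrightarrow> s' x = s x" "stacked M r l q s k p"
    "out_state M r q s p j m b"
  shows "stacked M r l q (s') (k + 1) p"
  using assms unfolding fo_defs by ((intro conjI allI impI)?; smt (z3))+

lemma down_grow2:
  assumes "valley M s 2 k p" "k = 1 \<and> p = 1 \<or> 2 \<le> p \<and> p \<le> k" "0 \<le> b" "b < M"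
    "right_slot s p b m" "m = k + 1" "b \<noteq> s m" "1 < k" "s k < b" "s' (k + 1) = b"
    "\<forall>x. x \<noteq> (k + 1) \<longrightarrow> s' x = s x" "stacked M r l q (s') (k + 1) p"
  shows "2 \<le> q" "b < r 1"
  using assms unfolding fo_defs by ((intro conjI allI impI)?; smt (z3))+

lemma down_grow3:
  assumes "valley M s 2 k p" "k = 1 \<and> p = 1 \<or> 2 \<le> p \<and> p \<le> k" "0 \<le> b" "b < M"
    "right_slot s p b m" "m = k + 1" "b \<noteq> s m" "1 < k" "s k < b" "s' (k + 1) = b"
    "\<forall>x. x \<noteq> (k + 1) \<longrightarrow> s' x = s x" "stacked M r l q (s') (k + 1) p"
    "1 \<le> j" "j < q" "b < r j" "j + 1 = q \<or> r (j + 1) \<le> b"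
  shows "stacked M r l q s k p" "out_state M r q s p j m b"
  using assms unfolding fo_defs by ((intro conjI allI impI)?; smt (z3))+

text \<open>The last entry of the lower row is inserted and absorbed. As that row does not change,
  only the way back from \<open>s' = s\<close> requires an argument.\<close>

lemma down_stay2:
  assumes "valley M s 2 k p" "k = 1 \<and> p = 1 \<or> 2 \<le> p \<and> p \<le> k" "0 \<le> b" "b < M"
    "right_slot s p b m" "m = k" "b = s k" "1 < k" "stacked M r l q (s) k p"
  shows "2 \<le> q" "b < r 1"
  using assms unfolding fo_defs by ((intro conjI allI impI)?; smt (z3))+

lemma down_stay3:
  assumes "valley M s 2 k p" "k = 1 \<and> p = 1 \<or> 2 \<le> p \<and> p \<le> k" "0 \<le> b" "b < M"
    "right_slot s p b m" "m = k" "b = s k" "1 < k" "stacked M r l q (s) k p" "1 \<le> j" "j < q" "b < r j"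
    "j + 1 = q \<or> r (j + 1) \<le> b"
  shows "stacked M r l q s k p" "out_state M r q s p j m b"
  using assms unfolding fo_defs by ((intro conjI allI impI)?; smt (z3))+

text \<open>\<open>s2\<close> is the lower row between its two halves: \<open>b\<close> has replaced
  \<open>s m\<close>, which then enters from the left in column \<open>n\<close>. (L1) and (L2) are
  treated together, since under (L2) the update at \<open>n\<close> changes nothing.\<close>

lemma down_replace_r1:
  assumes "valley M s 2 k p" "k = 1 \<and> p = 1 \<or> 2 \<le> p \<and> p \<le> k" "0 \<le> b" "b < M"
    "right_slot s p b m" "s p < b \<or> p + 1 < m" "b < s m" "m \<le> k" "2 \<le> p"
    "left_slot (s2) 2 p (s m) n" "n < p" "s2 m = b" "\<forall>x. x \<noteq> m \<longrightarrow> s2 x = s x"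
    "s' n = s m" "\<forall>x. x \<noteq> n \<longrightarrow> s' x = s2 x" "stacked M r l q s k p"
    "out_state M r q s p j m b"
  shows "stacked M r l q (s') k p"
  using assms unfolding fo_defs by ((intro conjI allI impI)?; smt (z3))+

lemma down_replace_r2:
  assumes "valley M s 2 k p" "k = 1 \<and> p = 1 \<or> 2 \<le> p \<and> p \<le> k" "0 \<le> b" "b < M"
    "right_slot s p b m" "s p < b \<or> p + 1 < m" "b < s m" "m \<le> k" "2 \<le> p"
    "left_slot (s2) 2 p (s m) n" "n < p" "s2 m = b" "\<forall>x. x \<noteq> m \<longrightarrow> s2 x = s x"
    "s' n = s m" "\<forall>x. x \<noteq> n \<longrightarrow> s' x = s2 x" "stacked M r l q (s') k p"
  shows "2 \<le> q" "b < r 1"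
  using assms unfolding fo_defs by ((intro conjI allI impI)?; smt (z3))+

lemma down_replace_r3:
  assumes "valley M s 2 k p" "k = 1 \<and> p = 1 \<or> 2 \<le> p \<and> p \<le> k" "0 \<le> b" "b < M"
    "right_slot s p b m" "s p < b \<or> p + 1 < m" "b < s m" "m \<le> k" "2 \<le> p"
    "left_slot (s2) 2 p (s m) n" "n < p" "s2 m = b" "\<forall>x. x \<noteq> m \<longrightarrow> s2 x = s x"
    "s' n = s m" "\<forall>x. x \<noteq> n \<longrightarrow> s' x = s2 x" "stacked M r l q (s') k p"
    "1 \<le> j" "j < q" "b < r j" "j + 1 = q \<or> r (j + 1) \<le> b"
  shows "stacked M r l q s k p" "out_state M r q s p j m b"
  using assms unfolding fo_defs by ((intro conjI allI impI)?; smt (z3))+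

text \<open>The left half hits the dip, whose entry grows; the dip of the lower row moves one column
  to the right.\<close>

lemma down_replace_rd1:
  assumes "valley M s 2 k p" "k = 1 \<and> p = 1 \<or> 2 \<le> p \<and> p \<le> k" "0 \<le> b" "b < M"
    "right_slot s p b m" "s p < b \<or> p + 1 < m" "b < s m" "m \<le> k" "2 \<le> p"
    "left_slot (s2) 2 p (s m) n" "n = p" "s2 m = b" "\<forall>x. x \<noteq> m \<longrightarrow> s2 x = s x"
    "s' n = s m" "\<forall>x. x \<noteq> n \<longrightarrow> s' x = s2 x" "stacked M r l q s k p"
    "out_state M r q s p j m b"
  shows "stacked M r l q (s') k (p + 1)"
  using assms unfolding fo_defs by ((intro conjI allI impI)?; smt (z3))+

lemma down_replace_rd2:
  assumes "valley M s 2 k p" "k = 1 \<and> p = 1 \<or> 2 \<le> p \<and> p \<le> k" "0 \<le> b" "b < M"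
    "right_slot s p b m" "s p < b \<or> p + 1 < m" "b < s m" "m \<le> k" "2 \<le> p"
    "left_slot (s2) 2 p (s m) n" "n = p" "s2 m = b" "\<forall>x. x \<noteq> m \<longrightarrow> s2 x = s x"
    "s' n = s m" "\<forall>x. x \<noteq> n \<longrightarrow> s' x = s2 x" "stacked M r l q (s') k (p + 1)"
  shows "2 \<le> q" "b < r 1"
  using assms unfolding fo_defs by ((intro conjI allI impI)?; smt (z3))+

lemma down_replace_rd3:
  assumes "valley M s 2 k p" "k = 1 \<and> p = 1 \<or> 2 \<le> p \<and> p \<le> k" "0 \<le> b" "b < M"
    "right_slot s p b m" "s p < b \<or> p + 1 < m" "b < s m" "m \<le> k" "2 \<le> p"
    "left_slot (s2) 2 p (s m) n" "n = p" "s2 m = b" "\<forall>x. x \<noteq> m \<longrightarrow> s2 x = s x"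
    "s' n = s m" "\<forall>x. x \<noteq> n \<longrightarrow> s' x = s2 x" "stacked M r l q (s') k (p + 1)"
    "1 \<le> j" "j < q" "b < r j" "j + 1 = q \<or> r (j + 1) \<le> b"
  shows "stacked M r l q s k p" "out_state M r q s p j m b"
  using assms unfolding fo_defs by ((intro conjI allI impI)?; smt (z3))+

text \<open>Here \<open>b\<close> lies below the minimum, so that the right half has already moved
  the dip to \<open>p + 1\<close>.\<close>

lemma down_replace_e1:
  assumes "valley M s 2 k p" "k = 1 \<and> p = 1 \<or> 2 \<le> p \<and> p \<le> k" "0 \<le> b" "b < M"
    "right_slot s p b m" "b < s p" "m = p + 1" "b < s m" "m \<le> k" "2 \<le> p"
    "left_slot (s2) 2 (p + 1) (s m) n" "n < (p + 1)" "s2 m = b"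
    "\<forall>x. x \<noteq> m \<longrightarrow> s2 x = s x" "s' n = s m"
    "\<forall>x. x \<noteq> n \<longrightarrow> s' x = s2 x" "stacked M r l q s k p"
    "out_state M r q s p j m b"
  shows "stacked M r l q (s') k (p + 1)"
  using assms unfolding fo_defs by ((intro conjI allI impI)?; smt (z3))+

lemma down_replace_e2:
  assumes "valley M s 2 k p" "k = 1 \<and> p = 1 \<or> 2 \<le> p \<and> p \<le> k" "0 \<le> b" "b < M"
    "right_slot s p b m" "b < s p" "m = p + 1" "b < s m" "m \<le> k" "2 \<le> p"
    "left_slot (s2) 2 (p + 1) (s m) n" "n < (p + 1)" "s2 m = b"
    "\<forall>x. x \<noteq> m \<longrightarrow> s2 x = s x" "s' n = s m"
    "\<forall>x. x \<noteq> n \<longrightarrow> s' x = s2 x" "stacked M r l q (s') k (p + 1)"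
  shows "2 \<le> q" "b < r 1"
  using assms unfolding fo_defs by ((intro conjI allI impI)?; smt (z3))+

lemma down_replace_e3:
  assumes "valley M s 2 k p" "k = 1 \<and> p = 1 \<or> 2 \<le> p \<and> p \<le> k" "0 \<le> b" "b < M"
    "right_slot s p b m" "b < s p" "m = p + 1" "b < s m" "m \<le> k" "2 \<le> p"
    "left_slot (s2) 2 (p + 1) (s m) n" "n < (p + 1)" "s2 m = b"
    "\<forall>x. x \<noteq> m \<longrightarrow> s2 x = s x" "s' n = s m"
    "\<forall>x. x \<noteq> n \<longrightarrow> s' x = s2 x" "stacked M r l q (s') k (p + 1)" "1 \<le> j"
    "j < q" "b < r j" "j + 1 = q \<or> r (j + 1) \<le> b"
  shows "stacked M r l q s k p" "out_state M r q s p j m b"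
  using assms unfolding fo_defs by ((intro conjI allI impI)?; smt (z3))+

text \<open>Both halves move the dip by one column.\<close>

lemma down_replace_ed1:
  assumes "valley M s 2 k p" "k = 1 \<and> p = 1 \<or> 2 \<le> p \<and> p \<le> k" "0 \<le> b" "b < M"
    "right_slot s p b m" "b < s p" "m = p + 1" "b < s m" "m \<le> k" "2 \<le> p"
    "left_slot (s2) 2 (p + 1) (s m) n" "n = (p + 1)" "s2 m = b"
    "\<forall>x. x \<noteq> m \<longrightarrow> s2 x = s x" "s' n = s m"
    "\<forall>x. x \<noteq> n \<longrightarrow> s' x = s2 x" "stacked M r l q s k p"
    "out_state M r q s p j m b"
  shows "stacked M r l q (s') k (p + 2)"
  using assms unfolding fo_defs by ((intro conjI allI impI)?; smt (z3))+

lemma down_replace_ed2: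
  assumes "valley M s 2 k p" "k = 1 \<and> p = 1 \<or> 2 \<le> p \<and> p \<le> k" "0 \<le> b" "b < M"
    "right_slot s p b m" "b < s p" "m = p + 1" "b < s m" "m \<le> k" "2 \<le> p"
    "left_slot (s2) 2 (p + 1) (s m) n" "n = (p + 1)" "s2 m = b"
    "\<forall>x. x \<noteq> m \<longrightarrow> s2 x = s x" "s' n = s m"
    "\<forall>x. x \<noteq> n \<longrightarrow> s' x = s2 x" "stacked M r l q (s') k (p + 2)"
  shows "2 \<le> q" "b < r 1"
  using assms unfolding fo_defs by ((intro conjI allI impI)?; smt (z3))+

lemma down_replace_ed3:
  assumes "valley M s 2 k p" "k = 1 \<and> p = 1 \<or> 2 \<le> p \<and> p \<le> k" "0 \<le> b" "b < M"
    "right_slot s p b m" "b < s p" "m = p + 1" "b < s m" "m \<le> k" "2 \<le> p"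
    "left_slot (s2) 2 (p + 1) (s m) n" "n = (p + 1)" "s2 m = b"
    "\<forall>x. x \<noteq> m \<longrightarrow> s2 x = s x" "s' n = s m"
    "\<forall>x. x \<noteq> n \<longrightarrow> s' x = s2 x" "stacked M r l q (s') k (p + 2)" "1 \<le> j"
    "j < q" "b < r j" "j + 1 = q \<or> r (j + 1) \<le> b"
  shows "stacked M r l q s k p" "out_state M r q s p j m b"
  using assms unfolding fo_defs by ((intro conjI allI impI)?; smt (z3))+

lemma down_swap1:
  assumes "valley M s 2 k p" "k = 1 \<and> p = 1 \<or> 2 \<le> p \<and> p \<le> k" "0 \<le> b" "b < M"
    "right_slot s p b m" "b = s p" "2 \<le> p" "p < k" "s (p + 1) < s (p - 1)" "s' p = s (p + 1)"
    "s' (p + 1) = s p" "\<forall>x. x \<noteq> p \<and> x \<noteq> (p + 1) \<longrightarrow> s' x = s x"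
    "stacked M r l q s k p" "out_state M r q s p j m b"
  shows "stacked M r l q (s') k (p + 1)"
  using assms unfolding fo_defs by ((intro conjI allI impI)?; smt (z3))+

lemma down_swap2:
  assumes "valley M s 2 k p" "k = 1 \<and> p = 1 \<or> 2 \<le> p \<and> p \<le> k" "0 \<le> b" "b < M"
    "right_slot s p b m" "b = s p" "2 \<le> p" "p < k" "s (p + 1) < s (p - 1)" "s' p = s (p + 1)"
    "s' (p + 1) = s p" "\<forall>x. x \<noteq> p \<and> x \<noteq> (p + 1) \<longrightarrow> s' x = s x"
    "stacked M r l q (s') k (p + 1)"
  shows "2 \<le> q" "b < r 1"
  using assms unfolding fo_defs by ((intro conjI allI impI)?; smt (z3))+

lemma down_swap3:
  assumes "valley M s 2 k p" "k = 1 \<and> p = 1 \<or> 2 \<le> p \<and> p \<le> k" "0 \<le> b" "b < M"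
    "right_slot s p b m" "b = s p" "2 \<le> p" "p < k" "s (p + 1) < s (p - 1)" "s' p = s (p + 1)"
    "s' (p + 1) = s p" "\<forall>x. x \<noteq> p \<and> x \<noteq> (p + 1) \<longrightarrow> s' x = s x"
    "stacked M r l q (s') k (p + 1)" "1 \<le> j" "j < q" "b < r j" "j + 1 = q \<or> r (j + 1) \<le> b"
  shows "stacked M r l q s k p" "out_state M r q s p j m b"
  using assms unfolding fo_defs by ((intro conjI allI impI)?; smt (z3))+

text \<open>Rule (R3) inside the lower row. Its output \<open>a\<close> depends on the row further
  down; what matters of this is condensed in the condition for \<open>m = p\<close> and in the
  alternative about the letters between \<open>a\<close> and \<open>s (m + 1)\<close>, which
  \<open>mid_state\<close> and \<open>mid_state_gap\<close> supply.\<close>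

lemma down_keep1:
  assumes "valley M s 2 k p" "k = 1 \<and> p = 1 \<or> 2 \<le> p \<and> p \<le> k" "0 \<le> b" "b < M"
    "right_slot s p b m" "b = s m" "m \<le> k" "2 \<le> p" "s m < a" "a < M" "a \<le> s (m + 1)"
    "m = p \<longrightarrow> 3 \<le> p \<and> s (p - 1) \<le> a"
    "s n = a \<or> s (m + 1) < M \<and> (\<forall>t. 2 \<le> t \<and> t < m \<longrightarrow> \<not> (a < s t \<and> s t \<le> s (m + 1)))"
    "left_slot (s) 2 p a n" "n < p" "s' n = a" "\<forall>x. x \<noteq> n \<longrightarrow> s' x = s x"
    "stacked M r l q s k p" "out_state M r q s p j m b"
  shows "stacked M r l q (s') k p"
  using assms unfolding fo_defs by ((intro conjI allI impI)?; smt (z3))+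

lemma down_keep2:
  assumes "valley M s 2 k p" "k = 1 \<and> p = 1 \<or> 2 \<le> p \<and> p \<le> k" "0 \<le> b" "b < M"
    "right_slot s p b m" "b = s m" "m \<le> k" "2 \<le> p" "s m < a" "a < M" "a \<le> s (m + 1)"
    "m = p \<longrightarrow> 3 \<le> p \<and> s (p - 1) \<le> a"
    "s n = a \<or> s (m + 1) < M \<and> (\<forall>t. 2 \<le> t \<and> t < m \<longrightarrow> \<not> (a < s t \<and> s t \<le> s (m + 1)))"
    "left_slot (s) 2 p a n" "n < p" "s' n = a" "\<forall>x. x \<noteq> n \<longrightarrow> s' x = s x"
    "stacked M r l q (s') k p"
  shows "2 \<le> q" "b < r 1"
  using assms unfolding fo_defs by ((intro conjI allI impI)?; smt (z3))+

lemma down_keep3: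
  assumes "valley M s 2 k p" "k = 1 \<and> p = 1 \<or> 2 \<le> p \<and> p \<le> k" "0 \<le> b" "b < M"
    "right_slot s p b m" "b = s m" "m \<le> k" "2 \<le> p" "s m < a" "a < M" "a \<le> s (m + 1)"
    "m = p \<longrightarrow> 3 \<le> p \<and> s (p - 1) \<le> a"
    "s n = a \<or> s (m + 1) < M \<and> (\<forall>t. 2 \<le> t \<and> t < m \<longrightarrow> \<not> (a < s t \<and> s t \<le> s (m + 1)))"
    "left_slot (s) 2 p a n" "n < p" "s' n = a" "\<forall>x. x \<noteq> n \<longrightarrow> s' x = s x"
    "stacked M r l q (s') k p" "1 \<le> j" "j < q" "b < r j" "j + 1 = q \<or> r (j + 1) \<le> b"
  shows "stacked M r l q s k p" "out_state M r q s p j m b"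
  using assms unfolding fo_defs by ((intro conjI allI impI)?; smt (z3))+

lemma down_keepd1:
  assumes "valley M s 2 k p" "k = 1 \<and> p = 1 \<or> 2 \<le> p \<and> p \<le> k" "0 \<le> b" "b < M"
    "right_slot s p b m" "b = s m" "m \<le> k" "2 \<le> p" "s m < a" "a < M" "a \<le> s (m + 1)"
    "m = p \<longrightarrow> 3 \<le> p \<and> s (p - 1) \<le> a"
    "s n = a \<or> s (m + 1) < M \<and> (\<forall>t. 2 \<le> t \<and> t < m \<longrightarrow> \<not> (a < s t \<and> s t \<le> s (m + 1)))"
    "left_slot (s) 2 p a n" "n = p" "s' n = a" "\<forall>x. x \<noteq> n \<longrightarrow> s' x = s x"
    "stacked M r l q s k p" "out_state M r q s p j m b"
  shows "stacked M r l q (s') k (p + 1)"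
  using assms unfolding fo_defs by ((intro conjI allI impI)?; smt (z3))+

lemma down_keepd2:
  assumes "valley M s 2 k p" "k = 1 \<and> p = 1 \<or> 2 \<le> p \<and> p \<le> k" "0 \<le> b" "b < M"
    "right_slot s p b m" "b = s m" "m \<le> k" "2 \<le> p" "s m < a" "a < M" "a \<le> s (m + 1)"
    "m = p \<longrightarrow> 3 \<le> p \<and> s (p - 1) \<le> a"
    "s n = a \<or> s (m + 1) < M \<and> (\<forall>t. 2 \<le> t \<and> t < m \<longrightarrow> \<not> (a < s t \<and> s t \<le> s (m + 1)))"
    "left_slot (s) 2 p a n" "n = p" "s' n = a" "\<forall>x. x \<noteq> n \<longrightarrow> s' x = s x"
    "stacked M r l q (s') k (p + 1)"
  shows "2 \<le> q" "b < r 1"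
  using assms unfolding fo_defs by ((intro conjI allI impI)?; smt (z3))+

lemma down_keepd3:
  assumes "valley M s 2 k p" "k = 1 \<and> p = 1 \<or> 2 \<le> p \<and> p \<le> k" "0 \<le> b" "b < M"
    "right_slot s p b m" "b = s m" "m \<le> k" "2 \<le> p" "s m < a" "a < M" "a \<le> s (m + 1)"
    "m = p \<longrightarrow> 3 \<le> p \<and> s (p - 1) \<le> a"
    "s n = a \<or> s (m + 1) < M \<and> (\<forall>t. 2 \<le> t \<and> t < m \<longrightarrow> \<not> (a < s t \<and> s t \<le> s (m + 1)))"
    "left_slot (s) 2 p a n" "n = p" "s' n = a" "\<forall>x. x \<noteq> n \<longrightarrow> s' x = s x"
    "stacked M r l q (s') k (p + 1)" "1 \<le> j" "j < q" "b < r j" "j + 1 = q \<or> r (j + 1) \<le> b"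
  shows "stacked M r l q s k p" "out_state M r q s p j m b"
  using assms unfolding fo_defs by ((intro conjI allI impI)?; smt (z3))+

text \<open>If the left half changes the row, then \<open>a\<close> does not occur on its decreasing
  side. An output of (R3) below \<open>r (i + 1)\<close> was thus taken from the lower row to the
  right of column \<open>i\<close>, which keeps column \<open>i + 1\<close> inside the upper
  row.\<close>

lemma mid_state_gap:
  assumes "stacked M r l q s k p" "mid_state M r q s i a" "left_slot r 1 q a j" "right_stays r s i a"
  shows
    "r j = a \<or> r (i + 1) < M \<and> (\<forall>t. 1 \<le> t \<and> t < i \<longrightarrow> \<not> (a < r t \<and> r t \<le> r (i + 1)))"
  using assms unfolding fo_defs by ((intro conjI allI impI)?; smt (z3))+

section \<open>Copies of emitted letters in the lower row, and the letters that follow them\<close>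

section \<open>Letters close to the output\<close>

text \<open>An output of (L2) other than \<open>r (j + 1)\<close> occurs in the lower row. Its
  generator is to be absorbed by the last copy there, in column \<open>x\<close>. Behind that copy
  \<open>b - 1\<close> never occurs, and \<open>b + 1\<close> only if another \<open>b + 1\<close>
  stands in column \<open>j\<close>, which allows a braid move.\<close>

lemma absorb_ex1:
  assumes "stacked M r l q s k p" "mid_state M r q s i (r j)" "left_slot r 1 q (r j) j"
    "b \<noteq> r (j + 1)" "j < p" "j + 1 < q" "maximal_between r s j (r (j + 1)) b"
  shows "\<exists>x. 2 \<le> x \<and> x \<le> k \<and> s x = b" "0 \<le> b"
    "r (j + 1) + 1 < r j \<or> 0 < r (j + 1)"
  using assms unfolding fo_defs by ((intro conjI allI impI)?; smt (z3))+

lemma absorb_far1: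
  assumes "stacked M r l q s k p" "mid_state M r q s i (r j)" "left_slot r 1 q (r j) j"
    "b \<noteq> r (j + 1)" "j < p" "j + 1 < q" "maximal_between r s j (r (j + 1)) b" "s x = b" "2 \<le> x"
    "x \<le> k" "\<forall>y. x < y \<and> y \<le> k \<longrightarrow> s y \<noteq> b" "x < y" "y \<le> k"
  shows "s y \<noteq> b - 1"
  using assms unfolding fo_defs by ((intro conjI allI impI)?; smt (z3))+

lemma absorb_near1:
  assumes "stacked M r l q s k p" "mid_state M r q s i (r j)" "left_slot r 1 q (r j) j"
    "b \<noteq> r (j + 1)" "j < p" "j + 1 < q" "maximal_between r s j (r (j + 1)) b" "s x = b" "2 \<le> x"
    "x \<le> k" "\<forall>y. x < y \<and> y \<le> k \<longrightarrow> s y \<noteq> b" "x < y" "y \<le> k"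
    "s y = b + 1"
  shows "s j = b + 1" "2 \<le> j" "j < x" "j < p" "p < y" "0 < b"
  using assms unfolding fo_defs by ((intro conjI allI impI)?; smt (z3))+

text \<open>First shape of the letters enclosed by two copies of \<open>b + 1\<close>: they begin
  with \<open>b\<close>. As \<open>b - 1\<close> is absent, the others are further copies of
  \<open>b\<close> or commute with both \<open>b\<close> and \<open>b + 1\<close>.\<close>

lemma absorb_near_dip1:
  assumes "stacked M r l q s k p" "mid_state M r q s i (r j)" "left_slot r 1 q (r j) j"
    "b \<noteq> r (j + 1)" "j < p" "j + 1 < q" "maximal_between r s j (r (j + 1)) b" "s x = b" "2 \<le> x"
    "x \<le> k" "\<forall>y. x < y \<and> y \<le> k \<longrightarrow> s y \<noteq> b" "x < y" "y \<le> k"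
    "s y = b + 1" "s (j + 1) = b"
  shows "s z \<noteq> b - 1"
  using assms unfolding fo_defs by ((intro conjI allI impI)?; smt (z3))+

text \<open>Second shape: \<open>b\<close> stands only at the end, directly before the right copy of
  \<open>b + 1\<close>, and the letters before it are too small to interact with
  \<open>b + 1\<close>.\<close>

lemma absorb_near_no1:
  assumes "stacked M r l q s k p" "mid_state M r q s i (r j)" "left_slot r 1 q (r j) j"
    "b \<noteq> r (j + 1)" "j < p" "j + 1 < q" "maximal_between r s j (r (j + 1)) b" "s x = b" "2 \<le> x"
    "x \<le> k" "\<forall>y. x < y \<and> y \<le> k \<longrightarrow> s y \<noteq> b" "x < y" "y \<le> k"
    "s y = b + 1" "s (j + 1) \<noteq> b"
  shows "x = y - 1" "j < z \<Longrightarrow> z < x \<Longrightarrow> s z < b"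
  using assms unfolding fo_defs by ((intro conjI allI impI)?; smt (z3))+

lemma absorb_ex2:
  assumes "stacked M r l q s k p" "mid_state M r q s i (r j)" "left_slot r 1 q (r j) j"
    "b \<noteq> r (j + 1)" "j < p" "q \<le> j + 1" "maximal_between r s j (- 1) b"
  shows "\<exists>x. 2 \<le> x \<and> x \<le> k \<and> s x = b" "0 \<le> b"
    "r (j + 1) + 1 < r j \<or> 0 < r (j + 1)"
  using assms unfolding fo_defs by ((intro conjI allI impI)?; smt (z3))+

lemma absorb_far2:
  assumes "stacked M r l q s k p" "mid_state M r q s i (r j)" "left_slot r 1 q (r j) j"
    "b \<noteq> r (j + 1)" "j < p" "q \<le> j + 1" "maximal_between r s j (- 1) b" "s x = b" "2 \<le> x"
    "x \<le> k" "\<forall>y. x < y \<and> y \<le> k \<longrightarrow> s y \<noteq> b" "x < y" "y \<le> k"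
  shows "s y \<noteq> b - 1"
  using assms unfolding fo_defs by ((intro conjI allI impI)?; smt (z3))+

lemma absorb_near2:
  assumes "stacked M r l q s k p" "mid_state M r q s i (r j)" "left_slot r 1 q (r j) j"
    "b \<noteq> r (j + 1)" "j < p" "q \<le> j + 1" "maximal_between r s j (- 1) b" "s x = b" "2 \<le> x"
    "x \<le> k" "\<forall>y. x < y \<and> y \<le> k \<longrightarrow> s y \<noteq> b" "x < y" "y \<le> k"
    "s y = b + 1"
  shows "s j = b + 1" "2 \<le> j" "j < x" "j < p" "p < y" "0 < b"
  using assms unfolding fo_defs by ((intro conjI allI impI)?; smt (z3))+

lemma absorb_near_dip2:
  assumes "stacked M r l q s k p" "mid_state M r q s i (r j)" "left_slot r 1 q (r j) j"
    "b \<noteq> r (j + 1)" "j < p" "q \<le> j + 1" "maximal_between r s j (- 1) b" "s x = b" "2 \<le> x"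
    "x \<le> k" "\<forall>y. x < y \<and> y \<le> k \<longrightarrow> s y \<noteq> b" "x < y" "y \<le> k"
    "s y = b + 1" "s (j + 1) = b"
  shows "s z \<noteq> b - 1"
  using assms unfolding fo_defs by ((intro conjI allI impI)?; smt (z3))+

lemma absorb_near_no2:
  assumes "stacked M r l q s k p" "mid_state M r q s i (r j)" "left_slot r 1 q (r j) j"
    "b \<noteq> r (j + 1)" "j < p" "q \<le> j + 1" "maximal_between r s j (- 1) b" "s x = b" "2 \<le> x"
    "x \<le> k" "\<forall>y. x < y \<and> y \<le> k \<longrightarrow> s y \<noteq> b" "x < y" "y \<le> k"
    "s y = b + 1" "s (j + 1) \<noteq> b"
  shows "x = y - 1" "j < z \<Longrightarrow> z < x \<Longrightarrow> s z < b"
  using assms unfolding fo_defs by ((intro conjI allI impI)?; smt (z3))+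

lemma absorb_ex3:
  assumes "stacked M r l q s k p" "mid_state M r q s i (r j)" "left_slot r 1 q (r j) j"
    "b \<noteq> r (j + 1)" "p \<le> j" "q \<le> j + 1" "b = s (j + 1)" "drops r s j"
  shows "2 \<le> j + 1" "j + 1 \<le> k" "r (j + 1) + 1 < r j \<or> 0 < r (j + 1)"
  using assms unfolding fo_defs by ((intro conjI allI impI)?; smt (z3))+

lemma absorb_far3:
  assumes "stacked M r l q s k p" "mid_state M r q s i (r j)" "left_slot r 1 q (r j) j"
    "b \<noteq> r (j + 1)" "p \<le> j" "q \<le> j + 1" "b = s (j + 1)" "drops r s j" "s x = b" "2 \<le> x"
    "x \<le> k" "\<forall>y. x < y \<and> y \<le> k \<longrightarrow> s y \<noteq> b" "x < y" "y \<le> k"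
  shows "s y \<noteq> b - 1" "s y \<noteq> b + 1"
  using assms unfolding fo_defs by ((intro conjI allI impI)?; smt (z3))+

text \<open>The row is unchanged by both halves and emits \<open>r (j + 1)\<close>, which is
  adjacent in value to \<open>r j\<close>. A copy of the emitted letter in the lower row has to
  account for it.\<close>

lemma braid_ex1:
  assumes "stacked M r l q s k p" "mid_state M r q s i (r j)" "left_slot r 1 q (r j) j" "r j < r (i + 1)"
    "right_stays r s i (r j)" "r j = r (j + 1) + 1" "j < p" "j + 1 < q"
    "maximal_between r s j (r (j + 1)) (r (j + 1))"
  shows "\<exists>x. 2 \<le> x \<and> x \<le> k \<and> s x = r (j + 1)"
  using assms unfolding fo_defs by ((intro conjI allI impI)?; smt (z3))+

lemma braid_far1:
  assumes "stacked M r l q s k p" "mid_state M r q s i (r j)" "left_slot r 1 q (r j) j" "r j < r (i + 1)"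
    "right_stays r s i (r j)" "r j = r (j + 1) + 1" "j < p" "j + 1 < q"
    "maximal_between r s j (r (j + 1)) (r (j + 1))" "s x = r (j + 1)" "2 \<le> x" "x \<le> k"
    "\<forall>y. x < y \<and> y \<le> k \<longrightarrow> s y \<noteq> r (j + 1)" "x < y" "y \<le> k"
  shows "s y \<noteq> r (j + 1) - 1"
  using assms unfolding fo_defs by ((intro conjI allI impI)?; smt (z3))+

text \<open>Letters 0 and 1 satisfy only the braid relation of length four. For
  \<open>r (j + 1) = 0\<close> this calls for one more letter 1 in front of the copy, which the last
  conclusion provides.\<close>

lemma braid_near1:
  assumes "stacked M r l q s k p" "mid_state M r q s i (r j)" "left_slot r 1 q (r j) j" "r j < r (i + 1)"
    "right_stays r s i (r j)" "r j = r (j + 1) + 1" "j < p" "j + 1 < q"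
    "maximal_between r s j (r (j + 1)) (r (j + 1))" "s x = r (j + 1)" "2 \<le> x" "x \<le> k"
    "\<forall>y. x < y \<and> y \<le> k \<longrightarrow> s y \<noteq> r (j + 1)" "x < y" "y \<le> k"
    "s y = r (j + 1) + 1"
  shows "x = y - 1" "y < z \<Longrightarrow> z \<le> k \<Longrightarrow> r (j + 1) + 2 < s z"
    "1 \<le> t \<Longrightarrow> t < j \<Longrightarrow> r (j + 1) + 2 < r t"
    "r (j + 1) = 0 \<Longrightarrow> s (x - 1) = r (j + 1) + 1 \<and> 2 < x"
  using assms unfolding fo_defs by ((intro conjI allI impI)?; smt (z3))+

lemma braid_ex2:
  assumes "stacked M r l q s k p" "mid_state M r q s i (r j)" "left_slot r 1 q (r j) j" "r j < r (i + 1)"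
    "right_stays r s i (r j)" "r j = r (j + 1) + 1" "j < p" "q \<le> j + 1"
    "maximal_between r s j (- 1) (r (j + 1))"
  shows "\<exists>x. 2 \<le> x \<and> x \<le> k \<and> s x = r (j + 1)"
  using assms unfolding fo_defs by ((intro conjI allI impI)?; smt (z3))+

lemma braid_far2:
  assumes "stacked M r l q s k p" "mid_state M r q s i (r j)" "left_slot r 1 q (r j) j" "r j < r (i + 1)"
    "right_stays r s i (r j)" "r j = r (j + 1) + 1" "j < p" "q \<le> j + 1"
    "maximal_between r s j (- 1) (r (j + 1))" "s x = r (j + 1)" "2 \<le> x" "x \<le> k"
    "\<forall>y. x < y \<and> y \<le> k \<longrightarrow> s y \<noteq> r (j + 1)" "x < y" "y \<le> k"
  shows "s y \<noteq> r (j + 1) - 1"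
  using assms unfolding fo_defs by ((intro conjI allI impI)?; smt (z3))+

lemma braid_near2:
  assumes "stacked M r l q s k p" "mid_state M r q s i (r j)" "left_slot r 1 q (r j) j" "r j < r (i + 1)"
    "right_stays r s i (r j)" "r j = r (j + 1) + 1" "j < p" "q \<le> j + 1"
    "maximal_between r s j (- 1) (r (j + 1))" "s x = r (j + 1)" "2 \<le> x" "x \<le> k"
    "\<forall>y. x < y \<and> y \<le> k \<longrightarrow> s y \<noteq> r (j + 1)" "x < y" "y \<le> k"
    "s y = r (j + 1) + 1"
  shows "x = y - 1" "y < z \<Longrightarrow> z \<le> k \<Longrightarrow> r (j + 1) + 2 < s z"
    "1 \<le> t \<Longrightarrow> t < j \<Longrightarrow> r (j + 1) + 2 < r t"
    "r (j + 1) = 0 \<Longrightarrow> s (x - 1) = r (j + 1) + 1 \<and> 2 < x"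
  using assms unfolding fo_defs by ((intro conjI allI impI)?; smt (z3))+

lemma braid_ex3:
  assumes "stacked M r l q s k p" "mid_state M r q s i (r j)" "left_slot r 1 q (r j) j" "r j < r (i + 1)"
    "right_stays r s i (r j)" "r j = r (j + 1) + 1" "p \<le> j"
    "q \<le> j + 1 \<longrightarrow> \<not> drops r s j \<or> s (j + 1) = r (j + 1)"
  shows "\<exists>x. 2 \<le> x \<and> x \<le> k \<and> s x = r (j + 1)"
  using assms unfolding fo_defs by ((intro conjI allI impI)?; smt (z3))+

lemma braid_far3:
  assumes "stacked M r l q s k p" "mid_state M r q s i (r j)" "left_slot r 1 q (r j) j" "r j < r (i + 1)"
    "right_stays r s i (r j)" "r j = r (j + 1) + 1" "p \<le> j"
    "q \<le> j + 1 \<longrightarrow> \<not> drops r s j \<or> s (j + 1) = r (j + 1)" "s x = r (j + 1)"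
    "2 \<le> x" "x \<le> k" "\<forall>y. x < y \<and> y \<le> k \<longrightarrow> s y \<noteq> r (j + 1)"
    "x < y" "y \<le> k"
  shows "s y \<noteq> r (j + 1) - 1"
  using assms unfolding fo_defs by ((intro conjI allI impI)?; smt (z3))+

lemma braid_near3:
  assumes "stacked M r l q s k p" "mid_state M r q s i (r j)" "left_slot r 1 q (r j) j" "r j < r (i + 1)"
    "right_stays r s i (r j)" "r j = r (j + 1) + 1" "p \<le> j"
    "q \<le> j + 1 \<longrightarrow> \<not> drops r s j \<or> s (j + 1) = r (j + 1)" "s x = r (j + 1)"
    "2 \<le> x" "x \<le> k" "\<forall>y. x < y \<and> y \<le> k \<longrightarrow> s y \<noteq> r (j + 1)"
    "x < y" "y \<le> k" "s y = r (j + 1) + 1"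
  shows "x = y - 1" "y < z \<Longrightarrow> z \<le> k \<Longrightarrow> r (j + 1) + 2 < s z"
    "1 \<le> t \<Longrightarrow> t < j \<Longrightarrow> r (j + 1) + 2 < r t"
    "r (j + 1) = 0 \<Longrightarrow> s (x - 1) = r (j + 1) + 1 \<and> 2 < x"
  using assms unfolding fo_defs by ((intro conjI allI impI)?; smt (z3))+

text \<open>Rule (R3) emits a letter below \<open>r (i + 1)\<close>, and (L1) writes it into the
  row. On words this letter appears to be created; it comes from its copy in the lower row.\<close>

lemma raise_ex:
  assumes "stacked M r l q s k p" "mid_state M r q s i a" "left_slot r 1 q a j" "r j < a" "a < r (i + 1)"
    "right_stays r s i a"
  shows "\<exists>x. 2 \<le> x \<and> x \<le> k \<and> s x = a"
  using assms unfolding fo_defs by ((intro conjI allI impI)?; smt (z3))+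

text \<open>Everything that the new letter has to cross exceeds it by at least two. If it is
  adjacent in value to the letter \<open>r j\<close> that it replaces, a copy of \<open>r j\<close>
  directly precedes it in the lower row and makes a braid move possible.\<close>

lemma raise_far:
  assumes "stacked M r l q s k p" "mid_state M r q s i a" "left_slot r 1 q a j" "r j < a" "a < r (i + 1)"
    "right_stays r s i a" "s x = a" "2 \<le> x" "x \<le> k"
    "\<forall>y. x < y \<and> y \<le> k \<longrightarrow> s y \<noteq> a"
  shows "x < y \<Longrightarrow> y \<le> k \<Longrightarrow> a + 1 < s y"
    "1 \<le> t \<Longrightarrow> t < j \<Longrightarrow> a + 1 < r t"
    "a = r j + 1 \<Longrightarrow> s (x - 1) = r j \<and> 0 < r j \<and> 2 < x"
  using assms unfolding fo_defs by ((intro conjI allI impI)?; smt (z3))+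

section \<open>Translation between lists with infinity and integer-valued functions\<close>

section \<open>Rows as functions\<close>

declare [[coercion_enabled]] [[coercion "int :: nat \<Rightarrow> int"]]

definition lift :: "int \<Rightarrow> nat extended \<Rightarrow> int" where
  "lift M e = (case e of Fin n \<Rightarrow> int n | \<infinity> \<Rightarrow> M | -\<infinity> \<Rightarrow> - 1)"

definition row :: "int \<Rightarrow> nat list \<Rightarrow> int \<Rightarrow> int" where
  "row M R x = lift M (row_at R (nat x))"

text \<open>Row insertion numbers the row below from column 2, hence the shift by one.\<close>

definition low :: "int \<Rightarrow> nat list \<Rightarrow> int \<Rightarrow> int" where
  "low M S x = row M S (x - 1)"

text \<open>The possible entries and outputs: a letter below \<open>M\<close> or infinity. On these
  \<open>lift\<close> preserves and reflects the order.\<close>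

definition bounded :: "int \<Rightarrow> nat extended \<Rightarrow> bool" where
  "bounded M e \<longleftrightarrow> e = \<infinity> \<or> (\<exists>n. e = Fin n \<and> int n < M)"

lemma lift_simps [simp]: "lift M (Fin n) = int n" "lift M \<infinity> = M" "lift M (-\<infinity>) = - 1"
  by (simp_all add: lift_def)

lemma lift_less: "bounded M e \<Longrightarrow> bounded M e' \<Longrightarrow> lift M e < lift M e' \<longleftrightarrow> e < e'"
  by (auto simp: bounded_def)

lemma lift_eq: "bounded M e \<Longrightarrow> bounded M e' \<Longrightarrow> lift M e = lift M e' \<longleftrightarrow> e = e'"
  by (auto simp: bounded_def)

lemma lift_le: "bounded M e \<Longrightarrow> bounded M e' \<Longrightarrow> lift M e \<le> lift M e' \<longleftrightarrow> e \<le> e'"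
  by (auto simp: bounded_def)

lemma row_nth: "1 \<le> x \<Longrightarrow> x \<le> int (length R) \<Longrightarrow> row M R x = int (R ! nat (x - 1))"
  by (auto simp: row_def row_at_def nat_diff_distrib' intro!: arg_cong[where f = "(!) R"])

lemma row_out: "x < 1 \<or> int (length R) < x \<Longrightarrow> row M R x = M"
  by (auto simp: row_def row_at_def)

lemma row_Suc: "n < length R \<Longrightarrow> row M R (int n + 1) = int (R ! n)"
  by (simp add: row_nth)

lemma lift_row_at: "lift M (row_at R n) = row M R (int n)"
  by (simp add: row_def)

lemma lift_below_at: "lift M (below_at S n) = low M S (int n)"
proof (cases "2 \<le> n \<and> n \<le> length S + 1")
  case True
  then have "nat (int n - 1 - 1) = n - 2" by simp
  with True show ?thesis unfolding low_def by (subst row_nth) (auto simp: below_at_def)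
next
  case False
  then show ?thesis unfolding low_def by (subst row_out) (auto simp: below_at_def)
qed

lemma bounded_row_at: "\<forall>x\<in>set R. int x < M \<Longrightarrow> bounded M (row_at R n)"
  by (auto simp: bounded_def row_at_def)

lemma bounded_below_at: "\<forall>x\<in>set S. int x < M \<Longrightarrow> bounded M (below_at S n)"
  by (auto simp: bounded_def below_at_def)

lemma row_update: "1 \<le> i \<Longrightarrow> i \<le> length R \<Longrightarrow> row M (R[i - 1 := a]) = (row M R)(int i := int a)"
  by (auto simp: fun_eq_iff row_def row_at_def nth_list_update)

lemma row_append: "row M (R @ [a]) = (row M R)(int (length R) + 1 := int a)"
  by (auto simp: fun_eq_iff row_def row_at_def nth_append)

lemma low_append: "low M (S @ [a]) = (low M S)(int (length S) + 2 := int a)"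
  by (auto simp: fun_eq_iff low_def row_append)

lemma row_inj:
  assumes "row M R = row M R'" "length R = length R'"
  shows "R = R'"
proof (rule nth_equalityI[OF assms(2)])
  fix i assume "i < length R"
  then show "R ! i = R' ! i"
    using row_Suc[of i R M] row_Suc[of i R' M] assms by simp
qed

lemma valley_shift: "valley M (\<lambda>x. r (x - 1)) (f + 1) (l + 1) (q + 1) \<longleftrightarrow> valley M r f l q"
proof
  assume *: "valley M r f l q"
  show "valley M (\<lambda>x. r (x - 1)) (f + 1) (l + 1) (q + 1)"
    unfolding valley_def using *[unfolded valley_def] by auto
next
  assume *: "valley M (\<lambda>x. r (x - 1)) (f + 1) (l + 1) (q + 1)"
  have A: "f + 1 \<le> x \<Longrightarrow> x \<le> l + 1 \<Longrightarrow> 0 \<le> r (x - 1) \<and> r (x - 1) < M"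
    and B: "x < f + 1 \<or> l + 1 < x \<Longrightarrow> r (x - 1) = M"
    and C: "f + 1 \<le> x \<Longrightarrow> x < y \<Longrightarrow> y \<le> q + 1 \<Longrightarrow> r (y - 1) < r (x - 1)"
    and D: "q + 1 \<le> x \<Longrightarrow> x < y \<Longrightarrow> y \<le> l + 1 \<Longrightarrow> r (x - 1) < r (y - 1)" for x y
    using *[unfolded valley_def] by blast+
  show "valley M r f l q"
    unfolding valley_def
    using A[of "x + 1" for x] B[of "x + 1" for x] C[of "x + 1" "y + 1" for x y]
      D[of "x + 1" "y + 1" for x y] by auto
qed

lemma valley_low: "valley M (low M S) 2 (int (length S) + 1) (q + 1) \<longleftrightarrow> valley M (row M S) 1 (length S) q"
  using valley_shift[of M "row M S" 1 "length S" q] by (simp add: low_def[abs_def])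

lemma valley_rowI:
  assumes "is_dip R q" "\<forall>x\<in>set R. int x < M"
  shows "valley M (row M R) 1 (length R) q"
proof -
  have q: "1 \<le> q" "q \<le> length R" "sorted_wrt (>) (take q R)" "sorted_wrt (<) (drop (q - 1) R)"
    using assms(1) by (auto simp: is_dip_def)
  have dec: "R ! m < R ! n" if "n < m" "m < q" for n m
    using sorted_wrt_nth_less[OF q(3) that(1)] that q(2) by simp
  have inc: "R ! n < R ! m" if "q - 1 \<le> n" "n < m" "m < length R" for n m
    using sorted_wrt_nth_less[OF q(4), of "n - (q - 1)" "m - (q - 1)"] that q by simp
  show ?thesis
    unfolding valley_def
  proof (intro conjI allI impI)
    fix x y :: int
    { assume "1 \<le> x \<and> x < y \<and> y \<le> int q"
      then show "row M R y < row M R x"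
        using dec[of "nat (x - 1)" "nat (y - 1)"] q by (simp add: row_nth nat_less_iff) }
    { assume *: "int q \<le> x \<and> x < y \<and> y \<le> int (length R)"
      then have "q - 1 \<le> nat (x - 1)" "nat (x - 1) < nat (y - 1)" "nat (y - 1) < length R"
        using q by linarith+
      from inc[OF this] show "row M R x < row M R y" using * q by (simp add: row_nth) }
  qed (use assms(2) in \<open>auto simp: row_nth row_out\<close>)
qed

lemma valley_rowD:
  assumes v: "valley M (row M R) 1 (length R) q" and q: "1 \<le> q" "q \<le> int (length R)"
  shows "is_dip R (nat q)" "\<forall>x\<in>set R. int x < M"
proof -
  have a: "row M R (int n + 1) < M" if "n < length R" for n
    using v that by (simp add: valley_def)
  show "\<forall>x\<in>set R. int x < M"
    using a by (auto simp: in_set_conv_nth row_Suc)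
  have dec: "R ! m < R ! n" if "n < m" "m < nat q" for n m
  proof -
    have "row M R (int m + 1) < row M R (int n + 1)"
      using v that q by (auto simp: valley_def)
    then show ?thesis using that q by (simp add: row_Suc)
  qed
  have inc: "R ! n < R ! m" if "nat q - 1 \<le> n" "n < m" "m < length R" for n m
  proof -
    have "row M R (int n + 1) < row M R (int m + 1)"
      using v that q unfolding valley_def by auto
    then show ?thesis using that q by (simp add: row_Suc)
  qed
  show "is_dip R (nat q)"
    unfolding is_dip_def sorted_wrt_iff_nth_less
    using q dec inc by (auto simp: nat_le_iff le_nat_iff)
qed

lemma dip_row: "valley M (row M R) 1 (length R) q \<Longrightarrow> 1 \<le> q \<Longrightarrow> q \<le> int (length R) \<Longrightarrow> int (dip R) = q"
  using dip_eqI[OF valley_rowD(1)] by fastforce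

text \<open>For an empty row \<open>below_dip\<close> is 0 while \<open>stacked\<close> uses 1. Both
  make the test \<open>j < p\<close> fail for every column \<open>j\<close>, as columns start at
  1.\<close>

definition low_dip :: "nat list \<Rightarrow> int" where
  "low_dip S = (if S = [] then 1 else int (dip S) + 1)"

definition above :: "int \<Rightarrow> nat list \<Rightarrow> nat list \<Rightarrow> bool" where
  "above M R S \<longleftrightarrow>
     stacked M (row M R) (length R) (dip R) (low M S) (int (length S) + 1) (low_dip S)"

text \<open>A stacked pair determines its dips. The case lemmas may therefore name the new dip by an
  expression such as \<open>q + 1\<close>, and this is identified with \<open>dip\<close> of the new
  list afterwards.\<close>

lemma aboveI:
  assumes "stacked M (row M R) (length R) q (low M S) (int (length S) + 1) p"
  shows "above M R S" "q = dip R" "p = low_dip S"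
proof -
  have 1: "1 \<le> q" "q \<le> length R" "valley M (row M R) 1 (length R) q"
    using assms unfolding stacked_def by auto
  show q: "q = dip R" using dip_row[OF 1(3,1,2)] by simp
  show p: "p = low_dip S"
  proof (cases "S = []")
    case True
    then show ?thesis using assms by (auto simp: stacked_def low_dip_def)
  next
    case False
    then have "2 \<le> p" "p \<le> int (length S) + 1" "valley M (low M S) 2 (int (length S) + 1) (p - 1 + 1)"
      using assms by (auto simp: stacked_def)
    then have "int (dip S) = p - 1"
      unfolding valley_low by (intro dip_row) auto
    then show ?thesis using False by (simp add: low_dip_def)
  qed
  show "above M R S" using assms q p by (simp add: above_def)
qed

lemma above_letters:
  assumes "above M R S"
  shows "\<forall>x\<in>set R. int x < M" "\<forall>x\<in>set S. int x < M" "R \<noteq> []"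
    "length S < length R"
    "is_dip R (dip R)" "S \<noteq> [] \<Longrightarrow> is_dip S (dip S)"
    "valley M (row M R) 1 (length R) (dip R)" "1 \<le> dip R" "dip R \<le> length R"
    "S \<noteq> [] \<Longrightarrow> valley M (row M S) 1 (length S) (dip S)" "S \<noteq> [] \<Longrightarrow> 1 \<le> dip S" "S \<noteq> [] \<Longrightarrow> dip S \<le> length S"
proof -
  note a = assms[unfolded above_def stacked_def]
  show 1: "1 \<le> dip R" "dip R \<le> length R" "valley M (row M R) 1 (length R) (dip R)" using a by auto
  show "R \<noteq> []" "length S < length R" using a 1 by auto
  show "\<forall>x\<in>set R. int x < M" "is_dip R (dip R)" using valley_rowD[OF 1(3)] 1 by auto
  have 2: "valley M (row M S) 1 (length S) (dip S)" "1 \<le> dip S" "dip S \<le> length S" if "S \<noteq> []"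
    using a that by (auto simp: low_dip_def valley_low)
  show "S \<noteq> [] \<Longrightarrow> valley M (row M S) 1 (length S) (dip S)" "S \<noteq> [] \<Longrightarrow> 1 \<le> dip S" "S \<noteq> [] \<Longrightarrow> dip S \<le> length S"
    by (fact 2)+
  show "S \<noteq> [] \<Longrightarrow> is_dip S (dip S)" using valley_rowD(1)[OF 2(1)] 2 by auto
  show "\<forall>x\<in>set S. int x < M"
    using valley_rowD(2)[OF 2(1)] 2 by (cases "S = []") auto
qed

text \<open>Replaces the list program by the predicates for slots and outputs, one case for each
  rule, with (R1) split according to whether the row grows.\<close>

lemma right_insert_cases:
  assumes R: "valley M (row M R) 1 (length R) (dip R)" "1 \<le> dip R" "dip R \<le> length R"
    and S: "\<forall>x\<in>set S. int x < M" and a: "int a < M"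
  obtains
    (grow) "right_slot (row M R) (dip R) a (int (length R) + 1)" "right_insert a R S = (\<infinity>, R @ [a])"
  | (replace) i where "1 \<le> i" "i \<le> length R" "right_slot (row M R) (dip R) a (int i)"
      "int a \<noteq> row M R i" "right_insert a R S = (Fin (R ! (i - 1)), R[i - 1 := a])"
  | (swap) "dip R < length R" "row M R (dip R) = a"
      "row M R (int (dip R) + 1) < row M R (int (dip R) - 1)"
      "right_insert a R S = (Fin (R ! dip R), R[dip R := a])"
  | (keep) i e where "1 \<le> i" "i \<le> length R" "right_slot (row M R) (dip R) a (int i)"
      "row M R i = a" "row M R (int i - 1) \<le> row M R (int i + 1)"
      "right_out (row M R) (low M S) i (lift M e)" "bounded M e" "right_insert a R S = (e, R)"
proof -
  define q where "q = dip R"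
  have RM: "\<forall>x\<in>set R. int x < M" using valley_rowD(2)[OF R(1)] R by simp
  note bR = bounded_row_at[OF RM] and bS = bounded_below_at[OF S]
  have bF: "bounded M (Fin a)" using a by (auto simp: bounded_def)
  define i where "i = (if Fin a = row_at R q then q
     else (LEAST i. q < i \<and> i \<le> length R + 1 \<and> row_at R i \<ge> Fin a))"
  have slot: "right_slot (row M R) q a (int i) \<and> 1 \<le> i \<and> i \<le> length R + 1 \<and> q \<le> i"
  proof (cases "Fin a = row_at R q")
    case True
    then have "row M R q = a" using lift_row_at[of M R q] by (metis lift_simps(1))
    then show ?thesis using True R by (simp add: i_def right_slot_def q_def)
  next
    case False
    let ?P = "\<lambda>i. q < i \<and> i \<le> length R + 1 \<and> row_at R i \<ge> Fin a"
    have P: "?P (length R + 1)" using R by (auto simp: q_def row_at_def)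
    have i: "?P i" using LeastI[of ?P, OF P] False by (simp add: i_def)
    have min: "\<not> ?P x" if "x < i" for x using not_less_Least[of x ?P] that False by (simp add: i_def)
    have "row M R q \<noteq> a" using False lift_eq[OF bF bR[of q]] by (simp add: lift_row_at)
    moreover have "int a \<le> row M R i" using i lift_le[OF bF bR[of i]] by (simp add: lift_row_at)
    moreover have "row M R x < a" if "int q < x" "x < int i" for x
    proof -
      have "\<not> ?P (nat x)" using min[of "nat x"] that by auto
      then have "row_at R (nat x) < Fin a" using that i by auto
      then have "lift M (row_at R (nat x)) < lift M (Fin a)" using lift_less[OF bR bF] by blast
      then show ?thesis by (simp add: row_def)
    qed
    ultimately show ?thesis using i by (auto simp: right_slot_def)
  qed
  have eq: "right_insert a R S = (if Fin a \<noteq> row_at R i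
      then (row_at R i, if i = length R + 1 then R @ [a] else R[i - 1 := a])
     else if row_at R (i - 1) > row_at R (i + 1) then (row_at R (i + 1), R[i := R ! (i - 1)])
     else (Min ({row_at R (i + 1)} \<union> ({below_at S i<..<row_at R (i + 1)} \<inter> A_set R S i)), R))"
    by (simp add: right_insert_def Let_def i_def q_def)
  have ne: "Fin a = row_at R i \<longleftrightarrow> int a = row M R i"
    using lift_eq[OF bF bR[of i]] by (simp add: lift_row_at)
  show thesis
  proof (cases "i = length R + 1")
    case True
    then have "row_at R i = \<infinity>" by (simp add: row_at_def)
    then show thesis using grow slot eq True by (simp add: q_def add.commute)
  next
    case False
    then have il: "i \<le> length R" using slot by simp
    have ri: "row_at R i = Fin (R ! (i - 1))" using slot il by (simp add: row_at_def)
    show thesis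
    proof (cases "int a = row M R i")
      case False
      then show thesis
        using replace[of i] slot il eq ne ri \<open>i \<noteq> length R + 1\<close> by (simp add: q_def)
    next
      case True
      have ai: "R ! (i - 1) = a" using True ne ri by simp
      have ii: "int (i - Suc 0) = int i - 1" using slot by simp
      show thesis
      proof (cases "row_at R (i + 1) < row_at R (i - 1)")
        case sw: True
        have less: "row M R (int i + 1) < row M R (int i - 1)"
          using sw lift_less[OF bR bR, of "i + 1" "i - 1"] by (simp add: lift_row_at ii add.commute)
        have "i < length R" using sw il by (cases "i = length R") (auto simp: row_at_def)
        \<comment> \<open>To the right of the dip the two neighbours of column \<open>i\<close> are
          in increasing order, which excludes (R2).\<close>
        moreover have "i = q"
        proof (rule ccontr)
          assume "i \<noteq> q"
          then have "q < i" using slot by simp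
          then have "row M R (int i - 1) < row M R (int i + 1)"
            using R(1) \<open>i < length R\<close> unfolding valley_def q_def by auto
          then show False using less by simp
        qed
        ultimately show thesis
          using swap less eq sw ne True ai by (simp add: q_def row_at_def)
      next
        case nsw: False
        have le: "row M R (int i - 1) \<le> row M R (int i + 1)"
          using nsw lift_le[OF bR bR, of "i - 1" "i + 1"] by (simp add: lift_row_at ii add.commute)
        let ?X = "{row_at R (i + 1)} \<union> ({below_at S i<..<row_at R (i + 1)} \<inter> A_set R S i)"
        define e where "e = Min ?X"
        have fin: "finite ?X" by (simp add: A_set_def)
        have eX: "e \<in> ?X" unfolding e_def by (rule Min_in[OF fin]) simp
        have emin: "e \<le> x" if "x \<in> ?X" for x unfolding e_def by (rule Min_le[OF fin that])
        have be: "bounded M e" using eX bR bS by (auto simp: A_set_def)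
        have r1: "row M R (int i + 1) = lift M (row_at R (i + 1))" by (simp add: lift_row_at add.commute)
        have si: "low M S (int i) = lift M (below_at S i)" by (simp add: lift_below_at)
        have "right_out (row M R) (low M S) i (lift M e)"
          unfolding right_out_def
        proof (intro conjI allI impI)
          show "lift M e \<le> row M R (int i + 1)"
            using emin[of "row_at R (i + 1)"] lift_le[OF be bR] by (simp add: r1)
          show "lift M e = row M R (int i + 1) \<or>
            low M S (int i) < lift M e \<and> lift M e < row M R (int i + 1) \<and>
            between (row M R) (low M S) (int i) (lift M e)"
          proof (cases "e = row_at R (i + 1)")
            case False
            then have e: "below_at S i < e" "e < row_at R (i + 1)" "e \<in> A_set R S i" using eX by auto
            have "between (row M R) (low M S) (int i) (lift M e)"
              using e(3) unfolding A_set_def between_def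
            proof
              assume "e \<in> below_at S ` {i + 1..length S + 1}"
              then obtain x where "x \<in> {i + 1..length S + 1}" "e = below_at S x" by blast
              then show "(\<exists>x>int i. low M S x = lift M e) \<or> (\<exists>t\<ge>1. t < int i \<and> row M R t = lift M e)"
                by (intro disjI1 exI[of _ "int x"]) (auto simp: lift_below_at)
            next
              assume "e \<in> row_at R ` {1..<i}"
              then obtain x where "x \<in> {1..<i}" "e = row_at R x" by blast
              then show "(\<exists>x>int i. low M S x = lift M e) \<or> (\<exists>t\<ge>1. t < int i \<and> row M R t = lift M e)"
                by (intro disjI2 exI[of _ "int x"]) (auto simp: lift_row_at)
            qed
            then show ?thesis using e lift_less[OF bS be] lift_less[OF be bR] by (simp add: r1 si)
          qed (simp add: r1)
          fix x :: int
          { assume x: "int i < x"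
            have "low M S x = lift M (below_at S (nat x))" using x by (simp add: lift_below_at)
            \<comment> \<open>\<open>A_set\<close> only lists the columns up to
              \<open>length S + 1\<close>. A value below \<open>e\<close> is finite, so its column
              is among them.\<close>
            moreover have "\<not> (below_at S i < below_at S (nat x) \<and> below_at S (nat x) < e)"
            proof
              assume h: "below_at S i < below_at S (nat x) \<and> below_at S (nat x) < e"
              then have "below_at S (nat x) < \<infinity>" by (meson less_le_trans less_extended_simps(4) le_less not_le)
              then have "nat x \<le> length S + 1" by (auto simp: below_at_def split: if_splits)
              then have "below_at S (nat x) \<in> ?X"
                using x h emin[of "row_at R (i + 1)"] by (auto simp: A_set_def)
              then show False using emin h by fastforce
            qed
            ultimately show "\<not> (low M S (int i) < low M S x \<and> low M S x < lift M e)"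
              using lift_less[OF bS bS] lift_less[OF bS be] by (simp add: si) }
          { assume x: "1 \<le> x \<and> x < int i"
            have "row M R x = lift M (row_at R (nat x))" by (simp add: row_def)
            moreover have "\<not> (below_at S i < row_at R (nat x) \<and> row_at R (nat x) < e)"
            proof
              assume h: "below_at S i < row_at R (nat x) \<and> row_at R (nat x) < e"
              have "nat x \<in> {1..<i}" using x by auto
              then have "row_at R (nat x) \<in> ?X"
                using h emin[of "row_at R (i + 1)"] by (auto simp: A_set_def)
              then show False using emin h by fastforce
            qed
            ultimately show "\<not> (low M S (int i) < row M R x \<and> row M R x < lift M e)"
              using lift_less[OF bS bR] lift_less[OF bR be] by (simp add: si) }
        qed
        moreover have "right_insert a R S = (e, R)"
          unfolding eq e_def using ne True nsw by (simp only: simp_thms if_True if_False)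
        ultimately show thesis
          using slot[unfolded q_def] il True le be by (intro keep[of i e]) simp_all
      qed
    qed
  qed
qed

lemma left_insert_cases:
  assumes R: "\<forall>x\<in>set R. int x < M" "1 \<le> dip R" "dip R \<le> length R"
    and S: "\<forall>x\<in>set S. int x < M" and a: "int a < M" "row M R (dip R) \<le> a"
  obtains
    (replace) j where "left_slot (row M R) 1 (dip R) a (int j)" "1 \<le> j" "j \<le> length R" "row M R j < a"
      "left_insert (Fin a) R S = (Fin (R ! (j - 1)), R[j - 1 := a])"
  | (keep) j e where "left_slot (row M R) 1 (dip R) a (int j)" "1 \<le> j" "j \<le> length R" "row M R j = a"
      "left_insert (Fin a) R S = (e, R)" "bounded M e"
      "left_out (row M R) (dip R) (low M S) (low_dip S) j (lift M e)"
proof -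
  define q where "q = dip R"
  note bR = bounded_row_at[OF R(1)] and bS = bounded_below_at[OF S]
  have bF: "bounded M (Fin a)" using a by (auto simp: bounded_def)
  let ?P = "\<lambda>j. 1 \<le> j \<and> j \<le> q \<and> row_at R j \<le> Fin a"
  define j where "j = (LEAST j. ?P j)"
  have "?P q" using R a lift_le[OF bR[of q] bF] by (simp add: q_def lift_row_at)
  then have j: "?P j" unfolding j_def by (rule LeastI)
  have min: "\<not> ?P x" if "x < j" for x using not_less_Least[of x ?P] that by (simp add: j_def)
  have jl: "j \<le> length R" using j R by (simp add: q_def)
  have rj: "row_at R j = Fin (R ! (j - 1))" using j jl by (simp add: row_at_def)
  have slot: "left_slot (row M R) 1 q a (int j)"
    unfolding left_slot_def
  proof (intro conjI allI impI)
    show "row M R (int j) \<le> int a" using j lift_le[OF bR[of j] bF] by (simp add: lift_row_at)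
    fix x :: int assume x: "1 \<le> x \<and> x < int j"
    then have "\<not> ?P (nat x)" by (intro min) auto
    then have "Fin a < row_at R (nat x)" using x j by auto
    then show "int a < row M R x" using lift_less[OF bF bR[of "nat x"]] by (simp add: row_def)
  qed (use j in auto)
  have ne: "Fin a = row_at R j \<longleftrightarrow> int a = row M R j"
    using lift_eq[OF bF bR[of j]] by (simp add: lift_row_at)
  have eq: "left_insert (Fin a) R S = (if Fin a \<noteq> row_at R j then (row_at R j, R[j - 1 := a]) else
      ((if j < below_dip S then
           (if j + 1 < q \<and> A_set R S j \<inter> {row_at R (j + 1)<..<below_at S j} \<noteq> {}
              then Max (A_set R S j \<inter> {row_at R (j + 1)<..<below_at S j})
            else if j + 1 \<ge> q \<and> A_set R S j \<inter> {-\<infinity><..<below_at S j} \<noteq> {}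
              then Max (A_set R S j \<inter> {-\<infinity><..<below_at S j})
            else row_at R (j + 1))
        else if q \<le> j + 1 \<and> (below_at S (j + 1) < row_at R (j + 1) \<or>
             row_at R j < row_at R (j + 2) \<and> below_at S (j + 1) < row_at R j \<and> row_at R j < below_at S (j + 2))
          then below_at S (j + 1) else row_at R (j + 1)), R))"
    unfolding left_insert_def Let_def extended.case q_def[symmetric] j_def[symmetric] by (rule refl)
  show thesis
  proof (cases "int a = row M R j")
    case False
    then show thesis
      using replace[of j] slot j jl ne rj eq by (auto simp: left_slot_def q_def)
  next
    case True
    \<comment> \<open>With minus infinity as lower end, the two cases of (L2)(I) share one
      interval.\<close>
    define c where "c = (if j + 1 < q then row_at R (j + 1) else -\<infinity>)"
    define X where "X = A_set R S j \<inter> {c<..<below_at S j}"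
    define e where "e = (if j < below_dip S then if X \<noteq> {} then Max X else row_at R (j + 1)
      else if q \<le> j + 1 \<and> (below_at S (j + 1) < row_at R (j + 1) \<or>
        row_at R j < row_at R (j + 2) \<and> below_at S (j + 1) < row_at R j \<and> row_at R j < below_at S (j + 2))
      then below_at S (j + 1) else row_at R (j + 1))"
    have eq: "left_insert (Fin a) R S = (e, R)"
      using True ne eq by (simp add: e_def X_def c_def)
    have fin: "finite X" by (simp add: A_set_def X_def)
    have bX: "bounded M x" if "x \<in> X" for x using that bR bS by (auto simp: A_set_def X_def)
    have be: "bounded M e" using bR bS bX[OF Max_in[OF fin]] by (auto simp: e_def)
    have r1: "row M R (int j + n) = lift M (row_at R (j + nat n))" if "0 \<le> n" for n
      using that by (simp add: lift_row_at)
    have s1: "low M S (int j + n) = lift M (below_at S (j + nat n))" if "0 \<le> n" for n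
      using that by (simp add: lift_below_at)
    \<comment> \<open>The encodings \<open>low_dip\<close> and \<open>below_dip\<close> differ on an
      empty lower row only, where both sides are false.\<close>
    have pp: "int j < low_dip S \<longleftrightarrow> j < below_dip S" using j by (simp add: low_dip_def below_dip_def less_Suc_eq_le)
    let ?c = "if int j + 1 < int q then row M R (int j + 1) else - 1"
    have c: "?c < lift M f \<longleftrightarrow> c < f" if "bounded M f" for f
    proof (cases "j + 1 < q")
      case True
      then show ?thesis using lift_less[OF bR that, of "j + 1"] by (simp add: r1 c_def)
    next
      case False
      have "0 \<le> lift M f" "-\<infinity> < f" using that a by (auto simp: bounded_def)
      then show ?thesis using False by (auto simp: c_def)
    qed
    have A1: "x \<in> A_set R S j \<Longrightarrow> between (row M R) (low M S) (int j) (lift M x)" for x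
      unfolding A_set_def between_def
    proof (elim UnE imageE)
      fix y assume "x = below_at S y" "y \<in> {j + 1..length S + 1}"
      then show "(\<exists>z>int j. low M S z = lift M x) \<or> (\<exists>t\<ge>1. t < int j \<and> row M R t = lift M x)"
        by (intro disjI1 exI[of _ "int y"]) (auto simp: lift_below_at)
    next
      fix y assume "x = row_at R y" "y \<in> {1..<j}"
      then show "(\<exists>z>int j. low M S z = lift M x) \<or> (\<exists>t\<ge>1. t < int j \<and> row M R t = lift M x)"
        by (intro disjI2 exI[of _ "int y"]) (auto simp: lift_row_at)
    qed
    have A2: "below_at S (nat x) \<in> X" if "int j < x" "?c < low M S x" "low M S x < low M S j" for x
    proof -
      have l: "low M S x = lift M (below_at S (nat x))" using that(1) by (simp add: lift_below_at)
      have "below_at S (nat x) < below_at S j"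
        using that(3) lift_less[OF bS bS, of "nat x" j] unfolding l by (simp add: lift_below_at)
      moreover have "c < below_at S (nat x)" using that(2) c[OF bS, of "nat x"] unfolding l by blast
      moreover have "nat x \<le> length S + 1"
        using \<open>below_at S (nat x) < below_at S j\<close> by (auto simp: below_at_def split: if_splits)
      ultimately show ?thesis using that(1) by (auto simp: X_def A_set_def)
    qed
    have A3: "row_at R (nat x) \<in> X" if "1 \<le> x" "x < int j" "?c < row M R x" "row M R x < low M S j" for x
    proof -
      have l: "row M R x = lift M (row_at R (nat x))" by (simp add: row_def)
      have "row_at R (nat x) < below_at S j"
        using that(4) lift_less[OF bR bS, of "nat x" j] unfolding l by (simp add: lift_below_at)
      moreover have "c < row_at R (nat x)" using that(3) c[OF bR, of "nat x"] unfolding l by blast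
      moreover have "nat x \<in> {1..<j}" using that by auto
      ultimately show ?thesis by (auto simp: X_def A_set_def)
    qed
    have "left_out (row M R) q (low M S) (low_dip S) j (lift M e)"
    proof (cases "j < below_dip S")
      case jp: True
      have "maximal_between (row M R) (low M S) j ?c (lift M e)"
      proof (cases "X = {}")
        case True
        then have e: "lift M e = row M R (int j + 1)" using jp by (simp add: e_def r1)
        have "\<not> (?c < low M S x \<and> low M S x < low M S j)" if "int j < x" for x
          using A2[OF that] True by blast
        moreover have "\<not> (?c < row M R x \<and> row M R x < low M S j)" if "1 \<le> x \<and> x < int j" for x
          using A3[of x] that True by blast
        ultimately show ?thesis unfolding maximal_between_def e by blast
      next
        case False
        then have e: "e = Max X" using jp by (simp add: e_def)
        have eX: "e \<in> X" using Max_in[OF fin False] e by simp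
        have max: "f \<le> e" if "f \<in> X" for f using Max_ge[OF fin that] e by simp
        have "lift M f \<le> lift M e" if "f \<in> X" for f using max[OF that] lift_le[OF bX[OF that] be] by blast
        note le = this
        have m2: "low M S x \<le> lift M e" if "int j < x" "?c < low M S x" "low M S x < low M S j" for x
        proof -
          have "low M S x = lift M (below_at S (nat x))" using that(1) by (simp add: lift_below_at)
          then show ?thesis using le[OF A2[OF that]] by simp
        qed
        have m3: "row M R x \<le> lift M e" if "1 \<le> x" "x < int j" "?c < row M R x" "row M R x < low M S j" for x
          using A3[OF that] le by (simp add: row_def)
        have "c < e" "e < below_at S j" "e \<in> A_set R S j" using eX by (auto simp: X_def)
        then have "between (row M R) (low M S) (int j) (lift M e)" "?c < lift M e" "lift M e < low M S j"
          using A1 c[OF be] lift_less[OF be bS, of j] by (auto simp: lift_below_at)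
        then show ?thesis unfolding maximal_between_def using m2 m3 by blast
      qed
      then show ?thesis using jp pp by (simp add: left_out_def)
    next
      case jp: False
      have d: "drops (row M R) (low M S) j \<longleftrightarrow> below_at S (j + 1) < row_at R (j + 1) \<or>
        row_at R j < row_at R (j + 2) \<and> below_at S (j + 1) < row_at R j \<and> row_at R j < below_at S (j + 2)"
      proof -
        have n: "int (j + 1) = int j + 1" "int (j + 2) = int j + 2" by simp_all
        show ?thesis
          unfolding drops_def
          using lift_less[OF bS bR, of "j + 1" "j + 1"] lift_less[OF bR bR, of j "j + 2"]
            lift_less[OF bS bR, of "j + 1" j] lift_less[OF bR bS, of j "j + 2"]
          unfolding lift_row_at lift_below_at n by blast
      qed
      show ?thesis
        using jp pp by (auto simp: left_out_def e_def d r1 s1)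
    qed
    then show thesis
      using slot j jl True eq be unfolding q_def by (intro keep[of j e]) simp_all
  qed
qed

section \<open>Insertion into one row over another, and its inverse\<close>

section \<open>Row insertion\<close>

lemma right_slot_ex:
  assumes "p < x" "b \<le> s x"
  shows "\<exists>m. right_slot s p b m"
proof (cases "b = s p")
  case False
  define n where "n = (LEAST n. b \<le> s (p + 1 + int n))"
  have "b \<le> s (p + 1 + int (nat (x - p - 1)))" using assms by simp
  then have n: "b \<le> s (p + 1 + int n)" unfolding n_def by (rule LeastI)
  have "s y < b" if "p < y" "y < p + 1 + int n" for y
    using not_less_Least[of "nat (y - p - 1)" "\<lambda>n. b \<le> s (p + 1 + int n)"] that
    by (simp add: n_def[symmetric] nat_less_iff)
  then show ?thesis
    using n False by (intro exI[of _ "p + 1 + int n"]) (auto simp: right_slot_def)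
qed (auto simp: right_slot_def)

lemma right_slot_unique: "right_slot r q a i \<Longrightarrow> right_slot r q a i' \<Longrightarrow> i = i'"
  unfolding right_slot_def by (metis linorder_neqE not_less)

text \<open>Taking the first column behind the dip whose entry reaches \<open>a\<close> makes its
  left neighbour smaller than \<open>a\<close>, even before the row is known to be monotone.\<close>

lemma mid_slot_ex:
  assumes "r q < a" "q \<le> x" "a \<le> r (x + 1)"
  shows "\<exists>i\<ge>q. r i < (a :: int) \<and> a \<le> r (i + 1 :: int)"
proof -
  define n where "n = (LEAST n. a \<le> r (q + 1 + int n))"
  have "a \<le> r (q + 1 + int (nat (x - q)))" using assms by (simp add: add.commute)
  then have n: "a \<le> r (q + 1 + int n)" unfolding n_def by (rule LeastI)
  have "r (q + int n) < a"
  proof (cases n)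
    case 0
    then show ?thesis using assms by simp
  next
    case (Suc k)
    then show ?thesis
      using not_less_Least[of k "\<lambda>n. a \<le> r (q + 1 + int n)", folded n_def] by (simp add: algebra_simps)
  qed
  then show ?thesis using n by (intro exI[of _ "q + int n"]) (simp add: algebra_simps)
qed

lemma out_slot_ex:
  assumes "2 \<le> q" "b < r 1"
  shows "\<exists>j\<ge>1. j < q \<and> b < r j \<and> (j + 1 = q \<or> r (j + 1 :: int) \<le> (b :: int))"
proof -
  let ?P = "\<lambda>n. int n + 2 = q \<or> r (int n + 2) \<le> b"
  define n where "n = (LEAST n. ?P n)"
  have e: "?P (nat (q - 2))" using assms by simp
  then have n: "?P n" unfolding n_def by (rule LeastI)
  have "n \<le> nat (q - 2)" unfolding n_def using e by (rule Least_le)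
  moreover have "b < r (int n + 1)"
  proof (cases n)
    case 0
    then show ?thesis using assms by simp
  next
    case (Suc k)
    then show ?thesis
      using not_less_Least[of k ?P] by (simp add: n_def[symmetric] algebra_simps)
  qed
  moreover have "int n + 1 + 1 = int n + 2" by simp
  ultimately show ?thesis
    using n assms by (intro exI[of _ "int n + 1"]) (simp only: \<open>int n + 1 + 1 = int n + 2\<close>, auto)
qed

lemma right_slot_low: "right_slot (row M S) q b i \<longleftrightarrow> right_slot (low M S) (q + 1) b (i + 1)"
proof -
  have "(\<forall>x. q + 1 < x \<and> x < i + 1 \<longrightarrow> row M S (x - 1) < b) \<longleftrightarrow> (\<forall>x. q < x \<and> x < i \<longrightarrow> row M S x < b)"
    by (metis add_diff_cancel_right' add_less_cancel_right diff_add_cancel)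
  then show ?thesis
    by (simp only: right_slot_def low_def add_diff_cancel_right' add_right_cancel add_less_cancel_right)
qed

lemma left_slot_low: "left_slot (row M S) 1 q b i \<longleftrightarrow> left_slot (low M S) 2 (q + 1) b (i + 1)"
proof -
  have "(\<forall>x. 2 \<le> x \<and> x < i + 1 \<longrightarrow> b < row M S (x - 1)) \<longleftrightarrow> (\<forall>x. 1 \<le> x \<and> x < i \<longrightarrow> b < row M S x)"
    (is "?A \<longleftrightarrow> ?B")
  proof
    assume ?A
    then show ?B by (intro allI impI) (drule_tac x = "x + 1" in spec, simp)
  qed simp
  then show ?thesis by (simp add: left_slot_def low_def)
qed

definition exits :: "int \<Rightarrow> nat \<Rightarrow> nat list \<Rightarrow> nat list \<Rightarrow> int \<Rightarrow> int \<Rightarrow> bool" where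
  "exits M b R S j m \<longleftrightarrow> right_slot (low M S) (low_dip S) b m \<and>
     out_state M (row M R) (dip R) (low M S) (low_dip S) j m b"

definition out_above :: "int \<Rightarrow> nat \<Rightarrow> nat list \<Rightarrow> nat list \<Rightarrow> bool" where
  "out_above M b R S \<longleftrightarrow> above M R S \<and> (\<exists>j m. exits M b R S j m)"

text \<open>The inverse of a row insertion: \<open>swaps\<close>, \<open>left_stays\<close> and \<open>right_stays\<close> decide which rules to revert.\<close>

definition undone :: "int \<Rightarrow> nat \<Rightarrow> nat list \<Rightarrow> nat list \<Rightarrow> int \<Rightarrow> nat \<Rightarrow> nat list \<Rightarrow> bool" where
  "undone M b R' S j a R \<longleftrightarrow>
     (if swaps (row M R') (dip R') (low M S) (low_dip S) j b
      then a = b \<and> row M R = (row M R')(j := row M R' (j + 1), j + 1 := row M R' j)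
      else \<exists>R'' i. length R'' = length R' \<and>
        row M R'' = (if left_stays (row M R') (dip R') (low M S) (low_dip S) j b
                     then row M R' else (row M R')(j := b)) \<and>
        above M R'' S \<and> mid_state M (row M R'') (dip R'') (low M S) i (row M R' j) \<and>
        int a = row M R'' i \<and>
        row M R = (if right_stays (row M R'') (low M S) i (row M R' j)
                   then row M R'' else (row M R'')(i := row M R' j)))"

definition undo :: "int \<Rightarrow> nat \<Rightarrow> nat list \<Rightarrow> nat list \<Rightarrow> nat \<Rightarrow> nat list \<Rightarrow> bool" where
  "undo M b R' S a R \<longleftrightarrow> length R = length R' \<and> (\<exists>j m. exits M b R' S j m \<and> undone M b R' S j a R)"

text \<open>Every choice left open in \<open>undone\<close> is forced: \<open>j\<close> by
  \<open>out_state_unique\<close>, then the intermediate row by its values and length, then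
  \<open>i\<close> by \<open>mid_state_unique\<close>.\<close>

lemma undo_unique:
  assumes R': "above M R' S" and 1: "undo M b R' S a1 R1" and 2: "undo M b R' S a2 R2"
  shows "a1 = a2 \<and> R1 = R2"
proof -
  obtain j m where j: "exits M b R' S j m" using 1 unfolding undo_def by blast
  have ju: "j' = j" if "exits M b R' S j' m'" for j' m'
    using out_state_unique[OF R'[unfolded above_def]] that j unfolding exits_def by blast
  have D: "undone M b R' S j a R" if "undo M b R' S a R" for a R
    using that ju unfolding undo_def by blast
  note D1 = D[OF 1, unfolded undone_def] and D2 = D[OF 2, unfolded undone_def]
  have rows: "row M R1 = row M R2 \<and> a1 = a2"
  proof (cases "swaps (row M R') (dip R') (low M S) (low_dip S) j b")
    case True
    then show ?thesis using D1 D2 by simp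
  next
    case False
    obtain Q1 i1 where Q1: "length Q1 = length R'"
        "row M Q1 = (if left_stays (row M R') (dip R') (low M S) (low_dip S) j b
                     then row M R' else (row M R')(j := b))"
        "above M Q1 S" "mid_state M (row M Q1) (dip Q1) (low M S) i1 (row M R' j)"
        "int a1 = row M Q1 i1"
        "row M R1 = (if right_stays (row M Q1) (low M S) i1 (row M R' j)
                   then row M Q1 else (row M Q1)(i1 := row M R' j))"
      using D1[unfolded if_not_P[OF False]] by blast
    obtain Q2 i2 where Q2: "length Q2 = length R'"
        "row M Q2 = (if left_stays (row M R') (dip R') (low M S) (low_dip S) j b
                     then row M R' else (row M R')(j := b))"
        "above M Q2 S" "mid_state M (row M Q2) (dip Q2) (low M S) i2 (row M R' j)"
        "int a2 = row M Q2 i2"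
        "row M R2 = (if right_stays (row M Q2) (low M S) i2 (row M R' j)
                   then row M Q2 else (row M Q2)(i2 := row M R' j))"
      using D2[unfolded if_not_P[OF False]] by blast
    have Q: "Q1 = Q2" by (rule row_inj[of M]) (use Q1 Q2 in simp_all)
    have "i1 = i2"
      using mid_state_unique[OF Q1(3)[unfolded above_def] Q1(4)] Q2(4) Q by simp
    then show ?thesis using Q Q1(5,6) Q2(5,6) by simp
  qed
  then show ?thesis
    using row_inj[of M R1 R2] 1 2 unfolding undo_def by auto
qed

lemma low_slot_ex:
  assumes "above M R S" "b < M"
  shows "\<exists>m. right_slot (low M S) (low_dip S) b m"
proof (rule right_slot_ex)
  show "low_dip S < int (length S) + 2"
    using above_letters(12)[OF assms(1)] by (auto simp: low_dip_def)
  show "b \<le> low M S (int (length S) + 2)"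
    using assms(2) by (simp add: low_def row_out)
qed

lemma left_insert_above:
  assumes R: "above M R S" and mid: "mid_state M (row M R) (dip R) (low M S) i a"
    and ins: "left_insert (Fin a) R S = (e, R')"
  obtains b j m where "e = Fin b" "above M R' S" "length R' = length R" "exits M b R' S j m" "row M R' j = a"
    "\<not> swaps (row M R') (dip R') (low M S) (low_dip S) j b"
    "row M R = (if left_stays (row M R') (dip R') (low M S) (low_dip S) j b
                then row M R' else (row M R')(j := b))"
proof -
  note st = R[unfolded above_def] and lt = above_letters[OF R]
  have aM: "int a < M" using mid by (simp add: mid_state_def)
  \<comment> \<open>The entry in column \<open>i\<close> is smaller than \<open>a\<close>, and from
    the dip to \<open>i\<close> the row increases; hence the minimum is below \<open>a\<close> and a
    left slot exists.\<close>
  have qa: "row M R (dip R) \<le> int a" using mid st unfolding mid_state_def stacked_def valley_def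
    by (smt (z3))
  show thesis
  proof (rule left_insert_cases[OF lt(1,8,9,2) aM qa])
    fix j assume j: "left_slot (row M R) 1 (dip R) (int a) (int j)" "1 \<le> j" "j \<le> length R"
        "row M R j < int a" "left_insert (Fin a) R S = (Fin (R ! (j - 1)), R[j - 1 := a])"
    define b where "b = R ! (j - 1)"
    have e: "e = Fin b" "R' = R[j - 1 := a]" using ins j by (simp_all add: b_def)
    have rb: "row M R j = b" using j by (simp add: row_nth b_def nat_diff_distrib')
    have r': "row M R' = (row M R)(int j := int a)" unfolding e using j by (intro row_update)
    have upd: "row M R' j = a" "\<forall>x. x \<noteq> int j \<longrightarrow> row M R' x = row M R x" by (auto simp: r')
    have bk: "row M R = (row M R')(int j := int b)" by (auto simp: r' rb[symmetric])
    have len: "int (length R) = int (length R')" by (simp add: e)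
    obtain m where m: "right_slot (low M S) (low_dip S) (row M R j) m"
      using low_slot_ex[OF R, of "row M R j"] j(4) aM by fastforce
    show thesis
    proof (cases "j < dip R")
      case True
      then have jq: "int j < int (dip R)" by simp
      note f = left_replace1[OF st mid j(1,4) m jq upd] left_replace1_moves[OF st mid j(1,4) m jq upd]
      have R': "above M R' S" "int (dip R) = int (dip R')" using aboveI[OF f(1)[unfolded len]] by blast+
      show thesis
        by (rule that[of b "int j" m]) (use e R' f upd bk m rb in \<open>auto simp: exits_def\<close>)
    next
      case False
      then have jq: "int j = int (dip R)" using j(1) by (simp add: left_slot_def)
      note f = left_replace2[OF st mid j(1,4) m jq upd] left_replace2_moves[OF st mid j(1,4) m jq upd]
      have R': "above M R' S" "int (dip R) + 1 = int (dip R')" using aboveI[OF f(1)[unfolded len]] by blast+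
      show thesis
        by (rule that[of b "int j" m]) (use e R' f upd bk m rb in \<open>auto simp: exits_def\<close>)
    qed
  next
    fix j f assume j: "left_slot (row M R) 1 (dip R) (int a) (int j)" "1 \<le> j" "j \<le> length R"
        "row M R j = int a" "left_insert (Fin a) R S = (f, R)" "bounded M f"
        "left_out (row M R) (dip R) (low M S) (low_dip S) j (lift M f)"
    have e: "e = f" "R' = R" using ins j by simp_all
    note st' = st mid[folded j(4)] j(1)[folded j(4)]
    \<comment> \<open>At this point the output may still be infinity; that it is a letter follows
      from \<open>out_state\<close> below.\<close>
    have M1: "\<exists>m. right_slot (low M S) (low_dip S) (lift M f) m"
    proof (rule right_slot_ex)
      show "low_dip S < int (length S) + 2" using lt(12) by (auto simp: low_dip_def)
      show "lift M f \<le> low M S (int (length S) + 2)"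
        using j(6) by (auto simp: low_def row_out bounded_def)
    qed
    then obtain m where m: "right_slot (low M S) (low_dip S) (lift M f) m" by blast
    have *: "out_state M (row M R) (dip R) (low M S) (low_dip S) j m (lift M f) \<and>
      \<not> swaps (row M R) (dip R) (low M S) (low_dip S) j (lift M f) \<and>
      left_stays (row M R) (dip R) (low M S) (low_dip S) j (lift M f)"
    proof (cases "int j < low_dip S")
      case jp: True
      show ?thesis
      proof (cases "int j + 1 < dip R")
        case True
        then have "maximal_between (row M R) (low M S) j (row M R (int j + 1)) (lift M f)"
          using j(7) jp by (simp add: left_out_def)
        from left_keep1[OF st' m jp True this] show ?thesis by blast
      next
        case False
        then have "maximal_between (row M R) (low M S) j (- 1) (lift M f)"
          using j(7) jp by (simp add: left_out_def)
        from left_keep2[OF st' m jp _ this] False show ?thesis by auto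
      qed
    next
      case jp: False
      show ?thesis
      proof (cases "int (dip R) \<le> int j + 1 \<and> drops (row M R) (low M S) j")
        case True
        then have "lift M f = low M S (int j + 1)" using j(7) jp by (simp add: left_out_def)
        from left_keep3[OF st' m _ _ _ this] True jp show ?thesis by auto
      next
        case False
        then have "lift M f = row M R (int j + 1)" using j(7) jp by (auto simp: left_out_def)
        from left_keep4[OF st' m _ False this] jp show ?thesis by auto
      qed
    qed
    then have "lift M f < M" by (simp add: out_state_def)
    then obtain b where b: "f = Fin b" using j(6) by (auto simp: bounded_def)
    show thesis
      by (rule that[of b "int j" m]) (use * e b m R j in \<open>auto simp: exits_def\<close>)
  qed
qed

lemma left_slot_unique: "left_slot r f q a j \<Longrightarrow> left_slot r f q a j' \<Longrightarrow> j = j'"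
  unfolding left_slot_def by (metis linorder_neqE not_less)

lemma right_out_unique: "right_out r s i a \<Longrightarrow> right_out r s i a' \<Longrightarrow> a = a'"
  unfolding right_out_def between_def by (smt (z3))

lemma maximal_between_unique:
  "maximal_between r s j c b \<Longrightarrow> maximal_between r s j c b' \<Longrightarrow> b = b'"
  unfolding maximal_between_def between_def by (smt (z3))

lemma left_out_unique: "left_out r q s p j b \<Longrightarrow> left_out r q s p j b' \<Longrightarrow> b = b'"
  unfolding left_out_def by (metis maximal_between_unique)

text \<open>After the right half of (R2) the minimum stands in columns \<open>q\<close> and
  \<open>q + 1\<close>. The strictly decreasing run ends at the left copy, so this one counts as the
  dip.\<close>

lemma dip_double:
  assumes "is_dip R q" "q < length R"
  shows "dip (R[q := R ! (q - 1)]) = q"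
  unfolding dip_def
proof (rule Greatest_equality)
  have q: "1 \<le> q" "sorted_wrt (>) (take q R)" using assms by (auto simp: is_dip_def)
  then show "q \<le> length (R[q := R ! (q - 1)]) \<and> sorted_wrt (>) (take q (R[q := R ! (q - 1)]))"
    using assms by simp
  fix y assume y: "y \<le> length (R[q := R ! (q - 1)]) \<and> sorted_wrt (>) (take y (R[q := R ! (q - 1)]))"
  show "y \<le> q"
  proof (rule ccontr)
    assume "\<not> y \<le> q"
    then have "take y (R[q := R ! (q - 1)]) ! (q - 1) > take y (R[q := R ! (q - 1)]) ! q"
      using y q assms by (intro sorted_wrt_nth_less[where P = "(>)"]) auto
    then show False using \<open>\<not> y \<le> q\<close> q assms by simp
  qed
qed

lemma row_insert_swap:
  assumes R: "above M R S" and q: "dip R < length R" and a: "row M R (dip R) = int a"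
    and less: "row M R (int (dip R) + 1) < row M R (int (dip R) - 1)"
  shows "row_insert a R S = (Fin a, R[dip R := a, dip R - 1 := R ! dip R])"
    "row M (R[dip R := a, dip R - 1 := R ! dip R]) =
       (row M R)(int (dip R) := row M R (int (dip R) + 1), int (dip R) + 1 := row M R (dip R))"
proof -
  note lt = above_letters[OF R]
  define q where "q = dip R"
  define z where "z = R ! q"
  have qR: "1 \<le> q" "q < length R" using lt(8) q by (simp_all add: q_def)
  have aR: "R ! (q - 1) = a" using a qR by (simp add: row_nth q_def nat_diff_distrib')
  have rz: "row M R (int q + 1) = z" using qR by (simp add: row_nth z_def)
  have aM: "int a < M" "int z < M" using lt(1) qR aR nth_mem[of "q - 1" R] nth_mem[of q R] by (auto simp: z_def)
  define R'' where "R'' = R[q := a]"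
  have ri: "right_insert a R S = (Fin z, R'')"
  proof (rule right_insert_cases[OF lt(7,8,9,2) aM(1)])
    assume "right_slot (row M R) (dip R) a (int (length R) + 1)"
    then show ?thesis using a q by (simp add: right_slot_def)
  next
    fix i assume "right_slot (row M R) (dip R) a (int i)" "int a \<noteq> row M R i"
    then show ?thesis using a by (auto simp: right_slot_def)
  next
    assume "right_insert a R S = (Fin (R ! dip R), R[dip R := a])"
    then show ?thesis by (simp add: R''_def q_def z_def)
  next
    fix i assume "right_slot (row M R) (dip R) a (int i)" "row M R (int i - 1) \<le> row M R (int i + 1)"
    then show ?thesis using a less by (auto simp: right_slot_def)
  qed
  have dR: "dip R'' = q"
    using dip_double[of R q] lt(5) qR aR by (simp add: R''_def q_def)
  have r'': "row M R'' = (row M R)(int q + 1 := int a)"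
    using row_update[of "q + 1" R M a] qR by (simp add: R''_def add.commute)
  have lR: "\<forall>x\<in>set R''. int x < M" using lt(1) aM(1) set_update_subset_insert[of R q a] by (auto simp: R''_def)
  have inc: "row M R q < row M R (int q + 1)"
    using lt(7) qR unfolding valley_def q_def by auto
  have le: "row M R'' (dip R'') \<le> int z" using inc rz by (simp add: dR r'')
  \<comment> \<open>All entries left of the dip exceed \<open>z\<close>, so left insertion cannot
    stop before column \<open>q\<close>.\<close>
  have big: "int z < row M R x" if "1 \<le> x" "x < int q" for x
  proof -
    have "row M R (int q - 1) \<le> row M R x"
      using lt(7) that unfolding valley_def q_def by (cases "x = int (dip R) - 1") (auto simp: less_imp_le)
    then show ?thesis using less rz by (simp add: q_def)
  qed
  have li: "left_insert (Fin z) R'' S = (Fin a, R''[q - 1 := z])"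
  proof (rule left_insert_cases[OF lR _ _ lt(2) aM(2) le])
    show "1 \<le> dip R''" "dip R'' \<le> length R''" using qR unfolding dR by (simp_all add: R''_def)
  next
    fix j assume j: "left_slot (row M R'') 1 (dip R'') (int z) (int j)" "1 \<le> j"
      "left_insert (Fin z) R'' S = (Fin (R'' ! (j - 1)), R''[j - 1 := z])"
    have "j = q"
    proof (rule ccontr)
      assume "j \<noteq> q"
      then have "j < q" "row M R j \<le> z" using j(1) by (auto simp: left_slot_def dR r'' split: if_split_asm)
      then show False using big[of "int j"] j(2) by simp
    qed
    then show ?thesis using j(3) qR aR by (simp add: R''_def)
  next
    fix j assume j: "left_slot (row M R'') 1 (dip R'') (int z) (int j)" "1 \<le> j" "row M R'' j = int z"
    have "j \<le> q" using j(1) by (simp add: left_slot_def dR)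
    then have "row M R j = int z" using j(3) by (simp add: r'')
    then show ?thesis using big[of "int j"] inc rz j(2) \<open>j \<le> q\<close> by (cases "j = q") auto
  qed
  have "row_insert a R S = (Fin a, R''[q - 1 := z])" using lt(3) by (simp add: row_insert_def ri li)
  then show "row_insert a R S = (Fin a, R[dip R := a, dip R - 1 := R ! dip R])"
    by (simp add: R''_def q_def z_def)
  have "row M (R''[q - 1 := z]) = (row M R'')(int q := int z)"
    using qR by (intro row_update) (auto simp: R''_def)
  then show "row M (R[dip R := a, dip R - 1 := R ! dip R]) =
       (row M R)(int (dip R) := row M R (int (dip R) + 1), int (dip R) + 1 := row M R (dip R))"
    using a rz by (auto simp: R''_def q_def z_def r''[unfolded R''_def q_def] fun_eq_iff)
qed

text \<open>Besides the output, \<open>out\<close> records how to revert the step. The shape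
  condition in \<open>stay\<close> is what makes insertion end in a corner.\<close>

lemma row_insert_above:
  assumes R: "above M R S" and a: "int a < M" and ins: "row_insert a R S = (e, R')"
  obtains (grow) "e = \<infinity>" "R' = R @ [a]" "right_slot (row M R) (dip R) a (int (length R) + 1)"
  | (stay) "e = \<infinity>" "R' = R" "a = last R" "S = [] \<or> length S + 1 < length R"
  | (out) b where "e = Fin b" "length R' = length R" "out_above M b R' S" "undo M b R' S a R"
proof -
  note st = R[unfolded above_def] and lt = above_letters[OF R]
  have ins': "row_insert a R S = (let (a', R'') = right_insert a R S in left_insert a' R'' S)"
    using lt(3) by (simp add: row_insert_def)
  show thesis
  proof (rule right_insert_cases[OF lt(7,8,9,2) a])
    assume "right_slot (row M R) (dip R) a (int (length R) + 1)" "right_insert a R S = (\<infinity>, R @ [a])"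
    then show thesis using grow ins ins' by (simp add: left_insert_def)
  next
    fix i assume i: "1 \<le> i" "i \<le> length R" "right_slot (row M R) (dip R) a (int i)"
      "int a \<noteq> row M R i" "right_insert a R S = (Fin (R ! (i - 1)), R[i - 1 := a])"
    define x where "x = R ! (i - 1)"
    define R'' where "R'' = R[i - 1 := a]"
    have rx: "row M R i = x" using i by (simp add: row_nth x_def nat_diff_distrib')
    have r'': "row M R'' = (row M R)(int i := int a)" unfolding R''_def using i by (intro row_update)
    have upd: "row M R'' i = a" "\<forall>x. x \<noteq> int i \<longrightarrow> row M R'' x = row M R x" by (auto simp: r'')
    have len: "int (length R) = int (length R'')" by (simp add: R''_def)
    have il: "int i \<le> int (length R)" using i by simp
    have a0: "0 \<le> int a" by simp
    have "above M R'' S \<and> mid_state M (row M R'') (dip R'') (low M S) i (int x) \<and>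
      \<not> right_stays (row M R'') (low M S) i (int x)"
    proof (cases "row M R (dip R) < int a \<or> int i \<noteq> int (dip R) + 1")
      case True
      note f = right_replace1[OF st i(3) a0 a i(4) il True upd]
      show ?thesis using f aboveI[OF f(1)[unfolded len]] by (simp add: rx)
    next
      case False
      then have c: "int a < row M R (dip R)" "int i = int (dip R) + 1"
        using i(3,4) by (auto simp: right_slot_def split: if_split_asm)
      note f = right_replace2[OF st i(3) a0 a i(4) il c upd]
      show ?thesis using f aboveI[OF f(1)[unfolded len]] by (simp add: rx)
    qed
    then have R'': "above M R'' S" "mid_state M (row M R'') (dip R'') (low M S) i (int x)"
      "\<not> right_stays (row M R'') (low M S) i (int x)" by blast+
    have "left_insert (Fin x) R'' S = (e, R')" using ins ins' i by (simp add: R''_def x_def)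
    from left_insert_above[OF R''(1,2) this] obtain b j m where b: "e = Fin b" "above M R' S"
      "length R' = length R''" "exits M b R' S j m" "row M R' j = int x"
      "\<not> swaps (row M R') (dip R') (low M S) (low_dip S) j b"
      "row M R'' = (if left_stays (row M R') (dip R') (low M S) (low_dip S) j b
                then row M R' else (row M R')(j := b))" by blast
    have bk: "row M R = (row M R'')(int i := int x)" by (auto simp: r'' rx[symmetric])
    have "undo M b R' S a R"
      unfolding undo_def
    proof (intro conjI exI)
      show "length R = length R'" using b(3) len by simp
      show "exits M b R' S j m" by (rule b(4))
      show "undone M b R' S j a R"
        unfolding undone_def if_not_P[OF b(6)]
        by (rule exI[of _ R''], rule exI[of _ "int i"]) (use b R'' upd(1) bk in simp)
    qed
    then show thesis using out[of b] b R'' len unfolding out_above_def by auto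
  next
    assume s: "dip R < length R" "row M R (dip R) = int a" "row M R (int (dip R) + 1) < row M R (int (dip R) - 1)"
    define q where "q = int (dip R)"
    have e: "e = Fin a" "R' = R[dip R := a, dip R - 1 := R ! dip R]"
      and r': "row M R' = (row M R)(q := row M R (q + 1), q + 1 := row M R q)"
      using row_insert_swap[OF R s] ins by (auto simp: q_def)
    have upd: "row M R' q = row M R (q + 1)" "row M R' (q + 1) = row M R q"
      "\<forall>x. x \<noteq> q \<and> x \<noteq> q + 1 \<longrightarrow> row M R' x = row M R x" by (auto simp: r')
    have ql: "q < int (length R)" using s by (simp add: q_def)
    obtain m where m: "right_slot (low M S) (low_dip S) (row M R q) m"
      using low_slot_ex[OF R, of "row M R q"] a s(2) by (auto simp: q_def)
    note f = swap_out[OF st[folded q_def] ql s(3)[folded q_def] m upd]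
    have len: "int (length R) = int (length R')" by (simp add: e)
    have R': "above M R' S" "q + 1 = int (dip R')" using aboveI[OF f(1)[unfolded len]] by blast+
    have ex: "exits M a R' S q m"
      using m f(2) R'(2) s(2) by (simp add: exits_def q_def)
    have "swaps (row M R') (dip R') (low M S) (low_dip S) q a" using f(3) R'(2) s(2) by (simp add: q_def)
    moreover have "row M R = (row M R')(q := row M R' (q + 1), q + 1 := row M R' q)"
      using upd by (auto simp: fun_eq_iff)
    ultimately have "undo M a R' S a R" unfolding undo_def undone_def using ex len by auto
    then show thesis using out[of a] e R' ex unfolding out_above_def by auto
  next
    fix i f assume i: "1 \<le> i" "i \<le> length R" "right_slot (row M R) (dip R) a (int i)"
      "row M R i = int a" "row M R (int i - 1) \<le> row M R (int i + 1)"
      "right_out (row M R) (low M S) i (lift M f)" "bounded M f" "right_insert a R S = (f, R)"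
    show thesis
    proof (cases f)
      case Pinf
      then have e: "e = \<infinity>" "R' = R" using ins ins' i by (simp_all add: left_insert_def)
      have "M \<le> row M R (int i + 1)" using i(6) Pinf by (simp add: right_out_def)
      have il: "i = length R"
      proof (rule ccontr)
        assume "i \<noteq> length R"
        then have "i < length R" using i(2) by simp
        moreover have "int (R ! i) < M" using lt(1) nth_mem[OF calculation] by blast
        ultimately show False using \<open>M \<le> row M R (int i + 1)\<close> by (simp add: row_Suc)
      qed
      then have "a = last R" using i(1,4) lt(3) by (simp add: row_nth last_conv_nth nat_diff_distrib')
      \<comment> \<open>Otherwise the lower row has an entry in the last column of \<open>R\<close>.
        It is smaller than the first entry of \<open>R\<close>, which belongs to the set considered
        by (R3), and so a letter would have been emitted instead of infinity.\<close>
      moreover have "S = [] \<or> length S + 1 < length R"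
      proof (rule ccontr)
        assume "\<not> (S = [] \<or> length S + 1 < length R)"
        then have S: "S \<noteq> []" "length S + 1 = length R" using lt(4) by auto
        have ii: "int i - 1 = int (length S)" using S(2) il by simp
        have fin: "low M S (int i) < M"
          using lt(10)[OF S(1)] S(1) unfolding low_def ii by (cases S) (auto simp: valley_def)
        have "0 < length S" using S(1) by simp
        then have i1: "1 < int i" using ii by linarith
        moreover have "low M S 1 = M" by (simp add: low_def row_out)
        ultimately have "low M S (int i) < row M R 1"
          using st fin unfolding stacked_def by (metis not_less)
        moreover have "row M R 1 < M" using lt(3,7) by (cases R) (auto simp: valley_def)
        moreover have "\<not> (low M S (int i) < row M R 1 \<and> row M R 1 < M)"
          using i(6) Pinf i1 by (simp add: right_out_def)
        ultimately show False by blast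
      qed
      ultimately show thesis using stay e by blast
    next
      case (Fin x)
      then have x: "int x < M" using i(7) by (simp add: bounded_def)
      note g = right_keep[OF st i(3)[folded i(4)] i(5), of "int x"]
      have mid: "mid_state M (row M R) (dip R) (low M S) i (int x)"
        and rs: "right_stays (row M R) (low M S) i (int x)"
        using g i(6) Fin x by auto
      have "left_insert (Fin x) R S = (e, R')" using ins ins' i Fin by simp
      from left_insert_above[OF R mid this] obtain b j m where b: "e = Fin b" "above M R' S"
        "length R' = length R" "exits M b R' S j m" "row M R' j = int x"
        "\<not> swaps (row M R') (dip R') (low M S) (low_dip S) j b"
        "row M R = (if left_stays (row M R') (dip R') (low M S) (low_dip S) j b
                  then row M R' else (row M R')(j := b))" by blast
      have "undo M b R' S a R"
        unfolding undo_def
      proof (intro conjI exI)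
        show "length R = length R'" using b(3) by simp
        show "exits M b R' S j m" by (rule b(4))
        show "undone M b R' S j a R"
          unfolding undone_def if_not_P[OF b(6)]
          by (rule exI[of _ R], rule exI[of _ "int i"]) (use b R mid rs i(4) in \<open>simp only: b(5) if_True simp_thms\<close>)
      qed
      then show thesis using out[of b] b unfolding out_above_def by auto
    next
      case Minf
      then show thesis using i(7) by (simp add: bounded_def)
    qed
  qed
qed

lemma row_Nil: "row M [] x = M"
  using row_out[of x "[]" M] by force

text \<open>The inserted letter is the entry in column \<open>i\<close> whichever rule was applied;
  \<open>right_stays\<close> tells whether \<open>x\<close> has to be put back into that
  column.\<close>

lemma right_insert_surj:
  assumes R: "above M R S" and mid: "mid_state M (row M R) (dip R) (low M S) i (int x)"
  shows "\<exists>a R0. above M R0 S \<and> int a < M \<and> right_insert a R0 S = (Fin x, R)"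
proof -
  note st = R[unfolded above_def] and lt = above_letters[OF R]
  define n where "n = nat i"
  have "1 \<le> i" using mid lt(8) by (simp add: mid_state_def)
  moreover have "i \<le> int (length R)"
    using mid row_out[of i R M] by (cases "i \<le> int (length R)") (auto simp: mid_state_def)
  ultimately have n: "1 \<le> n" "n \<le> length R" "i = int n" by (auto simp: n_def)
  define a where "a = R ! (n - 1)"
  have ra: "row M R i = a" using n by (simp add: row_nth a_def nat_diff_distrib')
  have aM: "int a < M" using n lt(1) by (simp add: a_def)
  show ?thesis
  proof (cases "right_stays (row M R) (low M S) i (int x)")
    case True
    note f = right_keep_back[OF st mid True]
    have "right_insert a R S = (Fin x, R)"
    proof (rule right_insert_cases[OF lt(7,8,9,2) aM])
      assume "right_slot (row M R) (dip R) a (int (length R) + 1)"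
      then show ?thesis using right_slot_unique[OF f(1)[unfolded ra]] f(4) by fastforce
    next
      fix k assume "right_slot (row M R) (dip R) a (int k)" "int a \<noteq> row M R k"
      then show ?thesis using right_slot_unique[OF f(1)[unfolded ra]] ra by fastforce
    next
      assume k: "row M R (dip R) = int a" "row M R (int (dip R) + 1) < row M R (int (dip R) - 1)"
      then have "i = int (dip R)" using f(1)[unfolded ra] by (simp add: right_slot_def)
      then show ?thesis using k f(2) by simp
    next
      fix k e assume k: "right_slot (row M R) (dip R) a (int k)"
        "right_out (row M R) (low M S) k (lift M e)" "bounded M e" "right_insert a R S = (e, R)"
      have "i = int k" by (rule right_slot_unique[OF f(1)[unfolded ra] k(1)])
      then have "lift M e = int x" using right_out_unique[OF f(3)] k(2) by simp
      then have "e = Fin x" using k(3) mid by (auto simp: bounded_def mid_state_def)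
      then show ?thesis using k(4) by simp
    qed
    then show ?thesis using R aM by blast
  next
    case False
    define R0 where "R0 = R[n - 1 := x]"
    have r0: "row M R0 = (row M R)(i := int x)" unfolding R0_def using n row_update by simp
    have upd: "row M R0 i = int x" "\<forall>y. y \<noteq> i \<longrightarrow> row M R0 y = row M R y" by (auto simp: r0)
    have len: "int (length R) = int (length R0)" by (simp add: R0_def)
    have "above M R0 S \<and> right_slot (row M R0) (dip R0) (int a) i \<and> int a < int x"
    proof (cases "i = int (dip R)")
      case True
      note f = right_replace_back2[OF st mid False True upd]
      show ?thesis using f(2,4) aboveI[OF f(1)[unfolded len]] by (simp add: ra)
    next
      case ne: False
      note f = right_replace_back1[OF st mid False ne upd]
      show ?thesis using f(2,4) aboveI[OF f(1)[unfolded len]] by (simp add: ra)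
    qed
    then have R0: "above M R0 S" "right_slot (row M R0) (dip R0) (int a) i" "int a < int x" by blast+
    note lt0 = above_letters[OF R0(1)]
    have "right_insert a R0 S = (Fin x, R)"
    proof (rule right_insert_cases[OF lt0(7,8,9,2) aM])
      assume "right_slot (row M R0) (dip R0) a (int (length R0) + 1)"
      then show ?thesis using right_slot_unique[OF R0(2)] n len by fastforce
    next
      fix k assume k: "right_slot (row M R0) (dip R0) a (int k)"
        "right_insert a R0 S = (Fin (R0 ! (k - 1)), R0[k - 1 := a])"
      have "k = n" using right_slot_unique[OF R0(2) k(1)] n by simp
      then show ?thesis using k(2) n by (simp add: R0_def a_def)
    next
      assume k: "row M R0 (dip R0) = int a"
      then show ?thesis using R0(2,3) upd(1) by (auto simp: right_slot_def)
    next
      fix k assume k: "right_slot (row M R0) (dip R0) a (int k)" "row M R0 k = int a"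
      then show ?thesis using right_slot_unique[OF R0(2) k(1)] upd(1) R0(3) by auto
    qed
    then show ?thesis using R0(1) aM by blast
  qed
qed

lemma row_insert_surj:
  assumes "out_above M b R' S"
  shows "\<exists>a R. above M R S \<and> int a < M \<and> row_insert a R S = (Fin b, R')"
proof -
  obtain j m where R': "above M R' S" and ex: "exits M b R' S j m"
    using assms unfolding out_above_def by blast
  note st = R'[unfolded above_def] and lt = above_letters[OF R']
  have m: "right_slot (low M S) (low_dip S) b m"
    and out: "out_state M (row M R') (dip R') (low M S) (low_dip S) j m b"
    using ex by (auto simp: exits_def)
  have j: "1 \<le> j" "j < int (dip R')" "b < M" "int b < row M R' j" using out by (auto simp: out_state_def)
  define n where "n = nat j"
  have n: "1 \<le> n" "n < dip R'" "n < length R'" "j = int n" using j lt(9) by (auto simp: n_def)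
  define x where "x = R' ! (n - 1)"
  have rx: "row M R' j = x" using n by (simp add: row_nth x_def nat_diff_distrib')
  show ?thesis
  proof (cases "swaps (row M R') (dip R') (low M S) (low_dip S) j b")
    case True
    have q: "int (dip R') = j + 1" "int b = row M R' (j + 1)"
      using True by (auto simp: swaps_def)
    have rb: "R' ! n = b" using q n by (simp add: row_nth)
    define R where "R = R'[n := x, n - 1 := b]"
    have r: "row M R = (row M R')(int (n + 1) := int x, int n := int b)"
      using row_update[of n "R'[n := x]" M b] row_update[of "n + 1" R' M x] n by (simp add: R_def)
    have upd: "row M R j = row M R' (dip R')" "row M R (dip R') = row M R' j"
        "\<forall>y. y \<noteq> j \<and> y \<noteq> int (dip R') \<longrightarrow> row M R y = row M R' y"
      using q n rx by (auto simp: r)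
    note f = swap_back[OF st out m True upd]
    have len: "int (length R') = int (length R)" by (simp add: R_def)
    have R: "above M R S" "j = int (dip R)" using aboveI[OF f(1)[unfolded len]] by blast+
    have dR: "dip R = n" using R(2) n by simp
    have "row_insert b R S = (Fin b, R[dip R := b, dip R - 1 := R ! dip R])"
    proof (rule row_insert_swap(1)[OF R(1)])
      show "dip R < length R" using n len by (simp add: dR)
      show "row M R (dip R) = int b" using upd(1) q R(2) by simp
      show "row M R (int (dip R) + 1) < row M R (int (dip R) - 1)" using f(2) upd(2) q R(2) by simp
    qed
    also have "R[dip R := b, dip R - 1 := R ! dip R] = R'"
    proof -
      have "R ! n = x" using n by (simp add: R_def)
      moreover have "R[n := b, n - 1 := x] = R'"
        by (rule nth_equalityI) (use n rb in \<open>auto simp: R_def x_def nth_list_update\<close>)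
      ultimately show ?thesis unfolding dR by simp
    qed
    finally show ?thesis using R(1) j(3) by blast
  next
    case nsw: False
    have "row M R' (dip R') < row M R' j"
      using st n j unfolding stacked_def valley_def by auto
    moreover have "int x < M" using lt(1) n by (simp add: x_def)
    then have "row M R' j \<le> row M R' (int (length R') + 1)" unfolding rx by (simp add: row_out)
    \<comment> \<open>The letter that passed between the halves is \<open>row M R' j\<close>. It
      exceeds the minimum and is at most the value \<open>M\<close> behind the row, so it fits
      somewhere into the increasing side.\<close>
    ultimately obtain i where i: "int (dip R') \<le> i" "row M R' i < row M R' j" "row M R' j \<le> row M R' (i + 1)"
      using mid_slot_ex[of "row M R'" "dip R'" "row M R' j" "int (length R')"] lt(9) by auto
    obtain R'' where R'': "above M R'' S" "mid_state M (row M R'') (dip R'') (low M S) i (int x)"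
      "left_insert (Fin x) R'' S = (Fin b, R')"
    proof (cases "left_stays (row M R') (dip R') (low M S) (low_dip S) j b")
      case ls: True
      note f = left_keep_back[OF st out m nsw ls i]
      have lo: "left_out (row M R') (dip R') (low M S) (low_dip S) j b"
        using left_keep_back1[OF st out m nsw ls i] left_keep_back2[OF st out m nsw ls i]
          left_keep_back3[OF st out m nsw ls i] unfolding left_out_def by (auto simp: not_less)
      have xM: "int x < M" using lt(1) n by (simp add: x_def)
      have qx: "row M R' (dip R') \<le> int x" using \<open>row M R' (dip R') < row M R' j\<close> rx by simp
      have "left_insert (Fin x) R' S = (Fin b, R')"
      proof (rule left_insert_cases[OF lt(1,8,9,2) xM qx])
        fix k assume k: "left_slot (row M R') 1 (dip R') (int x) (int k)" "row M R' k < int x"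
        then show ?thesis using left_slot_unique[OF f(2)[unfolded rx] k(1)] rx by simp
      next
        fix k e assume k: "left_slot (row M R') 1 (dip R') (int x) (int k)"
          "left_insert (Fin x) R' S = (e, R')" "bounded M e"
          "left_out (row M R') (dip R') (low M S) (low_dip S) k (lift M e)"
        have "j = int k" by (rule left_slot_unique[OF f(2)[unfolded rx] k(1)])
        then have "lift M e = int b" using left_out_unique[OF lo] k(4) by simp
        then have "e = Fin b" using k(3) j(3) by (auto simp: bounded_def)
        then show ?thesis using k(2) by simp
      qed
      then show thesis using that[of R'] R' f(1) rx by simp
    next
      case ls: False
      define R'' where "R'' = R'[n - 1 := b]"
      have r'': "row M R'' = (row M R')(j := int b)" unfolding R''_def using n row_update by simp
      have upd: "row M R'' j = int b" "\<forall>y. y \<noteq> j \<longrightarrow> row M R'' y = row M R' y" by (auto simp: r'')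
      have len: "int (length R') = int (length R'')" by (simp add: R''_def)
      have "above M R'' S \<and> mid_state M (row M R'') (dip R'') (low M S) i (int x) \<and>
        left_slot (row M R'') 1 (dip R'') (int x) j"
      proof (cases "j + 1 \<noteq> int (dip R') \<or> row M R' (dip R') < int b")
        case True
        note f = left_replace_back1[OF st out m nsw ls i True upd]
        show ?thesis using f(2,3) aboveI[OF f(1)[unfolded len]] by (simp add: rx)
      next
        case False
        then have c: "int b \<le> row M R' (dip R')" "j + 1 = int (dip R')" by auto
        note f = left_replace_back2[OF st out m nsw ls i c upd]
        show ?thesis using f(2,3) aboveI[OF f(1)[unfolded len]] by (simp add: rx)
      qed
      then have R'': "above M R'' S" "mid_state M (row M R'') (dip R'') (low M S) i (int x)"
        "left_slot (row M R'') 1 (dip R'') (int x) j" by blast+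
      note lt'' = above_letters[OF R''(1)]
      have xM: "int x < M" using lt(1) n by (simp add: x_def)
      have bx: "int b < int x" using j(4) rx by simp
      have qx: "row M R'' (dip R'') \<le> int x"
      proof (cases "j = int (dip R'')")
        case True
        then show ?thesis using upd(1) bx by simp
      next
        case False
        then have "row M R'' (dip R'') < row M R'' j"
          using R''(3) lt''(7) unfolding left_slot_def valley_def by auto
        then show ?thesis using upd(1) bx by simp
      qed
      have "left_insert (Fin x) R'' S = (Fin b, R')"
      proof (rule left_insert_cases[OF lt''(1,8,9,2) xM qx])
        fix k assume k: "left_slot (row M R'') 1 (dip R'') (int x) (int k)"
          "left_insert (Fin x) R'' S = (Fin (R'' ! (k - 1)), R''[k - 1 := x])"
        have "k = n" using left_slot_unique[OF R''(3) k(1)] n by simp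
        then show ?thesis using k(2) n by (simp add: R''_def x_def)
      next
        fix k assume k: "left_slot (row M R'') 1 (dip R'') (int x) (int k)" "row M R'' k = int x"
        then show ?thesis using left_slot_unique[OF R''(3) k(1)] upd(1) bx by simp
      qed
      then show thesis using that[of R''] R'' by blast
    qed
    obtain a R where R: "above M R S" "int a < M" "right_insert a R S = (Fin x, R'')"
      using right_insert_surj[OF R''(1,2)] by blast
    have "row_insert a R S = (Fin b, R')"
      using R(3) R''(3) above_letters(3)[OF R(1)] by (simp add: row_insert_def)
    then show ?thesis using R by blast
  qed
qed

lemma row_insert_inj:
  assumes "above M R1 S" "int a1 < M" "row_insert a1 R1 S = (Fin b, R')"
    and "above M R2 S" "int a2 < M" "row_insert a2 R2 S = (Fin b, R')"
  shows "a1 = a2 \<and> R1 = R2"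
proof -
  have *: "out_above M b R' S \<and> undo M b R' S a R"
    if "above M R S" "int a < M" "row_insert a R S = (Fin b, R')" for a R
    using row_insert_above[OF that] by auto
  show ?thesis
    using *[OF assms(1-3)] *[OF assms(4-6)] undo_unique unfolding out_above_def by blast
qed

text \<open>Converse of the outcome \<open>stay\<close>. If the lower row does not reach the last
  column of \<open>R\<close>, its value there is infinity; the interval in (R3) is then empty and
  nothing is emitted.\<close>

lemma row_insert_last:
  assumes R: "above M R S" and S: "S = [] \<or> length S + 1 < length R"
  shows "row_insert (last R) R S = (\<infinity>, R)"
proof -
  note lt = above_letters[OF R]
  define a where "a = last R"
  define l where "l = int (length R)"
  have l: "1 \<le> l" using lt(3) by (cases R) (auto simp: l_def)
  have ra: "row M R l = a" using lt(3) by (simp add: l_def a_def row_nth last_conv_nth nat_diff_distrib' Suc_leI)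
  have aM: "int a < M" using lt(1,3) by (simp add: a_def)
  have slot: "right_slot (row M R) (dip R) (int a) l"
    using lt(7,8,9) ra unfolding right_slot_def valley_def l_def by (smt (z3) of_nat_le_iff)
  have "right_insert a R S = (\<infinity>, R)"
  proof (rule right_insert_cases[OF lt(7,8,9,2) aM])
    assume "right_slot (row M R) (dip R) a (int (length R) + 1)"
    then show ?thesis using right_slot_unique[OF slot] by (fastforce simp: l_def)
  next
    fix k assume "right_slot (row M R) (dip R) a (int k)" "int a \<noteq> row M R k"
    then show ?thesis using right_slot_unique[OF slot] ra by fastforce
  next
    assume "dip R < length R" "row M R (dip R) = int a"
    then show ?thesis using slot by (simp add: right_slot_def l_def)
  next
    fix k e assume k: "right_slot (row M R) (dip R) a (int k)"
      "right_out (row M R) (low M S) k (lift M e)" "bounded M e" "right_insert a R S = (e, R)"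
    have "l = int k" by (rule right_slot_unique[OF slot k(1)])
    moreover have "row M R (l + 1) = M" by (simp add: row_out l_def)
    moreover have "low M S l = M" using S lt(3) by (auto simp: low_def row_out row_Nil l_def)
    ultimately have "lift M e = M \<or> M < lift M e" using k(2) by (auto simp: right_out_def)
    then have "e = \<infinity>" using k(3) by (auto simp: bounded_def)
    then show ?thesis using k(4) by simp
  qed
  then show ?thesis using lt(3) by (simp add: row_insert_def a_def left_insert_def)
qed

section \<open>Adding and removing the last cell of a row\<close>

lemma grow_stacked1:
  assumes "stacked M r l q s k p" "right_slot r q a (l + 1)" "0 \<le> a" "a < M" "r q < a"
    "r' (l + 1) = a" "\<forall>x. x \<noteq> l + 1 \<longrightarrow> r' x = r x"
  shows "stacked M r' (l + 1) q s k p"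
  using assms unfolding fo_defs by ((intro conjI allI impI)?; smt (z3))+

text \<open>A letter below the minimum can only find its slot behind the row if the row has no
  increasing part; it then becomes the new dip.\<close>

lemma grow_stacked2:
  assumes "stacked M r l q s k p" "right_slot r q a (l + 1)" "0 \<le> a" "a < M" "a < r q"
    "r' (l + 1) = a" "\<forall>x. x \<noteq> l + 1 \<longrightarrow> r' x = r x"
  shows "stacked M r' (l + 1) (l + 1) s k p"
  using assms unfolding fo_defs by ((intro conjI allI impI)?; smt (z3))+

lemma shrink_stacked1:
  assumes "stacked M r' (l + 1) q s k p" "k \<le> l" "1 \<le> l" "q \<le> l"
    "r (l + 1) = M" "\<forall>x. x \<noteq> l + 1 \<longrightarrow> r' x = r x"
  shows "stacked M r l q s k p" "right_slot r q (r' (l + 1)) (l + 1)"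
  using assms unfolding fo_defs by ((intro conjI allI impI)?; smt (z3))+

lemma shrink_stacked2:
  assumes "stacked M r' (l + 1) q s k p" "k \<le> l" "1 \<le> l" "q = l + 1"
    "r (l + 1) = M" "\<forall>x. x \<noteq> l + 1 \<longrightarrow> r' x = r x"
  shows "stacked M r l l s k p" "right_slot r l (r' (l + 1)) (l + 1)"
  using assms unfolding fo_defs by ((intro conjI allI impI)?; smt (z3))+

lemma above_append:
  assumes R: "above M R S" and a: "int a < M" "right_slot (row M R) (dip R) a (int (length R) + 1)"
  shows "above M (R @ [a]) S"
proof -
  note st = R[unfolded above_def]
  have upd: "row M (R @ [a]) (int (length R) + 1) = int a"
    "\<forall>x. x \<noteq> int (length R) + 1 \<longrightarrow> row M (R @ [a]) x = row M R x" by (auto simp: row_append)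
  have a0: "0 \<le> int a" by simp
  have ne: "row M R (dip R) \<noteq> int a"
    using a(2) above_letters(9)[OF R] by (auto simp: right_slot_def)
  have len: "int (length R) + 1 = int (length (R @ [a]))" by simp
  show ?thesis
  proof (cases "row M R (dip R) < int a")
    case True
    from aboveI(1)[OF grow_stacked1[OF st a(2) a0 a(1) True upd, unfolded len]] show ?thesis .
  next
    case False
    then have "int a < row M R (dip R)" using ne by simp
    from aboveI(1)[OF grow_stacked2[OF st a(2) a0 a(1) this upd, unfolded len]] show ?thesis .
  qed
qed

text \<open>The bound on \<open>S\<close> says that the shape remains strict after the
  removal.\<close>

lemma above_butlast:
  assumes Ra: "above M (R @ [a]) S" and R: "R \<noteq> []" "length S < length R"
  shows "above M R S" "int a < M" "row_insert a R S = (\<infinity>, R @ [a])"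
proof -
  define l where "l = int (length R)"
  have len: "int (length (R @ [a])) = l + 1" by (simp add: l_def)
  note st = Ra[unfolded above_def len]
  have upd: "row M R (l + 1) = M" "\<forall>x. x \<noteq> l + 1 \<longrightarrow> row M (R @ [a]) x = row M R x"
    by (auto simp: row_append row_out l_def)
  have ra: "row M (R @ [a]) (l + 1) = int a" by (simp add: row_append l_def)
  have kl: "int (length S) + 1 \<le> l" "1 \<le> l" using R by (auto simp: l_def Suc_leI)
  have "above M R S \<and> right_slot (row M R) (dip R) a (l + 1)"
  proof (cases "int (dip (R @ [a])) \<le> l")
    case True
    note f = shrink_stacked1[OF st kl True upd]
    show ?thesis using f(2)[unfolded ra] aboveI[OF f(1)[unfolded l_def]] by simp
  next
    case False
    then have "int (dip (R @ [a])) = l + 1" using above_letters(9)[OF Ra] by (simp add: l_def)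
    note f = shrink_stacked2[OF st kl this upd]
    show ?thesis using f(2)[unfolded ra] aboveI[OF f(1)[unfolded l_def]] by (simp add: l_def)
  qed
  then have A: "above M R S" and slot: "right_slot (row M R) (dip R) a (l + 1)" by blast+
  show "above M R S" by (rule A)
  show aM: "int a < M" using above_letters(1)[OF Ra] by simp
  note lt = above_letters[OF A]
  have "right_insert a R S = (\<infinity>, R @ [a])"
  proof (rule right_insert_cases[OF lt(7,8,9,2) aM])
    assume "right_insert a R S = (\<infinity>, R @ [a])"
    then show ?thesis .
  next
    fix k assume "right_slot (row M R) (dip R) a (int k)" "k \<le> length R"
    then show ?thesis using right_slot_unique[OF slot] by (fastforce simp: l_def)
  next
    assume "row M R (dip R) = int a"
    then show ?thesis using slot lt(9) by (simp add: right_slot_def l_def)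
  next
    fix k assume "right_slot (row M R) (dip R) a (int k)" "k \<le> length R"
    then show ?thesis using right_slot_unique[OF slot] by (fastforce simp: l_def)
  qed
  then show "row_insert a R S = (\<infinity>, R @ [a])" using R by (simp add: row_insert_def left_insert_def)
qed

section \<open>Compatibility of an insertion with the row above\<close>

lemma down_iffI:
  assumes m: "right_slot s p b m"
    and 1: "\<And>j. stacked M r l q s k p \<Longrightarrow> out_state M r q s p j m b \<Longrightarrow> stacked M r l q s' k' p'"
    and 2: "stacked M r l q s' k' p' \<Longrightarrow> 2 \<le> q \<and> b < r 1"
    and 3: "\<And>j. stacked M r l q s' k' p' \<Longrightarrow> 1 \<le> j \<Longrightarrow> j < q \<Longrightarrow> b < r j \<Longrightarrow>
       j + 1 = q \<or> r (j + 1) \<le> b \<Longrightarrow> stacked M r l q s k p \<and> out_state M r q s p j m b"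
  shows "stacked M r l q s' k' p' \<longleftrightarrow>
    stacked M r l q s k p \<and> (\<exists>j m. right_slot s p b m \<and> out_state M r q s p j m b)"
proof
  assume st: "stacked M r l q s' k' p'"
  obtain j where j: "1 \<le> j" "j < q" "b < r j" "j + 1 = q \<or> r (j + 1) \<le> b"
    using 2[OF st] out_slot_ex[of q b r] by blast
  from 3[OF st j] m show "stacked M r l q s k p \<and> (\<exists>j m. right_slot s p b m \<and> out_state M r q s p j m b)"
    by blast
next
  assume *: "stacked M r l q s k p \<and> (\<exists>j m. right_slot s p b m \<and> out_state M r q s p j m b)"
  then obtain j m' where "right_slot s p b m'" "out_state M r q s p j m' b" by blast
  then show "stacked M r l q s' k' p'" using 1[of j] * right_slot_unique[OF m] by auto
qed

text \<open>Quantifying over all rows above makes the relation symmetric in use: read forwards it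
  shows that insertion preserves tableaux, read backwards that it can be undone.\<close>

definition lowers :: "int \<Rightarrow> nat \<Rightarrow> nat list \<Rightarrow> nat list \<Rightarrow> bool" where
  "lowers M b S S' \<longleftrightarrow> (\<forall>R. above M R S' \<longleftrightarrow> out_above M b R S)"

lemma lowersI:
  assumes "\<And>r l q. stacked M r l q (low M S') (int (length S') + 1) (low_dip S') \<longleftrightarrow>
    stacked M r l q (low M S) (int (length S) + 1) (low_dip S) \<and>
    (\<exists>j m. right_slot (low M S) (low_dip S) b m \<and> out_state M r q (low M S) (low_dip S) j m b)"
  shows "lowers M b S S'"
  unfolding lowers_def out_above_def above_def exits_def using assms by blast

text \<open>Starting a new row is the case \<open>k = 1\<close>, \<open>p = 1\<close> of
  \<open>down_grow_dip1\<close> and its companions.\<close>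

lemma lowers_Nil:
  assumes "int b < M"
  shows "lowers M b [] [b]"
proof -
  have d: "low_dip [b] = 2"
    using dip_eqI[of "[b]" 1] by (simp add: low_dip_def is_dip_def)
  have s: "low M [] x = M" for x by (simp add: low_def row_Nil)
  have v: "valley M (low M []) 2 1 1" by (simp add: valley_def s)
  have k1: "(1 :: int) = 1 \<and> (1 :: int) = 1 \<or> 2 \<le> (1 :: int) \<and> (1 :: int) \<le> 1" by simp
  have b0: "0 \<le> int b" by simp
  have m: "right_slot (low M []) 1 b 2" using assms by (auto simp: right_slot_def s)
  have upd: "low M [b] (1 + 1) = int b" "\<forall>x. x \<noteq> 1 + 1 \<longrightarrow> low M [b] x = low M [] x"
    by (auto simp: low_append[of M "[]" b, simplified])
  have ne: "int b \<noteq> low M [] 2" using assms by (simp add: s)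
  have m2: "(2 :: int) = 1 + 1" by simp
  have c: "(1 :: int) = 1 \<or> (1 :: int) = 1 \<and> int b < low M [] 1" by simp
  note base = v k1 b0 assms m m2 ne c upd
  show ?thesis
  proof (rule lowersI)
    fix r l q
    have "stacked M r l q (low M [b]) (1 + 1) (1 + 1) \<longleftrightarrow> stacked M r l q (low M []) 1 1 \<and>
      (\<exists>j m. right_slot (low M []) 1 b m \<and> out_state M r q (low M []) 1 j m b)"
    proof (rule down_iffI[OF m])
      show "stacked M r l q (low M [b]) (1 + 1) (1 + 1)"
        if "stacked M r l q (low M []) 1 1" "out_state M r q (low M []) 1 j 2 b" for j
        using down_grow_dip1[OF base that] .
      show "2 \<le> q \<and> int b < r 1" if "stacked M r l q (low M [b]) (1 + 1) (1 + 1)"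
        using down_grow_dip2[OF base that] by blast
      show "stacked M r l q (low M []) 1 1 \<and> out_state M r q (low M []) 1 j 2 b"
        if "stacked M r l q (low M [b]) (1 + 1) (1 + 1)" "1 \<le> j" "j < q" "int b < r j"
          "j + 1 = q \<or> r (j + 1) \<le> int b" for j
        using down_grow_dip3[OF base that] by blast
    qed
    then show "stacked M r l q (low M [b]) (int (length [b]) + 1) (low_dip [b]) \<longleftrightarrow>
      stacked M r l q (low M []) (int (length ([] :: nat list)) + 1) (low_dip []) \<and>
      (\<exists>j m. right_slot (low M []) (low_dip []) b m \<and> out_state M r q (low M []) (low_dip []) j m b)"
      by (simp add: d low_dip_def[of "[]"])
  qed
qed

text \<open>Forgets the output and the rule: in either case \<open>a\<close> stands in its slot
  afterwards, and the dip has moved only if that slot was the dip.\<close>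

lemma left_insert_form:
  assumes R: "above M R S" and mid: "mid_state M (row M R) (dip R) (low M S) i a"
    and ins: "left_insert (Fin a) R S = (e, R')"
  obtains n where "left_slot (row M R) 1 (dip R) a (int n)" "1 \<le> n" "n \<le> length R"
    "row M R' = (row M R)(int n := int a)" "length R' = length R"
    "n < dip R \<and> dip R' = dip R \<or> n = dip R \<and> dip R' = dip R + 1"
proof -
  note st = R[unfolded above_def] and lt = above_letters[OF R]
  have aM: "int a < M" using mid by (simp add: mid_state_def)
  have qa: "row M R (dip R) < int a" using mid st unfolding mid_state_def stacked_def valley_def
    by (smt (z3))
  show thesis
  proof (rule left_insert_cases[OF lt(1,8,9,2) aM less_imp_le[OF qa]])
    fix j assume j: "left_slot (row M R) 1 (dip R) (int a) (int j)" "1 \<le> j" "j \<le> length R"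
        "row M R j < int a" "left_insert (Fin a) R S = (Fin (R ! (j - 1)), R[j - 1 := a])"
    have e: "R' = R[j - 1 := a]" using ins j by simp
    have r': "row M R' = (row M R)(int j := int a)" unfolding e using j by (intro row_update)
    have upd: "row M R' j = a" "\<forall>x. x \<noteq> int j \<longrightarrow> row M R' x = row M R x" by (auto simp: r')
    have len: "int (length R) = int (length R')" by (simp add: e)
    obtain m where m: "right_slot (low M S) (low_dip S) (row M R j) m"
      using low_slot_ex[OF R, of "row M R j"] j(4) aM by fastforce
    show thesis
    proof (cases "j < dip R")
      case True
      then have jq: "int j < int (dip R)" by simp
      have "int (dip R) = int (dip R')"
        using aboveI(2)[OF left_replace1(1)[OF st mid j(1,4) m jq upd, unfolded len]] .
      then show thesis using that[of j] j r' len True by simp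
    next
      case False
      then have jq: "int j = int (dip R)" using j(1) by (simp add: left_slot_def)
      have "int (dip R) + 1 = int (dip R')"
        using aboveI(2)[OF left_replace2(1)[OF st mid j(1,4) m jq upd, unfolded len]] .
      then show thesis using that[of j] j r' len jq by simp
    qed
  next
    fix j f assume j: "left_slot (row M R) 1 (dip R) (int a) (int j)" "1 \<le> j" "j \<le> length R"
        "row M R j = int a" "left_insert (Fin a) R S = (f, R)"
    have "R' = R" using ins j by simp
    moreover have "j < dip R" using j(1,4) qa by (cases "j = dip R") (auto simp: left_slot_def)
    moreover have "(row M R)(int j := int a) = row M R" using j(4) by (simp add: fun_upd_idem)
    ultimately show thesis using that[of j] j by simp
  qed
qed

text \<open>The cases are the rules for the right half combined with the position of the left slot
  before or at the dip, since these determine the new row and its dip.\<close>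

lemma row_insert_lowers:
  assumes S: "above M S T" and b: "int b < M" and ins: "row_insert b S T = (e, S')"
  shows "lowers M b S S'"
proof -
  note st = S[unfolded above_def] and lt = above_letters[OF S]
  define s where "s = low M S"
  define k where "k = int (length S) + 1"
  define p where "p = int (dip S) + 1"
  have lp: "low_dip S = p" using lt(3) by (simp add: low_dip_def p_def)
  have v: "valley M s 2 k p" using lt(7) by (simp add: s_def k_def p_def valley_low)
  have p2: "2 \<le> p" "p \<le> k" using lt(8,9) by (auto simp: p_def k_def)
  have kp: "k = 1 \<and> p = 1 \<or> 2 \<le> p \<and> p \<le> k" using p2 by simp
  have b0: "0 \<le> int b" by simp
  have k1: "1 < k" using p2 by simp
  have sr: "s x = row M S (x - 1)" for x by (simp add: s_def low_def)
  have ins': "row_insert b S T = (let (a', S'') = right_insert b S T in left_insert a' S'' T)"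
    using lt(3) by (simp add: row_insert_def)
  have S'I: "low_dip S' = int (dip S') + 1" if "S' \<noteq> []" for S' using that by (simp add: low_dip_def)
  \<comment> \<open>Collects the three facts proved for each kind of change; the slot, the new
    length and the new dip are left open.\<close>
  have goal: "lowers M b S S'"
    if "right_slot s p b m" "int (length S') + 1 = k'" "low_dip S' = p'"
      and "\<And>r l q j. stacked M r l q s k p \<Longrightarrow> out_state M r q s p j m b \<Longrightarrow> stacked M r l q (low M S') k' p'"
      and "\<And>r l q. stacked M r l q (low M S') k' p' \<Longrightarrow> 2 \<le> q \<and> int b < r 1"
      and "\<And>r l q j. stacked M r l q (low M S') k' p' \<Longrightarrow> 1 \<le> j \<Longrightarrow> j < q \<Longrightarrow> int b < r j \<Longrightarrow>
         j + 1 = q \<or> r (j + 1) \<le> int b \<Longrightarrow> stacked M r l q s k p \<and> out_state M r q s p j m b" for m k' p'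
    by (rule lowersI, unfold that(2,3) lp s_def[symmetric] k_def[symmetric], rule down_iffI[OF that(1)])
      (use that(4-6) in blast)+
  have slot: "right_slot s p b (i + 1)" if "right_slot (row M S) (dip S) b i" for i
    using that by (simp add: right_slot_low s_def p_def)
  have stay: ?thesis if e: "S' = S" "b = last S"
  proof -
    define l where "l = int (length S)"
    have ra: "row M S l = b"
      using lt(3) e(2) by (simp add: l_def row_nth last_conv_nth nat_diff_distrib' Suc_leI)
    have "right_slot (row M S) (dip S) (int b) l"
      using lt(7,8,9) ra unfolding right_slot_def valley_def l_def by (smt (z3) of_nat_le_iff)
    from slot[OF this] have m: "right_slot s p b k" by (simp add: k_def l_def)
    have sk: "int b = s k" using ra by (simp add: sr k_def l_def)
    note base = v kp b0 b m refl[of k] sk k1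
    show ?thesis
      by (rule goal[OF m])
        (use down_stay2[OF base] down_stay3[OF base] in \<open>auto simp: e lp k_def s_def[symmetric]\<close>)
  qed
  show ?thesis
  proof (rule right_insert_cases[OF lt(7,8,9,2) b])
    assume g: "right_slot (row M S) (dip S) (int b) (int (length S) + 1)" "right_insert b S T = (\<infinity>, S @ [b])"
    then have S': "S' = S @ [b]" using ins ins' by (simp add: left_insert_def)
    have m: "right_slot s p b (k + 1)" using slot[OF g(1)] by (simp add: k_def)
    have upd: "low M S' (k + 1) = int b" "\<forall>x. x \<noteq> k + 1 \<longrightarrow> low M S' x = s x"
      by (auto simp: S' low_append k_def s_def)
    have ne: "int b \<noteq> s (k + 1)" using b by (simp add: sr row_out k_def)
    have updr: "row M (S @ [b]) (int (length S) + 1) = int b"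
      "\<forall>x. x \<noteq> int (length S) + 1 \<longrightarrow> row M (S @ [b]) x = row M S x" by (auto simp: row_append)
    have len: "int (length S) + 1 = int (length (S @ [b]))" by simp
    have nq: "row M S (dip S) \<noteq> int b" using g(1) lt(9) by (auto simp: right_slot_def)
    show ?thesis
    proof (cases "int b < row M S (dip S)")
      case True
      have d: "int (length S) + 1 = int (dip (S @ [b]))"
        using aboveI(2)[OF grow_stacked2[OF st g(1) b0 b True updr, unfolded len]] by simp
      \<comment> \<open>A letter below the minimum passes over an increasing part only if there is
        none, so the dip is the last column.\<close>
      have c: "k = 1 \<or> k = p \<and> int b < s p"
        using g(1) True lt(7,8,9) p2 unfolding right_slot_def valley_def sr p_def k_def by (smt (z3) of_nat_le_iff)
      note base = v kp b0 b m refl[of "k + 1"] ne c upd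
      show ?thesis
      proof (rule goal[OF m])
        show "int (length S') + 1 = k + 1" by (simp add: S' k_def)
        show "low_dip S' = k + 1" using d by (simp add: S'I S' k_def)
      qed (use down_grow_dip1[OF base] down_grow_dip2[OF base] down_grow_dip3[OF base] in blast)+
    next
      case False
      then have less: "row M S (dip S) < int b" using nq by simp
      have d: "int (dip S) = int (dip (S @ [b]))"
        using aboveI(2)[OF grow_stacked1[OF st g(1) b0 b less updr, unfolded len]] by simp
      have c: "s k < int b"
        using g(1) less lt(9) unfolding right_slot_def sr k_def by (cases "dip S = length S") (auto split: if_splits)
      note base = v kp b0 b m refl[of "k + 1"] ne k1 c upd
      show ?thesis
      proof (rule goal[OF m])
        show "int (length S') + 1 = k + 1" by (simp add: S' k_def)
        show "low_dip S' = p" using d by (simp add: S'I S' p_def)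
      qed (use down_grow1[OF base] down_grow2[OF base] down_grow3[OF base] in blast)+
    qed
  next
    fix i assume i: "1 \<le> i" "i \<le> length S" "right_slot (row M S) (dip S) (int b) (int i)"
      "int b \<noteq> row M S i" "right_insert b S T = (Fin (S ! (i - 1)), S[i - 1 := b])"
    define x where "x = S ! (i - 1)"
    define S'' where "S'' = S[i - 1 := b]"
    \<comment> \<open>Column \<open>i\<close> of \<open>S\<close> is column \<open>i + 1\<close> in
      the numbering of the row above.\<close>
    define m where "m = int i + 1"
    have rx: "row M S i = x" using i by (simp add: row_nth x_def nat_diff_distrib')
    have r'': "row M S'' = (row M S)(int i := int b)" unfolding S''_def using i by (intro row_update)
    have updr: "row M S'' i = b" "\<forall>x. x \<noteq> int i \<longrightarrow> row M S'' x = row M S x" by (auto simp: r'')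
    have len: "int (length S) = int (length S'')" by (simp add: S''_def)
    have il: "int i \<le> int (length S)" using i by simp
    have sm: "s m = x" by (simp add: sr m_def rx)
    define s2 where "s2 = low M S''"
    have upd2: "s2 m = int b" "\<forall>y. y \<noteq> m \<longrightarrow> s2 y = s y"
      by (auto simp: s2_def low_def r'' sr m_def)
    have m: "right_slot s p b m" using slot[OF i(3)] by (simp add: m_def)
    have mk: "m \<le> k" using i by (simp add: m_def k_def)
    have bm: "int b < s m"
      using i(3,4) by (auto simp: right_slot_def sr m_def split: if_splits)
    have ins'': "left_insert (Fin x) S'' T = (e, S')" using ins ins' i by (simp add: S''_def x_def)
    have ne: "S' \<noteq> []" if "length S' = length S''" using that lt(3) by (auto simp: S''_def)
    show ?thesis
    proof (cases "row M S (dip S) < int b \<or> int i \<noteq> int (dip S) + 1")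
      case True
      note f = right_replace1[OF st i(3) b0 b i(4) il True updr]
      note S'' = aboveI[OF f(1)[unfolded len]]
      from left_insert_form[OF S''(1) f(2)[unfolded S''(2) rx] ins'']
      obtain n where n: "left_slot (row M S'') 1 (dip S'') x (int n)" "1 \<le> n" "n \<le> length S''"
        "row M S' = (row M S'')(int n := int x)" "length S' = length S''"
        "n < dip S'' \<and> dip S' = dip S'' \<or> n = dip S'' \<and> dip S' = dip S'' + 1" .
      define n' where "n' = int n + 1"
      have c: "s p < int b \<or> p + 1 < m"
        using True i(3,4) by (auto simp: right_slot_def sr p_def m_def split: if_splits)
      have sl: "left_slot s2 2 p (s m) n'"
        using n(1) S''(2) unfolding left_slot_low by (simp add: s2_def p_def n'_def sm)
      have upd: "low M S' n' = s m" "\<forall>y. y \<noteq> n' \<longrightarrow> low M S' y = s2 y"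
        by (auto simp: low_def n(4) sm n'_def s2_def)
      have kk: "int (length S') + 1 = k" using n(5) len by (simp add: k_def)
      note base = v kp b0 b m c bm mk p2(1) sl
      show ?thesis
      proof (cases "n < dip S''")
        case True
        then have np: "n' < p" "low_dip S' = p" using n(6) S''(2) ne[OF n(5)] by (auto simp: n'_def p_def S'I)
        note base' = base np(1) upd2 upd
        show ?thesis
          by (rule goal[OF m kk np(2)])
            (use down_replace_r1[OF base'] down_replace_r2[OF base'] down_replace_r3[OF base'] in blast)+
      next
        case False
        then have np: "n' = p" "low_dip S' = p + 1" using n(6) S''(2) ne[OF n(5)] by (auto simp: n'_def p_def S'I)
        note base' = base np(1) upd2 upd
        show ?thesis
          by (rule goal[OF m kk np(2)])
            (use down_replace_rd1[OF base'] down_replace_rd2[OF base'] down_replace_rd3[OF base'] in blast)+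
      qed
    next
      case False
      then have c: "int b < row M S (dip S)" "int i = int (dip S) + 1"
        using i(3,4) by (auto simp: right_slot_def split: if_split_asm)
      note f = right_replace2[OF st i(3) b0 b i(4) il c updr]
      note S'' = aboveI[OF f(1)[unfolded len]]
      from left_insert_form[OF S''(1) f(2)[unfolded S''(2) rx] ins'']
      obtain n where n: "left_slot (row M S'') 1 (dip S'') x (int n)" "1 \<le> n" "n \<le> length S''"
        "row M S' = (row M S'')(int n := int x)" "length S' = length S''"
        "n < dip S'' \<and> dip S' = dip S'' \<or> n = dip S'' \<and> dip S' = dip S'' + 1" .
      define n' where "n' = int n + 1"
      have c': "int b < s p" "m = p + 1" using c by (auto simp: sr p_def m_def)
      have sl: "left_slot s2 2 (p + 1) (s m) n'"
        using n(1) S''(2)[symmetric] unfolding left_slot_low by (simp add: s2_def p_def n'_def sm)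
      have upd: "low M S' n' = s m" "\<forall>y. y \<noteq> n' \<longrightarrow> low M S' y = s2 y"
        by (auto simp: low_def n(4) sm n'_def s2_def)
      have kk: "int (length S') + 1 = k" using n(5) len by (simp add: k_def)
      note base = v kp b0 b m c' bm mk p2(1) sl
      show ?thesis
      proof (cases "n < dip S''")
        case True
        then have np: "n' < p + 1" "low_dip S' = p + 1" using n(6) S''(2) ne[OF n(5)] by (auto simp: n'_def p_def S'I)
        note base' = base np(1) upd2 upd
        show ?thesis
          by (rule goal[OF m kk np(2)])
            (use down_replace_e1[OF base'] down_replace_e2[OF base'] down_replace_e3[OF base'] in blast)+
      next
        case False
        then have np: "n' = p + 1" "low_dip S' = p + 2" using n(6) S''(2) ne[OF n(5)] by (auto simp: n'_def p_def S'I)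
        note base' = base np(1) upd2 upd
        show ?thesis
          by (rule goal[OF m kk np(2)])
            (use down_replace_ed1[OF base'] down_replace_ed2[OF base'] down_replace_ed3[OF base'] in blast)+
      qed
    qed
  next
    assume h: "dip S < length S" "row M S (dip S) = int b" "row M S (int (dip S) + 1) < row M S (int (dip S) - 1)"
    define q where "q = int (dip S)"
    have e: "S' = S[dip S := b, dip S - 1 := S ! dip S]"
      and r': "row M S' = (row M S)(q := row M S (q + 1), q + 1 := row M S q)"
      using row_insert_swap[OF S h] ins by (auto simp: q_def)
    have updr: "row M S' q = row M S (q + 1)" "row M S' (q + 1) = row M S q"
      "\<forall>x. x \<noteq> q \<and> x \<noteq> q + 1 \<longrightarrow> row M S' x = row M S x" by (auto simp: r')
    have ql: "q < int (length S)" using h by (simp add: q_def)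
    obtain m' where m': "right_slot (low M T) (low_dip T) (row M S q) m'"
      using low_slot_ex[OF S, of "row M S q"] b h(2) by (auto simp: q_def)
    note f = swap_out[OF st[folded q_def] ql h(3)[folded q_def] m' updr]
    have len: "int (length S) = int (length S')" by (simp add: e)
    have d: "q + 1 = int (dip S')" using aboveI(2)[OF f(1)[unfolded len]] .
    have bp: "int b = s p" using h(2) by (simp add: sr p_def)
    have m: "right_slot s p b p" using bp by (simp add: right_slot_def)
    have c: "p < k" "s (p + 1) < s (p - 1)" using h by (simp_all add: sr p_def k_def add.commute)
    have upd: "low M S' p = s (p + 1)" "low M S' (p + 1) = s p"
      "\<forall>x. x \<noteq> p \<and> x \<noteq> p + 1 \<longrightarrow> low M S' x = s x"
      by (auto simp: low_def r' sr p_def q_def add.commute)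
    have "S' \<noteq> []" using lt(3) by (simp add: e)
    note base = v kp b0 b m bp p2(1) c upd
    show ?thesis
    proof (rule goal[OF m])
      show "int (length S') + 1 = k" by (simp add: e k_def)
      show "low_dip S' = p + 1" using d \<open>S' \<noteq> []\<close> by (simp add: S'I p_def q_def)
    qed (use down_swap1[OF base] down_swap2[OF base] down_swap3[OF base] in blast)+
  next
    fix i f assume i: "1 \<le> i" "i \<le> length S" "right_slot (row M S) (dip S) (int b) (int i)"
      "row M S i = int b" "row M S (int i - 1) \<le> row M S (int i + 1)"
      "right_out (row M S) (low M T) i (lift M f)" "bounded M f" "right_insert b S T = (f, S)"
    show ?thesis
    proof (cases f)
      case Pinf
      then have "e = \<infinity>" "S' = S" using ins ins' i by (simp_all add: left_insert_def)
      \<comment> \<open>An output of infinity with an unchanged row means, by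
        \<open>row_insert_above\<close>, that \<open>b\<close> is the last entry.\<close>
      then show ?thesis
        using stay row_insert_above[OF S b ins] by (metis append_self_conv extended.distinct(1) not_Cons_self2)
    next
      case (Fin x)
      then have x: "int x < M" using i(7) by (simp add: bounded_def)
      note g = right_keep[OF st i(3)[folded i(4)] i(5), of "int x"]
      have mid: "mid_state M (row M S) (dip S) (low M T) i (int x)"
        and rs: "right_stays (row M S) (low M T) i (int x)"
        using g i(6) Fin x by auto
      have "left_insert (Fin x) S T = (e, S')" using ins ins' i Fin by simp
      from left_insert_form[OF S mid this]
      obtain n where n: "left_slot (row M S) 1 (dip S) x (int n)" "1 \<le> n" "n \<le> length S"
        "row M S' = (row M S)(int n := int x)" "length S' = length S"
        "n < dip S \<and> dip S' = dip S \<or> n = dip S \<and> dip S' = dip S + 1" .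
      define n' where "n' = int n + 1"
      define m where "m = int i + 1"
      have m: "right_slot s p b m" using slot[OF i(3)] by (simp add: m_def)
      have c: "int b = s m" "m \<le> k" using i by (simp_all add: sr m_def k_def)
      have "m + 1 - 1 = int i + 1" by (simp add: m_def)
      then have e1: "s (m + 1) = row M S (int i + 1)" by (simp only: sr)
      have d: "s m < int x" "int x \<le> s (m + 1)" "m = p \<longrightarrow> 3 \<le> p \<and> s (p - 1) \<le> int x"
        unfolding e1 using mid by (auto simp: mid_state_def sr m_def p_def)
      have gap: "s n' = int x \<or> s (m + 1) < M \<and> (\<forall>t. 2 \<le> t \<and> t < m \<longrightarrow> \<not> (int x < s t \<and> s t \<le> s (m + 1)))"
      proof (cases "row M S n = int x")
        case True
        then show ?thesis by (simp add: sr n'_def)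
      next
        case False
        then have g: "row M S (int i + 1) < M"
          "\<And>t. 1 \<le> t \<and> t < int i \<Longrightarrow> \<not> (int x < row M S t \<and> row M S t \<le> row M S (int i + 1))"
          using mid_state_gap[OF st mid n(1) rs] by blast+
        have "\<not> (int x < s t \<and> s t \<le> s (m + 1))" if "2 \<le> t \<and> t < m" for t
          unfolding e1 sr[of t] using g(2)[of "t - 1"] that by (simp add: m_def)
        then show ?thesis using g(1) unfolding e1 by blast
      qed
      have sl: "left_slot s 2 p x n'"
        using n(1) unfolding left_slot_low by (simp add: s_def p_def n'_def)
      have upd: "low M S' n' = int x" "\<forall>y. y \<noteq> n' \<longrightarrow> low M S' y = s y"
        by (auto simp: low_def n(4) n'_def sr)
      have kk: "int (length S') + 1 = k" using n(5) by (simp add: k_def)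
      have ne: "S' \<noteq> []" using n(5) lt(3) by auto
      note base = v kp b0 b m c p2(1) d(1) x d(2,3) gap sl
      show ?thesis
      proof (cases "n < dip S")
        case True
        then have np: "n' < p" "low_dip S' = p" using n(6) ne by (auto simp: n'_def p_def S'I)
        note base' = base np(1) upd
        show ?thesis
          by (rule goal[OF m kk np(2)])
            (use down_keep1[OF base'] down_keep2[OF base'] down_keep3[OF base'] in blast)+
      next
        case False
        then have np: "n' = p" "low_dip S' = p + 1" using n(6) ne by (auto simp: n'_def p_def S'I)
        note base' = base np(1) upd
        show ?thesis
          by (rule goal[OF m kk np(2)])
            (use down_keepd1[OF base'] down_keepd2[OF base'] down_keepd3[OF base'] in blast)+
      qed
    next
      case Minf
      then show ?thesis using i(7) by (simp add: bounded_def)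
    qed
  qed
qed

section \<open>Insertion into a tableau and its inverse\<close>

section \<open>Tableau insertion\<close>

definition top_row :: "nat tableau \<Rightarrow> nat list" where
  "top_row P = (if P = [] then [] else hd P)"

fun valid :: "int \<Rightarrow> nat tableau \<Rightarrow> bool" where
  "valid M [] \<longleftrightarrow> True"
| "valid M (R # P) \<longleftrightarrow> above M R (top_row P) \<and> valid M P"

text \<open>Rows are shifted, so the last cell of row \<open>k\<close> is the last of its column
  exactly if the next row is shorter by at least two. Removing it then leaves a strict
  shape.\<close>

definition corner :: "'a tableau \<Rightarrow> nat \<Rightarrow> bool" where
  "corner P k \<longleftrightarrow> 1 \<le> k \<and> k \<le> length P \<and> (k < length P \<longrightarrow> length (P ! k) + 1 < length (P ! (k - 1)))"

definition add_box :: "nat list \<Rightarrow> nat \<Rightarrow> nat list" where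
  "add_box mu k = (if k = length mu + 1 then mu @ [1] else mu[k - 1 := mu ! (k - 1) + 1])"

lemma above_single: "int a < M \<Longrightarrow> above M [a] []"
proof -
  assume a: "int a < M"
  have "valley M (row M [a]) 1 1 1"
    using valley_rowI[of "[a]" 1 M] a by (simp add: is_dip_def)
  then show ?thesis
    by (intro aboveI(1)[where q = 1 and p = 1]) (auto simp: stacked_def low_def row_Nil valley_def)
qed

lemma tableau_insert_Cons:
  "row_insert a R (top_row P) = (\<infinity>, R') \<Longrightarrow> tableau_insert a (R # P) = (R' # P, 1)"
  "row_insert a R (top_row P) = (Fin b, R') \<Longrightarrow> tableau_insert b P = (P', k) \<Longrightarrow>
    tableau_insert a (R # P) = (R' # P', k + 1)"
  by (simp_all add: top_row_def)

lemma tableau_insert_Nil: "tableau_insert a [] = ([[a]], 1)"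
  by (simp add: row_insert_def)

lemma add_box_Cons: "1 \<le> k \<Longrightarrow> add_box (x # mu) (k + 1) = x # add_box mu k"
  by (cases k) (auto simp: add_box_def)

lemma corner_Cons: "1 \<le> k \<Longrightarrow> corner (R # P) (k + 1) \<longleftrightarrow> corner P k"
  by (auto simp: corner_def nth_Cons' split: nat.splits)

lemma corner_1: "corner (R # P) 1 \<longleftrightarrow> (P \<noteq> [] \<longrightarrow> length (hd P) + 1 < length R)"
  by (cases P) (auto simp: corner_def)

text \<open>The induction rests on the clause about \<open>lowers\<close>: the row above has emitted
  the letter inserted into the inner tableau, and the clause turns this into \<open>above\<close>
  for the new top row.\<close>

lemma tableau_insert_valid:
  assumes "valid M P" "int a < M" "tableau_insert a P = (P', k)"
  shows "valid M P' \<and> lowers M a (top_row P) (top_row P') \<and> corner P' k \<and>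
    (shape P' = shape P \<or> shape P' = add_box (shape P) k)"
  using assms
proof (induction P arbitrary: a P' k)
  case Nil
  then have "P' = [[a]]" "k = 1" using tableau_insert_Nil[of a] by auto
  then show ?case
    using Nil above_single lowers_Nil by (simp add: top_row_def corner_def shape_def add_box_def)
next
  case (Cons R P)
  define S where "S = top_row P"
  have R: "above M R S" and P: "valid M P" using Cons.prems by (simp_all add: S_def)
  obtain e R' where ri: "row_insert a R S = (e, R')" by fastforce
  have low: "lowers M a R R'" by (rule row_insert_lowers[OF R Cons.prems(2) ri])
  from R Cons.prems(2) ri show ?case
  proof (rule row_insert_above)
    assume g: "e = \<infinity>" "R' = R @ [a]" "right_slot (row M R) (dip R) a (int (length R) + 1)"
    have P': "P' = R' # P" "k = 1"
      using Cons.prems(3) tableau_insert_Cons(1) ri g(1) by (auto simp: S_def)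
    have "above M R' S" unfolding g(2) by (rule above_append[OF R Cons.prems(2) g(3)])
    moreover have "length S < length R" using above_letters(4)[OF R] .
    ultimately show ?case
      using P low unfolding P' corner_1 by (auto simp: S_def top_row_def shape_def add_box_def g(2))
  next
    assume g: "e = \<infinity>" "R' = R" "a = last R" "S = [] \<or> length S + 1 < length R"
    have P': "P' = R # P" "k = 1"
      using Cons.prems(3) tableau_insert_Cons(1) ri g(1,2) by (auto simp: S_def)
    have "P \<noteq> [] \<Longrightarrow> S \<noteq> []" using P above_letters(3) by (cases P) (auto simp: S_def top_row_def)
    then show ?case
      using P R low g unfolding P' corner_1 by (auto simp: S_def top_row_def)
  next
    fix b assume g: "e = Fin b" "length R' = length R" "out_above M b R' S"
    obtain Q k' where Q: "tableau_insert b P = (Q, k')" by fastforce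
    have P': "P' = R' # Q" "k = k' + 1"
      using Cons.prems(3) tableau_insert_Cons(2)[OF _ Q] ri g(1) by (auto simp: S_def)
    have bM: "int b < M" using g(3) unfolding out_above_def exits_def out_state_def by blast
    note IH = Cons.IH[OF P bM Q]
    have "above M R' (top_row Q)" using IH g(3) unfolding lowers_def S_def by blast
    moreover have "1 \<le> k'" using IH by (simp add: corner_def)
    moreover have "corner P' k"
      using IH corner_Cons[OF \<open>1 \<le> k'\<close>, of R' Q] unfolding P' by blast
    moreover have "shape P' = length R # shape Q" "shape (R # P) = length R # shape P"
      using g(2) by (simp_all add: P' shape_def)
    then have "shape P' = shape (R # P) \<or> shape P' = add_box (shape (R # P)) k"
      using IH add_box_Cons[OF \<open>1 \<le> k'\<close>, of "length R" "shape P"] P'(2) by auto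
    ultimately show ?case using IH low by (simp add: P' top_row_def)
  qed
qed

text \<open>The end row \<open>k\<close> tells in each row whether a letter was emitted. In the end
  row itself the comparison of shapes distinguishes an appended letter from an absorbed one.\<close>

lemma tableau_insert_inj:
  assumes "valid M P1" "int a1 < M" "tableau_insert a1 P1 = (P', k)"
    and "valid M P2" "int a2 < M" "tableau_insert a2 P2 = (P', k)"
    and "shape P' = shape P1 \<longleftrightarrow> shape P' = shape P2"
  shows "a1 = a2 \<and> P1 = P2"
  using assms
proof (induction P1 arbitrary: a1 a2 P2 P' k)
  case Nil
  then have P': "P' = [[a1]]" "k = 1" using tableau_insert_Nil[of a1] by auto
  show ?case
  proof (cases P2)
    case Nil
    then show ?thesis using \<open>tableau_insert a2 P2 = (P', k)\<close> P' tableau_insert_Nil[of a2] by simp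
  next
    case (Cons R2 Q2)
    obtain e R' where ri: "row_insert a2 R2 (top_row Q2) = (e, R')" by fastforce
    have R2: "above M R2 (top_row Q2)" using Nil.prems(4) Cons by simp
    from R2 Nil.prems(5) ri show ?thesis
    proof (rule row_insert_above)
      assume "e = \<infinity>" "R' = R2 @ [a2]"
      then show ?thesis
        using Nil.prems(6) P' Cons tableau_insert_Cons(1) ri above_letters(3)[OF R2] by auto
    next
      assume "e = \<infinity>" "R' = R2"
      then have "P' = P2" using Nil.prems(6) Cons tableau_insert_Cons(1) ri by auto
      then show ?thesis using Nil.prems(7) P' by (simp add: shape_def)
    next
      fix b assume "e = Fin b"
      obtain Q k' where Q: "tableau_insert b Q2 = (Q, k')" by fastforce
      have "k = k' + 1" using Nil.prems(6) Cons tableau_insert_Cons(2)[OF _ Q] ri \<open>e = Fin b\<close> by auto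
      moreover have "1 \<le> k'" using Q by (cases Q2) (auto split: prod.splits extended.splits)
      ultimately show ?thesis using P' by simp
    qed
  qed
next
  case (Cons R1 Q1)
  have R1: "above M R1 (top_row Q1)" and Q1: "valid M Q1" using Cons.prems(1) by simp_all
  show ?case
  proof (cases P2)
    case Nil
    then have P': "P' = [[a2]]" "k = 1" using Cons.prems(6) tableau_insert_Nil[of a2] by auto
    obtain e R' where ri: "row_insert a1 R1 (top_row Q1) = (e, R')" by fastforce
    from R1 Cons.prems(2) ri show ?thesis
    proof (rule row_insert_above)
      assume "e = \<infinity>" "R' = R1 @ [a1]"
      then show ?thesis
        using Cons.prems(3) P' tableau_insert_Cons(1) ri above_letters(3)[OF R1] by auto
    next
      assume "e = \<infinity>" "R' = R1"
      then have "P' = R1 # Q1" using Cons.prems(3) tableau_insert_Cons(1) ri by auto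
      then show ?thesis using Cons.prems(7) P' Nil by (simp add: shape_def)
    next
      fix b assume "e = Fin b"
      obtain Q k' where Q: "tableau_insert b Q1 = (Q, k')" by fastforce
      have "k = k' + 1" using Cons.prems(3) tableau_insert_Cons(2)[OF _ Q] ri \<open>e = Fin b\<close> by auto
      moreover have "1 \<le> k'" using Q by (cases Q1) (auto split: prod.splits extended.splits)
      ultimately show ?thesis using P' by simp
    qed
  next
    case P2: (Cons R2 Q2)
    have R2: "above M R2 (top_row Q2)" and Q2: "valid M Q2" using Cons.prems(4) P2 by simp_all
    obtain e1 R1' where r1: "row_insert a1 R1 (top_row Q1) = (e1, R1')" by fastforce
    obtain e2 R2' where r2: "row_insert a2 R2 (top_row Q2) = (e2, R2')" by fastforce
    \<comment> \<open>What the result alone says about the step in the first row: the step ends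
      there exactly if \<open>k = 1\<close>, and otherwise the comparison of shapes passes on to the
      inner tableau.\<close>
    have form: "(e = \<infinity> \<and> k = 1 \<and> P' = R' # Q \<and>
        (R' = R @ [a] \<and> shape P' \<noteq> shape (R # Q) \<or> R' = R \<and> a = last R \<and> shape P' = shape (R # Q))) \<or>
      (\<exists>b Q'. e = Fin b \<and> int b < M \<and> k \<noteq> 1 \<and> P' = R' # Q' \<and> tableau_insert b Q = (Q', k - 1) \<and>
        (shape P' = shape (R # Q) \<longleftrightarrow> shape Q' = shape Q))"
      if "above M R (top_row Q)" "int a < M" "row_insert a R (top_row Q) = (e, R')"
        "tableau_insert a (R # Q) = (P', k)" for a R Q e R'
      using that(1-3)
    proof (rule row_insert_above)
      assume "e = \<infinity>" "R' = R @ [a]"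
      then show ?thesis using that(4) tableau_insert_Cons(1) that(3) by (auto simp: shape_def)
    next
      assume "e = \<infinity>" "R' = R" "a = last R"
      then show ?thesis using that(4) tableau_insert_Cons(1) that(3) by auto
    next
      fix b assume b: "e = Fin b" "length R' = length R" "out_above M b R' (top_row Q)"
      obtain Q' k' where Q: "tableau_insert b Q = (Q', k')" by fastforce
      have "k = k' + 1" "P' = R' # Q'" using that(4) tableau_insert_Cons(2)[OF _ Q] that(3) b(1) by auto
      moreover have "1 \<le> k'" using Q by (cases Q) (auto split: prod.splits extended.splits)
      moreover have "int b < M" using b(3) unfolding out_above_def exits_def out_state_def by blast
      ultimately show ?thesis using b Q by (auto simp: shape_def)
    qed
    note f1 = form[OF R1 Cons.prems(2) r1 Cons.prems(3)]
    note f2 = form[OF R2 Cons.prems(5) r2 Cons.prems(6)[unfolded P2]]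
    show ?thesis
    proof (cases "k = 1")
      case True
      then show ?thesis using f1 f2 Cons.prems(7) unfolding P2 by auto
    next
      case False
      obtain b1 Q where 1: "e1 = Fin b1" "int b1 < M" "P' = R1' # Q" "tableau_insert b1 Q1 = (Q, k - 1)"
        "shape P' = shape (R1 # Q1) \<longleftrightarrow> shape Q = shape Q1" using f1 False by blast
      obtain b2 where 2: "e2 = Fin b2" "int b2 < M" "R2' = R1'" "tableau_insert b2 Q2 = (Q, k - 1)"
        "shape P' = shape (R2 # Q2) \<longleftrightarrow> shape Q = shape Q2" using f2 False 1(3) by auto
      have "b1 = b2 \<and> Q1 = Q2"
        using Cons.IH[OF Q1 1(2,4) Q2 2(2,4)] 1(5) 2(5) Cons.prems(7) P2 by simp
      then show ?thesis
        using row_insert_inj[OF R1 Cons.prems(2) r1[unfolded 1(1)], of R2 a2] R2 Cons.prems(5) r2 2 P2 by auto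
    qed
  qed
qed

text \<open>Both values of \<open>stays\<close> are possible at every corner, which matches the two
  ways of recording a letter in the corresponding cell.\<close>

lemma tableau_insert_surj:
  assumes "valid M P'" "corner P' k"
  shows
    "\<exists>a P. valid M P \<and> int a < M \<and> tableau_insert a P = (P', k) \<and> (shape P' = shape P \<longleftrightarrow> stays)"
  using assms
proof (induction P' arbitrary: k)
  case Nil
  then show ?case by (auto simp: corner_def)
next
  case (Cons R' Q')
  define S where "S = top_row Q'"
  have R': "above M R' S" and Q': "valid M Q'" using Cons.prems by (simp_all add: S_def)
  note lt = above_letters[OF R']
  have SQ: "S = [] \<longleftrightarrow> Q' = []"
    using Q' above_letters(3) by (cases Q') (auto simp: S_def top_row_def)
  show ?case
  proof (cases "k = 1")
    case True
    then have c: "Q' \<noteq> [] \<longrightarrow> length S + 1 < length R'"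
      using Cons.prems(2) unfolding True corner_1 by (auto simp: S_def top_row_def)
    show ?thesis
    proof (cases stays)
      case st: True
      have "row_insert (last R') R' S = (\<infinity>, R')" by (rule row_insert_last[OF R']) (use c SQ in auto)
      then show ?thesis
        using st True Cons.prems(1) lt(1,3) tableau_insert_Cons(1)[of "last R'" R' Q' R']
        by (intro exI[of _ "last R'"] exI[of _ "R' # Q'"]) (auto simp: S_def)
    next
      case st: False
      show ?thesis
      proof (cases "length R' = 1")
        \<comment> \<open>A row of length one that has just grown did not exist before.\<close>
        case l1: True
        then obtain a where a: "R' = [a]" by (cases R') auto
        have "Q' = []" using c l1 by auto
        then show ?thesis
          using st True a lt(1) tableau_insert_Nil[of a]
          by (intro exI[of _ a] exI[of _ "[]"]) (auto simp: shape_def)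
      next
        case l1: False
        define R where "R = butlast R'"
        define a where "a = last R'"
        have Ra: "R' = R @ [a]" using lt(3) by (simp add: R_def a_def)
        have ne: "R \<noteq> []" using l1 Ra by auto
        have "length S < length R" using c SQ ne Ra by (cases "Q' = []") auto
        note g = above_butlast[OF R'[unfolded Ra] ne this]
        then show ?thesis
          using st True Q' Ra tableau_insert_Cons(1)[of a R Q' R']
          by (intro exI[of _ a] exI[of _ "R # Q'"]) (auto simp: S_def shape_def)
      qed
    qed
  next
    case False
    have "1 \<le> k" using Cons.prems(2) by (simp add: corner_def)
    then have k1: "1 \<le> k - 1" "k = k - 1 + 1" using False by linarith+
    have k: "corner Q' (k - 1)" "k = k - 1 + 1"
      using corner_Cons[OF k1(1), of R' Q'] Cons.prems(2) k1(2) by simp_all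
    obtain b Q where Q: "valid M Q" "int b < M" "tableau_insert b Q = (Q', k - 1)" "shape Q' = shape Q \<longleftrightarrow> stays"
      using Cons.IH[OF Q' k(1)] by blast
    \<comment> \<open>\<open>lowers\<close> is read from \<open>above\<close> to
      \<open>out_above\<close>: since \<open>R'\<close> fits over the new inner tableau, it can have
      emitted \<open>b\<close> over the old one.\<close>
    have "out_above M b R' (top_row Q)"
      using tableau_insert_valid[OF Q(1-3)] R' unfolding lowers_def S_def by blast
    then obtain a R where R: "above M R (top_row Q)" "int a < M" "row_insert a R (top_row Q) = (Fin b, R')"
      using row_insert_surj by blast
    have "length R' = length R" using row_insert_above[OF R] by auto
    then show ?thesis
      using Q R k(2) tableau_insert_Cons(2)[OF R(3) Q(3)]
      by (intro exI[of _ a] exI[of _ "R # Q"]) (auto simp: shape_def)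
  qed
qed

section \<open>Forbidden patterns and the inequalities for adjacent rows\<close>

section \<open>Strict decomposition tableaux\<close>

text \<open>The negation of \<open>forbidden\<close> with rows indexed from 0; because of the shift,
  the entry above \<open>S ! c\<close> is \<open>R ! (c + 1)\<close>.\<close>

definition avoids :: "nat list \<Rightarrow> nat list \<Rightarrow> bool" where
  "avoids R S \<longleftrightarrow>
     (\<forall>c<length S. S ! c < R ! 0) \<and>
     (\<forall>c d. c < d \<and> d < length S \<and> c + 1 < length R \<longrightarrow> \<not> (R ! (c + 1) \<le> S ! d \<and> S ! d < S ! c)) \<and>
     (\<forall>c d. c < d \<and> d < length S \<and> c + 2 < length R \<longrightarrow>
        \<not> (R ! (c + 1) < R ! (c + 2) \<and> S ! c < S ! d \<and> S ! d \<le> R ! (c + 1))) \<and>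
     (\<forall>c t. t \<le> c \<and> c < length S \<and> c + 1 < length R \<longrightarrow> \<not> (S ! c < R ! t \<and> R ! t \<le> R ! (c + 1)))"

lemma shifted_diagram_iff:
  assumes "1 \<le> i" "i \<le> length T"
  shows
    "(i, j) \<in> shifted_diagram (shape T) \<longleftrightarrow> i \<le> j \<and> j - i < length (T ! (i - 1))"
  using assms by (auto simp: shifted_diagram_def shape_def)

lemma not_forbidden_iff:
  assumes i: "1 \<le> i" "i < length T"
  shows "\<not> forbidden T i \<longleftrightarrow> avoids (T ! (i - 1)) (T ! i)"
proof -
  define R where "R = T ! (i - 1)"
  define S where "S = T ! i"
  have D: "(i, j) \<in> shifted_diagram (shape T) \<longleftrightarrow> i \<le> j \<and> j - i < length R"
    "(i + 1, j) \<in> shifted_diagram (shape T) \<longleftrightarrow> i + 1 \<le> j \<and> j - (i + 1) < length S" for j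
    using shifted_diagram_iff[of i T j] shifted_diagram_iff[of "i + 1" T j] i by (simp_all add: R_def S_def)
  have E: "entry T i j = R ! (j - i)" "entry T (i + 1) j = S ! (j - (i + 1))" for j
    using i by (simp_all add: entry_def R_def S_def)
  have P: "(\<exists>j. i + 1 \<le> j \<and> Q j) \<longleftrightarrow> (\<exists>c. Q (i + 1 + c))" for Q
    by (metis le_add1 le_iff_add)
  have "forbidden T i \<longleftrightarrow>
     (\<exists>c. c < length S \<and> R ! 0 \<le> S ! c) \<or>
     (\<exists>c d. c < d \<and> d < length S \<and> c + 1 < length R \<and> R ! (c + 1) \<le> S ! d \<and> S ! d < S ! c) \<or>
     (\<exists>c d. c < d \<and> d < length S \<and> c + 2 < length R \<and> R ! (c + 1) < R ! (c + 2) \<and> S ! c < S ! d \<and> S ! d \<le> R ! (c + 1)) \<or>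
     (\<exists>c t. t \<le> c \<and> c < length S \<and> c + 1 < length R \<and> S ! c < R ! t \<and> R ! t \<le> R ! (c + 1))"
    (is "_ \<longleftrightarrow> ?A \<or> ?B \<or> ?C \<or> ?D")
  proof -
    have a: "(\<exists>j. (i + 1, j) \<in> shifted_diagram (shape T) \<and> entry T i i \<le> entry T (i + 1) j) \<longleftrightarrow> ?A"
      unfolding D E conj_assoc P by simp
    have b: "(\<exists>j j'. j < j' \<and> (i, j) \<in> shifted_diagram (shape T) \<and> (i + 1, j) \<in> shifted_diagram (shape T) \<and>
        (i + 1, j') \<in> shifted_diagram (shape T) \<and> entry T i j \<le> entry T (i + 1) j' \<and>
        entry T (i + 1) j' < entry T (i + 1) j) \<longleftrightarrow> ?B"
    proof
      assume "\<exists>j j'. j < j' \<and> (i, j) \<in> shifted_diagram (shape T) \<and> (i + 1, j) \<in> shifted_diagram (shape T) \<and>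
        (i + 1, j') \<in> shifted_diagram (shape T) \<and> entry T i j \<le> entry T (i + 1) j' \<and>
        entry T (i + 1) j' < entry T (i + 1) j"
      then obtain j j' where h: "j < j'" "j - i < length R" "i + 1 \<le> j" "j' - (i + 1) < length S"
        "R ! (j - i) \<le> S ! (j' - (i + 1))" "S ! (j' - (i + 1)) < S ! (j - (i + 1))"
        unfolding D E by blast
      obtain c d where "j = i + 1 + c" "j' = i + 1 + d"
        using h(1,3) le_Suc_ex[of "i + 1" j] le_Suc_ex[of "i + 1" j'] by auto
      then show ?B using h by (intro exI[of _ c] exI[of _ d]) auto
    next
      assume ?B
      then obtain c d where "c < d" "d < length S" "c + 1 < length R" "R ! (c + 1) \<le> S ! d" "S ! d < S ! c" by blast
      then show "\<exists>j j'. j < j' \<and> (i, j) \<in> shifted_diagram (shape T) \<and> (i + 1, j) \<in> shifted_diagram (shape T) \<and>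
        (i + 1, j') \<in> shifted_diagram (shape T) \<and> entry T i j \<le> entry T (i + 1) j' \<and>
        entry T (i + 1) j' < entry T (i + 1) j"
        unfolding D E by (intro exI[of _ "i + 1 + c"] exI[of _ "i + 1 + d"]) auto
    qed
    have c: "(\<exists>j j'. j < j' \<and> (i, j) \<in> shifted_diagram (shape T) \<and> (i, j + 1) \<in> shifted_diagram (shape T) \<and>
        (i + 1, j) \<in> shifted_diagram (shape T) \<and> (i + 1, j') \<in> shifted_diagram (shape T) \<and>
        entry T i j < entry T i (j + 1) \<and> entry T (i + 1) j < entry T (i + 1) j' \<and>
        entry T (i + 1) j' \<le> entry T i j) \<longleftrightarrow> ?C"
    proof
      assume "\<exists>j j'. j < j' \<and> (i, j) \<in> shifted_diagram (shape T) \<and> (i, j + 1) \<in> shifted_diagram (shape T) \<and>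
        (i + 1, j) \<in> shifted_diagram (shape T) \<and> (i + 1, j') \<in> shifted_diagram (shape T) \<and>
        entry T i j < entry T i (j + 1) \<and> entry T (i + 1) j < entry T (i + 1) j' \<and>
        entry T (i + 1) j' \<le> entry T i j"
      then obtain j j' where h: "j < j'" "j + 1 - i < length R" "i + 1 \<le> j" "j' - (i + 1) < length S"
        "R ! (j - i) < R ! (j + 1 - i)" "S ! (j - (i + 1)) < S ! (j' - (i + 1))" "S ! (j' - (i + 1)) \<le> R ! (j - i)"
        unfolding D E by blast
      obtain c d where "j = i + 1 + c" "j' = i + 1 + d"
        using h(1,3) le_Suc_ex[of "i + 1" j] le_Suc_ex[of "i + 1" j'] by auto
      then show ?C using h by (intro exI[of _ c] exI[of _ d]) auto
    next
      assume ?C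
      then obtain c d where "c < d" "d < length S" "c + 2 < length R" "R ! (c + 1) < R ! (c + 2)"
        "S ! c < S ! d" "S ! d \<le> R ! (c + 1)" by blast
      then show "\<exists>j j'. j < j' \<and> (i, j) \<in> shifted_diagram (shape T) \<and> (i, j + 1) \<in> shifted_diagram (shape T) \<and>
        (i + 1, j) \<in> shifted_diagram (shape T) \<and> (i + 1, j') \<in> shifted_diagram (shape T) \<and>
        entry T i j < entry T i (j + 1) \<and> entry T (i + 1) j < entry T (i + 1) j' \<and>
        entry T (i + 1) j' \<le> entry T i j"
        unfolding D E by (intro exI[of _ "i + 1 + c"] exI[of _ "i + 1 + d"]) auto
    qed
    have d: "(\<exists>j j'. j' < j \<and> (i, j') \<in> shifted_diagram (shape T) \<and> (i, j) \<in> shifted_diagram (shape T) \<and>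
        (i + 1, j) \<in> shifted_diagram (shape T) \<and> entry T (i + 1) j < entry T i j' \<and> entry T i j' \<le> entry T i j) \<longleftrightarrow> ?D"
    proof
      assume "\<exists>j j'. j' < j \<and> (i, j') \<in> shifted_diagram (shape T) \<and> (i, j) \<in> shifted_diagram (shape T) \<and>
        (i + 1, j) \<in> shifted_diagram (shape T) \<and> entry T (i + 1) j < entry T i j' \<and> entry T i j' \<le> entry T i j"
      then obtain j j' where h: "j' < j" "i \<le> j'" "j - i < length R" "i + 1 \<le> j" "j - (i + 1) < length S"
        "S ! (j - (i + 1)) < R ! (j' - i)" "R ! (j' - i) \<le> R ! (j - i)"
        unfolding D E by blast
      obtain c t where "j = i + 1 + c" "j' = i + t"
        using h(2,4) le_Suc_ex[of "i + 1" j] le_Suc_ex[of i j'] by auto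
      then show ?D using h by (intro exI[of _ c] exI[of _ t]) auto
    next
      assume ?D
      then obtain c t where "t \<le> c" "c < length S" "c + 1 < length R" "S ! c < R ! t" "R ! t \<le> R ! (c + 1)" by blast
      then show "\<exists>j j'. j' < j \<and> (i, j') \<in> shifted_diagram (shape T) \<and> (i, j) \<in> shifted_diagram (shape T) \<and>
        (i + 1, j) \<in> shifted_diagram (shape T) \<and> entry T (i + 1) j < entry T i j' \<and> entry T i j' \<le> entry T i j"
        unfolding D E by (intro exI[of _ "i + 1 + c"] exI[of _ "i + t"]) auto
    qed
    show ?thesis unfolding forbidden_def Let_def a b c d ..
  qed
  then show ?thesis
    unfolding avoids_def R_def[symmetric] S_def[symmetric] by (auto simp: not_le[symmetric])
qed

text \<open>The inequalities of \<open>stacked\<close> range over all columns, but outside the rows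
  the value \<open>M\<close> reduces them to those of \<open>avoids\<close>. Pattern (iv)/(v) cannot
  occur left of the dip, because the row decreases there.\<close>

lemma avoids_imp_stacked:
  assumes R: "valley M (row M R) 1 (length R) (dip R)" "1 \<le> dip R" "dip R \<le> length R"
    and S: "S \<noteq> []" "valley M (row M S) 1 (length S) (dip S)" "1 \<le> dip S" "dip S \<le> length S"
    and len: "length S < length R"
  shows "avoids R S \<longleftrightarrow> above M R S"
proof -
  define r s where "r = row M R" and "s = low M S"
  have rn: "R ! n = nat (r (int n + 1)) \<and> 0 \<le> r (int n + 1)" if "n < length R" for n
    using that by (simp add: r_def row_Suc)
  have r0: "R ! 0 = nat (r 1) \<and> 0 \<le> r 1"
  proof -
    have "0 < length R" using len by linarith
    from rn[OF this] show ?thesis by simp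
  qed
  have sn: "S ! n = nat (s (int n + 2)) \<and> 0 \<le> s (int n + 2)" if "n < length S" for n
    using row_Suc[OF that, of M] by (simp add: s_def low_def add.commute)
  have rM: "r x < M \<longleftrightarrow> 1 \<le> x \<and> x \<le> int (length R)" "r x \<le> M" for x
    using R(1) row_out[of x R M] by (auto simp: r_def valley_def) (metis less_irrefl not_le less_imp_le)+
  have sM: "s x < M \<longleftrightarrow> 2 \<le> x \<and> x \<le> int (length S) + 1" "s x \<le> M" for x
    using S(2) row_out[of "x - 1" S M] unfolding s_def low_def valley_def by (smt (verit))+
  have vs: "valley M s 2 (int (length S) + 1) (int (dip S) + 1)" using S(2) by (simp add: s_def valley_low)
  have ab: "above M R S \<longleftrightarrow>
     (\<forall>x y. int (dip R) \<le> x \<and> x < y \<longrightarrow> \<not> (s x < s y \<and> s y \<le> r x)) \<and>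
     (\<forall>x t. int (dip R) \<le> x \<and> 1 \<le> t \<and> t < x \<longrightarrow> \<not> (s x < r t \<and> r t \<le> r x)) \<and>
     (\<forall>x y. x < y \<longrightarrow> \<not> (r x \<le> s y \<and> s y < s x))"
    using R S len vs unfolding above_def stacked_def by (auto simp: low_dip_def r_def s_def)
  \<comment> \<open>This connects the ascent tested in \<open>forbidden\<close> with the condition
    \<open>q \<le> x\<close> of \<open>stacked\<close>: column \<open>c + 2\<close> is followed by a
    larger entry exactly from the dip on.\<close>
  have inc: "R ! (c + 1) < R ! (c + 2) \<longleftrightarrow> int (dip R) \<le> int c + 2" if "c + 2 < length R" for c
  proof (cases "int (dip R) \<le> int c + 2")
    case True
    then have "r (int c + 2) < r (int c + 3)" using R(1) that unfolding valley_def r_def by auto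
    then show ?thesis using True rn[of "c + 1"] rn[of "c + 2"] that by (simp add: add.commute nat_less_eq_zless)
  next
    case False
    then have "r (int c + 3) < r (int c + 2)" using R(1) that unfolding valley_def r_def by auto
    then show ?thesis using False rn[of "c + 1"] rn[of "c + 2"] that by (simp add: add.commute nat_less_eq_zless)
  qed
  show ?thesis
  proof
    assume a: "avoids R S"
    show "above M R S"
      unfolding ab
    proof (intro conjI allI impI notI)
      fix x y assume h: "int (dip R) \<le> x \<and> x < y" "s x < s y \<and> s y \<le> r x"
      have x: "2 \<le> x" "x \<le> int (length S) + 1" using sM[of x] sM(2)[of y] h by auto
      have y: "y \<le> int (length S) + 1"
        using sM[of y] rM[of x] h x len by auto
      define c d where "c = nat (x - 2)" and "d = nat (y - 2)"
      have cd: "x = int c + 2" "y = int d + 2" "c < d" "d < length S" "c + 2 < length R"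
        using x y h len by (auto simp: c_def d_def)
      have "\<not> (R ! (c + 1) < R ! (c + 2) \<and> S ! c < S ! d \<and> S ! d \<le> R ! (c + 1))"
        using a cd unfolding avoids_def by blast
      then show False
        using cd h inc[OF cd(5)] rn[of "c + 1"] sn[of c] sn[of d]
        by (auto simp: add.commute nat_less_eq_zless nat_le_eq_zle)
    next
      fix x t assume h: "int (dip R) \<le> x \<and> 1 \<le> t \<and> t < x" "s x < r t \<and> r t \<le> r x"
      have x: "2 \<le> x" "x \<le> int (length S) + 1" using sM[of x] rM(2)[of t] h by auto
      define c u where "c = nat (x - 2)" and "u = nat (t - 1)"
      have cd: "x = int c + 2" "t = int u + 1" "u \<le> c" "c < length S" "c + 1 < length R"
        using x h len by (auto simp: c_def u_def)
      have "\<not> (S ! c < R ! u \<and> R ! u \<le> R ! (c + 1))"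
        using a cd unfolding avoids_def by blast
      then show False
        using cd h rn[of "c + 1"] rn[of u] sn[of c]
        by (auto simp: add.commute nat_less_eq_zless nat_le_eq_zle)
    next
      fix x y assume h: "x < y" "r x \<le> s y \<and> s y < s x"
      have y: "2 \<le> y" "y \<le> int (length S) + 1" using sM[of y] sM(2)[of x] h by auto
      have x: "1 \<le> x" "x \<le> int (length R)" using rM[of x] sM(1)[of y] y h by auto
      define d where "d = nat (y - 2)"
      have d: "y = int d + 2" "d < length S" using y by (auto simp: d_def)
      show False
      \<comment> \<open>Column 1 of the lower row has the value \<open>M\<close>, so this instance
        is the bound of the lower row by the first entry of \<open>R\<close>.\<close>
      proof (cases "x = 1")
        case True
        moreover have "S ! d < R ! 0" using a d unfolding avoids_def by blast
        ultimately show False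
          using h d r0 sn[of d] len by (auto simp: nat_less_eq_zless)
      next
        case False
        define c where "c = nat (x - 2)"
        have c: "x = int c + 2" "c < d" "c + 1 < length R" using x h d False by (auto simp: c_def)
        have "\<not> (R ! (c + 1) \<le> S ! d \<and> S ! d < S ! c)"
          using a c d unfolding avoids_def by blast
        then show False
          using c h d rn[of "c + 1"] sn[of c] sn[of d]
          by (auto simp: add.commute nat_less_eq_zless nat_le_eq_zle)
      qed
    qed
  next
    assume a: "above M R S"
    show "avoids R S"
      unfolding avoids_def
    proof (intro conjI allI impI)
      fix c assume c: "c < length S"
      have "\<not> (r 1 \<le> s (int c + 2) \<and> s (int c + 2) < s 1)" using a unfolding ab by auto
      then show "S ! c < R ! 0"
        using c r0 sn[of c] len sM(1)[of "int c + 2"] sM[of 1] by (auto simp: not_le nat_less_eq_zless)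
    next
      fix c d assume c: "c < d \<and> d < length S \<and> c + 1 < length R"
      then have "\<not> (r (int c + 2) \<le> s (int d + 2) \<and> s (int d + 2) < s (int c + 2))" using a unfolding ab by auto
      then show "\<not> (R ! (c + 1) \<le> S ! d \<and> S ! d < S ! c)"
        using c rn[of "c + 1"] sn[of c] sn[of d] by (auto simp: add.commute nat_less_eq_zless nat_le_eq_zle)
    next
      fix c d assume c: "c < d \<and> d < length S \<and> c + 2 < length R"
      show "\<not> (R ! (c + 1) < R ! (c + 2) \<and> S ! c < S ! d \<and> S ! d \<le> R ! (c + 1))"
      proof (cases "int (dip R) \<le> int c + 2")
        case True
        then have "\<not> (s (int c + 2) < s (int d + 2) \<and> s (int d + 2) \<le> r (int c + 2))" using a c unfolding ab by auto
        then show ?thesis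
          using c rn[of "c + 1"] sn[of c] sn[of d] by (auto simp: add.commute nat_less_eq_zless nat_le_eq_zle)
      next
        case False
        then show ?thesis using inc[of c] c by simp
      qed
    next
      fix c t assume c: "t \<le> c \<and> c < length S \<and> c + 1 < length R"
      show "\<not> (S ! c < R ! t \<and> R ! t \<le> R ! (c + 1))"
      proof (cases "int (dip R) \<le> int c + 2")
        case True
        then have "\<not> (s (int c + 2) < r (int t + 1) \<and> r (int t + 1) \<le> r (int c + 2))" using a c unfolding ab by auto
        then show ?thesis
          using c rn[of "c + 1"] rn[of t] sn[of c] by (auto simp: add.commute nat_less_eq_zless nat_le_eq_zle)
      next
        case False
        have "r (int c + 2) < r (int t + 1)" using R(1) False c unfolding valley_def r_def by auto
        then show ?thesis
          using c rn[of "c + 1"] rn[of t] by (auto simp: add.commute nat_le_eq_zle)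
      qed
    qed
  qed
qed

lemma strict_partition_shape_Cons:
  "strict_partition (shape (R # P)) \<longleftrightarrow>
     R \<noteq> [] \<and> length (top_row P) < length R \<and> strict_partition (shape P)"
  by (cases P) (auto simp: strict_partition_def shape_def top_row_def)

lemma valid_iff:
  assumes "\<forall>R\<in>set P. \<forall>x\<in>set R. int x < M"
  shows "valid M P \<longleftrightarrow> strict_partition (shape P) \<and> (\<forall>R\<in>set P. unimodal R)
    \<and>
    (\<forall>i. 1 \<le> i \<and> i < length P \<longrightarrow> avoids (P ! (i - 1)) (P ! i))"
  using assms
proof (induction P)
  case Nil
  then show ?case by (simp add: strict_partition_def shape_def)
next
  case (Cons R P)
  have IH: "valid M P \<longleftrightarrow> strict_partition (shape P) \<and> (\<forall>R\<in>set P. unimodal R) \<and>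
    (\<forall>i. 1 \<le> i \<and> i < length P \<longrightarrow> avoids (P ! (i - 1)) (P ! i))"
    using Cons by simp
  have uni: "valley M (row M R) 1 (length R) (dip R) \<and> 1 \<le> dip R \<and> dip R \<le> length R"
    if "unimodal R" "\<forall>x\<in>set R. int x < M" for R
    using that valley_rowI dip_eqI unfolding unimodal_def by (metis is_dip_def)
  have split: "(\<forall>i. 1 \<le> i \<and> i < length (R # P) \<longrightarrow> avoids ((R # P) ! (i - 1)) ((R # P) ! i)) \<longleftrightarrow>
    (P \<noteq> [] \<longrightarrow> avoids R (top_row P)) \<and> (\<forall>i. 1 \<le> i \<and> i < length P \<longrightarrow> avoids (P ! (i - 1)) (P ! i))"
    (is "?L \<longleftrightarrow> ?R")
  proof
    assume L: ?L
    have "P \<noteq> [] \<longrightarrow> avoids R (top_row P)" using L[rule_format, of 1] by (cases P) (auto simp: top_row_def)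
    moreover have "avoids (P ! (i - 1)) (P ! i)" if "1 \<le> i" "i < length P" for i
      using L[rule_format, of "i + 1"] that by (cases i) auto
    ultimately show ?R by blast
  next
    assume R: ?R
    show ?L
    proof (intro allI impI)
      fix i assume i: "1 \<le> i \<and> i < length (R # P)"
      show "avoids ((R # P) ! (i - 1)) ((R # P) ! i)"
      proof (cases "i = 1")
        case True
        then show ?thesis using R i by (cases P) (auto simp: top_row_def)
      next
        case False
        then obtain n where "i = n + 2" using i by (metis add_2_eq_Suc' less_eq_Suc_le nat_less_le le_Suc_ex One_nat_def Suc_1 add.commute)
        then show ?thesis using R i by (auto dest!: spec[of _ "n + 1"])
      qed
    qed
  qed
  have *: "above M R (top_row P) \<longleftrightarrow>
      R \<noteq> [] \<and> length (top_row P) < length R \<and> unimodal R \<and> (P \<noteq> [] \<longrightarrow> avoids R (top_row P))"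
    if P: "\<forall>R\<in>set P. unimodal R"
  proof (cases "P = []")
    case True
    show ?thesis
    proof
      assume "above M R (top_row P)"
      then show "R \<noteq> [] \<and> length (top_row P) < length R \<and> unimodal R \<and> (P \<noteq> [] \<longrightarrow> avoids R (top_row P))"
        using above_letters[of M R] True unfolding unimodal_def by blast
    next
      assume a: "R \<noteq> [] \<and> length (top_row P) < length R \<and> unimodal R \<and> (P \<noteq> [] \<longrightarrow> avoids R (top_row P))"
      then have u: "valley M (row M R) 1 (length R) (dip R)" "1 \<le> dip R" "dip R \<le> length R"
        using uni[of R] Cons.prems by auto
      have "low M [] x = M" for x by (simp add: low_def row_Nil)
      moreover have "\<not> M < row M R x" for x
        using u(1) row_out[of x R M] unfolding valley_def by (metis less_irrefl not_le less_asym)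
      ultimately show "above M R (top_row P)"
        using u True a by (auto simp: above_def stacked_def valley_def[of _ "low M []"] low_dip_def top_row_def)
    qed
  next
    case False
    have t: "unimodal (top_row P)" "\<forall>x\<in>set (top_row P). int x < M"
      using P Cons.prems False by (auto simp: top_row_def)
    note uS = uni[OF t]
    have tne: "top_row P \<noteq> []" using uS by auto
    show ?thesis
    proof
      assume a: "above M R (top_row P)"
      have "avoids R (top_row P)"
        using avoids_imp_stacked[of M R "top_row P"] above_letters[OF a] a tne uS by blast
      then show "R \<noteq> [] \<and> length (top_row P) < length R \<and> unimodal R \<and> (P \<noteq> [] \<longrightarrow> avoids R (top_row P))"
        using above_letters[OF a] unfolding unimodal_def by blast
    next
      assume a: "R \<noteq> [] \<and> length (top_row P) < length R \<and> unimodal R \<and> (P \<noteq> [] \<longrightarrow> avoids R (top_row P))"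
      then have u: "valley M (row M R) 1 (length R) (dip R)" "1 \<le> dip R" "dip R \<le> length R"
        using uni[of R] Cons.prems by auto
      then show "above M R (top_row P)"
        using avoids_imp_stacked[OF u tne] uS a False by blast
    qed
  qed
  show ?case
    unfolding valid.simps(2) IH split strict_partition_shape_Cons using * by auto
qed

text \<open>\<open>SDT\<close> does not by itself force decreasing row lengths, whereas
  \<open>valid\<close> does; hence the explicit condition on the shape.\<close>

lemma SDT_valid_iff:
  assumes "\<forall>R\<in>set P. \<forall>x\<in>set R. int x < M"
  shows "strict_partition (shape P) \<and> P \<in> SDT (shape P) \<longleftrightarrow> valid M P"
  unfolding valid_iff[OF assms] SDT_def
  using not_forbidden_iff[of _ P] by (auto simp: shape_def)

lemma ex_bound: "\<exists>M. \<forall>R\<in>set P. \<forall>x\<in>set R. int x < M"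
proof -
  have "finite (\<Union>R\<in>set P. set R)" by simp
  then obtain m where "\<forall>x\<in>(\<Union>R\<in>set P. set R). x < m" using finite_nat_set_iff_bounded by blast
  then show ?thesis by (intro exI[of _ "int m"]) auto
qed

lemma valid_letters: "valid M P \<Longrightarrow> \<forall>R\<in>set P. \<forall>x\<in>set R. int x < M"
  by (induction P) (auto dest: above_letters(1))

text \<open>By \<open>valid_iff\<close>, \<open>M\<close> enters only as a bound for the
  letters.\<close>

lemma valid_mono: "valid M P \<Longrightarrow> M \<le> N \<Longrightarrow> valid N P"
  using valid_letters[of M P] valid_iff[of P M] valid_iff[of P N] by fastforce

section \<open>Set-valued recording tableaux, element by element\<close>

section \<open>Recording tableaux\<close>

definition in_shape :: "nat list \<Rightarrow> nat \<Rightarrow> nat \<Rightarrow> bool" where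
  "in_shape mu i c \<longleftrightarrow> i < length mu \<and> c < mu ! i"

text \<open>Membership in \<open>ShSet\<close> in terms of elements. Rows and cells are counted from
  0, each row from its own start, so the cell below \<open>(i, c + 1)\<close> is
  \<open>(i + 1, c)\<close>.\<close>

definition standard :: "nat \<Rightarrow> nat set tableau \<Rightarrow> bool" where
  "standard n Q \<longleftrightarrow>
     (\<forall>i c. in_shape (shape Q) i c \<longrightarrow> Q ! i ! c \<noteq> {} \<and> Q ! i ! c \<subseteq> {1..n}) \<and>
     (\<forall>x\<in>{1..n}. \<exists>i c. in_shape (shape Q) i c \<and> x \<in> Q ! i ! c) \<and>
     (\<forall>i c i' c' x. in_shape (shape Q) i c \<and> in_shape (shape Q) i' c' \<and> x \<in> Q ! i ! c \<and> x \<in> Q ! i' ! c' \<longrightarrow>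
        i = i' \<and> c = c') \<and>
     (\<forall>i c x y. in_shape (shape Q) i (c + 1) \<and> in_shape (shape Q) (i + 1) c \<and>
        x \<in> Q ! i ! (c + 1) \<and> y \<in> Q ! (i + 1) ! c \<longrightarrow> x < y) \<and>
     (\<forall>i c x y. in_shape (shape Q) i (c + 1) \<and> x \<in> Q ! i ! c \<and> y \<in> Q ! i ! (c + 1) \<longrightarrow> x < y)"

lemma diagram_in_shape: "(i + 1, i + 1 + c) \<in> shifted_diagram mu \<longleftrightarrow> in_shape mu i c"
  by (auto simp: shifted_diagram_def in_shape_def)

lemma diagramE:
  assumes "(i, j) \<in> shifted_diagram mu"
  obtains a c where "i = a + 1" "j = a + 1 + c" "in_shape mu a c"
proof -
  have "1 \<le> i" "i \<le> j" using assms by (auto simp: shifted_diagram_def)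
  then obtain a c where "i = a + 1" "j = a + 1 + c" by (metis le_Suc_ex add.commute)
  then show thesis using that assms diagram_in_shape[of a c mu] by blast
qed

lemma entry_cell: "entry Q (i + 1) (i + 1 + c) = Q ! i ! c"
  by (simp add: entry_def)

lemma Max_less_Min_iff:
  fixes A B :: "nat set"
  assumes "finite A" "A \<noteq> {}" "finite B" "B \<noteq> {}"
  shows "Max A < Min B \<longleftrightarrow> (\<forall>x\<in>A. \<forall>y\<in>B. x < y)"
  using assms by (metis Max_in Max_ge Min_in Min_le le_less_trans less_le_trans)

lemma ShSet_iff_standard: "Q \<in> ShSet n mu \<longleftrightarrow> shape Q = mu \<and> standard n Q"
proof (cases "shape Q = mu")
  case False
  then show ?thesis by (simp add: ShSet_def)
next
  case sh: True
  have ball: "(\<forall>(i, j)\<in>shifted_diagram mu. F i j) \<longleftrightarrow> (\<forall>i c. in_shape mu i c \<longrightarrow> F (i + 1) (i + 1 + c))" for F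
  proof (intro iffI allI impI ballI)
    fix i c assume "\<forall>(i, j)\<in>shifted_diagram mu. F i j" "in_shape mu i c"
    then show "F (i + 1) (i + 1 + c)" using diagram_in_shape[of i c mu] by blast
  next
    fix z assume a: "\<forall>i c. in_shape mu i c \<longrightarrow> F (i + 1) (i + 1 + c)" "z \<in> shifted_diagram mu"
    obtain i j where z: "z = (i, j)" by fastforce
    then have "(i, j) \<in> shifted_diagram mu" using a(2) by simp
    then obtain b c where "i = b + 1" "j = b + 1 + c" "in_shape mu b c" by (rule diagramE)
    then show "case z of (i, j) \<Rightarrow> F i j" using a(1) z by simp
  qed
  have un: "(\<Union>(i, j)\<in>shifted_diagram mu. entry Q i j) = {x. \<exists>i c. in_shape mu i c \<and> x \<in> Q ! i ! c}"
  proof (intro set_eqI iffI)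
    fix x assume "x \<in> (\<Union>(i, j)\<in>shifted_diagram mu. entry Q i j)"
    then obtain i j where ij: "(i, j) \<in> shifted_diagram mu" "x \<in> entry Q i j" by auto
    from ij(1) obtain a c where "i = a + 1" "j = a + 1 + c" "in_shape mu a c" by (rule diagramE)
    then show "x \<in> {x. \<exists>i c. in_shape mu i c \<and> x \<in> Q ! i ! c}" using ij(2) entry_cell[of Q a c] by auto
  next
    fix x assume "x \<in> {x. \<exists>i c. in_shape mu i c \<and> x \<in> Q ! i ! c}"
    then obtain i c where "in_shape mu i c" "x \<in> Q ! i ! c" by auto
    then show "x \<in> (\<Union>(i, j)\<in>shifted_diagram mu. entry Q i j)"
      using diagram_in_shape[of i c mu] entry_cell[of Q i c]
      by (intro UN_I[of "(i + 1, i + 1 + c)"]) simp_all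
  qed
  have "Q \<in> ShSet n mu \<longleftrightarrow>
     (\<forall>i c. in_shape mu i c \<longrightarrow> Q ! i ! c \<noteq> {}) \<and>
     {x. \<exists>i c. in_shape mu i c \<and> x \<in> Q ! i ! c} = {1..n} \<and>
     (\<forall>i c. in_shape mu i c \<longrightarrow> (\<forall>i' c'. in_shape mu i' c' \<longrightarrow>
        (i, c) \<noteq> (i', c') \<longrightarrow> Q ! i ! c \<inter> Q ! i' ! c' = {})) \<and>
     (\<forall>i c. in_shape mu i c \<longrightarrow>
        (\<forall>c'. c = c' + 1 \<and> in_shape mu (i + 1) c' \<longrightarrow> Max (Q ! i ! c) < Min (Q ! (i + 1) ! c')) \<and>
        (in_shape mu i (c + 1) \<longrightarrow> Max (Q ! i ! c) < Min (Q ! i ! (c + 1))))"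
  proof -
    have e2: "entry Q (i + 1 + 1) (i + 1 + 1 + c) = Q ! (i + 1) ! c" for i c
      using entry_cell[of Q "i + 1" c] by simp
    have down: "((i + 1 + 1, i + 1 + c) \<in> shifted_diagram mu \<longrightarrow> v < Min (entry Q (i + 1 + 1) (i + 1 + c))) \<longleftrightarrow>
      (\<forall>c'. c = c' + 1 \<and> in_shape mu (i + 1) c' \<longrightarrow> v < Min (Q ! (i + 1) ! c'))" for i c v
    proof (cases c)
      case 0
      then show ?thesis by (auto simp: shifted_diagram_def)
    next
      case (Suc c')
      then have c: "i + 1 + c = i + 1 + 1 + c'" by simp
      show ?thesis unfolding c e2 diagram_in_shape[of "i + 1" c' mu] using Suc by auto
    qed
    have right: "(i + 1, i + 1 + c + 1) \<in> shifted_diagram mu \<longleftrightarrow> in_shape mu i (c + 1)"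
      "entry Q (i + 1) (i + 1 + c + 1) = Q ! i ! (c + 1)" for i c
      using diagram_in_shape[of i "c + 1" mu] entry_cell[of Q i "c + 1"] by (simp_all add: add.assoc)
    have ne: "(i + 1, i + 1 + c) = (i' + 1, i' + 1 + c') \<longleftrightarrow> (i, c) = (i', c')" for i c i' c' :: nat
      by auto
    show ?thesis
      unfolding ShSet_def mem_Collect_eq ball un entry_cell right down ne
      by (simp only: sh simp_thms)
  qed
  also have "\<dots> \<longleftrightarrow> standard n Q"
  \<comment> \<open>On infinite or empty sets \<open>Max\<close> and \<open>Min\<close> say nothing
    about elements, so the comparison is made only once the cells are known to be non-empty subsets
    of \<open>{1..n}\<close>.\<close>
  proof (cases "(\<forall>i c. in_shape mu i c \<longrightarrow> Q ! i ! c \<noteq> {}) \<and> (\<forall>i c. in_shape mu i c \<longrightarrow> Q ! i ! c \<subseteq> {1..n})")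
    case True
    have fin: "finite (Q ! i ! c)" "Q ! i ! c \<noteq> {}" if "in_shape mu i c" for i c
      using True that finite_subset[of "Q ! i ! c" "{1..n}"] by blast+
    have prev: "in_shape mu i c" if "in_shape mu i (c + 1)" for i c using that by (simp add: in_shape_def)
    have mm: "Max (Q ! i ! c) < Min (Q ! i' ! c') \<longleftrightarrow> (\<forall>x\<in>Q ! i ! c. \<forall>y\<in>Q ! i' ! c'. x < y)"
      if "in_shape mu i c" "in_shape mu i' c'" for i c i' c'
      using Max_less_Min_iff[OF fin[OF that(1)] fin[OF that(2)]] .
    have "(\<forall>i c. in_shape mu i c \<longrightarrow>
        (\<forall>c'. c = c' + 1 \<and> in_shape mu (i + 1) c' \<longrightarrow> Max (Q ! i ! c) < Min (Q ! (i + 1) ! c')) \<and>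
        (in_shape mu i (c + 1) \<longrightarrow> Max (Q ! i ! c) < Min (Q ! i ! (c + 1)))) \<longleftrightarrow>
      (\<forall>i c. in_shape mu i (c + 1) \<and> in_shape mu (i + 1) c \<longrightarrow> Max (Q ! i ! (c + 1)) < Min (Q ! (i + 1) ! c)) \<and>
      (\<forall>i c. in_shape mu i (c + 1) \<longrightarrow> Max (Q ! i ! c) < Min (Q ! i ! (c + 1)))"
      using prev by blast
    also have "\<dots> \<longleftrightarrow>
      (\<forall>i c x y. in_shape mu i (c + 1) \<and> in_shape mu (i + 1) c \<and> x \<in> Q ! i ! (c + 1) \<and> y \<in> Q ! (i + 1) ! c \<longrightarrow> x < y) \<and>
      (\<forall>i c x y. in_shape mu i (c + 1) \<and> x \<in> Q ! i ! c \<and> y \<in> Q ! i ! (c + 1) \<longrightarrow> x < y)"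
    proof (rule arg_cong2[where f = "(\<and>)"])
      show "(\<forall>i c. in_shape mu i (c + 1) \<and> in_shape mu (i + 1) c \<longrightarrow> Max (Q ! i ! (c + 1)) < Min (Q ! (i + 1) ! c)) \<longleftrightarrow>
        (\<forall>i c x y. in_shape mu i (c + 1) \<and> in_shape mu (i + 1) c \<and> x \<in> Q ! i ! (c + 1) \<and> y \<in> Q ! (i + 1) ! c \<longrightarrow> x < y)"
        by (meson mm)
      show "(\<forall>i c. in_shape mu i (c + 1) \<longrightarrow> Max (Q ! i ! c) < Min (Q ! i ! (c + 1))) \<longleftrightarrow>
        (\<forall>i c x y. in_shape mu i (c + 1) \<and> x \<in> Q ! i ! c \<and> y \<in> Q ! i ! (c + 1) \<longrightarrow> x < y)"
        by (meson mm prev)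
    qed
    finally have order: "(\<forall>i c. in_shape mu i c \<longrightarrow>
        (\<forall>c'. c = c' + 1 \<and> in_shape mu (i + 1) c' \<longrightarrow> Max (Q ! i ! c) < Min (Q ! (i + 1) ! c')) \<and>
        (in_shape mu i (c + 1) \<longrightarrow> Max (Q ! i ! c) < Min (Q ! i ! (c + 1)))) \<longleftrightarrow>
      (\<forall>i c x y. in_shape mu i (c + 1) \<and> in_shape mu (i + 1) c \<and> x \<in> Q ! i ! (c + 1) \<and> y \<in> Q ! (i + 1) ! c \<longrightarrow> x < y) \<and>
      (\<forall>i c x y. in_shape mu i (c + 1) \<and> x \<in> Q ! i ! c \<and> y \<in> Q ! i ! (c + 1) \<longrightarrow> x < y)" .
    have cover: "{x. \<exists>i c. in_shape mu i c \<and> x \<in> Q ! i ! c} = {1..n} \<longleftrightarrow>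
      (\<forall>x\<in>{1..n}. \<exists>i c. in_shape mu i c \<and> x \<in> Q ! i ! c)"
      using True by blast
    have disj: "(\<forall>i c. in_shape mu i c \<longrightarrow> (\<forall>i' c'. in_shape mu i' c' \<longrightarrow>
        (i, c) \<noteq> (i', c') \<longrightarrow> Q ! i ! c \<inter> Q ! i' ! c' = {})) \<longleftrightarrow>
      (\<forall>i c i' c' x. in_shape mu i c \<and> in_shape mu i' c' \<and> x \<in> Q ! i ! c \<and> x \<in> Q ! i' ! c' \<longrightarrow> i = i' \<and> c = c')"
      by blast
    show ?thesis unfolding standard_def sh order cover disj using True by blast
  next
    case False
    then show ?thesis unfolding standard_def sh by blast
  qed
  finally show ?thesis using sh by simp
qed

text \<open>The cell receiving \<open>n + 1\<close> may be old or new, which treats growth and stay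
  together. It must have no right or lower neighbour, as \<open>n + 1\<close> is the largest
  entry.\<close>

lemma standard_add:
  assumes Q: "standard n Q"
    and cells: "\<And>i c. in_shape (shape Q') i c \<longleftrightarrow> in_shape (shape Q) i c \<or> i = i0 \<and> c = c0"
    and vals: "\<And>i c. in_shape (shape Q') i c \<Longrightarrow>
      Q' ! i ! c = (if in_shape (shape Q) i c then Q ! i ! c else {}) \<union> (if i = i0 \<and> c = c0 then {n + 1} else {})"
    and corner: "\<not> in_shape (shape Q') i0 (c0 + 1)" "\<And>c. c0 = c + 1 \<Longrightarrow> \<not> in_shape (shape Q') (i0 + 1) c"
  shows "standard (n + 1) Q'"
proof -
  let ?s = "in_shape (shape Q)" and ?s' = "in_shape (shape Q')"
  have ne: "Q ! i ! c \<noteq> {}" "Q ! i ! c \<subseteq> {1..n}" if "?s i c" for i c using Q that by (auto simp: standard_def)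
  have mem: "x \<in> Q' ! i ! c \<longleftrightarrow> ?s i c \<and> x \<in> Q ! i ! c \<or> i = i0 \<and> c = c0 \<and> x = n + 1" if "?s' i c" for i c x
    using vals[OF that] by auto
  have le: "x \<le> n" if "?s i c" "x \<in> Q ! i ! c" for i c x using ne(2)[OF that(1)] that(2) by auto
  have prev: "?s i c" if "?s i (c + 1)" for i c using that by (simp add: in_shape_def)
  have prev': "?s' i c" if "?s' i (c + 1)" for i c using that by (simp add: in_shape_def)
  show ?thesis
    unfolding standard_def
  proof (intro conjI allI impI ballI; (elim conjE)?)
    fix i c assume s: "?s' i c"
    show "Q' ! i ! c \<noteq> {}" using vals[OF s] ne(1)[of i c] cells[of i c] s by auto
    show "Q' ! i ! c \<subseteq> {1..n + 1}" using mem[OF s] ne(2)[of i c] by fastforce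
  next
    fix x assume x: "x \<in> {1..n + 1}"
    show "\<exists>i c. ?s' i c \<and> x \<in> Q' ! i ! c"
    proof (cases "x = n + 1")
      case True
      then show ?thesis using cells[of i0 c0] mem[of i0 c0] by blast
    next
      case False
      then have "x \<in> {1..n}" using x by auto
      then obtain i c where "?s i c" "x \<in> Q ! i ! c" using Q unfolding standard_def by blast
      then show ?thesis using cells[of i c] mem[of i c] by blast
    qed
  next
    fix i c i' c' x assume s: "?s' i c" "?s' i' c'" "x \<in> Q' ! i ! c" "x \<in> Q' ! i' ! c'"
    have "x \<noteq> n + 1 \<longrightarrow> i = i' \<and> c = c'" using s mem Q unfolding standard_def by metis
    moreover have "x = n + 1 \<longrightarrow> i = i0 \<and> c = c0 \<and> i' = i0 \<and> c' = c0"
      using s mem[OF s(1)] mem[OF s(2)] le[of i c x] le[of i' c' x] by auto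
    ultimately show "i = i'" "c = c'" by auto
  next
    fix i c x y assume s: "?s' i (c + 1)" "?s' (i + 1) c" "x \<in> Q' ! i ! (c + 1)" "y \<in> Q' ! (i + 1) ! c"
    have x: "?s i (c + 1)" "x \<in> Q ! i ! (c + 1)"
      using s(1,2,3) mem[OF s(1)] corner(2)[of c] by auto
    have "?s (i + 1) c \<and> y \<in> Q ! (i + 1) ! c \<or> y = n + 1" using s(4) mem[OF s(2)] by blast
    then show "x < y" using x Q le[OF x] unfolding standard_def by auto
  next
    fix i c x y assume s: "?s' i (c + 1)" "x \<in> Q' ! i ! c" "y \<in> Q' ! i ! (c + 1)"
    have x: "?s i c" "x \<in> Q ! i ! c"
      using s mem[OF prev'[OF s(1)]] corner(1) by auto
    have "?s i (c + 1) \<and> y \<in> Q ! i ! (c + 1) \<or> y = n + 1" using s(3) mem[OF s(1)] by blast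
    then show "x < y" using x Q le[OF x] unfolding standard_def by auto
  qed
qed

lemma standard_last:
  assumes Q: "standard (n + 1) Q"
  obtains i0 c0 where "in_shape (shape Q) i0 c0" "n + 1 \<in> Q ! i0 ! c0"
    "\<not> in_shape (shape Q) i0 (c0 + 1)" "\<And>c. c0 = c + 1 \<Longrightarrow> \<not> in_shape (shape Q) (i0 + 1) c"
proof -
  have "n + 1 \<in> {1..n + 1}" by simp
  then obtain i0 c0 where 0: "in_shape (shape Q) i0 c0" "n + 1 \<in> Q ! i0 ! c0"
    using Q unfolding standard_def by blast
  have le: "\<exists>y\<in>Q ! i ! c. y \<le> n + 1" if "in_shape (shape Q) i c" for i c
    using Q that unfolding standard_def by fastforce
  have "\<not> in_shape (shape Q) i0 (c0 + 1)"
    using le[of i0 "c0 + 1"] 0 Q unfolding standard_def by (metis not_le)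
  moreover have "\<not> in_shape (shape Q) (i0 + 1) c" if "c0 = c + 1" for c
    using le[of "i0 + 1" c] 0 Q that unfolding standard_def by (metis not_le)
  ultimately show thesis using that 0 by blast
qed

text \<open>Inverse of \<open>standard_add\<close>: a cell disappears exactly if
  \<open>n + 1\<close> was its only element.\<close>

lemma standard_remove:
  assumes Q': "standard (n + 1) Q'" and 0: "in_shape (shape Q') i0 c0" "n + 1 \<in> Q' ! i0 ! c0"
    and cells: "\<And>i c. in_shape (shape Q) i c \<longleftrightarrow> in_shape (shape Q') i c \<and> Q' ! i ! c \<noteq> {n + 1}"
    and vals: "\<And>i c. in_shape (shape Q) i c \<Longrightarrow> Q ! i ! c = Q' ! i ! c - {n + 1}"
  shows "standard n Q"
proof -
  let ?s = "in_shape (shape Q)" and ?s' = "in_shape (shape Q')"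
  have prev: "?s i c" if "?s i (c + 1)" for i c using that by (simp add: in_shape_def)
  show ?thesis
    unfolding standard_def
  proof (intro conjI allI impI ballI; (elim conjE)?)
    fix i c assume s: "?s i c"
    then have s': "?s' i c" "Q' ! i ! c \<noteq> {n + 1}" using cells by auto
    then have "Q' ! i ! c \<noteq> {}" "Q' ! i ! c \<subseteq> {1..n + 1}" using Q' unfolding standard_def by blast+
    then show "Q ! i ! c \<noteq> {}" "Q ! i ! c \<subseteq> {1..n}" using vals[OF s] s'(2) by force+
  next
    fix x assume x: "x \<in> {1..n}"
    then have "x \<in> {1..n + 1}" "x \<noteq> n + 1" by auto
    then obtain i c where "?s' i c" "x \<in> Q' ! i ! c" using Q' unfolding standard_def by blast
    then show "\<exists>i c. ?s i c \<and> x \<in> Q ! i ! c" using cells vals \<open>x \<noteq> n + 1\<close> by blast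
  next
    fix i c i' c' x assume s: "?s i c" "?s i' c'" "x \<in> Q ! i ! c" "x \<in> Q ! i' ! c'"
    have "?s' i c" "?s' i' c'" "x \<in> Q' ! i ! c" "x \<in> Q' ! i' ! c'" using s cells vals by auto
    then have "i = i' \<and> c = c'" using Q' unfolding standard_def by blast
    then show "i = i'" "c = c'" by auto
  next
    fix i c x y assume s: "?s i (c + 1)" "?s (i + 1) c" "x \<in> Q ! i ! (c + 1)" "y \<in> Q ! (i + 1) ! c"
    have "?s' i (c + 1)" "?s' (i + 1) c" "x \<in> Q' ! i ! (c + 1)" "y \<in> Q' ! (i + 1) ! c" using s cells vals by auto
    then show "x < y" using Q' unfolding standard_def by blast
  next
    fix i c x y assume s: "?s i (c + 1)" "x \<in> Q ! i ! c" "y \<in> Q ! i ! (c + 1)"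
    have "?s' i (c + 1)" "x \<in> Q' ! i ! c" "y \<in> Q' ! i ! (c + 1)" using s cells vals prev[OF s(1)] by auto
    then show "x < y" using Q' unfolding standard_def by blast
  qed
qed

lemma tableau_eqI:
  assumes "shape Q = shape Q'" "\<And>i c. in_shape (shape Q) i c \<Longrightarrow> Q ! i ! c = Q' ! i ! c"
  shows "Q = Q'"
proof (rule nth_equalityI)
  show l: "length Q = length Q'" using assms(1) by (metis length_map shape_def)
  fix i assume i: "i < length Q"
  have li: "length (Q ! i) = length (Q' ! i)"
    using assms(1) i l by (metis nth_map shape_def)
  show "Q ! i = Q' ! i"
    by (rule nth_equalityI[OF li]) (use assms(2)[of i] i in \<open>auto simp: in_shape_def shape_def\<close>)
qed

definition new_col :: "nat list \<Rightarrow> nat \<Rightarrow> nat" where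
  "new_col mu k = (if k = length mu + 1 then 0 else mu ! (k - 1))"

lemma in_shape_add_box:
  assumes "1 \<le> k" "k \<le> length mu + 1"
  shows
    "in_shape (add_box mu k) i c \<longleftrightarrow> in_shape mu i c \<or> i = k - 1 \<and> c = new_col mu k"
  using assms by (auto simp: in_shape_def add_box_def new_col_def nth_append nth_list_update less_Suc_eq)

lemma record_growth_shape: "shape (record_growth t mu mu' Q) = mu'"
  by (rule nth_equalityI) (simp_all add: record_growth_def shape_def del: upt_Suc)

lemma record_growth_nth:
  assumes "in_shape mu' i c"
  shows "record_growth t mu mu' Q ! i ! c = (if in_shape mu i c then Q ! i ! c else {t})"
  using assms diagram_in_shape[of i c mu] entry_cell[of Q i c]
  by (simp add: record_growth_def in_shape_def nth_upt del: upt_Suc)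

text \<open>In a shifted diagram the columns in which the rows end weakly decrease
  downwards.\<close>

lemma strict_partition_decreasing:
  assumes "strict_partition mu" "k \<le> l" "l < length mu"
  shows "mu ! l + l \<le> mu ! k + k"
  using assms(2,3)
proof (induction l rule: dec_induct)
  case (step l)
  have "mu ! Suc l < mu ! l"
    using assms(1) step.prems unfolding strict_partition_def by (auto intro: sorted_wrt_nth_less[where P = "(>)"])
  then show ?case using step by simp
qed simp

text \<open>At a corner the next row ends in an earlier column, and the rows further down do not end
  later. The row selected in \<open>record_stay\<close> is thus \<open>k\<close> itself.\<close>

lemma record_stay_eq:
  assumes mu: "strict_partition mu" "shape Q = mu" and k: "corner Q k"
  shows
    "record_stay t mu k Q = Q[k - 1 := (Q ! (k - 1))[mu ! (k - 1) - 1 := insert t (Q ! (k - 1) ! (mu ! (k - 1) - 1))]]"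
proof -
  have k1: "1 \<le> k" "k \<le> length mu" "k < length mu \<longrightarrow> mu ! k + 1 < mu ! (k - 1)"
    using k mu(2) by (auto simp: corner_def shape_def)
  have pos: "0 < mu ! (k - 1)" using mu(1) k1 by (auto simp: strict_partition_def)
  have "Max {l. 1 \<le> l \<and> l \<le> length mu \<and> mu ! (l - 1) + l = mu ! (k - 1) + k} = k"
  proof (rule Max_eqI)
    show "finite {l. 1 \<le> l \<and> l \<le> length mu \<and> mu ! (l - 1) + l = mu ! (k - 1) + k}" by simp
    show "k \<in> {l. 1 \<le> l \<and> l \<le> length mu \<and> mu ! (l - 1) + l = mu ! (k - 1) + k}" using k1 by simp
    fix l assume l: "l \<in> {l. 1 \<le> l \<and> l \<le> length mu \<and> mu ! (l - 1) + l = mu ! (k - 1) + k}"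
    show "l \<le> k"
    proof (rule ccontr)
      assume "\<not> l \<le> k"
      then have "mu ! (l - 1) + (l - 1) \<le> mu ! k + k" "k < length mu"
        using strict_partition_decreasing[OF mu(1), of k "l - 1"] l by auto
      then show False using l k1 \<open>\<not> l \<le> k\<close> by auto
    qed
  qed
  then show ?thesis
    using k1 pos by (simp add: record_stay_def Let_def entry_def)
qed

section \<open>One insertion step on pairs of tableaux\<close>

definition pairs :: "nat \<Rightarrow> (nat tableau \<times> nat set tableau) set" where
  "pairs n = {(P, Q). strict_partition (shape P) \<and> P \<in> SDT (shape P) \<and> Q \<in> ShSet n (shape P)}"

lemma pairs_iff: "(P, Q) \<in> pairs n \<longleftrightarrow> (\<exists>M. valid M P) \<and> shape Q = shape P \<and> standard n Q"
proof -
  have "strict_partition (shape P) \<and> P \<in> SDT (shape P) \<longleftrightarrow> (\<exists>M. valid M P)"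
    using ex_bound[of P] SDT_valid_iff[of P] valid_letters[of _ P] by metis
  then show ?thesis using ShSet_iff_standard[of Q n "shape P"] unfolding pairs_def by blast
qed

lemma valid_strict_partition: "valid M P \<Longrightarrow> strict_partition (shape P)"
  using SDT_valid_iff[OF valid_letters[of M P]] by blast

lemma corner_shape:
  "corner P k \<longleftrightarrow> 1 \<le> k \<and> k \<le> length (shape P) \<and>
     (k < length (shape P) \<longrightarrow> shape P ! k + 1 < shape P ! (k - 1))"
  by (auto simp: corner_def shape_def)

lemma KH_step_eq:
  assumes "tableau_insert a P = (P', k)"
  shows "KH_step (P, Q) (t, a) = (P', if shape P' = shape P then record_stay t (shape P) k Q
    else record_growth t (shape P) (shape P') Q)"
  using assms by (simp add: KH_step_def)

text \<open>Growth and stay become uniform when the cell is described in the new shape: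
  \<open>t\<close> always enters the last cell of row \<open>k\<close>, and the shape has grown
  exactly if that cell is new.\<close>

lemma KH_step_record:
  assumes P: "valid M P" "int a < M" and Q: "shape Q = shape P"
    and ins: "tableau_insert a P = (P', k)" and step: "KH_step (P, Q) (t, a) = (P', Q')"
    and i0: "i0 = k - 1" and c0: "c0 = shape P' ! (k - 1) - 1"
  shows "1 \<le> k" "shape Q' = shape P'" "in_shape (shape P') i0 c0"
    "in_shape (shape P') i c \<longleftrightarrow> in_shape (shape P) i c \<or> i = i0 \<and> c = c0"
    "in_shape (shape P') i c \<Longrightarrow>
      Q' ! i ! c = (if in_shape (shape P) i c then Q ! i ! c else {}) \<union> (if i = i0 \<and> c = c0 then {t} else {})"
    "shape P' = shape P \<longleftrightarrow> in_shape (shape P) i0 c0"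
    "\<not> in_shape (shape P') i0 (c0 + 1)" "c0 = d + 1 \<Longrightarrow> \<not> in_shape (shape P') (i0 + 1) d"
proof -
  have P': "valid M P'" "corner P' k" "shape P' = shape P \<or> shape P' = add_box (shape P) k"
    using tableau_insert_valid[OF P ins] by auto
  have sp: "strict_partition (shape P')" "strict_partition (shape P)"
    using valid_strict_partition P P' by blast+
  have k: "1 \<le> k" "k \<le> length (shape P')"
    "k < length (shape P') \<Longrightarrow> shape P' ! k + 1 < shape P' ! (k - 1)"
    using P'(2) unfolding corner_shape by auto
  show "1 \<le> k" by (fact k(1))
  have pos: "0 < shape P' ! (k - 1)" using sp(1) k unfolding strict_partition_def by auto
  show in0: "in_shape (shape P') i0 c0" using k pos unfolding in_shape_def i0 c0 by auto
  show "\<not> in_shape (shape P') i0 (c0 + 1)" using pos unfolding in_shape_def i0 c0 by auto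
  show "\<not> in_shape (shape P') (i0 + 1) d" if "c0 = d + 1"
    using that k unfolding in_shape_def i0 c0 by auto
  have "shape Q' = shape P' \<and> (in_shape (shape P') i c \<longleftrightarrow> in_shape (shape P) i c \<or> i = i0 \<and> c = c0) \<and>
    (in_shape (shape P') i c \<longrightarrow>
      Q' ! i ! c = (if in_shape (shape P) i c then Q ! i ! c else {}) \<union> (if i = i0 \<and> c = c0 then {t} else {})) \<and>
    (shape P' = shape P \<longleftrightarrow> in_shape (shape P) i0 c0)"
  proof (cases "shape P' = shape P")
    case True
    have "corner Q k" using P'(2) Q True unfolding corner_shape by simp
    then have Q': "Q' = Q[i0 := (Q ! i0)[c0 := insert t (Q ! i0 ! c0)]]"
      using step record_stay_eq[OF sp(2) Q, of k t] True unfolding KH_step_eq[OF ins] i0 c0 by simp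
    have "shape Q' = shape Q"
    proof -
      have "i0 < length Q" using k Q True unfolding i0 shape_def by (metis One_nat_def Suc_le_eq Suc_pred length_map less_le_trans zero_less_one)
      then show ?thesis unfolding Q' shape_def map_update by (simp, metis list_update_id nth_map)
    qed
    moreover have "Q' ! i ! c = Q ! i ! c \<union> (if i = i0 \<and> c = c0 then {t} else {})"
      if "in_shape (shape P') i c" for i c
    proof -
      have "in_shape (shape Q) i c" using that True Q by simp
      then have "i < length Q" "c < length (Q ! i)" by (auto simp: in_shape_def shape_def)
      then show ?thesis unfolding Q' by (cases "i = i0"; cases "c = c0") auto
    qed
    ultimately show ?thesis using True in0 Q by auto
  next
    case False
    then have ab: "shape P' = add_box (shape P) k" using P'(3) by simp
    have k': "k \<le> length (shape P) + 1"
      using k(2) unfolding ab by (auto simp: add_box_def split: if_splits)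
    have c0': "c0 = new_col (shape P) k"
      using k k' unfolding c0 ab by (auto simp: add_box_def new_col_def nth_append)
    have cells: "in_shape (shape P') i c \<longleftrightarrow> in_shape (shape P) i c \<or> i = i0 \<and> c = c0" for i c
      unfolding ab in_shape_add_box[OF k(1) k'] i0 c0' by simp
    have not: "\<not> in_shape (shape P) i0 c0"
      using k(1) k' unfolding in_shape_def i0 c0' new_col_def by auto
    have Q': "Q' = record_growth t (shape P) (shape P') Q"
      using step False unfolding KH_step_eq[OF ins] by simp
    show ?thesis
      using False not cells record_growth_shape[of t "shape P" "shape P'" Q]
        record_growth_nth[of "shape P'" i c t "shape P" Q] unfolding Q' by auto
  qed
  then show "shape Q' = shape P'"
    "in_shape (shape P') i c \<longleftrightarrow> in_shape (shape P) i c \<or> i = i0 \<and> c = c0"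
    "in_shape (shape P') i c \<Longrightarrow>
      Q' ! i ! c = (if in_shape (shape P) i c then Q ! i ! c else {}) \<union> (if i = i0 \<and> c = c0 then {t} else {})"
    "shape P' = shape P \<longleftrightarrow> in_shape (shape P) i0 c0" by blast+
qed

text \<open>The bound is raised to exceed the next letter as well.\<close>

lemma pairs_bound:
  assumes "(P, Q) \<in> pairs n"
  obtains M where "valid M P" "int a < M"
proof -
  obtain M where "valid M P" using assms pairs_iff by blast
  then have "valid (max M (int a + 1)) P" using valid_mono by auto
  then show thesis using that[of "max M (int a + 1)"] by auto
qed

lemma KH_step_in:
  assumes "(P, Q) \<in> pairs n"
  shows "KH_step (P, Q) (n + 1, a) \<in> pairs (n + 1)"
proof -
  obtain M where M: "valid M P" "int a < M" using assms by (rule pairs_bound)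
  have Q: "shape Q = shape P" "standard n Q" using assms unfolding pairs_iff by auto
  obtain P' k where ins: "tableau_insert a P = (P', k)" by fastforce
  obtain Q' where step: "KH_step (P, Q) (n + 1, a) = (P', Q')" using KH_step_eq[OF ins] by blast
  note rec = KH_step_record[OF M Q(1) ins step refl refl]
  have "standard (n + 1) Q'"
  proof (rule standard_add[OF Q(2)])
    show "in_shape (shape Q') i c \<longleftrightarrow> in_shape (shape Q) i c \<or> i = k - 1 \<and> c = shape P' ! (k - 1) - 1" for i c
      using rec(4)[of i c] unfolding rec(2) Q(1) .
    show "Q' ! i ! c = (if in_shape (shape Q) i c then Q ! i ! c else {}) \<union>
      (if i = k - 1 \<and> c = shape P' ! (k - 1) - 1 then {n + 1} else {})" if "in_shape (shape Q') i c" for i c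
      using rec(5)[of i c] that unfolding rec(2) Q(1) by blast
    show "\<not> in_shape (shape Q') (k - 1) (shape P' ! (k - 1) - 1 + 1)" using rec(7) unfolding rec(2) .
    show "\<not> in_shape (shape Q') (k - 1 + 1) c" if "shape P' ! (k - 1) - 1 = c + 1" for c
      using rec(8)[OF that] unfolding rec(2) .
  qed
  then show ?thesis
    unfolding step pairs_iff using tableau_insert_valid[OF M ins] rec(2) by blast
qed

text \<open>The entries of the earlier recording tableaux are at most \<open>n\<close>, so
  \<open>n + 1\<close> marks the cell in which the step ended and thereby the row
  \<open>k\<close>.\<close>

lemma KH_step_inj:
  assumes "(P1, Q1) \<in> pairs n" "(P2, Q2) \<in> pairs n"
    and eq: "KH_step (P1, Q1) (n + 1, a1) = KH_step (P2, Q2) (n + 1, a2)"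
  shows "a1 = a2 \<and> P1 = P2 \<and> Q1 = Q2"
proof -
  obtain M1 where M1: "valid M1 P1" "int a1 < M1" using assms(1) by (rule pairs_bound)
  obtain M2 where M2: "valid M2 P2" "int a2 < M2" using assms(2) by (rule pairs_bound)
  define M where "M = max M1 M2"
  have M: "valid M P1" "int a1 < M" "valid M P2" "int a2 < M"
    using M1 M2 valid_mono unfolding M_def by auto
  have Q: "shape Q1 = shape P1" "standard n Q1" "shape Q2 = shape P2" "standard n Q2"
    using assms(1,2) unfolding pairs_iff by auto
  obtain P' k1 where ins1: "tableau_insert a1 P1 = (P', k1)" by fastforce
  obtain Q' where step1: "KH_step (P1, Q1) (n + 1, a1) = (P', Q')" using KH_step_eq[OF ins1] by blast
  obtain k2 where ins2: "tableau_insert a2 P2 = (P', k2)"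
    using eq step1 unfolding KH_step_def by (auto split: prod.splits)
  have step2: "KH_step (P2, Q2) (n + 1, a2) = (P', Q')" using eq step1 by simp
  note rec1 = KH_step_record[OF M(1,2) Q(1) ins1 step1 refl refl]
  note rec2 = KH_step_record[OF M(3,4) Q(3) ins2 step2 refl refl]
  have Q': "standard (n + 1) Q'"
    using KH_step_in[OF assms(1), of a1] unfolding step1 pairs_iff by blast
  have small: "n + 1 \<notin> Q1 ! i ! c" "Q1 ! i ! c \<noteq> {}" if "in_shape (shape P1) i c" for i c
    using Q(1,2) that unfolding standard_def by fastforce+
  have small2: "n + 1 \<notin> Q2 ! i ! c" "Q2 ! i ! c \<noteq> {}" if "in_shape (shape P2) i c" for i c
    using Q(3,4) that unfolding standard_def by fastforce+
  have "n + 1 \<in> Q' ! (k1 - 1) ! (shape P' ! (k1 - 1) - 1)" "n + 1 \<in> Q' ! (k2 - 1) ! (shape P' ! (k2 - 1) - 1)"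
    using rec1(5)[OF rec1(3)] rec2(5)[OF rec2(3)] by auto
  then have "k1 - 1 = k2 - 1"
    using Q' rec1(2,3) rec2(3) unfolding standard_def by metis
  then have k: "k2 = k1" using rec1(1) rec2(1) by simp
  define i0 where "i0 = k1 - 1"
  define c0 where "c0 = shape P' ! (k1 - 1) - 1"
  note rec1 = KH_step_record[OF M(1,2) Q(1) ins1 step1 i0_def c0_def]
  note rec2 = KH_step_record[OF M(3,4) Q(3) ins2[unfolded k] step2 i0_def c0_def]
  \<comment> \<open>An old cell held some smaller number before, a new one contains
    \<open>n + 1\<close> alone.\<close>
  have "in_shape (shape P1) i0 c0 \<longleftrightarrow> Q' ! i0 ! c0 \<noteq> {n + 1}"
    using rec1(5)[OF rec1(3)] small[of i0 c0] by auto
  moreover have "in_shape (shape P2) i0 c0 \<longleftrightarrow> Q' ! i0 ! c0 \<noteq> {n + 1}"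
    using rec2(5)[OF rec2(3)] small2[of i0 c0] by auto
  ultimately have "shape P' = shape P1 \<longleftrightarrow> shape P' = shape P2"
    using rec1(6) rec2(6) by blast
  then have P: "a1 = a2" "P1 = P2"
    using tableau_insert_inj[OF M(1,2) ins1 M(3,4) ins2[unfolded k]] by auto
  have "Q1 = Q2"
  proof (rule tableau_eqI)
    show "shape Q1 = shape Q2" using Q P by simp
    fix i c assume "in_shape (shape Q1) i c"
    then have s: "in_shape (shape P1) i c" "in_shape (shape P2) i c" "in_shape (shape P') i c"
      using Q(1) P rec1(4) by auto
    have "Q1 ! i ! c = Q' ! i ! c - {n + 1}" using rec1(5)[OF s(3)] small(1)[OF s(1)] s by auto
    moreover have "Q2 ! i ! c = Q' ! i ! c - {n + 1}" using rec2(5)[OF s(3)] small2(1)[OF s(2)] s by auto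
    ultimately show "Q1 ! i ! c = Q2 ! i ! c" by simp
  qed
  then show ?thesis using P by simp
qed

lemma KH_step_surj:
  assumes "(P', Q') \<in> pairs (n + 1)"
  shows "\<exists>P Q a. (P, Q) \<in> pairs n \<and> KH_step (P, Q) (n + 1, a) = (P', Q')"
proof -
  obtain M where M: "valid M P'" using assms pairs_iff by blast
  have Q': "shape Q' = shape P'" "standard (n + 1) Q'" using assms unfolding pairs_iff by auto
  have sp: "strict_partition (shape P')" using valid_strict_partition[OF M] .
  obtain i0 c0 where cell: "in_shape (shape P') i0 c0" "n + 1 \<in> Q' ! i0 ! c0"
    "\<not> in_shape (shape P') i0 (c0 + 1)" "\<And>c. c0 = c + 1 \<Longrightarrow> \<not> in_shape (shape P') (i0 + 1) c"
    using standard_last[OF Q'(2)] unfolding Q'(1) by metis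
  define k where "k = i0 + 1"
  have i0: "i0 = k - 1" by (simp add: k_def)
  have len: "shape P' ! i0 = c0 + 1" using cell(1,3) unfolding in_shape_def by auto
  have c0: "c0 = shape P' ! (k - 1) - 1" using len by (simp add: k_def)
  have "corner P' k"
    unfolding corner_shape
  proof (intro conjI impI)
    show "1 \<le> k" "k \<le> length (shape P')" using cell(1) by (auto simp: k_def in_shape_def)
    assume kl: "k < length (shape P')"
    have "0 < shape P' ! k" using sp kl unfolding strict_partition_def by auto
    moreover have "shape P' ! k < shape P' ! i0"
      using sp kl unfolding strict_partition_def k_def by (auto intro: sorted_wrt_nth_less[where P = "(>)"])
    ultimately obtain c where c: "c0 = c + 1" using len by (cases c0) auto
    then have "shape P' ! k \<le> c" using cell(4)[OF c] kl unfolding in_shape_def k_def by auto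
    then show "shape P' ! k + 1 < shape P' ! (k - 1)" using len c by (simp add: k_def)
  qed
  then obtain a P where P: "valid M P" "int a < M" "tableau_insert a P = (P', k)"
    "shape P' = shape P \<longleftrightarrow> Q' ! i0 ! c0 \<noteq> {n + 1}"
    using tableau_insert_surj[OF M, of k "Q' ! i0 ! c0 \<noteq> {n + 1}"] by blast
  \<comment> \<open>\<open>n + 1\<close> is erased. If it was alone in its cell, that cell is
    missing from the shape of \<open>P\<close>, so no empty cell arises.\<close>
  define Q where "Q = map (\<lambda>i. map (\<lambda>c. Q' ! i ! c - {n + 1}) [0..<length (P ! i)]) [0..<length P]"
  have Q: "shape Q = shape P"
    by (rule nth_equalityI) (simp_all add: Q_def shape_def)
  have Qv: "Q ! i ! c = Q' ! i ! c - {n + 1}" if "in_shape (shape P) i c" for i c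
    using that by (auto simp: Q_def in_shape_def shape_def)
  obtain Q2 where step: "KH_step (P, Q) (n + 1, a) = (P', Q2)" using KH_step_eq[OF P(3)] by blast
  note rec = KH_step_record[OF P(1,2) Q P(3) step i0 c0]
  have other: "n + 1 \<notin> Q' ! i ! c" if "in_shape (shape P') i c" "(i, c) \<noteq> (i0, c0)" for i c
    using Q' that cell unfolding standard_def by metis
  have cells: "in_shape (shape Q) i c \<longleftrightarrow> in_shape (shape Q') i c \<and> Q' ! i ! c \<noteq> {n + 1}" for i c
  proof (cases "(i, c) = (i0, c0)")
    case True
    then show ?thesis using rec(3,6) P(4) unfolding Q Q'(1) by simp
  next
    case False
    then show ?thesis using rec(4)[of i c] other[of i c] unfolding Q Q'(1) by auto
  qed
  have "standard n Q"
    by (rule standard_remove[OF Q'(2), of i0 c0]) (use cell cells Q Q' Qv in auto)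
  then have "(P, Q) \<in> pairs n" unfolding pairs_iff using P(1) Q by blast
  moreover have "Q2 = Q'"
  proof (rule tableau_eqI)
    show "shape Q2 = shape Q'" using rec(2) Q'(1) by simp
    fix i c assume "in_shape (shape Q2) i c"
    then have s: "in_shape (shape P') i c" using rec(2) by simp
    have d: "in_shape (shape P) i c \<longleftrightarrow> Q' ! i ! c \<noteq> {n + 1}" using cells[of i c] s Q Q'(1) by simp
    show "Q2 ! i ! c = Q' ! i ! c"
    proof (cases "(i, c) = (i0, c0)")
      case True
      then have "n + 1 \<in> Q' ! i ! c" using cell(2) by simp
      then show ?thesis
        using True rec(5)[OF s] Qv[of i c] d by (cases "in_shape (shape P) i c") auto
    next
      case False
      then have "in_shape (shape P) i c" "n + 1 \<notin> Q' ! i ! c"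
        using rec(4)[of i c] s other[OF s] by auto
      then show ?thesis using False rec(5)[OF s] Qv[of i c] by auto
    qed
  qed
  ultimately show ?thesis using step by blast
qed

section \<open>Words of length \<open>n\<close> and pairs of tableaux\<close>

lemma KH_snoc: "KH (w @ [a]) = KH_step (KH w) (length w + 1, a)"
  by (simp add: KH_def enumerate_append_eq)

lemma pairs_0: "pairs 0 = {([], [])}"
proof -
  have "P = [] \<and> Q = []" if h: "(P, Q) \<in> pairs 0" for P Q
  proof -
    obtain M where P: "valid M P" using h pairs_iff by blast
    have Q: "shape Q = shape P" "standard 0 Q" using h unfolding pairs_iff by auto
    have "\<not> in_shape (shape P) i c" for i c using Q unfolding standard_def by fastforce
    moreover have "shape P \<noteq> [] \<Longrightarrow> in_shape (shape P) 0 0"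
      using valid_strict_partition[OF P] unfolding strict_partition_def in_shape_def by auto
    ultimately have "shape P = []" by blast
    then show ?thesis using Q(1) by (simp add: shape_def)
  qed
  moreover have "([], []) \<in> pairs 0"
    unfolding pairs_iff by (auto simp: standard_def in_shape_def shape_def)
  ultimately show ?thesis by auto
qed

lemma KH_bij_betw: "bij_betw KH {a. length a = n} (pairs n)"
proof (induction n)
  case 0
  then show ?case by (simp add: pairs_0 KH_def bij_betw_def)
next
  case (Suc n)
  have KH: "KH w \<in> pairs n" if "length w = n" for w
    using Suc that unfolding bij_betw_def by blast
  have "inj_on KH {a. length a = Suc n}"
  proof (rule inj_onI)
    fix u v :: "nat list" assume uv: "u \<in> {a. length a = Suc n}" "v \<in> {a. length a = Suc n}" "KH u = KH v"
    obtain u' x where u: "u = u' @ [x]" using uv(1) by (cases u rule: rev_cases) auto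
    obtain v' y where v: "v = v' @ [y]" using uv(2) by (cases v rule: rev_cases) auto
    have l: "length u' = n" "length v' = n" using uv u v by auto
    obtain P1 Q1 P2 Q2 where PQ: "KH u' = (P1, Q1)" "KH v' = (P2, Q2)" by (metis surj_pair)
    have "x = y \<and> P1 = P2 \<and> Q1 = Q2"
      by (rule KH_step_inj) (use KH[OF l(1)] KH[OF l(2)] PQ uv(3) l in \<open>auto simp: u v KH_snoc\<close>)
    then have "x = y" "KH u' = KH v'" using PQ by auto
    moreover have "u' = v'"
      using Suc l calculation(2) unfolding bij_betw_def inj_on_def by blast
    ultimately show "u = v" using u v by simp
  qed
  moreover have "KH ` {a. length a = Suc n} = pairs (Suc n)"
  proof (intro set_eqI iffI)
    fix z assume "z \<in> KH ` {a. length a = Suc n}"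
    then obtain u where u: "length u = Suc n" "z = KH u" by auto
    obtain w x where w: "u = w @ [x]" using u(1) by (cases u rule: rev_cases) auto
    have "KH w \<in> pairs n" using KH u w by auto
    then show "z \<in> pairs (Suc n)"
      using KH_step_in[of "fst (KH w)" "snd (KH w)" n x] u w by (auto simp: KH_snoc)
  next
    fix z assume "z \<in> pairs (Suc n)"
    then obtain P Q a where PQ: "(P, Q) \<in> pairs n" "KH_step (P, Q) (n + 1, a) = z"
      using KH_step_surj[of "fst z" "snd z" n] by auto
    have "(P, Q) \<in> KH ` {a. length a = n}" using Suc PQ(1) unfolding bij_betw_def by blast
    then obtain w where w: "length w = n" "KH w = (P, Q)" by (metis (mono_tags) imageE mem_Collect_eq)
    then have "KH (w @ [a]) = z" using PQ by (simp add: KH_snoc)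
    then show "z \<in> KH ` {a. length a = Suc n}" using w by (intro image_eqI[of _ _ "w @ [a]"]) auto
  qed
  ultimately show ?case unfolding bij_betw_def by blast
qed

lemma sum_list_add_box: "1 \<le> k \<Longrightarrow> sum_list (add_box mu k) \<le> sum_list mu + 1"
  by (cases "k - 1 < length mu") (auto simp: add_box_def sum_list_update list_update_beyond)

lemma KH_size: "sum_list (shape (fst (KH a))) \<le> length a"
proof (induction a rule: rev_induct)
  case Nil
  then show ?case by (simp add: KH_def shape_def)
next
  case (snoc x w)
  obtain P Q where PQ: "KH w = (P, Q)" by fastforce
  have "(P, Q) \<in> pairs (length w)" using KH_bij_betw[of "length w"] PQ unfolding bij_betw_def by force
  then obtain M where M: "valid M P" "int x < M" by (rule pairs_bound)
  obtain P' k where ins: "tableau_insert x P = (P', k)" by fastforce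
  have "shape P' = shape P \<or> shape P' = add_box (shape P) k" "1 \<le> k"
    using tableau_insert_valid[OF M ins] by (auto simp: corner_def)
  then have "sum_list (shape P') \<le> sum_list (shape P) + 1" using sum_list_add_box[of k "shape P"] by auto
  then show ?case using snoc PQ KH_step_eq[OF ins] by (simp add: KH_snoc)
qed

text \<open>The bound on the size of the shape is a by-product of surjectivity: each pair comes from
  a word of length \<open>n\<close>, and a letter adds at most one cell.\<close>

lemma pairs_eq_Union:
  "pairs n = (\<Union>mu\<in>{mu. strict_partition mu \<and> sum_list mu \<le> n}. SDT mu \<times> ShSet n mu)"
proof -
  have "sum_list (shape P) \<le> n" if "(P, Q) \<in> pairs n" for P Q
  proof -
    have "(P, Q) \<in> KH ` {a. length a = n}" using that KH_bij_betw[of n] unfolding bij_betw_def by blast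
    then obtain a where "length a = n" "KH a = (P, Q)" by (metis (mono_tags) imageE mem_Collect_eq)
    then show ?thesis using KH_size[of a] by simp
  qed
  moreover have "shape P = mu" if "P \<in> SDT mu" for P mu using that by (simp add: SDT_def)
  ultimately have "(P, Q) \<in> pairs n \<longleftrightarrow>
    (P, Q) \<in> (\<Union>mu\<in>{mu. strict_partition mu \<and> sum_list mu \<le> n}. SDT mu \<times> ShSet n mu)" for P Q
    unfolding pairs_def UN_iff mem_Sigma_iff mem_Collect_eq prod.case by blast
  note eq = this
  show ?thesis
  proof (rule set_eqI)
    fix z
    show "z \<in> pairs n \<longleftrightarrow> z \<in> (\<Union>mu\<in>{mu. strict_partition mu \<and> sum_list mu \<le> n}. SDT mu \<times> ShSet n mu)"
      using eq[of "fst z" "snd z"] by (simp only: prod.collapse)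
  qed
qed

section \<open>Calculus of words in the 0-Hecke monoid\<close>

section \<open>Words in the 0-Hecke monoid\<close>

text \<open>Letters are integers so that the values of row functions can be used directly.\<close>

definition hecke :: "int list \<Rightarrow> int \<Rightarrow> int" where
  "hecke u = foldl hecke_step id (map nat u)"

text \<open>Generators that commute. Equal letters are included, which spares separate cases when a
  word contains repetitions.\<close>

definition far :: "int \<Rightarrow> int \<Rightarrow> bool" where
  "far a b \<longleftrightarrow> 0 \<le> a \<and> 0 \<le> b \<and> a \<noteq> b + 1 \<and> b \<noteq> a + 1"

lemma hecke_append: "hecke (u @ v) = hecke u \<odot> hecke v"
  unfolding hecke_def map_append using hecke_prod_word by metis

lemma hecke_cong: "hecke u = hecke v \<Longrightarrow> hecke (x @ u @ y) = hecke (x @ v @ y)"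
  by (simp add: hecke_append)

lemma hecke_idem: "hecke (x @ a # a # y) = hecke (x @ a # y)"
proof -
  have "hecke [a, a] = hecke [a]"
    using hecke_relations(1)[of "nat a"] hecke_prod_gens(1)[of "nat a" "nat a"]
    by (simp add: hecke_def)
  then show ?thesis using hecke_cong[of "[a, a]" "[a]" x y] by simp
qed

lemma far_commute: "far a b \<longleftrightarrow> far b a"
  by (auto simp: far_def)

lemma hecke_far:
  assumes "far a b"
  shows "hecke (x @ a # b # y) = hecke (x @ b # a # y)"
proof -
  have *: "hecke [a, b] = hecke [b, a]" if "0 \<le> a" "a + 2 \<le> b" for a b
  proof -
    have "nat a + 2 \<le> nat b" using that by linarith
    then show ?thesis
      using hecke_relations(2)[of "nat a" "nat b"] unfolding hecke_prod_gens hecke_def by simp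
  qed
  have "a = b \<or> a + 2 \<le> b \<or> b + 2 \<le> a" using assms unfolding far_def by linarith
  then have "hecke [a, b] = hecke [b, a]" using *[of a b] *[of b a] assms unfolding far_def by auto
  then show ?thesis using hecke_cong[of "[a, b]" "[b, a]" x y] by simp
qed

lemma hecke_far_absorb:
  assumes "far a b"
  shows "hecke (x @ a # b # a # y) = hecke (x @ a # b # y)"
    "hecke (x @ a # b # a # y) = hecke (x @ b # a # y)"
  using hecke_far[OF assms, of "x @ [a]" y] hecke_far[OF assms, of x "a # y"] hecke_idem[of x a "b # y"]
    hecke_idem[of "x @ [b]" a y] by simp_all

text \<open>Because generators are idempotent, the relation of length three holds for commuting
  letters too, so it can be applied to any two positive letters without looking at their
  distance.\<close>

lemma hecke_braid:
  assumes "0 < a" "0 < b"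
  shows "hecke (x @ a # b # a # y) = hecke (x @ b # a # b # y)"
proof -
  have *: "hecke [a, a + 1, a] = hecke [a + 1, a, a + 1]" if "0 < a" for a
    using hecke_relations(3)[of "nat a"] that nat_add_distrib[of a 1]
    unfolding hecke_prod_gens(2) hecke_def by simp
  consider "far a b" | "b = a + 1" | "a = b + 1" using assms unfolding far_def by linarith
  then have "hecke [a, b, a] = hecke [b, a, b]"
  proof cases
    case 1
    then show ?thesis
      using hecke_far_absorb[of a b "[]" "[]"] hecke_far_absorb[of b a "[]" "[]"] by (simp add: far_commute)
  qed (use *[of a] *[of b] assms in auto)
  then show ?thesis using hecke_cong[of "[a, b, a]" "[b, a, b]" x y] by simp
qed

text \<open>The relation of length four follows from shorter ones unless the letters are 0 and 1,
  and so holds for all pairs.\<close>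

lemma hecke_braid4:
  assumes "0 \<le> a" "0 \<le> b"
  shows "hecke (x @ a # b # a # b # y) = hecke (x @ b # a # b # a # y)"
proof -
  consider "far a b" | "0 < a" "0 < b" | "a = 0" "b = 1" | "a = 1" "b = 0"
    using assms unfolding far_def by linarith
  then have "hecke [a, b, a, b] = hecke [b, a, b, a]"
  proof cases
    case 1
    then show ?thesis
      using hecke_far_absorb[of a b "[]" "[b]"] hecke_far_absorb[of b a "[]" "[a]"]
        hecke_far_absorb[of a b "[]" "[]"] hecke_far_absorb[of b a "[]" "[]"] hecke_idem[of "[a]" b "[]"]
        hecke_idem[of "[b]" a "[]"] by (simp add: far_commute)
  next
    case 2
    then show ?thesis
      using hecke_braid[of a b "[]" "[b]"] hecke_braid[of a b "[b]" "[]"] hecke_idem[of "[b, a]" b "[]"]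
        hecke_idem[of "[]" b "[a, b]"] by simp
  qed (use hecke_relations(4)[unfolded hecke_prod_gens(3)] in \<open>simp_all add: hecke_def\<close>)
  then show ?thesis using hecke_cong[of "[a, b, a, b]" "[b, a, b, a]" x y] by simp
qed

lemma hecke_commute:
  assumes "\<forall>c\<in>set u. far c a"
  shows "hecke (x @ u @ a # y) = hecke (x @ a # u @ y)"
  using assms
proof (induction u arbitrary: x)
  case (Cons c u)
  then show ?case using Cons.IH[of "x @ [c]"] hecke_far[of c a x "u @ y"] by simp
qed simp

section \<open>Word identities behind the insertion rules\<close>

lemma right_replace_word:
  assumes "\<forall>c\<in>set C. far c a"
  shows "hecke (S @ P @ z # C @ [a]) = hecke (S @ P @ z # a # C)"
  using hecke_commute[OF assms, of "S @ P @ [z]" "[]"] by simp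

lemma swap_word:
  assumes "\<forall>c\<in>set A. far c x" "\<forall>c\<in>set C. far c x"
  shows "hecke (S @ A @ x # z # C @ [x]) = hecke (S @ x # A @ z # x # C)"
  using hecke_commute[OF assms(2), of "S @ A @ [x, z]" "[]"] hecke_commute[OF assms(1), of S "z # x # C"] by simp

text \<open>For (R3) with output \<open>z\<close>, the right neighbour of \<open>x\<close>: the
  inserted \<open>x\<close> moves back over \<open>C\<close>, and \<open>x z x\<close> becomes
  \<open>z x z\<close>, so that a \<open>z\<close> is ready to travel to the left.\<close>

lemma right_keep_word:
  assumes "\<forall>c\<in>set C. far c x" "far x z \<or> 0 < x \<and> 0 < z"
  shows "hecke (S @ P @ x # z # C @ [x]) = hecke (S @ P @ z # x # z # C)"
proof -
  have "hecke (S @ P @ x # z # x # C) = hecke (S @ P @ z # x # z # C)"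
    using assms(2) hecke_braid[of x z "S @ P" C] hecke_far_absorb[of x z "S @ P" C]
      hecke_far_absorb[of z x "S @ P" C] by (auto simp: far_commute)
  then show ?thesis using hecke_commute[OF assms(1), of "S @ P @ [x, z]" "[]"] by simp
qed

lemma right_absorb_word:
  assumes "\<forall>c\<in>set C. far c x"
  shows "hecke (S @ P @ x # C @ [x]) = hecke (S @ P @ x # C)"
  using hecke_commute[OF assms, of "S @ P @ [x]" "[]"] hecke_idem[of "S @ P" x C] by simp

lemma left_replace_word:
  assumes "\<forall>c\<in>set A. far c y" "\<forall>c\<in>set B. far c z"
  shows "hecke (S @ A @ y # B @ z # T) = hecke (S @ y # A @ z # B @ T)"
  using hecke_commute[OF assms(2), of "S @ A @ [y]" T] hecke_commute[OF assms(1), of S "z # B @ T"] by simp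

lemma left_keep_word:
  assumes "\<forall>c\<in>set A. far c n" "\<forall>c\<in>set B. far c y" "far n y \<or> 0 < n \<and> 0 < y"
  shows "hecke (S @ A @ y # n # B @ y # T) = hecke (S @ n # A @ y # n # B @ T)"
proof -
  have "hecke ((S @ A) @ y # n # y # B @ T) = hecke ((S @ A) @ n # y # n # B @ T)"
    using assms(3) hecke_braid[of y n "S @ A" "B @ T"] hecke_far_absorb[of y n "S @ A" "B @ T"]
      hecke_far_absorb[of n y "S @ A" "B @ T"] by (auto simp: far_commute)
  then show ?thesis
    using hecke_commute[OF assms(2), of "S @ A @ [y, n]" T] hecke_commute[OF assms(1), of S "y # n # B @ T"] by simp
qed

lemma left_absorb_word:
  assumes "\<forall>c\<in>set B. far c y" "far n y"
  shows "hecke (S @ A @ y # n # B @ y # T) = hecke (S @ A @ y # n # B @ T)"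
  using hecke_commute[OF assms(1), of "S @ A @ [y, n]" T] hecke_far_absorb(1)[of y n "S @ A" "B @ T"] assms(2)
  by (simp add: far_commute)

text \<open>Around the dip, \<open>y x y x\<close> becomes \<open>x y x y\<close>. This works for
  \<open>x = 0\<close>, \<open>y = 1\<close> as well, where no relation of length three is
  available.\<close>

lemma dip_keep_word:
  assumes "\<forall>c\<in>set A. far c x" "\<forall>c\<in>set C. far c x" "0 \<le> x" "0 \<le> y"
  shows "hecke (S @ A @ y # x # y # C @ [x]) = hecke (S @ x # A @ y # x # y # C)"
  using hecke_commute[OF assms(2), of "S @ A @ [y, x, y]" "[]"] hecke_commute[OF assms(1), of S "y # x # y # C"]
    hecke_braid4[OF assms(3,4), of "S @ A" C] by simp

lemma dip_absorb_word:
  assumes "\<forall>c\<in>set C. far c x" "far x y \<or> 0 < x \<and> 0 < y"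
  shows "hecke (S @ A @ y # x # y # C @ [x]) = hecke (S @ A @ y # x # y # C)"
proof -
  have "hecke ((S @ A) @ y # x # y # x # C) = hecke ((S @ A) @ y # x # y # C)"
    using assms(2)
  proof
    assume "far x y"
    then show ?thesis
      using hecke_far_absorb(1)[of x y "S @ A @ [y]" C] hecke_far[of x y "S @ A @ [y]" C] by simp
  next
    assume "0 < x \<and> 0 < y"
    then show ?thesis
      using hecke_braid[of x y "S @ A @ [y]" C] hecke_idem[of "S @ A" y "x # y # C"] by simp
  qed
  then show ?thesis using hecke_commute[OF assms(1), of "S @ A @ [y, x, y]" "[]"] by simp
qed

text \<open>The letter \<open>z\<close> is created behind \<open>y\<close> at the expense of the
  lower row \<open>S\<close>; then \<open>y\<close> is emitted to the left of \<open>A\<close>, and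
  \<open>z\<close> takes its place.\<close>

lemma raise_word:
  assumes "hecke (S @ [y, z]) = hecke (S @ [y])" "\<forall>c\<in>set A. far c y"
    "\<forall>c\<in>set A. far c z"
  shows "hecke (S @ A @ y # D) = hecke (S @ y # A @ z # D)"
  using hecke_cong[OF assms(1), of "[]" "A @ D"] hecke_commute[OF assms(2), of S D]
    hecke_commute[OF assms(3), of "S @ [y]" D] by simp

lemma left_keep_far_word:
  assumes "\<forall>c\<in>set A. far c n" "far n y"
  shows "hecke (S @ A @ y # n # D) = hecke (S @ n # A @ y # n # D)"
  using hecke_commute[OF assms(1), of S "y # n # D"] hecke_far_absorb(2)[OF assms(2), of "S @ A" D] by simp

lemma raise_far_word:
  assumes "\<forall>c\<in>set S2. far c z" "far y z"
  shows "hecke ((S1 @ z # S2) @ [y, z]) = hecke ((S1 @ z # S2) @ [y])"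
  using hecke_far[OF assms(2), of "S1 @ z # S2" "[]"] hecke_commute[OF assms(1), of "S1 @ [z]" "[y]"]
    hecke_idem[of S1 z "S2 @ [y]"] by simp

lemma raise_near_word:
  assumes "\<forall>c\<in>set S2. far c y" "\<forall>c\<in>set S2. far c z" "0 < y" "0 < z"
  shows "hecke ((S1 @ y # z # S2) @ [y, z]) = hecke ((S1 @ y # z # S2) @ [y])"
  using hecke_commute[OF assms(1), of "S1 @ [y, z]" "[z]"] hecke_commute[OF assms(2), of "S1 @ [y, z, y]" "[]"]
    hecke_commute[OF assms(1), of "S1 @ [y, z]" "[]"] hecke_braid[OF assms(4,3), of "S1 @ [y]" S2]
    hecke_idem[of S1 y "z # y # S2"] by simp

lemma absorb_word:
  assumes "\<forall>c\<in>set S2. far c b"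
  shows "hecke (S1 @ b # S2 @ [b]) = hecke (S1 @ b # S2)"
  using hecke_commute[OF assms, of "S1 @ [b]" "[]"] hecke_idem[of S1 b S2] by simp

text \<open>Moving the first \<open>c\<close> over \<open>X\<close> produces \<open>c b c b\<close>,
  which equals \<open>c b c\<close>.\<close>

lemma absorb_between_word:
  assumes "\<forall>u\<in>set X. far u c" "\<forall>u\<in>set S2. far u b" "0 < b" "0 < c"
  shows "hecke (S1 @ c # X @ b # c # S2 @ [b]) = hecke (S1 @ c # X @ b # c # S2)"
  using hecke_commute[OF assms(2), of "S1 @ c # X @ [b, c]" "[]"] hecke_commute[OF assms(1), of S1 "b # c # b # S2"]
    hecke_braid[OF assms(3,4), of "S1 @ X @ [c]" S2] hecke_idem[of "S1 @ X" c "b # c # S2"]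
    hecke_commute[OF assms(1), of S1 "b # c # S2"] by simp

lemma hecke_filter:
  assumes "\<forall>u\<in>set U. u = b \<or> far u b"
  shows "hecke (S @ b # U @ T) = hecke (S @ b # filter (\<lambda>u. u \<noteq> b) U @ T)"
  using assms
proof (induction U arbitrary: S)
  case (Cons u U)
  show ?case
  proof (cases "u = b")
    case True
    then show ?thesis using Cons hecke_idem[of S b "U @ T"] by simp
  next
    case False
    then have "far u b" using Cons.prems by simp
    then show ?thesis
      using Cons.IH[of "S @ [u]"] Cons.prems hecke_far[of u b S "U @ T"] False
        hecke_far[of u b S "filter (\<lambda>u. u \<noteq> b) U @ T"] by simp
  qed
qed simp

text \<open>Further copies of \<open>b\<close> inside \<open>U\<close> merge with the first one. The
  remaining letters commute with \<open>b\<close> and \<open>c\<close>, which leaves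
  \<open>c b c b\<close> as before.\<close>

lemma absorb_dip_word:
  assumes U: "\<forall>u\<in>set U. u = b \<or> far u b \<and> far u c" "\<forall>u\<in>set S2. far u b"
    "0 < b" "0 < c"
  shows "hecke (S1 @ c # b # U @ c # S2 @ [b]) = hecke (S1 @ c # b # U @ c # S2)"
proof -
  define V where "V = filter (\<lambda>u. u \<noteq> b) U"
  have V: "\<forall>u\<in>set V. far u b" "\<forall>u\<in>set V. far u c" using U(1) by (auto simp: V_def)
  have f: "hecke (S1 @ c # b # U @ T) = hecke (S1 @ c # b # V @ T)" for T
    using hecke_filter[of U b "S1 @ [c]" T] U(1) unfolding V_def by auto
  have "hecke (S1 @ c # b # V @ c # S2 @ [b]) = hecke (S1 @ c # b # V @ c # b # S2)"
    using hecke_commute[OF U(2), of "S1 @ c # b # V @ [c]" "[]"] by simp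
  also have "\<dots> = hecke (S1 @ c # b # c # b # V @ S2)"
    using hecke_commute[OF V(2), of "S1 @ [c, b]" "b # S2"] hecke_commute[OF V(1), of "S1 @ [c, b, c]" S2] by simp
  also have "\<dots> = hecke (S1 @ c # b # c # V @ S2)"
    using hecke_braid[OF U(3,4), of "S1 @ [c]" "V @ S2"] hecke_idem[of S1 c "b # c # V @ S2"] by simp
  also have "\<dots> = hecke (S1 @ c # b # V @ c # S2)"
    using hecke_commute[OF V(2), of "S1 @ [c, b]" S2] by simp
  finally show ?thesis using f[of "c # S2 @ [b]"] f[of "c # S2"] by simp
qed

text \<open>Everything reduces to \<open>n c n c n = n c n\<close>. Positive letters satisfy this by
  the relation of length three; otherwise a \<open>c\<close> in front is needed, so that the
  relation of length four applies.\<close>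

lemma braid_word:
  assumes S: "\<forall>u\<in>set S3. far u n \<and> far u c" and A:
    "\<forall>u\<in>set A. far u n \<and> far u c"
    and n: "0 \<le> n" "0 \<le> c" "0 < n \<and> 0 < c \<or> (\<exists>S0. S1 = S0 @ [c])"
  shows "hecke (S1 @ n # c # S3 @ A @ c # n # D) = hecke (S1 @ n # c # S3 @ n # A @ c # n # D)"
proof -
  have far: "\<forall>u\<in>set (S3 @ A). far u c" "\<forall>u\<in>set (S3 @ A). far u n" "\<forall>u\<in>set S3. far u n"
    using S A by auto
  have "hecke (S1 @ n # c # S3 @ A @ c # n # D) = hecke (S1 @ n # c # n # S3 @ A @ D)"
    using hecke_commute[OF far(1), of "S1 @ [n, c]" "n # D"] hecke_commute[OF far(2), of "S1 @ [n, c, c]" D]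
      hecke_idem[of "S1 @ [n]" c "n # S3 @ A @ D"] by simp
  moreover have "hecke (S1 @ n # c # S3 @ n # A @ c # n # D) = hecke (S1 @ n # c # n # c # n # S3 @ A @ D)"
    using hecke_commute[OF far(3), of "S1 @ [n, c]" "A @ c # n # D"]
      hecke_commute[OF far(1), of "S1 @ [n, c, n]" "n # D"] hecke_commute[OF far(2), of "S1 @ [n, c, n, c]" D] by simp
  moreover have "hecke (S1 @ n # c # n # c # n # E) = hecke (S1 @ n # c # n # E)" for E
    using n(3)
  proof
    assume "0 < n \<and> 0 < c"
    then show ?thesis
      using hecke_braid[of c n "S1 @ [n]" "n # E"] hecke_idem[of S1 n "c # n # n # E"] hecke_idem[of "S1 @ [n, c]" n E]
      by simp
  next
    assume "\<exists>S0. S1 = S0 @ [c]"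
    then obtain S0 where S1: "S1 = S0 @ [c]" by blast
    show ?thesis
      unfolding S1
      using hecke_braid4[OF n(1,2), of "S0 @ [c]" "n # E"] hecke_idem[of S0 c "n # c # n # n # E"]
        hecke_idem[of "S0 @ [c, n, c]" n E]
      by simp
  qed
  ultimately show ?thesis by simp
qed

section \<open>Row insertion as a transformation of words\<close>

section \<open>Insertion on 0-Hecke words\<close>

definition word :: "(int \<Rightarrow> int) \<Rightarrow> int \<Rightarrow> int \<Rightarrow> int list" where
  "word r f l = map r [f..l]"

lemma word_far: "(\<And>x. f \<le> x \<Longrightarrow> x \<le> l \<Longrightarrow> far (r x) a) \<Longrightarrow> \<forall>c\<in>set (word r f l). far c a"
  by (auto simp: word_def)

lemma word_cong: "(\<And>x. f \<le> x \<Longrightarrow> x \<le> l \<Longrightarrow> r x = r' x) \<Longrightarrow> word r f l = word r' f l"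
  by (auto simp: word_def)

lemma word_split: "f \<le> m \<Longrightarrow> m \<le> l \<Longrightarrow> word r f l = word r f (m - 1) @ r m # word r (m + 1) l"
  using upto_split3[of f m l] by (simp add: word_def)

lemma word_Cons: "f \<le> l \<Longrightarrow> word r f l = r f # word r (f + 1) l"
  by (simp add: word_def upto_rec1)

lemma word_Nil: "l < f \<Longrightarrow> word r f l = []"
  by (simp add: word_def)

lemma ex_last:
  assumes "\<exists>x::int. f \<le> x \<and> x \<le> l \<and> P x"
  obtains x where "f \<le> x" "x \<le> l" "P x" "\<forall>y. x < y \<and> y \<le> l \<longrightarrow> \<not> P y"
proof -
  define X where "X = {x. f \<le> x \<and> x \<le> l \<and> P x}"
  have "X \<subseteq> {f..l}" by (auto simp: X_def)
  then have X: "finite X" by (rule finite_subset) simp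
  have ne: "X \<noteq> {}" using assms by (auto simp: X_def)
  define m where "m = Max X"
  have "m \<in> X" using X ne by (simp add: m_def)
  then have m: "f \<le> m" "m \<le> l" "P m" by (simp_all add: X_def)
  have "\<not> P y" if "m < y" "y \<le> l" for y
  proof
    assume "P y"
    then have "y \<in> X" using that m(1) by (simp add: X_def)
    then have "y \<le> m" unfolding m_def using X by simp
    then show False using that by simp
  qed
  then show thesis using that[OF m] by blast
qed

lemma right_replace_far:
  assumes "stacked M r l q s k p" "right_slot r q a i" "0 \<le> a" "a \<noteq> r i" "i \<le> l"
  shows "1 \<le> i" "i < x \<Longrightarrow> x \<le> l \<Longrightarrow> far (r x) a"
  using assms unfolding fo_defs far_def by ((intro conjI allI impI)?; smt (z3))+

lemma stacked_nonneg:
  assumes "stacked M r l q s k p"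
  shows "1 \<le> x \<Longrightarrow> x \<le> l \<Longrightarrow> 0 \<le> r x"
    "2 \<le> x \<Longrightarrow> x \<le> k \<Longrightarrow> 0 \<le> s x" "1 \<le> q" "q \<le> l"
  using assms unfolding stacked_def valley_def by auto

lemma stacked_valley:
  assumes "stacked M r l q s k p"
  shows "1 \<le> x \<Longrightarrow> x < y \<Longrightarrow> y \<le> q \<Longrightarrow> r y < r x"
    "q \<le> x \<Longrightarrow> x < y \<Longrightarrow> y \<le> l \<Longrightarrow> r x < r y"
    "r x < M \<Longrightarrow> 1 \<le> x \<and> x \<le> l"
proof -
  have v: "valley M r 1 l q" using assms unfolding stacked_def by blast
  show "r y < r x" if "1 \<le> x" "x < y" "y \<le> q" using v that unfolding valley_def by blast
  show "r x < r y" if "q \<le> x" "x < y" "y \<le> l" using v that unfolding valley_def by blast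
  have "x < 1 \<or> l < x \<longrightarrow> r x = M" using v unfolding valley_def by blast
  then show "1 \<le> x \<and> x \<le> l" if "r x < M" using that by linarith
qed

lemma right_keep_far:
  assumes st: "stacked M r l q s k p" and slot: "right_slot r q (r i) i" and il: "i \<le> l"
  shows "1 \<le> i" "q \<le> i" "i + 1 < x \<Longrightarrow> x \<le> l \<Longrightarrow> far (r x) (r i)"
    "i + 1 \<le> l \<Longrightarrow> r i < r (i + 1)" "0 \<le> r i"
proof -
  show qi: "q \<le> i" using slot unfolding right_slot_def by (auto split: if_splits)
  then show i1: "1 \<le> i" using stacked_nonneg(3)[OF st] by simp
  show i0: "0 \<le> r i" using stacked_nonneg(1)[OF st i1 il] .
  show inc: "r i < r (i + 1)" if "i + 1 \<le> l" using stacked_valley(2)[OF st qi _ that] by simp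
  show "far (r x) (r i)" if "i + 1 < x" "x \<le> l"
    using stacked_valley(2)[OF st _ that] qi inc that i0 by (auto simp: far_def)
qed

text \<open>The relation of length three fails only for the letters 0 and 1. In (R3) with output
  \<open>r (i + 1)\<close> these occur as \<open>r i\<close> and \<open>r (i + 1)\<close> only if
  the emitted letter also stands directly to the left of column \<open>i\<close>.\<close>

lemma right_keep_pos:
  assumes "stacked M r l q s k p" "right_slot r q (r i) i" "mid_state M r q s i (r (i + 1))"
    "left_slot r 1 q (r (i + 1)) j" "\<not> (j + 1 = i \<and> r j = r (i + 1))"
  shows "far (r i) (r (i + 1)) \<or> 0 < r i" "i + 1 \<le> l"
  using assms unfolding fo_defs far_def by ((intro conjI allI impI)?; smt (z3))+

lemma left_slot_range:
  assumes "stacked M r l q s k p" "mid_state M r q s i z" "left_slot r 1 q z j"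
  shows "1 \<le> j" "j < i" "i \<le> l"
  using assms unfolding fo_defs by ((intro conjI allI impI)?; smt (z3))+

lemma left_replace_far:
  assumes "stacked M r l q s k p" "mid_state M r q s i z" "left_slot r 1 q z j" "r j < z"
  shows "1 \<le> t \<Longrightarrow> t < j \<Longrightarrow> far (r t) (r j)"
    "j < t \<Longrightarrow> t < i \<Longrightarrow> far (r t) z"
  using assms unfolding fo_defs far_def by ((intro conjI allI impI)?; smt (z3))+

lemma left_keep_far:
  assumes st: "stacked M r l q s k p" and mid: "mid_state M r q s i (r j)" and slot: "left_slot r 1 q (r j) j"
  shows "1 \<le> t \<Longrightarrow> t < j \<Longrightarrow> far (r t) (r (j + 1))"
    "j + 1 < t \<Longrightarrow> t < i \<Longrightarrow> far (r t) (r j)"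
    "j + 1 < i \<Longrightarrow> far (r (j + 1)) (r j) \<or> 0 < r (j + 1)" "0 \<le> r (j + 1)" "r (j + 1) < r j"
    "j + 1 = i \<Longrightarrow> q = i" "j < q"
proof -
  note nn = stacked_nonneg[OF st] and v = stacked_valley[OF st]
  have m: "q \<le> i" "r i < r j" "r j < M" using mid by (simp_all add: mid_state_def)
  have s: "1 \<le> j" "j \<le> q" "\<And>x. 1 \<le> x \<Longrightarrow> x < j \<Longrightarrow> r j < r x" using slot by (simp_all add: left_slot_def)
  have il: "i \<le> l" using v(3)[of i] m by simp
  show jq: "j < q"
  proof (rule ccontr)
    assume "\<not> j < q"
    then have "j = q" using s(2) by simp
    then show False using v(2)[of q i] m il by (cases "q = i") auto
  qed
  then show "j + 1 = i \<Longrightarrow> q = i" using m by simp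
  show n0: "0 \<le> r (j + 1)" using nn(1)[of "j + 1"] jq s nn(4) by simp
  show nj: "r (j + 1) < r j" using v(1)[of j "j + 1"] s jq by simp
  show "far (r t) (r (j + 1))" if "1 \<le> t" "t < j" using s(3)[OF that] nj n0 by (auto simp: far_def)
  show "far (r t) (r j)" if t: "j + 1 < t" "t < i"
  proof -
    have "r t < r (j + 1) \<or> r t < r i"
      using v(1)[of "j + 1" t] v(2)[of t i] s t il by (cases "t \<le> q") auto
    moreover have "0 \<le> r t" using nn(1)[of t] s t il by simp
    ultimately show ?thesis using nj m n0 by (auto simp: far_def)
  qed
  show "far (r (j + 1)) (r j) \<or> 0 < r (j + 1)" if "j + 1 < i"
  proof (rule ccontr)
    assume "\<not> (far (r (j + 1)) (r j) \<or> 0 < r (j + 1))"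
    then have z: "r (j + 1) = 0" "r j = 1" using n0 nj by (auto simp: far_def)
    have i0: "0 \<le> r i" "0 \<le> r q" using nn(1)[of i] nn(1)[of q] nn(3,4) il m by auto
    show False
    proof (cases "j + 1 < q")
      case True
      then show ?thesis using v(1)[of "j + 1" q] s z i0 by simp
    next
      case False
      then have "q = j + 1" using jq by simp
      then show ?thesis using v(2)[of q i] that z i0 m il by simp
    qed
  qed
qed

lemma left_absorb_far1:
  assumes "stacked M r l q s k p" "mid_state M r q s i (r j)" "left_slot r 1 q (r j) j" "j + 1 < i"
    "b \<noteq> r (j + 1)" "j + 1 < q" "j < p" "maximal_between r s j (r (j + 1)) b"
  shows "far (r (j + 1)) (r j)"
  using assms unfolding fo_defs far_def by ((intro conjI allI impI)?; smt (z3))+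

lemma left_absorb_far2:
  assumes "stacked M r l q s k p" "mid_state M r q s i (r j)" "left_slot r 1 q (r j) j" "j + 1 < i"
    "q \<le> j + 1"
  shows "far (r (j + 1)) (r j)"
  using assms unfolding fo_defs far_def by ((intro conjI allI impI)?; smt (z3))+

text \<open>After (R1), an (L2) step happens at a distance from column \<open>i\<close>, so that the
  two halves act on the word separately.\<close>

lemma replaced_gap:
  assumes "stacked M r l q s k p" "mid_state M r q s i (r j)" "left_slot r 1 q (r j) j"
    "\<not> right_stays r s i (r j)"
  shows "j + 1 < i"
  using assms unfolding fo_defs by ((intro conjI allI impI)?; smt (z3))+

lemma lower_valley:
  assumes "stacked M r l q s k p" "s j = b + 1" "s y = b + 1" "2 \<le> j" "j < p" "p < y" "y \<le> k"
  shows "j < z \<Longrightarrow> z < y \<Longrightarrow> 0 \<le> s z \<and> s z \<le> b"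
    "y < z \<Longrightarrow> z \<le> k \<Longrightarrow> b + 1 < s z"
  using assms unfolding fo_defs by ((intro conjI allI impI)?; smt (z3))+

lemma swap_far:
  assumes "stacked M r l q s k p" "q < l" "r (q + 1) < r (q - 1)"
  shows "1 \<le> t \<Longrightarrow> t < q \<Longrightarrow> far (r t) (r q)"
    "q + 1 < x \<Longrightarrow> x \<le> l \<Longrightarrow> far (r x) (r q)"
  using assms unfolding fo_defs far_def by ((intro conjI allI impI)?; smt (z3))+

lemma right_replace_hecke:
  assumes "stacked M r l q s k p" "right_slot r q a i" "0 \<le> a" "a \<noteq> r i" "i \<le> l"
  shows "hecke (S @ word r 1 l @ [a]) = hecke (S @ word r 1 (i - 1) @ r i # a # word r (i + 1) l)"
proof -
  note far = right_replace_far[OF assms]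
  have "\<forall>c\<in>set (word r (i + 1) l). far c a" using far(2) by (intro word_far) auto
  then show ?thesis
    using right_replace_word[of "word r (i + 1) l" a S "word r 1 (i - 1)" "r i"] word_split[OF far(1) assms(5), of r]
    by simp
qed

lemma right_keep_hecke:
  assumes "stacked M r l q s k p" "right_slot r q (r i) i" "i + 1 \<le> l"
    "far (r i) (r (i + 1)) \<or> 0 < r i"
  shows "hecke (S @ word r 1 l @ [r i]) = hecke (S @ word r 1 (i - 1) @ r (i + 1) # word r i l)"
proof -
  have il: "i \<le> l" using assms(3) by simp
  note far = right_keep_far[OF assms(1,2) il]
  have "\<forall>c\<in>set (word r (i + 2) l). far c (r i)" using far(3) by (intro word_far) auto
  moreover have "far (r i) (r (i + 1)) \<or> 0 < r i \<and> 0 < r (i + 1)" using assms(3,4) far(4) by auto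
  moreover have "word r i l = r i # r (i + 1) # word r (i + 2) l"
    using word_Cons[of i l r] word_Cons[of "i + 1" l r] assms(3) by (simp add: add.assoc)
  moreover have "word r 1 l = word r 1 (i - 1) @ r i # r (i + 1) # word r (i + 2) l"
    using word_split[OF far(1) il, of r] word_Cons[of "i + 1" l r] assms(3) by (simp add: add.assoc)
  ultimately show ?thesis
    using right_keep_word[of "word r (i + 2) l" "r i" "r (i + 1)" S "word r 1 (i - 1)"] by simp
qed

text \<open>The gap after \<open>r i\<close> lets the inserted copy commute back and merge with
  \<open>r i\<close>.\<close>

lemma right_absorb_hecke:
  assumes "stacked M r l q s k p" "right_slot r q (r i) i" "i \<le> l" "r i + 1 < r (i + 1)"
  shows "hecke (S @ word r 1 l @ [r i]) = hecke (S @ word r 1 l)"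
proof -
  note far = right_keep_far[OF assms(1,2,3)]
  have "far (r x) (r i)" if "i + 1 \<le> x" "x \<le> l" for x
    using far(3)[of x] that assms(4) stacked_nonneg(1)[OF assms(1)] far(1,5) by (cases "x = i + 1") (auto simp: far_def)
  then have "\<forall>c\<in>set (word r (i + 1) l). far c (r i)" by (intro word_far) auto
  then show ?thesis
    using right_absorb_word[of "word r (i + 1) l" "r i" S "word r 1 (i - 1)"] word_split[OF far(1) assms(3), of r]
    by simp
qed

lemma left_replace_hecke:
  assumes "stacked M r l q s k p" "mid_state M r q s i z" "left_slot r 1 q z j" "r j < z"
    "r' j = z" "\<forall>x. x \<noteq> j \<longrightarrow> r' x = r x"
  shows "hecke (S @ word r 1 (i - 1) @ z # word r i l) = hecke (S @ r j # word r' 1 l)"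
proof -
  note range = left_slot_range[OF assms(1,2,3)] and far = left_replace_far[OF assms(1,2,3,4)]
  have "\<forall>c\<in>set (word r 1 (j - 1)). far c (r j)" "\<forall>c\<in>set (word r (j + 1) (i - 1)). far c z"
    using far by (auto intro!: word_far)
  moreover have "word r 1 (i - 1) = word r 1 (j - 1) @ r j # word r (j + 1) (i - 1)"
    using range by (intro word_split) auto
  moreover have "word r' 1 l = word r 1 (j - 1) @ z # word r (j + 1) (i - 1) @ word r i l"
  proof -
    have "word r' 1 l = word r' 1 (j - 1) @ z # word r' (j + 1) l"
      using range word_split[of 1 j l r'] assms(5) by simp
    moreover have "word r' 1 (j - 1) = word r 1 (j - 1)" "word r' (j + 1) l = word r (j + 1) l"
      using assms(6) by (auto intro!: word_cong)
    moreover have "word r (j + 1) l = word r (j + 1) (i - 1) @ word r i l"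
      using range word_split[of "j + 1" i l r] word_Cons[of i l r] by simp
    ultimately show ?thesis by simp
  qed
  ultimately show ?thesis
    using left_replace_word[of "word r 1 (j - 1)" "r j" "word r (j + 1) (i - 1)" z S "word r i l"] by simp
qed

text \<open>The lower row absorbs \<open>b\<close> at its last copy. Assumption \<open>F\<close>
  excludes \<open>b - 1\<close> behind that copy; \<open>N\<close> describes the situation in which
  \<open>b + 1\<close> follows it, and each of its two alternatives fits one of the braid
  identities.\<close>

lemma absorb_hecke:
  assumes st: "stacked M r l q s k p" and ex: "\<exists>x. 2 \<le> x \<and> x \<le> k \<and> s x = b"
    and F: "\<And>x y. s x = b \<Longrightarrow> 2 \<le> x \<Longrightarrow> x \<le> k \<Longrightarrow> \<forall>y. x < y \<and> y \<le> k \<longrightarrow> s y \<noteq> b \<Longrightarrow> x < y \<Longrightarrow> y \<le> k \<Longrightarrow> s y \<noteq> b - 1"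
    and N: "\<And>x y. s x = b \<Longrightarrow> 2 \<le> x \<Longrightarrow> x \<le> k \<Longrightarrow> \<forall>y. x < y \<and> y \<le> k \<longrightarrow> s y \<noteq> b \<Longrightarrow> x < y \<Longrightarrow> y \<le> k \<Longrightarrow> s y = b + 1 \<Longrightarrow>
      s j = b + 1 \<and> 2 \<le> j \<and> j < x \<and> j < p \<and> p < y \<and> 0 < b \<and> (s (j + 1) = b \<longrightarrow> (\<forall>z. s z \<noteq> b - 1)) \<and>
      (s (j + 1) \<noteq> b \<longrightarrow> x = y - 1 \<and> (\<forall>z. j < z \<and> z < x \<longrightarrow> s z < b))"
  shows "hecke (word s 2 k @ [b]) = hecke (word s 2 k)"
proof -
  obtain x where x: "2 \<le> x" "x \<le> k" "s x = b" "\<forall>y. x < y \<and> y \<le> k \<longrightarrow> s y \<noteq> b"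
    using ex by (rule ex_last)
  note F = F[OF x(3,1,2,4)] and N = N[OF x(3,1,2,4)]
  have b0: "0 \<le> b" using stacked_nonneg(2)[OF st x(1,2)] x(3) by simp
  note nn = stacked_nonneg(2)[OF st]
  show ?thesis
  proof (cases "\<exists>y. x < y \<and> y \<le> k \<and> s y = b + 1")
    case False
    have "far (s y) b" if "x + 1 \<le> y" "y \<le> k" for y
      using F[of y] False nn[of y] b0 x(1) that by (auto simp: far_def)
    then have "\<forall>c\<in>set (word s (x + 1) k). far c b" by (intro word_far) auto
    then show ?thesis
      using absorb_word[of "word s (x + 1) k" b "word s 2 (x - 1)"] word_split[OF x(1,2), of s] x(3) by simp
  next
    case True
    then obtain y where y: "x < y" "y \<le> k" "s y = b + 1" by blast
    have j: "s j = b + 1" "2 \<le> j" "j < x" "j < p" "p < y" "0 < b"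
      and dip: "s (j + 1) = b \<Longrightarrow> s z \<noteq> b - 1"
      and no: "s (j + 1) \<noteq> b \<Longrightarrow> x = y - 1" "s (j + 1) \<noteq> b \<Longrightarrow> j < z \<Longrightarrow> z < x \<Longrightarrow> s z < b" for z
      using N[OF y] by auto
    note low = lower_valley[OF st j(1) y(3) j(2,4,5) y(2)]
    have S: "word s 2 k = word s 2 (j - 1) @ (b + 1) # word s (j + 1) (y - 1) @ (b + 1) # word s (y + 1) k"
      using word_split[of 2 j k s] word_split[of "j + 1" y k s] j y x by simp
    have "far (s z) b" if "y + 1 \<le> z" "z \<le> k" for z
      using low(2)[of z] that b0 by (auto simp: far_def)
    then have T: "\<forall>c\<in>set (word s (y + 1) k). far c b" by (intro word_far) auto
    show ?thesis
    proof (cases "s (j + 1) = b")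
      case True
      have U: "word s (j + 1) (y - 1) = b # word s (j + 2) (y - 1)"
        using word_Cons[of "j + 1" "y - 1" s] True j y x by (simp add: add.assoc)
      have "u = b \<or> far u b \<and> far u (b + 1)" if u: "u \<in> set (word s (j + 2) (y - 1))" for u
      proof -
        obtain z where "j + 2 \<le> z" "z \<le> y - 1" "u = s z" using u by (auto simp: word_def)
        then show ?thesis using low(1)[of z] dip[OF True, of z] b0 by (auto simp: far_def)
      qed
      then show ?thesis
        using absorb_dip_word[of "word s (j + 2) (y - 1)" b "b + 1" "word s (y + 1) k" "word s 2 (j - 1)"] T j(6)
        unfolding S U by simp
    next
      case False
      have yx: "x = y - 1" by (rule no(1)[OF False])
      have U: "word s (j + 1) (y - 1) = word s (j + 1) (x - 1) @ [b]"
        using word_split[of "j + 1" x x s] word_Nil[of x "x + 1" s] j x(3) yx by simp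
      have "far (s z) (b + 1)" if "j + 1 \<le> z" "z \<le> x - 1" for z
        using no(2)[OF False, of z] low(1)[of z] that yx b0 by (auto simp: far_def)
      then have "\<forall>c\<in>set (word s (j + 1) (x - 1)). far c (b + 1)" by (intro word_far) auto
      then show ?thesis
        using absorb_between_word[of "word s (j + 1) (x - 1)" "b + 1" "word s (y + 1) k" b "word s 2 (j - 1)"] T j(6)
        unfolding S U by simp
    qed
  qed
qed

lemma left_out_cases:
  assumes "left_out r q s p j b"
  obtains "j < p" "j + 1 < q" "maximal_between r s j (r (j + 1)) b"
  | "j < p" "q \<le> j + 1" "maximal_between r s j (- 1) b"
  | "p \<le> j" "q \<le> j + 1" "b = s (j + 1)" "drops r s j"
  | "p \<le> j" "q \<le> j + 1 \<longrightarrow> \<not> drops r s j" "b = r (j + 1)"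
proof (cases "j < p")
  case True
  then show thesis using assms that(1,2) unfolding left_out_def by (cases "j + 1 < q") auto
next
  case False
  then show thesis using assms that(3,4) unfolding left_out_def by (cases "q \<le> j + 1 \<and> drops r s j") auto
qed

lemma left_out_absorb:
  assumes h: "stacked M r l q s k p" "mid_state M r q s i (r j)" "left_slot r 1 q (r j) j"
    "b \<noteq> r (j + 1)"
    and out: "left_out r q s p j b"
  shows "hecke (word s 2 k @ [b]) = hecke (word s 2 k)" "far (r (j + 1)) (r j) \<or> 0 < r (j + 1)"
    "j + 1 < i \<Longrightarrow> far (r (j + 1)) (r j)"
proof -
  note lk = left_keep_far[OF h(1,2,3)]
  have pos: "far (r (j + 1)) (r j) \<or> 0 < r (j + 1)" if "r (j + 1) + 1 < r j \<or> 0 < r (j + 1)"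
    using that lk(4,5) by (auto simp: far_def)
  from out have "hecke (word s 2 k @ [b]) = hecke (word s 2 k) \<and> (far (r (j + 1)) (r j) \<or> 0 < r (j + 1)) \<and>
    (j + 1 < i \<longrightarrow> far (r (j + 1)) (r j))"
  proof (rule left_out_cases)
    assume c: "j < p" "j + 1 < q" "maximal_between r s j (r (j + 1)) b"
    note ex = absorb_ex1[OF h c] and near = absorb_near1[OF h c]
    have "hecke (word s 2 k @ [b]) = hecke (word s 2 k)"
    proof (rule absorb_hecke[OF h(1) ex(1) absorb_far1[OF h c]])
      fix x y assume a: "s x = b" "2 \<le> x" "x \<le> k" "\<forall>y. x < y \<and> y \<le> k \<longrightarrow> s y \<noteq> b" "x < y" "y \<le> k" "s y = b + 1"
      show "s j = b + 1 \<and> 2 \<le> j \<and> j < x \<and> j < p \<and> p < y \<and> 0 < b \<and> (s (j + 1) = b \<longrightarrow> (\<forall>z. s z \<noteq> b - 1)) \<and>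
        (s (j + 1) \<noteq> b \<longrightarrow> x = y - 1 \<and> (\<forall>z. j < z \<and> z < x \<longrightarrow> s z < b))"
        using near[OF a] absorb_near_dip1[OF h c a] absorb_near_no1[OF h c a] by blast
    qed
    then show ?thesis using pos[OF ex(3)] left_absorb_far1[OF h(1,2,3) _ h(4) c(2,1,3)] by blast
  next
    assume c: "j < p" "q \<le> j + 1" "maximal_between r s j (- 1) b"
    note ex = absorb_ex2[OF h c] and near = absorb_near2[OF h c]
    have "hecke (word s 2 k @ [b]) = hecke (word s 2 k)"
    proof (rule absorb_hecke[OF h(1) ex(1) absorb_far2[OF h c]])
      fix x y assume a: "s x = b" "2 \<le> x" "x \<le> k" "\<forall>y. x < y \<and> y \<le> k \<longrightarrow> s y \<noteq> b" "x < y" "y \<le> k" "s y = b + 1"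
      show "s j = b + 1 \<and> 2 \<le> j \<and> j < x \<and> j < p \<and> p < y \<and> 0 < b \<and> (s (j + 1) = b \<longrightarrow> (\<forall>z. s z \<noteq> b - 1)) \<and>
        (s (j + 1) \<noteq> b \<longrightarrow> x = y - 1 \<and> (\<forall>z. j < z \<and> z < x \<longrightarrow> s z < b))"
        using near[OF a] absorb_near_dip2[OF h c a] absorb_near_no2[OF h c a] by blast
    qed
    then show ?thesis using pos[OF ex(3)] left_absorb_far2[OF h(1,2,3) _ c(2)] by blast
  next
    assume c: "p \<le> j" "q \<le> j + 1" "b = s (j + 1)" "drops r s j"
    note ex = absorb_ex3[OF h c]
    have e: "\<exists>x. 2 \<le> x \<and> x \<le> k \<and> s x = b" using ex c(3) by blast
    have "hecke (word s 2 k @ [b]) = hecke (word s 2 k)"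
      by (rule absorb_hecke[OF h(1) e absorb_far3(1)[OF h c]]) (use absorb_far3(2)[OF h c] in blast)+
    then show ?thesis using pos[OF ex(3)] left_absorb_far2[OF h(1,2,3) _ c(2)] by blast
  next
    assume "b = r (j + 1)"
    then show ?thesis using h(4) by simp
  qed
  then show "hecke (word s 2 k @ [b]) = hecke (word s 2 k)" "far (r (j + 1)) (r j) \<or> 0 < r (j + 1)"
    "j + 1 < i \<Longrightarrow> far (r (j + 1)) (r j)" by blast+
qed

lemma left_keep_hecke:
  assumes h: "stacked M r l q s k p" "mid_state M r q s i (r j)" "left_slot r 1 q (r j) j"
    and out: "left_out r q s p j b" and ji: "j + 1 < i"
  shows "hecke (word s 2 k @ word r 1 (i - 1) @ r j # word r i l) = hecke (word s 2 k @ b # word r 1 l)"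
proof -
  let ?S = "word s 2 k"
  note range = left_slot_range[OF h] and far = left_keep_far[OF h]
  have A: "\<forall>c\<in>set (word r 1 (j - 1)). far c (r (j + 1))" and B: "\<forall>c\<in>set (word r (j + 2) (i - 1)). far c (r j)"
    using far(1,2) by (auto intro!: word_far)
  have R: "word r 1 (i - 1) = word r 1 (j - 1) @ r j # r (j + 1) # word r (j + 2) (i - 1)"
    using range ji word_split[of 1 j "i - 1" r] word_Cons[of "j + 1" "i - 1" r] by (simp add: add.assoc)
  have W: "word r 1 l = word r 1 (j - 1) @ r j # r (j + 1) # word r (j + 2) (i - 1) @ word r i l"
    using range word_split[of 1 i l r] word_Cons[of i l r] R by simp
  show ?thesis
  proof (cases "b = r (j + 1)")
    case True
    have "far (r (j + 1)) (r j) \<or> 0 < r (j + 1) \<and> 0 < r j" using far(3)[OF ji] far(5) by auto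
    then show ?thesis
      using left_keep_word[OF A B, of ?S "word r i l"] unfolding R W True by simp
  next
    case False
    note ab = left_out_absorb[OF h False out]
    show ?thesis
      using left_absorb_word[OF B ab(3)[OF ji], of ?S "word r 1 (j - 1)" "word r i l"]
        hecke_cong[OF ab(1), of "[]" "word r 1 l"] unfolding R W by simp
  qed
qed

text \<open>Both halves act on the same three letters, the dip between two equal neighbours. They
  cannot be separated, so the inserted letter is carried through in one move.\<close>

lemma dip_keep_hecke:
  assumes h: "stacked M r l q s k p" "mid_state M r q s i (r j)" "left_slot r 1 q (r j) j"
    and slot: "right_slot r q (r i) i"
    and out: "left_out r q s p j b" and ji: "j + 1 = i" "r (i + 1) = r j" "i + 1 \<le> l"
  shows "hecke (word s 2 k @ word r 1 l @ [r i]) = hecke (word s 2 k @ b # word r 1 l)"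
proof -
  let ?S = "word s 2 k"
  note range = left_slot_range[OF h] and far = left_keep_far[OF h]
  have A: "\<forall>c\<in>set (word r 1 (j - 1)). far c (r i)" using far(1) ji(1) by (auto intro!: word_far)
  have C: "\<forall>c\<in>set (word r (i + 2) l). far c (r i)"
    using right_keep_far(3)[OF h(1) slot] ji(3) by (auto intro!: word_far)
  have R: "word r 1 l = word r 1 (j - 1) @ r j # r i # r j # word r (i + 2) l"
    using range ji word_split[of 1 j l r] word_Cons[of i l r] word_Cons[of "i + 1" l r] by (simp add: add.assoc)
  have pos: "0 \<le> r i" "0 \<le> r j" "r i < r j" using far(4,5) ji(1) by auto
  show ?thesis
  proof (cases "b = r (j + 1)")
    case True
    then show ?thesis using dip_keep_word[OF A C pos(1,2), of ?S] ji(1) unfolding R by simp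
  next
    case False
    note ab = left_out_absorb[OF h False out]
    have "far (r i) (r j) \<or> 0 < r i \<and> 0 < r j" using ab(2) ji(1) pos by auto
    then show ?thesis
      using dip_absorb_word[OF C, of "r j" ?S "word r 1 (j - 1)"] hecke_cong[OF ab(1), of "[]" "word r 1 l"]
      unfolding R by simp
  qed
qed

lemma raise_hecke:
  assumes h: "stacked M r l q s k p" "mid_state M r q s i z" "left_slot r 1 q z j" "r j < z" "z < r (i + 1)"
    "right_stays r s i z"
    and r': "r' j = z" "\<forall>x. x \<noteq> j \<longrightarrow> r' x = r x"
  shows "hecke (word s 2 k @ word r 1 l) = hecke (word s 2 k @ r j # word r' 1 l)"
proof -
  note range = left_slot_range[OF h(1,2,3)] and nn = stacked_nonneg[OF h(1)]
  obtain x where x: "2 \<le> x" "x \<le> k" "s x = z" "\<forall>y. x < y \<and> y \<le> k \<longrightarrow> s y \<noteq> z"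
    using raise_ex[OF h] by (rule ex_last)
  note rf = raise_far[OF h x(3,1,2,4)]
  have j0: "0 \<le> r j" using nn(1)[of j] range by simp
  have S2: "\<forall>c\<in>set (word s (x + 1) k). far c z" "\<forall>c\<in>set (word s (x + 1) k). far c (r j)"
    using rf(1) h(4) j0 by (force intro!: word_far simp: far_def)+
  have S: "word s 2 k = word s 2 (x - 1) @ z # word s (x + 1) k"
    using word_split[OF x(1,2), of s] x(3) by simp
  \<comment> \<open>The lower row together with \<open>r j\<close> absorbs \<open>z\<close>: by
    commutation, or by a braid move if \<open>z = r j + 1\<close>.\<close>
  have "hecke (word s 2 k @ [r j, z]) = hecke (word s 2 k @ [r j])"
  proof (cases "z = r j + 1")
    case True
    have "word s 2 (x - 1) = word s 2 (x - 2) @ [r j]"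
      using rf(3)[OF True] word_split[of 2 "x - 1" "x - 1" s] word_Nil[of "x - 1" x s] by simp
    then show ?thesis
      using raise_near_word[OF S2(2,1), of "word s 2 (x - 2)"] rf(3)[OF True] h(4) unfolding S by simp
  next
    case False
    then have "far (r j) z" using h(4) j0 by (auto simp: far_def)
    then show ?thesis using raise_far_word[OF S2(1)] unfolding S by blast
  qed
  moreover have "\<forall>c\<in>set (word r 1 (j - 1)). far c (r j)" "\<forall>c\<in>set (word r 1 (j - 1)). far c z"
    using rf(2) h(4) j0 by (force intro!: word_far simp: far_def)+
  ultimately have "hecke (word s 2 k @ word r 1 (j - 1) @ r j # word r (j + 1) l) =
    hecke (word s 2 k @ r j # word r 1 (j - 1) @ z # word r (j + 1) l)"
    by (rule raise_word)
  moreover have "word r' 1 (j - 1) = word r 1 (j - 1)" "word r' (j + 1) l = word r (j + 1) l"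
    using r'(2) by (auto intro!: word_cong)
  ultimately show ?thesis
    using word_split[of 1 j l r] word_split[of 1 j l r'] range r'(1) by simp
qed

text \<open>The letter \<open>r (j + 1)\<close> is emitted and also stays in the row, next to the
  letter \<open>r j\<close> with which it does not commute. If its copy in the lower row is followed
  by \<open>r (j + 1) + 1\<close>, the two rows together have the form required by
  \<open>braid_word\<close>.\<close>

lemma braid_hecke:
  assumes h: "stacked M r l q s k p" "mid_state M r q s i (r j)" "left_slot r 1 q (r j) j" and near:
    "r j = r (j + 1) + 1"
    and ex: "\<exists>x. 2 \<le> x \<and> x \<le> k \<and> s x = r (j + 1)"
    and F: "\<And>x y. s x = r (j + 1) \<Longrightarrow> 2 \<le> x \<Longrightarrow> x \<le> k \<Longrightarrow> \<forall>y. x < y \<and> y \<le> k \<longrightarrow> s y \<noteq> r (j + 1) \<Longrightarrow> x < y \<Longrightarrow> y \<le> k \<Longrightarrow>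
      s y \<noteq> r (j + 1) - 1"
    and N: "\<And>x y. s x = r (j + 1) \<Longrightarrow> 2 \<le> x \<Longrightarrow> x \<le> k \<Longrightarrow> \<forall>y. x < y \<and> y \<le> k \<longrightarrow> s y \<noteq> r (j + 1) \<Longrightarrow> x < y \<Longrightarrow> y \<le> k \<Longrightarrow>
      s y = r (j + 1) + 1 \<Longrightarrow>
      x = y - 1 \<and> (\<forall>z. y < z \<and> z \<le> k \<longrightarrow> r (j + 1) + 2 < s z) \<and> (\<forall>t. 1 \<le> t \<and> t < j \<longrightarrow> r (j + 1) + 2 < r t) \<and>
      (r (j + 1) = 0 \<longrightarrow> s (x - 1) = r (j + 1) + 1 \<and> 2 < x)"
  shows "hecke (word s 2 k @ word r 1 l) = hecke (word s 2 k @ r (j + 1) # word r 1 l)"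
proof -
  define n where "n = r (j + 1)"
  note range = left_slot_range[OF h] and nn = stacked_nonneg[OF h(1)]
  obtain x where x: "2 \<le> x" "x \<le> k" "s x = n" "\<forall>y. x < y \<and> y \<le> k \<longrightarrow> s y \<noteq> n"
    using ex unfolding n_def by (rule ex_last)
  note F = F[folded n_def, OF x(3,1,2,4)] and N = N[folded n_def, OF x(3,1,2,4)]
  have n0: "0 \<le> n" using nn(1)[of "j + 1"] range by (simp add: n_def)
  have S: "word s 2 k = word s 2 (x - 1) @ n # word s (x + 1) k"
    using word_split[OF x(1,2), of s] x(3) by simp
  have "hecke (word s 2 k @ word r 1 l) = hecke (word s 2 k @ n # word r 1 l)"
  proof (cases "\<exists>y. x < y \<and> y \<le> k \<and> s y = n + 1")
    case False
    have "far (s y) n" if "x + 1 \<le> y" "y \<le> k" for y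
      using F[of y] False nn(2)[of y] n0 x(1) that by (auto simp: far_def)
    then have "\<forall>c\<in>set (word s (x + 1) k). far c n" by (intro word_far) auto
    then have "hecke (word s 2 k @ [n]) = hecke (word s 2 k)"
      using absorb_word[of "word s (x + 1) k" n "word s 2 (x - 1)"] unfolding S by simp
    from hecke_cong[OF this, of "[]" "word r 1 l"] show ?thesis by simp
  next
    case True
    then obtain y where y: "x < y" "y \<le> k" "s y = n + 1" by blast
    have yx: "y = x + 1" and s3: "\<And>z. y < z \<Longrightarrow> z \<le> k \<Longrightarrow> n + 2 < s z" and rt: "\<And>t. 1 \<le> t \<Longrightarrow> t < j \<Longrightarrow> n + 2 < r t"
      and zero: "n = 0 \<Longrightarrow> s (x - 1) = n + 1 \<and> 2 < x" using N[OF y] by auto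
    have T: "word s (x + 1) k = (n + 1) # word s (x + 2) k"
      using word_Cons[of "x + 1" k s] y yx by (simp add: add.assoc)
    have R: "word r 1 l = word r 1 (j - 1) @ (n + 1) # n # word r (j + 2) l"
      using word_split[of 1 j l r] word_Cons[of "j + 1" l r] range near by (simp add: n_def add.assoc)
    have "\<forall>c\<in>set (word s (x + 2) k). far c n \<and> far c (n + 1)"
    proof
      fix c assume "c \<in> set (word s (x + 2) k)"
      then obtain z where "x + 2 \<le> z" "z \<le> k" "c = s z" by (auto simp: word_def)
      then show "far c n \<and> far c (n + 1)" using s3[of z] yx n0 by (auto simp: far_def)
    qed
    moreover have "\<forall>c\<in>set (word r 1 (j - 1)). far c n \<and> far c (n + 1)"
    proof
      fix c assume "c \<in> set (word r 1 (j - 1))"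
      then obtain z where "1 \<le> z" "z < j" "c = r z" by (auto simp: word_def)
      then show "far c n \<and> far c (n + 1)" using rt[of z] n0 by (auto simp: far_def)
    qed
    moreover have "0 < n \<and> 0 < n + 1 \<or> (\<exists>S0. word s 2 (x - 1) = S0 @ [n + 1])"
    proof (cases "n = 0")
      case True
      then have "word s 2 (x - 1) = word s 2 (x - 2) @ [n + 1]"
        using zero[OF True] word_split[of 2 "x - 1" "x - 1" s] word_Nil[of "x - 1" x s] by simp
      then show ?thesis by blast
    qed (use n0 in auto)
    ultimately show ?thesis
      using braid_word[of "word s (x + 2) k" n "n + 1" "word r 1 (j - 1)" "word s 2 (x - 1)" "word r (j + 2) l"] n0
      unfolding S T R by simp
  qed
  then show ?thesis by (simp add: n_def)
qed

text \<open>The inserted letter has already been absorbed on the right, so it has to be shown that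
  emitting \<open>b\<close> in front of the unchanged row costs nothing.\<close>

lemma stay_keep_hecke:
  assumes h: "stacked M r l q s k p" "mid_state M r q s i (r j)" "left_slot r 1 q (r j) j" "r j < r (i + 1)"
    "right_stays r s i (r j)"
    and out: "left_out r q s p j b"
  shows "hecke (word s 2 k @ word r 1 l) = hecke (word s 2 k @ b # word r 1 l)"
proof (cases "b = r (j + 1)")
  case False
  from hecke_cong[OF left_out_absorb(1)[OF h(1,2,3) False out], of "[]" "word r 1 l"] show ?thesis by simp
next
  case b: True
  note range = left_slot_range[OF h(1,2,3)] and far = left_keep_far[OF h(1,2,3)]
  show ?thesis
  proof (cases "r j = r (j + 1) + 1")
    case False
    then have "far (r (j + 1)) (r j)" using far(4,5) by (auto simp: far_def)
    moreover have "\<forall>c\<in>set (word r 1 (j - 1)). far c (r (j + 1))" using far(1) by (auto intro!: word_far)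
    moreover have "word r 1 l = word r 1 (j - 1) @ r j # r (j + 1) # word r (j + 2) l"
      using word_split[of 1 j l r] word_Cons[of "j + 1" l r] range by (simp add: add.assoc)
    ultimately show ?thesis
      using left_keep_far_word[of "word r 1 (j - 1)" "r (j + 1)" "r j" "word s 2 k" "word r (j + 2) l"] b by simp
  next
    case near: True
    from out show ?thesis
    proof (rule left_out_cases)
      assume c: "j < p" "j + 1 < q" "maximal_between r s j (r (j + 1)) b"
      note c = c[unfolded b]
      show ?thesis
        unfolding b
        by (rule braid_hecke[OF h(1,2,3) near braid_ex1[OF h near c] braid_far1[OF h near c]])
          (use braid_near1[OF h near c] in blast)+
    next
      assume c: "j < p" "q \<le> j + 1" "maximal_between r s j (- 1) b"
      note c = c[unfolded b]
      show ?thesis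
        unfolding b
        by (rule braid_hecke[OF h(1,2,3) near braid_ex2[OF h near c] braid_far2[OF h near c]])
          (use braid_near2[OF h near c] in blast)+
    next
      assume "p \<le> j" "q \<le> j + 1" "b = s (j + 1)" "drops r s j"
      then have c: "p \<le> j" "q \<le> j + 1 \<longrightarrow> \<not> drops r s j \<or> s (j + 1) = r (j + 1)" using b by auto
      show ?thesis
        unfolding b
        by (rule braid_hecke[OF h(1,2,3) near braid_ex3[OF h near c] braid_far3[OF h near c]])
          (use braid_near3[OF h near c] in blast)+
    next
      assume "p \<le> j" "q \<le> j + 1 \<longrightarrow> \<not> drops r s j"
      then have c: "p \<le> j" "q \<le> j + 1 \<longrightarrow> \<not> drops r s j \<or> s (j + 1) = r (j + 1)" by auto
      show ?thesis
        unfolding b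
        by (rule braid_hecke[OF h(1,2,3) near braid_ex3[OF h near c] braid_far3[OF h near c]])
          (use braid_near3[OF h near c] in blast)+
    qed
  qed
qed

section \<open>From words of row functions back to lists and tableaux\<close>

lemma map_int_row: "map int R = word (row M R) 1 (length R)"
  by (rule nth_equalityI) (auto simp: word_def nth_upto row_Suc add.commute[of 1])

lemma map_int_low: "map int S = word (low M S) 2 (int (length S) + 1)"
proof (rule nth_equalityI)
  fix i assume "i < length (map int S)"
  then have i: "i < length S" by simp
  have "word (low M S) 2 (int (length S) + 1) ! i = low M S (2 + int i)"
    using i by (simp add: word_def nth_upto)
  then show "map int S ! i = word (low M S) 2 (int (length S) + 1) ! i"
    using i row_Suc[OF i, of M] by (simp add: low_def add.commute)
qed (simp add: word_def)

lemma left_insert_outcome: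
  assumes R: "above M R S" and mid: "mid_state M (row M R) (dip R) (low M S) i (int z)"
    and ins: "left_insert (Fin z) R S = (Fin b, R')"
  obtains (replace) j where "left_slot (row M R) 1 (dip R) z j" "row M R j < z" "row M R j = b" "length R' = length R"
      "row M R' j = z" "\<forall>x. x \<noteq> j \<longrightarrow> row M R' x = row M R x"
  | (keep) j where "left_slot (row M R) 1 (dip R) z j" "row M R j = z" "R' = R"
      "left_out (row M R) (dip R) (low M S) (low_dip S) j b"
proof -
  note st = R[unfolded above_def] and lt = above_letters[OF R]
  have zM: "int z < M" using mid by (simp add: mid_state_def)
  have qz: "row M R (dip R) \<le> int z"
    using mid st unfolding mid_state_def stacked_def valley_def by (smt (z3))
  show thesis
  proof (rule left_insert_cases[OF lt(1,8,9,2) zM qz])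
    fix j assume j: "left_slot (row M R) 1 (dip R) (int z) (int j)" "1 \<le> j" "j \<le> length R"
        "row M R j < int z" "left_insert (Fin z) R S = (Fin (R ! (j - 1)), R[j - 1 := z])"
    have e: "b = R ! (j - 1)" "R' = R[j - 1 := z]" using ins j by simp_all
    have rb: "row M R j = b" using j by (simp add: row_nth e nat_diff_distrib')
    have r': "row M R' = (row M R)(int j := int z)" unfolding e using j by (intro row_update)
    show thesis by (rule replace[of "int j"]) (use j rb r' e in auto)
  next
    fix j f assume j: "left_slot (row M R) 1 (dip R) (int z) (int j)" "1 \<le> j" "j \<le> length R"
        "row M R j = int z" "left_insert (Fin z) R S = (f, R)" "bounded M f"
        "left_out (row M R) (dip R) (low M S) (low_dip S) j (lift M f)"
    have "f = Fin b" "R' = R" using ins j by simp_all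
    then show thesis using keep[of "int j"] j by simp
  qed
qed

lemma hecke_last: "R \<noteq> [] \<Longrightarrow> hecke (map int (R @ [last R])) = hecke (map int R)"
  using hecke_idem[of "map int (butlast R)" "int (last R)" "[]"]
  by (metis append.assoc append_Cons append_Nil append_butlast_last_id list.simps(8,9) map_append)

lemma row_insert_hecke_end:
  assumes R: "above M R S" and a: "int a < M" and ins: "row_insert a R S = (\<infinity>, R')"
  shows "hecke (map int (R @ [a])) = hecke (map int R')"
  using R a ins
proof (rule row_insert_above)
  assume "R' = R" "a = last R"
  then show ?thesis using hecke_last above_letters(3)[OF R] by blast
qed simp_all

text \<open>The row below is part of the word, as the emitted letter may come from it or be absorbed
  by it.\<close>

lemma row_insert_hecke:
  assumes R: "above M R S" and a: "int a < M" and ins: "row_insert a R S = (Fin b, R')"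
  shows "hecke (map int (S @ R @ [a])) = hecke (map int (S @ b # R'))"
proof -
  note st = R[unfolded above_def] and lt = above_letters[OF R]
  define k where "k = int (length S) + 1"
  define l where "l = int (length R)"
  define r where "r = row M R"
  define s where "s = low M S"
  have mS: "map int S = word s 2 k" unfolding s_def k_def by (rule map_int_low)
  have mR: "map int R = word r 1 l" unfolding r_def l_def by (rule map_int_row)
  have ins': "row_insert a R S = (let (a', R'') = right_insert a R S in left_insert a' R'' S)"
    using lt(3) by (simp add: row_insert_def)
  have st': "stacked M r l (dip R) s k (low_dip S)" using st by (simp add: r_def s_def l_def k_def)
  show ?thesis
  proof (rule right_insert_cases[OF lt(7,8,9,2) a])
    assume "right_insert a R S = (\<infinity>, R @ [a])"
    then show ?thesis using ins ins' by (simp add: left_insert_def)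
  next
    fix i assume i: "1 \<le> i" "i \<le> length R" "right_slot (row M R) (dip R) a (int i)"
      "int a \<noteq> row M R i" "right_insert a R S = (Fin (R ! (i - 1)), R[i - 1 := a])"
    define x where "x = R ! (i - 1)"
    define R'' where "R'' = R[i - 1 := a]"
    have rx: "row M R i = x" using i by (simp add: row_nth x_def nat_diff_distrib')
    have r'': "row M R'' = (row M R)(int i := int a)" unfolding R''_def using i by (intro row_update)
    have upd: "row M R'' i = a" "\<forall>x. x \<noteq> int i \<longrightarrow> row M R'' x = row M R x" by (auto simp: r'')
    have len: "int (length R) = int (length R'')" by (simp add: R''_def)
    have il: "int i \<le> int (length R)" using i by simp
    have a0: "0 \<le> int a" by simp
    have "above M R'' S \<and> mid_state M (row M R'') (dip R'') (low M S) i (int x) \<and>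
      \<not> right_stays (row M R'') (low M S) i (int x)"
    proof (cases "row M R (dip R) < int a \<or> int i \<noteq> int (dip R) + 1")
      case True
      note f = right_replace1[OF st i(3) a0 a i(4) il True upd]
      show ?thesis using f aboveI[OF f(1)[unfolded len]] by (simp add: rx)
    next
      case False
      then have c: "int a < row M R (dip R)" "int i = int (dip R) + 1"
        using i(3,4) by (auto simp: right_slot_def split: if_split_asm)
      note f = right_replace2[OF st i(3) a0 a i(4) il c upd]
      show ?thesis using f aboveI[OF f(1)[unfolded len]] by (simp add: rx)
    qed
    then have R'': "above M R'' S" "mid_state M (row M R'') (dip R'') (low M S) i (int x)"
      "\<not> right_stays (row M R'') (low M S) i (int x)" by blast+
    define t where "t = row M R''"
    have st'': "stacked M t l (dip R'') s k (low_dip S)"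
      using R''(1) len unfolding above_def by (simp add: t_def s_def l_def k_def)
    have mid'': "mid_state M t (dip R'') s (int i) (int x)" using R''(2) by (simp add: t_def s_def)
    have "word r 1 (int i - 1) = word t 1 (int i - 1)" "word r (int i + 1) l = word t (int i + 1) l"
      using upd(2) by (auto simp: r_def t_def intro!: word_cong)
    moreover have "word t i l = int a # word t (int i + 1) l"
      using word_Cons[of "int i" l t] upd(1) il by (simp add: t_def l_def)
    \<comment> \<open>After the right half, the expelled letter stands directly to the left of
      column \<open>i\<close>, where the left half takes it up.\<close>
    ultimately have step1: "hecke (word s 2 k @ word r 1 l @ [int a]) =
      hecke (word s 2 k @ word t 1 (int i - 1) @ int x # word t i l)"
      using right_replace_hecke[OF st' i(3)[folded r_def] a0, of "word s 2 k"] i(4) il rx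
      by (simp add: r_def l_def)
    have li: "left_insert (Fin x) R'' S = (Fin b, R')" using ins ins' i by (simp add: R''_def x_def)
    show ?thesis
      using R''(1,2) li
    proof (rule left_insert_outcome)
      fix j assume j: "left_slot (row M R'') 1 (dip R'') x j" "row M R'' j < x" "row M R'' j = b" "length R' = length R''"
        "row M R' j = x" "\<forall>y. y \<noteq> j \<longrightarrow> row M R' y = row M R'' y"
      have "map int R' = word (row M R') 1 l" using map_int_row[of R' M] j(4) len by (simp add: l_def)
      then show ?thesis
        using step1 left_replace_hecke[OF st'' mid'' j(1)[folded t_def] j(2)[folded t_def] j(5) j(6)[folded t_def], of "word s 2 k"] j(3)
        by (simp add: mS mR t_def)
    next
      fix j assume j: "left_slot (row M R'') 1 (dip R'') x j" "row M R'' j = x" "R' = R''"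
        "left_out (row M R'') (dip R'') (low M S) (low_dip S) j b"
      have h: "mid_state M t (dip R'') s (int i) (t j)" "left_slot t 1 (dip R'') (t j) j" "\<not> right_stays t s i (t j)"
        "left_out t (dip R'') s (low_dip S) j b"
        using mid'' j R''(3) by (simp_all add: t_def s_def)
      have "j + 1 < int i" by (rule replaced_gap[OF st'' h(1,2,3)])
      from left_keep_hecke[OF st'' h(1,2,4) this]
      have "hecke (word s 2 k @ word t 1 (int i - 1) @ int x # word t i l) = hecke (word s 2 k @ int b # word t 1 l)"
        using j(2) by (simp add: t_def)
      moreover have "map int R' = word t 1 l" using map_int_row[of R' M] j(3) len by (simp add: l_def t_def)
      ultimately show ?thesis using step1 by (simp add: mS mR)
    qed
  next
    assume c: "dip R < length R" "row M R (dip R) = int a" "row M R (int (dip R) + 1) < row M R (int (dip R) - 1)"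
    define q where "q = int (dip R)"
    have e: "b = a" "R' = R[dip R := a, dip R - 1 := R ! dip R]"
      and r': "row M R' = r(q := r (q + 1), q + 1 := r q)"
      using row_insert_swap[OF R c] ins by (auto simp: q_def r_def)
    have q: "1 \<le> q" "q < l" using lt(8) c(1) by (simp_all add: q_def l_def)
    have ra: "r q = a" using c(2) by (simp add: r_def q_def)
    have c': "r (q + 1) < r (q - 1)" using c(3) by (simp add: r_def q_def)
    note far = swap_far[OF st'[folded q_def] q(2) c']
    have A: "\<forall>c\<in>set (word r 1 (q - 1)). far c (r q)" and C: "\<forall>c\<in>set (word r (q + 2) l). far c (r q)"
      using far by (auto intro!: word_far)
    have W: "word r 1 l = word r 1 (q - 1) @ r q # r (q + 1) # word r (q + 2) l"
      using word_split[of 1 q l r] word_Cons[of "q + 1" l r] q by (simp add: add.assoc)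
    have "word (row M R') 1 l = word (row M R') 1 (q - 1) @ row M R' q # row M R' (q + 1) # word (row M R') (q + 2) l"
      using word_split[of 1 q l "row M R'"] word_Cons[of "q + 1" l "row M R'"] q by (simp add: add.assoc)
    moreover have "word (row M R') 1 (q - 1) = word r 1 (q - 1)" "word (row M R') (q + 2) l = word r (q + 2) l"
      by (auto simp: r' intro!: word_cong)
    ultimately have W': "word (row M R') 1 l = word r 1 (q - 1) @ r (q + 1) # r q # word r (q + 2) l"
      by (simp add: r')
    have "length R' = length R" using e by simp
    then have "map int R' = word (row M R') 1 l" using map_int_row[of R' M] by (simp add: l_def)
    then show ?thesis
      using swap_word[OF A C, of "word s 2 k" "r (q + 1)"] e(1) by (simp add: mS mR W W' ra)
  next
    fix i f assume i: "1 \<le> i" "i \<le> length R" "right_slot (row M R) (dip R) a (int i)"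
      "row M R i = int a" "row M R (int i - 1) \<le> row M R (int i + 1)"
      "right_out (row M R) (low M S) i (lift M f)" "bounded M f" "right_insert a R S = (f, R)"
    obtain x where f: "f = Fin x"
      using ins ins' i(8) by (cases f) (auto simp: left_insert_def)
    have x: "int x < M" using i(7) f by (simp add: bounded_def)
    note g = right_keep[OF st i(3)[folded i(4)] i(5), of "int x"]
    have mid: "mid_state M (row M R) (dip R) (low M S) i (int x)"
      and rs: "right_stays (row M R) (low M S) i (int x)"
      using g i(6) f x by auto
    have mid': "mid_state M r (dip R) s i (int x)" and rs': "right_stays r s i (int x)"
      using mid rs by (simp_all add: r_def s_def)
    have ra: "r i = a" using i(4) by (simp add: r_def)
    have slot: "right_slot r (dip R) (r i) i" using i(3) ra by (simp add: r_def)
    have il: "int i \<le> l" using i(2) by (simp add: l_def)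
    have xr: "r i < int x" "int x \<le> r (int i + 1)" using mid' by (simp_all add: mid_state_def)
    have li: "left_insert (Fin x) R S = (Fin b, R')" using ins ins' i f by simp
    show ?thesis
    proof (cases "int x = r (int i + 1)")
      case True
      \<comment> \<open>The excluded position of \<open>j\<close> is the one around the dip that
        \<open>dip_keep_hecke\<close> treats as a whole.\<close>
      have keep: "hecke (word s 2 k @ word r 1 l @ [int a]) = hecke (word s 2 k @ word r 1 (int i - 1) @ int x # word r i l)"
        if j: "left_slot r 1 (dip R) x j" "\<not> (j + 1 = int i \<and> r j = x)" for j
      proof -
        note p = right_keep_pos[OF st' slot, of j]
        show ?thesis
          using right_keep_hecke[OF st' slot, of "word s 2 k"] p mid' j ra unfolding True by simp
      qed
      from R mid li show ?thesis
      proof (rule left_insert_outcome)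
        fix j assume j: "left_slot (row M R) 1 (dip R) x j" "row M R j < x" "row M R j = b" "length R' = length R"
          "row M R' j = x" "\<forall>y. y \<noteq> j \<longrightarrow> row M R' y = row M R y"
        have "map int R' = word (row M R') 1 l" using map_int_row[of R' M] j(4) by (simp add: l_def)
        then show ?thesis
          using keep[OF j(1)[folded r_def]] j(2,3)
            left_replace_hecke[OF st' mid' j(1)[folded r_def] j(2)[folded r_def] j(5) j(6)[folded r_def], of "word s 2 k"]
          by (simp add: mS mR r_def)
      next
        fix j assume j: "left_slot (row M R) 1 (dip R) x j" "row M R j = x" "R' = R"
          "left_out (row M R) (dip R) (low M S) (low_dip S) j b"
        have h: "mid_state M r (dip R) s (int i) (r j)" "left_slot r 1 (dip R) (r j) j"
          "left_out r (dip R) s (low_dip S) j b"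
          using mid' j by (simp_all add: r_def s_def)
        have rj: "r j = x" using j(2) by (simp add: r_def)
        note range = left_slot_range[OF st' h(1,2)]
        have mR': "map int R' = word r 1 l" using mR j(3) by simp
        show ?thesis
        proof (cases "j + 1 = int i")
          case False
          then have ji: "j + 1 < int i" using range by simp
          show ?thesis
            using keep[OF j(1)[folded r_def]] False left_keep_hecke[OF st' h ji] by (simp add: mS mR mR' rj)
        next
          case ji: True
          have "int i + 1 \<le> l"
          proof (rule ccontr)
            assume "\<not> int i + 1 \<le> l"
            then have "r (int i + 1) = M" using row_out[of "int i + 1" R M] by (simp add: r_def l_def)
            then show False using True x by simp
          qed
          from dip_keep_hecke[OF st' h(1,2) slot h(3) ji _ this] show ?thesis
            using True by (simp add: mS mR mR' rj ra)
        qed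
      qed
    next
      case False
      then have xl: "int x < r (int i + 1)" using xr by simp
      \<comment> \<open>As the output lies strictly between \<open>r i\<close> and
        \<open>r (i + 1)\<close>, these two letters commute and the inserted letter disappears into
        its copy.\<close>
      have keep: "hecke (word s 2 k @ word r 1 l @ [int a]) = hecke (word s 2 k @ word r 1 l)"
        using right_absorb_hecke[OF st' slot il, of "word s 2 k"] xl xr ra by simp
      from R mid li show ?thesis
      proof (rule left_insert_outcome)
        fix j assume j: "left_slot (row M R) 1 (dip R) x j" "row M R j < x" "row M R j = b" "length R' = length R"
          "row M R' j = x" "\<forall>y. y \<noteq> j \<longrightarrow> row M R' y = row M R y"
        have "map int R' = word (row M R') 1 l" using map_int_row[of R' M] j(4) by (simp add: l_def)
        then show ?thesis
          using keep j(3) raise_hecke[OF st' mid' j(1)[folded r_def] j(2)[folded r_def] xl rs' j(5) j(6)[folded r_def]]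
          by (simp add: mS mR r_def)
      next
        fix j assume j: "left_slot (row M R) 1 (dip R) x j" "row M R j = x" "R' = R"
          "left_out (row M R) (dip R) (low M S) (low_dip S) j b"
        have h: "mid_state M r (dip R) s (int i) (r j)" "left_slot r 1 (dip R) (r j) j" "r j < r (int i + 1)"
          "right_stays r s i (r j)" "left_out r (dip R) s (low_dip S) j b"
          using mid' rs' xl j by (simp_all add: r_def s_def)
        have mR': "map int R' = word r 1 l" using mR j(3) by simp
        show ?thesis using keep stay_keep_hecke[OF st' h] by (simp add: mS mR mR')
      qed
    qed
  qed
qed

lemma reading_word_Cons: "reading_word (R # P) = reading_word P @ R"
  by (simp add: reading_word_def)

lemma reading_word_top_row: "\<exists>u. reading_word P = u @ top_row P"
  by (cases P) (auto simp: reading_word_def top_row_def)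

lemma tableau_insert_hecke:
  assumes "valid M P" "int a < M" "tableau_insert a P = (P', k)"
  shows "hecke (map int (reading_word P @ [a])) = hecke (map int (reading_word P'))"
  using assms
proof (induction P arbitrary: a P' k)
  case Nil
  then have "P' = [[a]]" using tableau_insert_Nil[of a] by simp
  then show ?case by (simp add: reading_word_def)
next
  case (Cons R P)
  have R: "above M R (top_row P)" and P: "valid M P" using Cons.prems by simp_all
  obtain e R' where ri: "row_insert a R (top_row P) = (e, R')" by fastforce
  from R Cons.prems(2) ri show ?case
  proof (rule row_insert_above)
    assume g: "e = \<infinity>"
    have "P' = R' # P" using Cons.prems(3) tableau_insert_Cons(1) ri g by auto
    then show ?thesis
      using hecke_cong[OF row_insert_hecke_end[OF R Cons.prems(2) ri[unfolded g]], of "map int (reading_word P)" "[]"]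
      by (simp add: reading_word_Cons)
  next
    assume g: "e = \<infinity>"
    have "P' = R' # P" using Cons.prems(3) tableau_insert_Cons(1) ri g by auto
    then show ?thesis
      using hecke_cong[OF row_insert_hecke_end[OF R Cons.prems(2) ri[unfolded g]], of "map int (reading_word P)" "[]"]
      by (simp add: reading_word_Cons)
  next
    fix b assume g: "e = Fin b" "out_above M b R' (top_row P)"
    obtain Q k' where Q: "tableau_insert b P = (Q, k')" by fastforce
    have P': "P' = R' # Q"
      using Cons.prems(3) tableau_insert_Cons(2)[OF _ Q] ri g(1) by auto
    have bM: "int b < M" using g(2) unfolding out_above_def exits_def out_state_def by blast
    \<comment> \<open>The identity for one row involves only the row below; the rest of the reading
      word stands in front of both.\<close>
    obtain u where u: "reading_word P = u @ top_row P" using reading_word_top_row by blast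
    show ?thesis
      using hecke_cong[OF row_insert_hecke[OF R Cons.prems(2) ri[unfolded g]], of "map int u" "[]"]
        hecke_cong[OF Cons.IH[OF P bM Q], of "[]" "map int R'"]
      by (simp add: reading_word_Cons P' u)
  qed
qed

lemma hecke_map_int: "hecke (map int u) = foldl hecke_step id u"
proof -
  have "map nat (map int u) = u" by (induction u) simp_all
  then show ?thesis unfolding hecke_def by simp
qed

lemma KH_hecke:
  assumes "KH a = (P, Q)"
  shows "hecke (map int a) = hecke (map int (reading_word P))"
  using assms
proof (induction a arbitrary: P Q rule: rev_induct)
  case Nil
  then show ?case by (simp add: KH_def reading_word_def)
next
  case (snoc x w)
  obtain P0 Q0 where 0: "KH w = (P0, Q0)" by fastforce
  have "(P0, Q0) \<in> pairs (length w)"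
    using KH_bij_betw[of "length w"] 0 unfolding bij_betw_def by force
  then obtain M where M: "valid M P0" "int x < M" by (rule pairs_bound)
  obtain P' k where ins: "tableau_insert x P0 = (P', k)" by fastforce
  have "P = P'" using snoc.prems 0 KH_step_eq[OF ins] by (simp add: KH_snoc)
  then show ?case
    using tableau_insert_hecke[OF M ins] hecke_cong[OF snoc.IH[OF 0], of "[]" "[int x]"] by simp
qed

theorem theorem1p1:
  fixes n :: nat
  shows "bij_betw KH {a. length a = n}
           (\<Union>mu\<in>{mu. strict_partition mu \<and> sum_list mu \<le> n}. SDT mu \<times> ShSet n mu)
         \<and> (\<forall>a P Q. KH a = (P, Q) \<longrightarrow>
              (\<exists>w\<in>(\<Union>m. signed_perms m).
                 hecke_expression a w \<and> hecke_expression (reading_word P) w))"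
proof (intro conjI allI impI)
  show "bij_betw KH {a. length a = n}
    (\<Union>mu\<in>{mu. strict_partition mu \<and> sum_list mu \<le> n}. SDT mu \<times> ShSet n mu)"
    using KH_bij_betw[of n] unfolding pairs_eq_Union .
next
  fix a P Q assume KH: "KH a = (P, Q)"
  \<comment> \<open>A bound on the letters places the product in one of the groups
    \<open>signed_perms m\<close>.\<close>
  obtain m where m: "\<forall>x\<in>set a. x < m" using finite_nat_set_iff_bounded[of "set a"] by auto
  have "foldl hecke_step id a \<in> signed_perms m"
    using m by (intro signed_perms_foldl id_signed_perms) auto
  then show "\<exists>w\<in>(\<Union>m. signed_perms m). hecke_expression a w \<and> hecke_expression (reading_word P) w"
    unfolding hecke_expression_iff using KH_hecke[OF KH] unfolding hecke_map_int by blast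
qed

end
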